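(* For every $0<\varepsilon<1$ there exists $C=C(\varepsilon)>0$ such that for every $p\ge\omega(\log n/n)$ and $c=Cn$, $$\Pr\left[G\sim\mathcal G_c(n,p)\text{ contains }(1-\varepsilon)np/2\text{ edge-disjoint rainbow Hamilton cycles}\right]=1-o(1).$$
   Context: $\mathcal G_c(n,p)$: random graph on $[n]$ with each pair an edge independently with probability $p$, each edge then colored uniformly and independently from $[c]$. A Hamilton cycle is rainbow if all its edges have distinct colors. Asymptotics as $n\to\infty$. *)

theory Defs
  imports "HOL-Probability.Probability"
begin

text \<open>Vertex set [n] is rendered as {0..<n}; colour set [c] as {0..<c}.
  A coloured graph is a function on unordered pairs, represented as (i,j) with i<j<n:
  None = no edge, Some k = edge with colour k.\<close>

definition vpairs :: "nat \<Rightarrow> (nat \<times> nat) set" where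
  "vpairs n = {(i,j). i < j \<and> j < n}"

definition edge_pmf :: "real \<Rightarrow> nat \<Rightarrow> nat option pmf" where
  "edge_pmf p c = bind_pmf (bernoulli_pmf p)
     (\<lambda>b. if b then map_pmf Some (pmf_of_set {0..<c}) else return_pmf None)"

definition Gnpc :: "nat \<Rightarrow> real \<Rightarrow> nat \<Rightarrow> (nat \<times> nat \<Rightarrow> nat option) pmf" where
  "Gnpc n p c = Pi_pmf (vpairs n) None (\<lambda>_. edge_pmf p c)"

definition uedge :: "nat \<Rightarrow> nat \<Rightarrow> nat \<times> nat" where
  "uedge a b = (min a b, max a b)"

definition ham_order :: "nat \<Rightarrow> nat list \<Rightarrow> bool" where
  "ham_order n vs \<longleftrightarrow> n \<ge> 3 \<and> length vs = n \<and> distinct vs \<and> set vs = {0..<n}"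

definition cycle_edges :: "nat \<Rightarrow> nat list \<Rightarrow> (nat \<times> nat) set" where
  "cycle_edges n vs = {uedge (vs ! i) (vs ! ((i + 1) mod n)) | i. i < n}"

definition rainbow_ham_cycle :: "nat \<Rightarrow> (nat \<times> nat \<Rightarrow> nat option) \<Rightarrow> nat list \<Rightarrow> bool" where
  "rainbow_ham_cycle n G vs \<longleftrightarrow> ham_order n vs
     \<and> (\<forall>e \<in> cycle_edges n vs. G e \<noteq> None)
     \<and> inj_on (\<lambda>e. the (G e)) (cycle_edges n vs)"

definition has_disjoint_rainbow_HCs :: "nat \<Rightarrow> (nat \<times> nat \<Rightarrow> nat option) \<Rightarrow> nat \<Rightarrow> bool" where
  "has_disjoint_rainbow_HCs n G k \<longleftrightarrow>
     (\<exists>H :: nat \<Rightarrow> nat list.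
        (\<forall>i<k. rainbow_ham_cycle n G (H i)) \<and>
        (\<forall>i<k. \<forall>j<k. i \<noteq> j \<longrightarrow> cycle_edges n (H i) \<inter> cycle_edges n (H j) = {}))"

end

theory Submission
  imports Defs "HOL-Real_Asymp.Real_Asymp" 
begin

text \<open>
  Split the colours into three palettes; the first contains almost all of them, the other two a
  small constant fraction each. Cut the vertices into \<open>Q = L * R\<close> layers. Every permutation of the
  layers, with consecutive layers joined unless one of their positions is divisible by \<open>L\<close>, is a
  template for a family of vertex-disjoint paths. An edge colouring (in the sense of Koenig) of the
  first-palette graph between any two layers distributes almost all of its edges over about
  \<open>n p / 2\<close> linear forests, each following one template. Deleting the few edges that repeat a colour
  makes the forests rainbow and leaves only a small set of special vertices of each forest to join up.

  In the second palette a random choice of \<open>k\<close> edges at every special vertex of every forest, all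
  choices being made at once and without conflicts by Rosenfeld's counting argument, turns each
  forest into an expander. By Posa rotations each stage then has quadratically many boosters, pairs
  whose addition brings the cyclic order closer to a Hamilton cycle. The third palette contains a
  constant proportion of any such set of boosters, and labelling its edges by a uniformly random
  forest leaves enough of them for each forest, so that all forests close up to edge-disjoint rainbow
  Hamilton cycles.
\<close>

section \<open>Cyclic orders and rotations\<close>

text \<open>Using all permutations makes every pair of layers alike: the same number
  \<open>\<mu>\<close> of templates joins them, so the single budget \<open>\<mu> * h\<close> suits
  every pair, and two vertices of different layers lie in the core of the same forest for only
  O(1/L^2) of the forests. \<open>L\<close> is fixed after \<epsilon>. A forest has O(n/L) special
  vertices with O(log L) expander edges each, so the roughly np/2 forests together ask for much less
  than a palette of constant share contains. Whole layers of special vertices, the pivots, meet no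
  forest edge. Rotations turn only about pivots, whose neighbours are special by construction; hence
  path ends never leave the special set. The obstacle is dependence. Boosters depend on edges
  already chosen, so the third palette is shown to be dense in the boosters of every graph with at
  most 2n edges that occurs in G: presence of such a graph has price p per edge, about (np)^(2n)
  over all of them, against a tail exp(-a n^2 p) with a constant a. The forests depend on the edge
  set of the first palette alone, so its colours can be redrawn afterwards.\<close>

fun steps :: "nat list \<Rightarrow> (nat \<times> nat) set" where
  "steps [] = {}"
| "steps [x] = {}"
| "steps (x # y # zs) = insert (uedge x y) (steps (y # zs))"

definition cyc :: "nat list \<Rightarrow> (nat \<times> nat) set" where
  "cyc vs = insert (uedge (last vs) (hd vs)) (steps vs)"

lemma uedge_commute: "uedge a b = uedge b a"
  by (auto simp: uedge_def min_def max_def)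

lemma uedge_eq_iff: "uedge a b = uedge c d \<longleftrightarrow> (a = c \<and> b = d) \<or> (a = d \<and> b = c)"
  by (auto simp: uedge_def min_def max_def)

lemma uedge_mem_Times: "uedge a b \<in> S \<times> S \<longleftrightarrow> a \<in> S \<and> b \<in> S"
  by (auto simp: uedge_def min_def max_def)

lemma uedge_in_vpairs: "uedge a b \<in> vpairs n \<longleftrightarrow> a < n \<and> b < n \<and> a \<noteq> b"
  by (auto simp: uedge_def vpairs_def min_def max_def)

lemma vpairs_uedge: "e \<in> vpairs n \<Longrightarrow> e = uedge (fst e) (snd e)"
  by (auto simp: uedge_def vpairs_def)

lemma finite_steps [simp]: "finite (steps vs)"
  by (induction vs rule: steps.induct) auto

lemma finite_cyc [simp]: "finite (cyc vs)"
  by (simp add: cyc_def)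

lemma steps_append:
  assumes "xs \<noteq> []" "ys \<noteq> []"
  shows "steps (xs @ ys) = insert (uedge (last xs) (hd ys)) (steps xs \<union> steps ys)"
  using assms
proof (induction xs rule: steps.induct)
  case (2 x) then show ?case by (cases ys) auto
qed auto

lemma steps_rev: "steps (rev vs) = steps vs"
proof (induction vs rule: steps.induct)
  case (3 x y zs)
  have "steps (rev (x # y # zs)) = steps (rev (y # zs) @ [x])" by simp
  also have "\<dots> = insert (uedge y x) (steps (rev (y # zs)) \<union> steps [x])"
    by (subst steps_append) (auto simp: last_rev)
  finally show ?case using 3 by (simp add: uedge_commute)
qed auto

lemma steps_Times: "steps vs \<subseteq> set vs \<times> set vs"
  by (induction vs rule: steps.induct) (auto simp: uedge_def min_def max_def)

lemma steps_conv_nth: "steps vs = {uedge (vs ! i) (vs ! Suc i) | i. Suc i < length vs}"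
proof (induction vs rule: steps.induct)
  case (3 x y zs)
  have "{uedge ((x # y # zs) ! i) ((x # y # zs) ! Suc i) | i. Suc i < length (x # y # zs)}
      = insert (uedge x y) {uedge ((y # zs) ! i) ((y # zs) ! Suc i) | i. Suc i < length (y # zs)}"
    (is "?A = insert _ ?B")
  proof (intro equalityI subsetI)
    fix e assume "e \<in> ?A"
    then obtain i where i: "Suc i < length (x # y # zs)"
      "e = uedge ((x # y # zs) ! i) ((x # y # zs) ! Suc i)" by blast
    show "e \<in> insert (uedge x y) ?B"
    proof (cases i)
      case 0 then show ?thesis using i by simp
    next
      case (Suc j) then show ?thesis using i by auto
    qed
  next
    fix e assume "e \<in> insert (uedge x y) ?B"
    then show "e \<in> ?A"
    proof
      assume "e = uedge x y" then show ?thesis by (intro CollectI exI[of _ 0]) auto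
    next
      assume "e \<in> ?B"
      then obtain i where "Suc i < length (y # zs)"
        "e = uedge ((y # zs) ! i) ((y # zs) ! Suc i)" by blast
      then show ?thesis by (intro CollectI exI[of _ "Suc i"]) auto
    qed
  qed
  then show ?case using 3 by simp
qed auto

lemma cyc_conv_cycle_edges:
  assumes "length vs = n" "n > 0"
  shows "cyc vs = cycle_edges n vs"
proof (intro equalityI subsetI)
  fix e assume "e \<in> cyc vs"
  then consider "e = uedge (last vs) (hd vs)" | "e \<in> steps vs" by (auto simp: cyc_def)
  then show "e \<in> cycle_edges n vs"
  proof cases
    case 1
    have "e = uedge (vs ! (n - 1)) (vs ! ((n - 1 + 1) mod n))"
      using 1 assms last_conv_nth[of vs] hd_conv_nth[of vs] by auto
    then show ?thesis unfolding cycle_edges_def using assms by (intro CollectI exI[of _ "n - 1"]) auto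
  next
    case 2
    then obtain i where "Suc i < n" "e = uedge (vs ! i) (vs ! Suc i)"
      using assms by (auto simp: steps_conv_nth)
    then show ?thesis unfolding cycle_edges_def by (intro CollectI exI[of _ i]) auto
  qed
next
  fix e assume "e \<in> cycle_edges n vs"
  then obtain i where i: "i < n" "e = uedge (vs ! i) (vs ! ((i + 1) mod n))"
    by (auto simp: cycle_edges_def)
  show "e \<in> cyc vs"
  proof (cases "Suc i = n")
    case True
    then have "i = n - 1" by simp
    then have "e = uedge (last vs) (hd vs)"
      using i assms last_conv_nth[of vs] hd_conv_nth[of vs] by auto
    then show ?thesis by (simp add: cyc_def)
  next
    case False
    then show ?thesis using i assms by (auto simp: cyc_def steps_conv_nth)
  qed
qed

text \<open>A cyclic order of \<open>V\<close> with at most \<open>b\<close> steps outside \<open>\<Gamma>\<close>, all of them between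
  vertices of \<open>S\<close>; for \<open>b = 0\<close> it is a Hamilton cycle of \<open>\<Gamma>\<close>.\<close>

definition closeable :: "nat set \<Rightarrow> nat set \<Rightarrow> (nat \<times> nat) set \<Rightarrow> nat \<Rightarrow> bool" where
  "closeable V S \<Gamma> b \<longleftrightarrow> (\<exists>vs. distinct vs \<and> set vs = V \<and> cyc vs - \<Gamma> \<subseteq> S \<times> S \<and> card (cyc vs - \<Gamma>) \<le> b)"

text \<open>A Hamilton path with both ends in \<open>S\<close>. The strict bound leaves room for the
  closing pair, which may itself be missing from \<open>\<Gamma>\<close>.\<close>

definition open_order :: "nat set \<Rightarrow> nat set \<Rightarrow> (nat \<times> nat) set \<Rightarrow> nat \<Rightarrow> nat list \<Rightarrow> bool" where
  "open_order V S \<Gamma> b vs \<longleftrightarrow> distinct vs \<and> set vs = V \<and> steps vs - \<Gamma> \<subseteq> S \<times> S \<and>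
     card (steps vs - \<Gamma>) < b \<and> hd vs \<in> S \<and> last vs \<in> S"

text \<open>If \<open>b\<close> cannot be lowered, some step of the cyclic order is missing from
  \<open>\<Gamma>\<close>. Cutting the cycle there gives a path with one missing step fewer, whose
  ends are in \<open>S\<close> because all missing steps run inside \<open>S\<close>.\<close>

lemma closeable_open_order:
  assumes "closeable V S \<Gamma> b" "\<not> closeable V S \<Gamma> (b - 1)" "card V \<ge> 3"
  obtains vs where "open_order V S \<Gamma> b vs"
proof -
  obtain vs where vs: "distinct vs" "set vs = V" "cyc vs - \<Gamma> \<subseteq> S \<times> S" "card (cyc vs - \<Gamma>) \<le> b"
    using assms(1) by (auto simp: closeable_def)
  have c: "card (cyc vs - \<Gamma>) > b - 1"
    using assms(2) vs by (auto simp: closeable_def not_le)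
  then have b: "b > 0" using vs(4) by simp
  have "card (cyc vs - \<Gamma>) \<noteq> 0" using c by linarith
  then have "cyc vs - \<Gamma> \<noteq> {}" by (metis card.empty)
  then obtain e where e: "e \<in> cyc vs" "e \<notin> \<Gamma>" by blast
  have len: "length vs \<ge> 3" using vs assms(3) by (metis distinct_card)
  have lt: "card (A - \<Gamma>) < b" if "A \<subseteq> cyc vs" "e \<notin> A" for A
  proof -
    have "A - \<Gamma> \<subset> cyc vs - \<Gamma>" using that e by blast
    then have "card (A - \<Gamma>) < card (cyc vs - \<Gamma>)" by (intro psubset_card_mono) auto
    then show ?thesis using vs by simp
  qed
  show ?thesis
  proof (cases "e \<in> steps vs")
    case False
    then have e': "e = uedge (last vs) (hd vs)" using e by (auto simp: cyc_def)
    have "e \<in> S \<times> S" using e vs by blast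
    then have "hd vs \<in> S" "last vs \<in> S" unfolding e' by (auto simp only: uedge_mem_Times)
    moreover have "card (steps vs - \<Gamma>) < b" using lt[of "steps vs"] False by (auto simp: cyc_def)
    ultimately have "open_order V S \<Gamma> b vs"
      using vs by (auto simp: open_order_def cyc_def)
    then show ?thesis by (rule that)
  next
    case True
    then obtain i where i: "Suc i < length vs" "e = uedge (vs ! i) (vs ! Suc i)"
      by (auto simp: steps_conv_nth)
    define xs ys where "xs = take (Suc i) vs" and "ys = drop (Suc i) vs"
    have ne: "xs \<noteq> []" "ys \<noteq> []" and vs_eq: "vs = xs @ ys"
      using i by (auto simp: xs_def ys_def)
    have lx: "last xs = vs ! i" using i by (simp add: xs_def take_Suc_conv_app_nth)
    have hy: "hd ys = vs ! Suc i" using i by (simp add: ys_def hd_drop_conv_nth)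
    have cyc1: "cyc vs = insert e (steps (ys @ xs))"
      unfolding cyc_def vs_eq using ne lx hy i
      by (auto simp: steps_append)
    \<comment> \<open>The cut edge joins the last vertex of the new order to its first, so it could
      be a step as well only if there were just two vertices.\<close>
    have nin: "e \<notin> steps (ys @ xs)"
    proof
      assume "e \<in> steps (ys @ xs)"
      then obtain k where k: "Suc k < length (ys @ xs)" "e = uedge ((ys @ xs) ! k) ((ys @ xs) ! Suc k)"
        by (auto simp: steps_conv_nth)
      have d: "distinct (ys @ xs)" using vs vs_eq by auto
      have L: "length (ys @ xs) = length vs" using vs_eq by simp
      have la: "(ys @ xs) ! (length vs - 1) = vs ! i"
        using lx ne L by (metis last_appendR last_conv_nth append_is_Nil_conv)
      have h0: "(ys @ xs) ! 0 = vs ! Suc i"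
        using hy ne by (simp add: hd_conv_nth nth_append)
      have "uedge ((ys @ xs) ! (length vs - 1)) ((ys @ xs) ! 0)
         = uedge ((ys @ xs) ! k) ((ys @ xs) ! Suc k)" using la h0 k(2) i(2) by simp
      then consider "(ys @ xs) ! (length vs - 1) = (ys @ xs) ! k" "(ys @ xs) ! 0 = (ys @ xs) ! Suc k"
        | "(ys @ xs) ! (length vs - 1) = (ys @ xs) ! Suc k" "(ys @ xs) ! 0 = (ys @ xs) ! k"
        by (auto simp: uedge_eq_iff)
      then show False
      proof cases
        case 1
        then have "0 = Suc k" using nth_eq_iff_index_eq[OF d, of 0 "Suc k"] k(1) len L by linarith
        then show False by simp
      next
        case 2
        then have "0 = k" using nth_eq_iff_index_eq[OF d, of 0 k] k(1) len L by linarith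
        moreover have "length vs - 1 = Suc k"
          using 2 nth_eq_iff_index_eq[OF d, of "length vs - 1" "Suc k"] k(1) len L by linarith
        ultimately show False using len by simp
      qed
    qed
    have "e \<in> S \<times> S" using e vs by blast
    then have "hd ys \<in> S" "last xs \<in> S" unfolding i(2) lx hy by (auto simp only: uedge_mem_Times)
    moreover have "card (steps (ys @ xs) - \<Gamma>) < b"
      using lt[of "steps (ys @ xs)"] nin cyc1 by auto
    ultimately have "open_order V S \<Gamma> b (ys @ xs)"
      using vs vs_eq ne cyc1 by (auto simp: open_order_def)
    then show ?thesis by (rule that)
  qed
qed

section \<open>Posa rotations and boosters\<close>

definition path_nbrs :: "nat list \<Rightarrow> nat \<Rightarrow> nat set" where
  "path_nbrs vs x = {v. uedge x v \<in> steps vs}"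

lemma path_nbrs_bound:
  assumes "distinct vs"
  shows "finite (path_nbrs vs x)" "card (path_nbrs vs x) \<le> 2"
proof -
  have "\<exists>a b. path_nbrs vs x \<subseteq> {a, b}"
  proof (cases "x \<in> set vs")
    case False
    then have "path_nbrs vs x = {}"
      using steps_Times[of vs] uedge_mem_Times[of x _ "set vs"] by (auto simp: path_nbrs_def)
    then show ?thesis by simp
  next
    case True
    then obtain i where i: "i < length vs" "x = vs ! i" by (auto simp: in_set_conv_nth)
    have "path_nbrs vs x \<subseteq> {vs ! (i - 1), vs ! Suc i}"
    proof
      fix v assume "v \<in> path_nbrs vs x"
      then obtain k where k: "Suc k < length vs" "uedge x v = uedge (vs ! k) (vs ! Suc k)"
        by (auto simp: path_nbrs_def steps_conv_nth)
      then consider "vs ! i = vs ! k" "v = vs ! Suc k" | "vs ! i = vs ! Suc k" "v = vs ! k"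
        using i by (auto simp: uedge_eq_iff)
      then show "v \<in> {vs ! (i - 1), vs ! Suc i}"
        using nth_eq_iff_index_eq[OF assms] i(1) k(1) by cases auto
    qed
    then show ?thesis by blast
  qed
  then obtain a b where ab: "path_nbrs vs x \<subseteq> {a, b}" by blast
  then show "finite (path_nbrs vs x)" by (rule finite_subset) simp
  have "card (path_nbrs vs x) \<le> card {a, b}" using ab by (intro card_mono) auto
  also have "\<dots> \<le> 2" by (simp add: card_insert_if)
  finally show "card (path_nbrs vs x) \<le> 2" .
qed

text \<open>Posa rotation at the head: the edge from \<open>hd vs\<close> to the pivot
  \<open>vs ! i\<close> replaces the step entering the pivot. The new head is
  \<open>vs ! (i - 1)\<close> and the last vertex stays fixed.\<close>

definition rotates :: "nat set \<Rightarrow> (nat \<times> nat) set \<Rightarrow> nat list \<Rightarrow> nat list \<Rightarrow> bool" where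
  "rotates W \<Gamma> vs vs' \<longleftrightarrow> (\<exists>i. 0 < i \<and> i < length vs \<and> vs ! i \<in> W \<and> uedge (hd vs) (vs ! i) \<in> \<Gamma> \<and>
     vs' = rev (take i vs) @ drop i vs)"

lemma rotation_steps:
  assumes "distinct vs" "0 < i" "i < length vs"
  defines "vs' \<equiv> rev (take i vs) @ drop i vs"
  obtains C where "steps vs = insert (uedge (vs ! (i - 1)) (vs ! i)) C"
    "steps vs' = insert (uedge (hd vs) (vs ! i)) C"
    "uedge (vs ! (i - 1)) (vs ! i) \<notin> C"
    "hd vs' = vs ! (i - 1)" "last vs' = last vs" "distinct vs'" "set vs' = set vs"
proof (rule that)
  let ?C = "steps (take i vs) \<union> steps (drop i vs)"
  have ne: "take i vs \<noteq> []" "drop i vs \<noteq> []" using assms by auto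
  have lt: "last (take i vs) = vs ! (i - 1)"
    using assms by (cases i) (simp_all add: take_Suc_conv_app_nth)
  have hdr: "hd (drop i vs) = vs ! i" using assms by (simp add: hd_drop_conv_nth)
  have sp: "vs = take i vs @ drop i vs" by simp
  show "steps vs = insert (uedge (vs ! (i - 1)) (vs ! i)) ?C"
    using steps_append[OF ne] lt hdr by simp
  show "steps vs' = insert (uedge (hd vs) (vs ! i)) ?C"
    unfolding vs'_def using steps_append[of "rev (take i vs)" "drop i vs"] ne hdr assms
    by (simp add: steps_rev last_rev)
  show "uedge (vs ! (i - 1)) (vs ! i) \<notin> ?C"
  proof
    assume "uedge (vs ! (i - 1)) (vs ! i) \<in> ?C"
    then have "uedge (vs ! (i - 1)) (vs ! i) \<in> set (take i vs) \<times> set (take i vs) \<or>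
      uedge (vs ! (i - 1)) (vs ! i) \<in> set (drop i vs) \<times> set (drop i vs)"
      using steps_Times by blast
    then have "vs ! i \<in> set (take i vs) \<or> vs ! (i - 1) \<in> set (drop i vs)"
      by (simp only: uedge_mem_Times) auto
    moreover have "vs ! i \<in> set (drop i vs)" using hdr ne by (metis hd_in_set)
    moreover have "vs ! (i - 1) \<in> set (take i vs)" using lt ne by (metis last_in_set)
    moreover have "set (take i vs) \<inter> set (drop i vs) = {}"
      using assms(1) by (simp add: set_take_disj_set_drop_if_distinct)
    ultimately show False by blast
  qed
  show "hd vs' = vs ! (i - 1)" unfolding vs'_def using ne lt by (simp add: hd_rev)
  show "last vs' = last vs" unfolding vs'_def using ne by (simp add: last_drop)
  have "distinct (take i vs @ drop i vs)" using assms(1) by simp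
  then show "distinct vs'" unfolding vs'_def by (simp only: distinct_append distinct_rev set_rev)
  have "set vs = set (take i vs @ drop i vs)" by simp
  then show "set vs' = set vs" unfolding vs'_def by (simp only: set_append set_rev)
qed

text \<open>If the step removed by the rotation were missing from \<open>\<Gamma>\<close>, the new
  path would have one missing step fewer, and closing it would contradict that \<open>b\<close> is
  least. So the removed step is an edge of \<open>\<Gamma>\<close> at a vertex of \<open>W\<close>,
  and its other end, the new head, is in \<open>S\<close>.\<close>

lemma rotates_open_order:
  assumes "rotates W \<Gamma> vs vs'" "open_order V S \<Gamma> b vs" "\<not> closeable V S \<Gamma> (b - 1)"
    and nbr: "\<And>w v. w \<in> W \<Longrightarrow> uedge w v \<in> \<Gamma> \<Longrightarrow> v \<in> S"
  shows "open_order V S \<Gamma> b vs'" "last vs' = last vs"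
proof -
  obtain i where i: "0 < i" "i < length vs" "vs ! i \<in> W" "uedge (hd vs) (vs ! i) \<in> \<Gamma>"
    and vs': "vs' = rev (take i vs) @ drop i vs"
    using assms(1) by (auto simp: rotates_def)
  have oo: "distinct vs" "set vs = V" "steps vs - \<Gamma> \<subseteq> S \<times> S" "card (steps vs - \<Gamma>) < b"
    "hd vs \<in> S" "last vs \<in> S" using assms(2) by (auto simp: open_order_def)
  let ?e = "uedge (vs ! (i - 1)) (vs ! i)"
  obtain C where C: "steps vs = insert ?e C" "steps vs' = insert (uedge (hd vs) (vs ! i)) C" "?e \<notin> C"
    "hd vs' = vs ! (i - 1)" "last vs' = last vs" "distinct vs'" "set vs' = set vs"
    using rotation_steps[OF oo(1) i(1,2)] unfolding vs' by metis
  show "last vs' = last vs" by fact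
  have new: "steps vs' - \<Gamma> = C - \<Gamma>" using C i by auto
  have finC: "finite C" using C(1) by (metis finite_insert finite_steps)
  have e_in: "?e \<in> \<Gamma>"
  proof (rule ccontr)
    assume ne: "?e \<notin> \<Gamma>"
    then have "?e \<in> S \<times> S" using oo C by blast
    then have hS: "hd vs' \<in> S" unfolding C(4) by (simp only: uedge_mem_Times)
    have "steps vs - \<Gamma> = insert ?e (C - \<Gamma>)" using C ne by auto
    then have "card (steps vs - \<Gamma>) = Suc (card (C - \<Gamma>))" using C(3) finC by simp
    then have "card (C - \<Gamma>) + 1 < b" using oo by simp
    moreover have "cyc vs' - \<Gamma> \<subseteq> insert (uedge (last vs') (hd vs')) (C - \<Gamma>)"
      unfolding cyc_def using new by auto
    then have "card (cyc vs' - \<Gamma>) \<le> card (insert (uedge (last vs') (hd vs')) (C - \<Gamma>))"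
      using finC by (intro card_mono) auto
    then have "card (cyc vs' - \<Gamma>) \<le> Suc (card (C - \<Gamma>))"
      using card_insert_le_m1 finC by (metis card_insert_if finite_Diff le_SucI le_refl le_trans)
    moreover have "cyc vs' - \<Gamma> \<subseteq> S \<times> S"
    proof -
      have "uedge (last vs') (hd vs') \<in> S \<times> S" using hS oo C by (simp only: uedge_mem_Times)
      moreover have "C - \<Gamma> \<subseteq> S \<times> S" using oo C by auto
      ultimately show ?thesis unfolding cyc_def using new by auto
    qed
    ultimately have "closeable V S \<Gamma> (b - 1)"
      unfolding closeable_def using C oo by (intro exI[of _ vs']) auto
    then show False using assms(3) by simp
  qed
  then have "vs ! (i - 1) \<in> S" using nbr[of "vs ! i" "vs ! (i - 1)"] i by (simp add: uedge_commute)
  moreover have "C - \<Gamma> = steps vs - \<Gamma>" using C e_in by auto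
  ultimately show "open_order V S \<Gamma> b vs'"
    unfolding open_order_def using C oo new by auto
qed

text \<open>Posa's argument with one end fixed. Let X be the set of reachable heads. A
  \<open>\<Gamma>\<close>-neighbour of a head in \<open>W\<close> that is neither in X nor an
  initial path neighbour of X would keep its path neighbours, yet a rotation about it makes one of
  them a head. So these neighbours number at most 3 card X, and expansion forces card X > a.\<close>

lemma Posa_endpoints:
  assumes oo: "open_order V S \<Gamma> b vs0" and nc: "\<not> closeable V S \<Gamma> (b - 1)"
    and nbr: "\<And>w v. w \<in> W \<Longrightarrow> uedge w v \<in> \<Gamma> \<Longrightarrow> v \<in> S"
    and sub: "W \<subseteq> S" "S \<subseteq> V" "finite V"
    and expand: "\<And>X. X \<subseteq> S \<Longrightarrow> X \<noteq> {} \<Longrightarrow> card X \<le> a \<Longrightarrow>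
       card {w \<in> W. \<exists>x\<in>X. uedge x w \<in> \<Gamma>} > 3 * card X"
  shows "\<exists>X\<subseteq>S. card X > a \<and>
    (\<forall>x\<in>X. \<exists>vs. open_order V S \<Gamma> b vs \<and> hd vs = x \<and> last vs = last vs0)"
proof -
  define R where "R = (rotates W \<Gamma>)\<^sup>*\<^sup>*"
  define X where "X = {hd vs |vs. R vs0 vs}"
  define N where "N = (\<Union>x\<in>X. path_nbrs vs0 x)"
  have reach: "open_order V S \<Gamma> b vs \<and> last vs = last vs0" if "R vs0 vs" for vs
    using that unfolding R_def
  proof (induction rule: rtranclp_induct)
    case base then show ?case using oo by simp
  next
    case (step y z)
    then show ?case using rotates_open_order[OF step.hyps(2) _ nc nbr] by auto
  qed
  have XS: "X \<subseteq> S" using reach by (auto simp: X_def open_order_def)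
  \<comment> \<open>A rotation changes the path neighbours of three vertices only: the old head, the
    new head and the pivot. The heads are in \<open>X\<close>; the pivot is adjacent to the new
    head, and by induction was so initially, hence lies in \<open>N\<close> unless its neighbourhood
    had changed before.\<close>
  have inv: "path_nbrs vs u = path_nbrs vs0 u" if "R vs0 vs" "u \<notin> X \<union> N" for vs u
    using that(1) unfolding R_def
  proof (induction rule: rtranclp_induct)
    case (step y z)
    have Ry: "R vs0 y" and Rz: "R vs0 z" using step.hyps by (auto simp: R_def)
    obtain i where i: "0 < i" "i < length y" "z = rev (take i y) @ drop i y"
      using step.hyps(2) by (auto simp: rotates_def)
    have "distinct y" using reach[OF Ry] by (auto simp: open_order_def)
    then obtain C where C: "steps y = insert (uedge (y ! (i - 1)) (y ! i)) C"
      "steps z = insert (uedge (hd y) (y ! i)) C" "hd z = y ! (i - 1)"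
      using rotation_steps[OF _ i(1,2)] unfolding i(3) by metis
    have hX: "hd y \<in> X" "y ! (i - 1) \<in> X"
      using Ry Rz unfolding X_def C(3)[symmetric] by blast+
    have "u \<noteq> y ! i"
    proof
      assume "u = y ! i"
      then have "y ! (i - 1) \<in> path_nbrs y u" using C(1) by (simp add: path_nbrs_def uedge_commute)
      then have "y ! (i - 1) \<in> path_nbrs vs0 u" using step.IH by simp
      then have "u \<in> path_nbrs vs0 (y ! (i - 1))" by (simp add: path_nbrs_def uedge_commute)
      then show False using that(2) hX by (auto simp: N_def)
    qed
    moreover have "u \<noteq> hd y" "u \<noteq> y ! (i - 1)" using that(2) hX by auto
    ultimately have "path_nbrs z u = path_nbrs y u"
      unfolding path_nbrs_def C by (auto simp: uedge_eq_iff)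
    then show ?case using step.IH by simp
  qed simp
  have nb: "{w \<in> W. \<exists>x\<in>X. uedge x w \<in> \<Gamma>} \<subseteq> X \<union> N"
  proof
    fix u assume "u \<in> {w \<in> W. \<exists>x\<in>X. uedge x w \<in> \<Gamma>}"
    then obtain vs where u: "u \<in> W" "R vs0 vs" "uedge (hd vs) u \<in> \<Gamma>" by (auto simp: X_def)
    have o: "open_order V S \<Gamma> b vs" using reach u by simp
    have "u \<in> set vs" using u sub o by (auto simp: open_order_def)
    then obtain i where i: "i < length vs" "u = vs ! i" by (auto simp: in_set_conv_nth)
    show "u \<in> X \<union> N"
    proof (cases "i = 0")
      case True
      then have "u = hd vs" using i by (cases vs) auto
      then show ?thesis using u by (auto simp: X_def)
    next
      case False
      define vs' where "vs' = rev (take i vs) @ drop i vs"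
      have "rotates W \<Gamma> vs vs'" unfolding rotates_def vs'_def using False i u by blast
      then have R': "R vs0 vs'" using u(2) by (auto simp: R_def intro: rtranclp.intros)
      have "distinct vs" using o by (auto simp: open_order_def)
      then obtain C where C: "steps vs = insert (uedge (vs ! (i - 1)) (vs ! i)) C" "hd vs' = vs ! (i - 1)"
        using rotation_steps[of vs i] False i unfolding vs'_def by (metis bot_nat_0.not_eq_extremum)
      have m: "vs ! (i - 1) \<in> X" using R' unfolding X_def C(2)[symmetric] by blast
      show ?thesis
      proof (rule ccontr)
        assume "u \<notin> X \<union> N"
        then have "path_nbrs vs u = path_nbrs vs0 u" using inv u by blast
        moreover have "vs ! (i - 1) \<in> path_nbrs vs u" using C i by (simp add: path_nbrs_def uedge_commute)
        ultimately have "u \<in> path_nbrs vs0 (vs ! (i - 1))" by (simp add: path_nbrs_def uedge_commute)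
        then show False using m \<open>u \<notin> X \<union> N\<close> by (auto simp: N_def)
      qed
    qed
  qed
  have finX: "finite X" using XS sub by (meson finite_subset)
  have d0: "distinct vs0" using oo by (auto simp: open_order_def)
  have finN: "finite N" unfolding N_def using finX path_nbrs_bound[OF d0] by auto
  have "card N \<le> (\<Sum>x\<in>X. card (path_nbrs vs0 x))" unfolding N_def using finX by (rule card_UN_le)
  also have "\<dots> \<le> (\<Sum>x\<in>X. 2)" using path_nbrs_bound[OF d0] by (intro sum_mono) auto
  finally have "card N \<le> 2 * card X" by simp
  then have "card (X \<union> N) \<le> 3 * card X" using card_Un_le[of X N] by linarith
  then have "card {w \<in> W. \<exists>x\<in>X. uedge x w \<in> \<Gamma>} \<le> 3 * card X"
    using card_mono[OF _ nb] finX finN by simp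
  moreover have "X \<noteq> {}" unfolding X_def R_def by auto
  ultimately have "card X > a" using expand[OF XS] by fastforce
  then show ?thesis using XS reach by (intro exI[of _ X]) (auto simp: X_def)
qed

lemma open_order_rev: "open_order V S \<Gamma> b vs \<Longrightarrow> vs \<noteq> [] \<Longrightarrow> open_order V S \<Gamma> b (rev vs)"
  by (auto simp: open_order_def steps_rev hd_rev last_rev)

lemma open_order_insert_closeable:
  assumes "open_order V S \<Gamma> b vs"
  shows "closeable V S (insert (uedge (hd vs) (last vs)) \<Gamma>) (b - 1)"
proof -
  have "cyc vs - insert (uedge (hd vs) (last vs)) \<Gamma> \<subseteq> steps vs - \<Gamma>"
    by (auto simp: cyc_def uedge_commute)
  moreover from card_mono[OF _ this] have "card (cyc vs - insert (uedge (hd vs) (last vs)) \<Gamma>) \<le> b - 1"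
    using assms unfolding open_order_def by (metis Suc_pred' finite_Diff finite_steps le_trans less_Suc_eq_le not_less_zero neq0_conv)
  ultimately show ?thesis
    using assms unfolding closeable_def open_order_def by (intro exI[of _ vs]) auto
qed

text \<open>Rotating one end produces the set X. For each x in X a path starting in x is reversed,
  so that x becomes the fixed end, and rotating again yields its partners. Joining the two ends of a
  resulting path closes it.\<close>

lemma Posa_boosters:
  assumes cl: "closeable V S \<Gamma> b" and nc: "\<not> closeable V S \<Gamma> (b - 1)"
    and nbr: "\<And>w v. w \<in> W \<Longrightarrow> uedge w v \<in> \<Gamma> \<Longrightarrow> v \<in> S"
    and sub: "W \<subseteq> S" "S \<subseteq> V" "finite V" "card V \<ge> 3"
    and expand: "\<And>X. X \<subseteq> S \<Longrightarrow> X \<noteq> {} \<Longrightarrow> card X \<le> a \<Longrightarrow>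
       card {w \<in> W. \<exists>x\<in>X. uedge x w \<in> \<Gamma>} > 3 * card X"
  shows "\<exists>X\<subseteq>S. card X > a \<and> (\<forall>x\<in>X. \<exists>Y\<subseteq>S. card Y > a \<and>
     (\<forall>y\<in>Y. closeable V S (insert (uedge x y) \<Gamma>) (b - 1)))"
proof -
  obtain vs0 where vs0: "open_order V S \<Gamma> b vs0" using closeable_open_order[OF cl nc sub(4)] .
  obtain X where X: "X \<subseteq> S" "card X > a"
    "\<And>x. x \<in> X \<Longrightarrow> \<exists>vs. open_order V S \<Gamma> b vs \<and> hd vs = x \<and> last vs = last vs0"
  proof -
    have "\<exists>X\<subseteq>S. card X > a \<and> (\<forall>x\<in>X. \<exists>vs. open_order V S \<Gamma> b vs \<and> hd vs = x \<and> last vs = last vs0)"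
      by (rule Posa_endpoints[where W = W, OF vs0 nc _ sub(1-3)]) (use nbr expand in blast)+
    then show thesis using that by blast
  qed
  have "\<exists>Y\<subseteq>S. card Y > a \<and> (\<forall>y\<in>Y. closeable V S (insert (uedge x y) \<Gamma>) (b - 1))" if x: "x \<in> X" for x
  proof -
    obtain vs where vs: "open_order V S \<Gamma> b vs" "hd vs = x" using X(3)[OF x] by blast
    have ne: "vs \<noteq> []" using vs sub by (auto simp: open_order_def)
    obtain Y where Y: "Y \<subseteq> S" "card Y > a"
      "\<And>y. y \<in> Y \<Longrightarrow> \<exists>ws. open_order V S \<Gamma> b ws \<and> hd ws = y \<and> last ws = last (rev vs)"
    proof -
      have "\<exists>X\<subseteq>S. card X > a \<and> (\<forall>x\<in>X. \<exists>ws. open_order V S \<Gamma> b ws \<and> hd ws = x \<and> last ws = last (rev vs))"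
        by (rule Posa_endpoints[where W = W, OF open_order_rev[OF vs(1) ne] nc _ sub(1-3)]) (use nbr expand in blast)+
      then show thesis using that by blast
    qed
    have "closeable V S (insert (uedge x y) \<Gamma>) (b - 1)" if "y \<in> Y" for y
      using Y(3)[OF that] open_order_insert_closeable vs ne by (metis last_rev uedge_commute)
    then show ?thesis using Y by blast
  qed
  then show ?thesis using X by blast
qed

section \<open>Edge colourings and independent transversals\<close>

text \<open>Induction on the edges, with the two components of a pair as the two sides. The new edge
  (u, v) receives a colour \<open>\<alpha>\<close> free at u, after the chain of
  \<open>\<alpha>\<close> and \<open>\<beta>\<close> edges through v has been swapped, where
  \<open>\<beta>\<close> is free at v.\<close>

lemma konig_edge_colouring:
  fixes E :: "('a \<times> 'b) set" and C :: "'c set"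
  assumes "finite E" "finite C"
    and "\<And>a. card {e \<in> E. fst e = a} \<le> card C"
    and "\<And>b. card {e \<in> E. snd e = b} \<le> card C"
  shows "\<exists>f. (\<forall>e\<in>E. f e \<in> C) \<and>
     (\<forall>e\<in>E. \<forall>e'\<in>E. e \<noteq> e' \<and> (fst e = fst e' \<or> snd e = snd e') \<longrightarrow> f e \<noteq> f e')"
  using assms(1,3,4)
proof (induction E rule: finite_induct)
  case (insert e E)
  obtain u v where e: "e = (u, v)" by (cases e)
  have sub1: "card {e \<in> E. fst e = a} \<le> card C" for a
    using insert.prems(1)[of a] card_mono[of "{x \<in> insert e E. fst x = a}" "{x \<in> E. fst x = a}"] insert.hyps
    by fastforce
  have sub2: "card {e \<in> E. snd e = b} \<le> card C" for b
    using insert.prems(2)[of b] card_mono[of "{x \<in> insert e E. snd x = b}" "{x \<in> E. snd x = b}"] insert.hyps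
    by fastforce
  obtain f where f: "\<And>e. e \<in> E \<Longrightarrow> f e \<in> C"
    "\<And>e e'. e \<in> E \<Longrightarrow> e' \<in> E \<Longrightarrow> e \<noteq> e' \<Longrightarrow> fst e = fst e' \<or> snd e = snd e' \<Longrightarrow> f e \<noteq> f e'"
  proof -
    obtain f where f: "\<forall>e\<in>E. f e \<in> C"
      "\<forall>e\<in>E. \<forall>e'\<in>E. e \<noteq> e' \<and> (fst e = fst e' \<or> snd e = snd e') \<longrightarrow> f e \<noteq> f e'"
      using insert.IH[OF sub1 sub2] by (elim exE conjE)
    show thesis by (rule that[of f]) (use f in simp_all)
  qed
  have inj1: "inj_on f {x \<in> E. fst x = a}" for a
  proof (rule inj_onI)
    fix x y assume "x \<in> {x \<in> E. fst x = a}" "y \<in> {x \<in> E. fst x = a}" "f x = f y"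
    then show "x = y" using f(2)[of x y] by auto
  qed
  have inj2: "inj_on f {x \<in> E. snd x = b}" for b
  proof (rule inj_onI)
    fix x y assume "x \<in> {x \<in> E. snd x = b}" "y \<in> {x \<in> E. snd x = b}" "f x = f y"
    then show "x = y" using f(2)[of x y] by auto
  qed
  have "card (f ` {x \<in> E. fst x = u}) < card C"
  proof -
    have "{x \<in> insert e E. fst x = u} = insert e {x \<in> E. fst x = u}" using e by auto
    then have "Suc (card {x \<in> E. fst x = u}) \<le> card C"
      using insert.prems(1)[of u] insert.hyps by simp
    then show ?thesis using card_image[OF inj1] by simp
  qed
  then obtain \<alpha> where \<alpha>: "\<alpha> \<in> C" "\<alpha> \<notin> f ` {x \<in> E. fst x = u}"
  proof -
    have "\<not> C \<subseteq> f ` {x \<in> E. fst x = u}"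
    proof
      assume "C \<subseteq> f ` {x \<in> E. fst x = u}"
      then have "card C \<le> card (f ` {x \<in> E. fst x = u})" using insert.hyps(1) by (intro card_mono) auto
      then show False using \<open>card (f ` {x \<in> E. fst x = u}) < card C\<close> by simp
    qed
    then show thesis using that by blast
  qed
  have "card (f ` {x \<in> E. snd x = v}) < card C"
  proof -
    have "{x \<in> insert e E. snd x = v} = insert e {x \<in> E. snd x = v}" using e by auto
    then have "Suc (card {x \<in> E. snd x = v}) \<le> card C"
      using insert.prems(2)[of v] insert.hyps by simp
    then show ?thesis using card_image[OF inj2] by simp
  qed
  then obtain \<beta> where \<beta>: "\<beta> \<in> C" "\<beta> \<notin> f ` {x \<in> E. snd x = v}"
  proof -
    have "\<not> C \<subseteq> f ` {x \<in> E. snd x = v}"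
    proof
      assume "C \<subseteq> f ` {x \<in> E. snd x = v}"
      then have "card C \<le> card (f ` {x \<in> E. snd x = v})" using insert.hyps(1) by (intro card_mono) auto
      then show False using \<open>card (f ` {x \<in> E. snd x = v}) < card C\<close> by simp
    qed
    then show thesis using that by blast
  qed
  text \<open>The \<open>\<alpha>\<close>/\<open>\<beta>\<close>-Kempe chain starting at \<open>v\<close> enters \<open>fst\<close>-vertices only along
    \<open>\<alpha>\<close>-edges, so it never reaches \<open>u\<close>.\<close>
  define step where "step = (\<lambda>S :: 'b set. S \<union> {y. \<exists>x y'. y' \<in> S \<and> (x, y') \<in> E \<and> f (x, y') = \<alpha> \<and> (x, y) \<in> E \<and> f (x, y) = \<beta>})"
  define S where "S = (\<Union>k. (step ^^ k) {v})"
  have vS: "v \<in> S" unfolding S_def by (rule UN_I[of 0]) auto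
  have S_closed: "y \<in> S" if y': "y' \<in> S" and "(x, y') \<in> E" "f (x, y') = \<alpha>" "(x, y) \<in> E" "f (x, y) = \<beta>" for x y y'
  proof -
    obtain k where "y' \<in> (step ^^ k) {v}" using y' unfolding S_def by blast
    then have "y \<in> (step ^^ Suc k) {v}" using that unfolding step_def by auto
    then show ?thesis unfolding S_def by blast
  qed
  have S_cases: "y = v \<or> (\<exists>x y'. y' \<in> S \<and> (x, y') \<in> E \<and> f (x, y') = \<alpha> \<and> (x, y) \<in> E \<and> f (x, y) = \<beta>)"
    if yS: "y \<in> S" for y
  proof -
    obtain k where "y \<in> (step ^^ k) {v}" using yS unfolding S_def by blast
    then show ?thesis
    proof (induction k)
      case (Suc k)
      have "(step ^^ k) {v} \<subseteq> S" unfolding S_def by blast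
      then show ?case using Suc by (auto simp: step_def)
    qed simp
  qed
  define T where "T = {x. \<exists>y\<in>S. (x, y) \<in> E \<and> f (x, y) = \<alpha>}"
  have uT: "u \<notin> T" using \<alpha>(2) by (auto simp: T_def image_iff)
  \<comment> \<open>So \<open>T\<close> and \<open>S\<close> are the two sides of one union of
    components of the \<open>\<alpha>\<close>/\<open>\<beta>\<close> graph. Going back along a
    \<open>\<beta>\<close> edge works because \<open>v\<close>, the only start of the chain, has
    none.\<close>
  have chain: "fst d \<in> T \<longleftrightarrow> snd d \<in> S" if d: "d \<in> E" "f d = \<alpha> \<or> f d = \<beta>" for d
  proof -
    obtain x y where xy: "d = (x, y)" by (cases d)
    show ?thesis
    proof (cases "f d = \<alpha>")
      case True
      show ?thesis
      proof
        assume "fst d \<in> T"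
        then obtain y' where y': "y' \<in> S" "(x, y') \<in> E" "f (x, y') = \<alpha>" using xy by (auto simp: T_def)
        then have "y' = y" using f(2)[of "(x, y')" d] d True xy by auto
        then show "snd d \<in> S" using y' xy by simp
      next
        assume "snd d \<in> S"
        then show "fst d \<in> T" using d True xy by (auto simp: T_def)
      qed
    next
      case False
      then have fb: "f d = \<beta>" using d by simp
      show ?thesis
      proof
        assume "fst d \<in> T"
        then obtain y' where "y' \<in> S" "(x, y') \<in> E" "f (x, y') = \<alpha>" using xy by (auto simp: T_def)
        then show "snd d \<in> S" using S_closed[of y' x y] d fb xy by simp
      next
        assume "snd d \<in> S"
        moreover have "y \<noteq> v" using \<beta>(2) d fb xy by (force simp: image_iff)
        ultimately obtain x' y' where *: "y' \<in> S" "(x', y') \<in> E" "f (x', y') = \<alpha>" "(x', y) \<in> E" "f (x', y) = \<beta>"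
          using S_cases[of y] xy by auto
        then have "x' = x" using f(2)[of "(x', y)" d] d fb xy by auto
        then show "fst d \<in> T" using * xy by (auto simp: T_def)
      qed
    qed
  qed
  \<comment> \<open>By \<open>chain\<close>, swapping on the edges that end in \<open>S\<close>
    keeps the colouring proper. It frees \<open>\<alpha>\<close> at \<open>v\<close> and changes
    nothing at \<open>u\<close>, which is not in \<open>T\<close>.\<close>
  define g where "g = (\<lambda>d. if snd d \<in> S \<and> d \<in> E then (if f d = \<alpha> then \<beta> else if f d = \<beta> then \<alpha> else f d) else f d)"
  have g_in: "g d \<in> C" if "d \<in> E" for d
    using f(1)[OF that] \<alpha> \<beta> by (auto simp: g_def)
  have g_proper: "g d \<noteq> g d'" if "d \<in> E" "d' \<in> E" "d \<noteq> d'" "fst d = fst d' \<or> snd d = snd d'" for d d'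
    using f(2)[OF that] chain[OF that(1)] chain[OF that(2)] that
    by (auto simp: g_def split: if_splits)
  have free: "g d \<noteq> \<alpha>" if "d \<in> E" and uv: "fst d = u \<or> snd d = v" for d
  proof
    assume ga: "g d = \<alpha>"
    consider "fst d = u" | "snd d = v" using uv by blast
    then show False
    proof cases
      case 1
      then have "f d \<noteq> \<alpha>" using \<alpha>(2) that(1) by blast
      then have "snd d \<in> S" "f d = \<beta>" using ga by (auto simp: g_def split: if_splits)
      then show False using chain[OF that(1)] 1 uT by simp
    next
      case 2
      then have "f d \<noteq> \<beta>" using \<beta>(2) that(1) by blast
      then show False using ga 2 vS that by (auto simp: g_def split: if_splits)
    qed
  qed
  define g' where "g' = g(e := \<alpha>)"
  have "\<forall>d\<in>insert e E. g' d \<in> C" using g_in \<alpha> by (auto simp: g'_def)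
  moreover have "\<forall>d\<in>insert e E. \<forall>d'\<in>insert e E. d \<noteq> d' \<and> (fst d = fst d' \<or> snd d = snd d') \<longrightarrow> g' d \<noteq> g' d'"
  proof (intro ballI impI)
    fix d d' assume "d \<in> insert e E" "d' \<in> insert e E" "d \<noteq> d' \<and> (fst d = fst d' \<or> snd d = snd d')"
    then consider "d \<in> E" "d' \<in> E" "d \<noteq> d'" "fst d = fst d' \<or> snd d = snd d'"
      | "d = e" "d' \<in> E" "fst d' = u \<or> snd d' = v" | "d \<in> E" "d' = e" "fst d = u \<or> snd d = v"
      using e by auto
    then show "g' d \<noteq> g' d'"
    proof cases
      case 1
      then have "d \<noteq> e" "d' \<noteq> e" using insert.hyps(2) by auto
      then show ?thesis using g_proper[OF 1] by (simp add: g'_def)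
    next
      case 2
      then have "d' \<noteq> e" using insert.hyps(2) by auto
      then show ?thesis using free[OF 2(2,3)] 2(1) by (simp add: g'_def)
    next
      case 3
      then have "d \<noteq> e" using insert.hyps(2) by auto
      then show ?thesis using free[OF 3(1,3)] 3(2) by (simp add: g'_def)
    qed
  qed
  ultimately show ?case by blast
qed auto

section \<open>Independent transversals by counting\<close>

definition transversals :: "('p \<Rightarrow> 'e set) \<Rightarrow> ('p \<Rightarrow> 'e \<Rightarrow> 'p \<Rightarrow> 'e \<Rightarrow> bool) \<Rightarrow> 'p set \<Rightarrow> ('p \<Rightarrow> 'e) set" where
  "transversals L conf T = {f \<in> PiE T L. \<forall>v\<in>T. \<forall>v'\<in>T. v \<noteq> v' \<longrightarrow> \<not> conf v (f v) v' (f v')}"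

text \<open>Each slot v chooses from its list \<open>L v\<close> of size at least \<open>D\<close>,
  and a single choice excludes at most D/4 choices at other slots. The 4 is the constant for which a
  new slot multiplies the number of transversals by at least half of its list size.\<close>

locale sparse_conflicts =
  fixes P :: "'p set" and L :: "'p \<Rightarrow> 'e set" and conf and D :: real
  assumes finite_P: "finite P" and finite_L: "\<And>v. v \<in> P \<Longrightarrow> finite (L v)"
    and D_pos: "D > 0" and D_le: "\<And>v. v \<in> P \<Longrightarrow> D \<le> card (L v)"
    and conf_sym: "\<And>v x v' y. conf v x v' y \<Longrightarrow> conf v' y v x"
    and few: "\<And>v x. v \<in> P \<Longrightarrow> x \<in> L v \<Longrightarrow>
       real (card {(v', y). v' \<in> P \<and> y \<in> L v' \<and> v' \<noteq> v \<and> conf v x v' y}) \<le> D / 4"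
begin

abbreviation "IT \<equiv> transversals L conf"

lemma finite_IT: "T \<subseteq> P \<Longrightarrow> finite (IT T)"
  unfolding transversals_def
  by (rule finite_subset[of _ "PiE T L"]) (auto intro!: finite_PiE finite_L intro: finite_subset[OF _ finite_P])

lemma restrict_IT: "f \<in> IT T \<Longrightarrow> T' \<subseteq> T \<Longrightarrow> restrict f T' \<in> IT T'"
  by (auto simp: transversals_def)

lemma inj_on_restrict:
  assumes "A \<subseteq> {f \<in> IT T. f v = y}"
  shows "inj_on (\<lambda>f. restrict f (T - {v})) A"
proof (rule inj_onI)
  fix f g assume fg: "f \<in> A" "g \<in> A" "restrict f (T - {v}) = restrict g (T - {v})"
  have "f x = g x" for x
  proof (cases "x \<in> T - {v}")
    case True then show ?thesis using fg(3) by (metis restrict_apply')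
  next
    case False
    have "f \<in> PiE T L" "g \<in> PiE T L" "f v = y" "g v = y"
      using fg(1,2) assms by (auto simp: transversals_def)
    then show ?thesis using False by (cases "x = v") (simp_all add: PiE_arb[of _ T L])
  qed
  then show "f = g" by blast
qed

text \<open>Rosenfeld's counting argument.\<close>

lemma IT_growth:
  assumes "T \<subseteq> P" "v \<in> P" "v \<notin> T"
  shows "real (card (L v)) / 2 * card (IT T) \<le> card (IT (insert v T))"
  using assms
proof (induction "card T" arbitrary: T v rule: less_induct)
  case less
  have finT: "finite T" using less.prems finite_P by (meson finite_subset)
  let ?I = "IT T"
  \<comment> \<open>Pairs (f, x) whose extension by x at v has a conflict. Each is charged to a
    conflicting choice (v', f v'); transversals with a prescribed value at v' are at most a 2/D
    share by the induction hypothesis for T without v'. With D/4 conflicts per x, at most half of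
    all pairs are bad.\<close>
  define B where "B = {(f, x). f \<in> ?I \<and> x \<in> L v \<and> (\<exists>v'\<in>T. conf v x v' (f v'))}"
  define K where "K = (\<lambda>x. {(v', y). v' \<in> P \<and> y \<in> L v' \<and> v' \<noteq> v \<and> conf v x v' y})"
  have finK: "finite (K x)" for x
    unfolding K_def by (rule finite_subset[of _ "Sigma P L"]) (auto intro: finite_P finite_L)
  have single: "real (card {f \<in> ?I. f v' = y}) \<le> 2 / D * card ?I" if "v' \<in> T" for v' y
  proof -
    have "card {f \<in> ?I. f v' = y} = card ((\<lambda>f. restrict f (T - {v'})) ` {f \<in> ?I. f v' = y})"
      by (rule card_image[symmetric]) (rule inj_on_restrict[OF order_refl])
    also have "\<dots> \<le> card (IT (T - {v'}))"
      using less.prems by (intro card_mono finite_IT) (auto intro: restrict_IT)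
    finally have 1: "real (card {f \<in> ?I. f v' = y}) \<le> card (IT (T - {v'}))" by simp
    have "card (T - {v'}) < card T" using that finT by (meson card_Diff1_less)
    then have "real (card (L v')) / 2 * card (IT (T - {v'})) \<le> card (IT (insert v' (T - {v'})))"
      using less.prems that by (intro less.hyps) auto
    then have "real (card (L v')) / 2 * card (IT (T - {v'})) \<le> card ?I"
      using that by (simp add: insert_absorb)
    moreover have "D / 2 * card (IT (T - {v'})) \<le> real (card (L v')) / 2 * card (IT (T - {v'}))"
      using D_le[of v'] that less.prems by (intro mult_right_mono) auto
    ultimately have "D / 2 * card (IT (T - {v'})) \<le> card ?I" by linarith
    then have "real (card (IT (T - {v'}))) \<le> 2 / D * card ?I" using D_pos by (simp add: field_simps)
    then show ?thesis using 1 by linarith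
  qed
  have finI: "finite ?I" using less.prems by (intro finite_IT) auto
  have finLv: "finite (L v)" using finite_L less.prems by simp
  define K' where "K' = Sigma (L v) (\<lambda>x. {z \<in> K x. fst z \<in> T})"
  have finK': "finite K'" unfolding K'_def using finLv finK by auto
  define A where "A = (\<lambda>k :: 'e \<times> 'p \<times> 'e. (\<lambda>f. (f, fst k)) ` {f \<in> ?I. f (fst (snd k)) = snd (snd k)})"
  have B_sub: "B \<subseteq> (\<Union>k\<in>K'. A k)"
  proof
    fix z assume "z \<in> B"
    then obtain f x v' where z: "z = (f, x)" "f \<in> ?I" "x \<in> L v" "v' \<in> T" "conf v x v' (f v')"
      unfolding B_def by blast
    have "v' \<in> P" "f v' \<in> L v'" "v' \<noteq> v" using z less.prems by (auto simp: transversals_def)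
    then have "(x, v', f v') \<in> K'" using z by (simp add: K'_def K_def)
    moreover have "z \<in> A (x, v', f v')" using z by (simp add: A_def)
    ultimately show "z \<in> (\<Union>k\<in>K'. A k)" by blast
  qed
  have finA: "finite (A k)" for k unfolding A_def using finI by simp
  have "card B \<le> card (\<Union>k\<in>K'. A k)"
    by (rule card_mono[OF _ B_sub]) (simp add: finK' finA)
  also have "\<dots> \<le> (\<Sum>k\<in>K'. card (A k))" using finK' by (rule card_UN_le)
  finally have "real (card B) \<le> (\<Sum>k\<in>K'. real (card (A k)))"
    by (metis of_nat_le_iff of_nat_sum)
  also have "\<dots> \<le> (\<Sum>k\<in>K'. 2 / D * card ?I)"
  proof (rule sum_mono)
    fix k assume "k \<in> K'"
    then have "fst (snd k) \<in> T" by (auto simp: K'_def)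
    have "card (A k) \<le> card {f \<in> ?I. f (fst (snd k)) = snd (snd k)}"
      unfolding A_def using finI by (intro card_image_le) simp
    then show "real (card (A k)) \<le> 2 / D * card ?I"
      using single[OF \<open>fst (snd k) \<in> T\<close>, of "snd (snd k)"] by linarith
  qed
  also have "\<dots> = card K' * (2 / D * card ?I)" by simp
  also have "\<dots> \<le> (card (L v) * (D / 4)) * (2 / D * card ?I)"
  proof (rule mult_right_mono)
    have "real (card K') = (\<Sum>x\<in>L v. real (card {z \<in> K x. fst z \<in> T}))"
      unfolding K'_def using finLv finK by (subst card_SigmaI) auto
    also have "\<dots> \<le> (\<Sum>x\<in>L v. D / 4)"
    proof (rule sum_mono)
      fix x assume x: "x \<in> L v"
      have "card {z \<in> K x. fst z \<in> T} \<le> card (K x)" using finK by (intro card_mono) auto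
      moreover have "real (card (K x)) \<le> D / 4" unfolding K_def using few[of v x] less.prems x by simp
      ultimately show "real (card {z \<in> K x. fst z \<in> T}) \<le> D / 4" by linarith
    qed
    finally show "real (card K') \<le> card (L v) * (D / 4)" by simp
  qed (use D_pos in simp)
  also have "\<dots> = real (card (L v)) / 2 * card ?I" using D_pos by simp
  finally have cardB: "real (card B) \<le> real (card (L v)) / 2 * card ?I" .
  have BA: "B \<subseteq> ?I \<times> L v" by (auto simp: B_def)
  have "inj_on (\<lambda>(f, x). f(v := x)) (?I \<times> L v - B)"
  proof (rule inj_onI, clarify)
    fix f x g y assume fg: "f \<in> ?I" "g \<in> ?I" "f(v := x) = g(v := y)"
    have "f \<in> PiE T L" "g \<in> PiE T L" using fg(1,2) by (auto simp: transversals_def)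
    then have "f z = g z" for z
      using fun_cong[OF fg(3), of z] less.prems(3) by (cases "z = v") (simp_all add: PiE_arb[of _ T L])
    moreover have "x = y" using fun_cong[OF fg(3), of v] by simp
    ultimately show "f = g \<and> x = y" by blast
  qed
  moreover have "(\<lambda>(f, x). f(v := x)) ` (?I \<times> L v - B) \<subseteq> IT (insert v T)"
  proof clarify
    fix f x assume fx: "f \<in> ?I" "x \<in> L v" "(f, x) \<notin> B"
    have "f \<in> PiE T L" using fx by (auto simp: transversals_def)
    then have "f(v := x) \<in> PiE (insert v T) L"
      using fx(2) by (rule PiE_fun_upd[rotated])
    moreover have "\<not> conf w ((f(v := x)) w) w' ((f(v := x)) w')"
      if "w \<in> insert v T" "w' \<in> insert v T" "w \<noteq> w'" for w w'
      using that fx less.prems conf_sym unfolding B_def transversals_def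
      by (cases "w = v"; cases "w' = v") auto
    ultimately show "f(v := x) \<in> IT (insert v T)" unfolding transversals_def by blast
  qed
  ultimately have "card (?I \<times> L v - B) \<le> card (IT (insert v T))"
    using less.prems by (intro card_inj_on_le[where f = "\<lambda>(f, x). f(v := x)"] finite_IT) auto
  moreover have "card (?I \<times> L v - B) = card ?I * card (L v) - card B"
    using BA finI finLv by (subst card_Diff_subset) (auto intro: finite_subset[OF BA] simp: card_cartesian_product)
  ultimately have "real (card ?I) * card (L v) - card B \<le> card (IT (insert v T))"
    by (metis diff_le_eq le_diff_conv of_nat_add of_nat_le_iff of_nat_mult)
  then show ?case using cardB by (simp add: algebra_simps)
qed

lemma IT_remove:
  assumes "T \<subseteq> P" "v \<in> T"
  shows "real (card (IT (T - {v}))) \<le> 2 / D * card (IT T)"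
proof -
  have "real (card (L v)) / 2 * card (IT (T - {v})) \<le> card (IT T)"
    using IT_growth[of "T - {v}" v] assms by (auto simp: insert_absorb)
  moreover have "D / 2 * card (IT (T - {v})) \<le> real (card (L v)) / 2 * card (IT (T - {v}))"
    using D_le[of v] assms by (intro mult_right_mono) auto
  ultimately have "D / 2 * card (IT (T - {v})) \<le> card (IT T)" by linarith
  then show ?thesis using D_pos by (simp add: field_simps)
qed

lemma IT_nonempty: "T \<subseteq> P \<Longrightarrow> card (IT T) > 0"
proof -
  assume "T \<subseteq> P"
  moreover from this have "finite T" using finite_P by (meson finite_subset)
  moreover have "finite T \<Longrightarrow> T \<subseteq> P \<Longrightarrow> card (IT T) > 0"
  proof (induction T rule: finite_induct)
    case empty
    have "IT {} = {\<lambda>_. undefined}" by (auto simp: transversals_def)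
    then show ?case by simp
  next
    case (insert v T)
    then have "0 < D / 2 * card (IT T)" using D_pos by simp
    also have "\<dots> \<le> real (card (L v)) / 2 * card (IT T)"
      using D_le[of v] insert.prems by (intro mult_right_mono) auto
    also have "\<dots> \<le> card (IT (insert v T))"
      using insert by (intro IT_growth) auto
    finally show ?case by simp
  qed
  ultimately show ?thesis by blast
qed

text \<open>Peeling off the slots of \<open>Z\<close> one by one, each removal costs a factor 2/D. A
  uniformly random transversal is thus dominated by independent choices, up to a factor 2 per slot
  relative to lists of size \<open>D\<close>.\<close>

lemma IT_marginal:
  assumes "finite Z" "Z \<subseteq> T" "T \<subseteq> P" "\<And>z. z \<in> Z \<Longrightarrow> finite (L' z)"
  shows "real (card {f \<in> IT T. \<forall>z\<in>Z. f z \<in> L' z}) \<le> (\<Prod>z\<in>Z. 2 * card (L' z) / D) * card (IT T)"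
  using assms
proof (induction Z arbitrary: T rule: finite_induct)
  case (insert z Z)
  let ?A = "{f \<in> IT T. \<forall>x\<in>insert z Z. f x \<in> L' x}"
  let ?B = "{g \<in> IT (T - {z}). \<forall>x\<in>Z. g x \<in> L' x}"
  have "inj_on (\<lambda>f. (f z, restrict f (T - {z}))) ?A"
  proof (rule inj_onI)
    fix f g assume fg: "f \<in> ?A" "g \<in> ?A" "(f z, restrict f (T - {z})) = (g z, restrict g (T - {z}))"
    have "f \<in> {f \<in> IT T. f z = g z}" "g \<in> {f \<in> IT T. f z = g z}" using fg by simp_all
    moreover have "restrict f (T - {z}) = restrict g (T - {z})" using fg(3) by simp
    ultimately show "f = g" using inj_on_restrict[OF order_refl, of T z "g z"] by (meson inj_onD)
  qed
  moreover have "(\<lambda>f. (f z, restrict f (T - {z}))) ` ?A \<subseteq> L' z \<times> ?B"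
  proof (rule image_subsetI)
    fix f assume f: "f \<in> ?A"
    then have "restrict f (T - {z}) \<in> IT (T - {z})" by (intro restrict_IT[of f T]) auto
    moreover have "restrict f (T - {z}) x \<in> L' x" if "x \<in> Z" for x
    proof -
      have "x \<in> T - {z}" using that insert.hyps insert.prems by blast
      then show ?thesis using f that by simp
    qed
    ultimately show "(f z, restrict f (T - {z})) \<in> L' z \<times> ?B" using f by simp
  qed
  moreover have finB: "finite ?B" using finite_IT[of "T - {z}"] insert.prems by (auto intro: finite_subset)
  ultimately have "card ?A \<le> card (L' z \<times> ?B)"
    using insert.prems by (intro card_inj_on_le) auto
  then have "real (card ?A) \<le> card (L' z) * real (card ?B)"
    by (simp add: card_cartesian_product flip: of_nat_mult)
  also have "\<dots> \<le> card (L' z) * ((\<Prod>z\<in>Z. 2 * card (L' z) / D) * card (IT (T - {z})))"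
    using insert.prems insert.hyps by (intro mult_left_mono insert.IH) auto
  also have "\<dots> \<le> card (L' z) * ((\<Prod>z\<in>Z. 2 * card (L' z) / D) * (2 / D * card (IT T)))"
    using insert.prems D_pos by (intro mult_left_mono IT_remove prod_nonneg) auto
  also have "\<dots> = (\<Prod>z\<in>insert z Z. 2 * card (L' z) / D) * card (IT T)"
    using insert.hyps by simp
  finally show ?case .
qed simp

text \<open>First moment method: a bad event says that all slots of \<open>Z b\<close> choose inside
  \<open>L' b\<close>, and by \<open>IT_marginal\<close> the bad transversals do not exhaust all of
  them.\<close>

lemma transversal_avoiding:
  assumes "finite \<B>" "\<And>b. b \<in> \<B> \<Longrightarrow> Z b \<subseteq> P" "\<And>b z. b \<in> \<B> \<Longrightarrow> z \<in> Z b \<Longrightarrow> finite (L' b z)"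
    and "(\<Sum>b\<in>\<B>. \<Prod>z\<in>Z b. 2 * card (L' b z) / D) < 1"
  shows "\<exists>f\<in>IT P. \<forall>b\<in>\<B>. \<exists>z\<in>Z b. f z \<notin> L' b z"
proof (rule ccontr)
  assume "\<not> ?thesis"
  then have none: "\<forall>f\<in>IT P. \<exists>b\<in>\<B>. \<forall>z\<in>Z b. f z \<in> L' b z" by simp
  have "IT P \<subseteq> (\<Union>b\<in>\<B>. {f \<in> IT P. \<forall>z\<in>Z b. f z \<in> L' b z})"
  proof
    fix f assume "f \<in> IT P"
    then show "f \<in> (\<Union>b\<in>\<B>. {f \<in> IT P. \<forall>z\<in>Z b. f z \<in> L' b z})" using none by simp
  qed
  then have "card (IT P) \<le> card (\<Union>b\<in>\<B>. {f \<in> IT P. \<forall>z\<in>Z b. f z \<in> L' b z})"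
    using finite_IT[of P] assms(1) by (intro card_mono) auto
  also have "\<dots> \<le> (\<Sum>b\<in>\<B>. card {f \<in> IT P. \<forall>z\<in>Z b. f z \<in> L' b z})"
    using assms(1) by (rule card_UN_le)
  finally have "real (card (IT P)) \<le> real (\<Sum>b\<in>\<B>. card {f \<in> IT P. \<forall>z\<in>Z b. f z \<in> L' b z})"
    by (rule of_nat_mono)
  also have "\<dots> = (\<Sum>b\<in>\<B>. real (card {f \<in> IT P. \<forall>z\<in>Z b. f z \<in> L' b z}))"
    by (rule of_nat_sum)
  also have "\<dots> \<le> (\<Sum>b\<in>\<B>. (\<Prod>z\<in>Z b. 2 * card (L' b z) / D) * card (IT P))"
  proof (intro sum_mono IT_marginal)
    fix b assume b: "b \<in> \<B>"
    show "finite (Z b)" using assms(2)[OF b] finite_P by (rule finite_subset)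
  qed (use assms(2,3) in auto)
  also have "\<dots> = (\<Sum>b\<in>\<B>. \<Prod>z\<in>Z b. 2 * card (L' b z) / D) * card (IT P)"
    by (simp add: sum_distrib_right)
  also have "\<dots> < 1 * real (card (IT P))"
    using assms(4) IT_nonempty[of P] by (intro mult_strict_right_mono) auto
  finally show False by simp
qed

end

section \<open>From linear forests to cyclic orders\<close>

lemma linear_forest_order:
  fixes pos :: "nat \<Rightarrow> nat"
  assumes "finite V" "V \<noteq> {}" "N \<subseteq> V \<times> V"
    and "\<And>a b. (a, b) \<in> N \<Longrightarrow> pos a < pos b"
    and "\<And>a b c. (a, b) \<in> N \<Longrightarrow> (a, c) \<in> N \<Longrightarrow> b = c"
    and "\<And>a b c. (a, c) \<in> N \<Longrightarrow> (b, c) \<in> N \<Longrightarrow> a = b"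
  shows "\<exists>vs. distinct vs \<and> set vs = V \<and> hd vs \<notin> Range N \<and> last vs \<notin> Domain N \<and>
    successively (\<lambda>a b. (a, b) \<in> N \<or> (a \<notin> Domain N \<and> b \<notin> Range N)) vs"
  using assms
proof (induction "card V" arbitrary: V N)
  case (Suc k)
  \<comment> \<open>The vertex of largest position has no outgoing arc. It is deleted together with
    its incoming arc; afterwards it is appended at the end if it had no predecessor, and otherwise
    inserted directly behind its predecessor \<open>u\<close>, which ended a path of
    \<open>N'\<close>.\<close>
  obtain v where v: "v \<in> V" "\<And>w. w \<in> V \<Longrightarrow> pos w \<le> pos v"
  proof -
    have "Max (pos ` V) \<in> pos ` V" using Suc.prems(1,2) by (intro Max_in) auto
    then obtain v where "v \<in> V" "pos v = Max (pos ` V)" by auto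
    then show thesis using that[of v] Suc.prems(1) by simp
  qed
  have vD: "v \<notin> Domain N" using v Suc.prems(3,4) by (meson Domain.cases SigmaD2 leD subsetD)
  define N' where "N' = N - {(a, b). b = v}"
  show ?case
  proof (cases "V = {v}")
    case True
    then have "N = {}" using Suc.prems(3,4) vD by auto
    then show ?thesis using True by (intro exI[of _ "[v]"]) auto
  next
    case False
    have "k = card (V - {v})" using Suc.hyps(2) v Suc.prems(1) by simp
    moreover have "V - {v} \<noteq> {}" using False v by blast
    moreover have "N' \<subseteq> (V - {v}) \<times> (V - {v})" using Suc.prems(3) vD by (auto simp: N'_def)
    moreover have "N' \<subseteq> N" by (auto simp: N'_def)
    ultimately have "\<exists>vs. distinct vs \<and> set vs = V - {v} \<and> hd vs \<notin> Range N' \<and> last vs \<notin> Domain N' \<and>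
      successively (\<lambda>a b. (a, b) \<in> N' \<or> (a \<notin> Domain N' \<and> b \<notin> Range N')) vs"
    proof (intro Suc.hyps(1))
      show "pos a < pos b" if "(a, b) \<in> N'" for a b
        using Suc.prems(4) that \<open>N' \<subseteq> N\<close> by blast
      show "b = c" if "(a, b) \<in> N'" "(a, c) \<in> N'" for a b c
        using Suc.prems(5)[of a b c] that \<open>N' \<subseteq> N\<close> by blast
      show "a = b" if "(a, c) \<in> N'" "(b, c) \<in> N'" for a b c
        using Suc.prems(6)[of a c b] that \<open>N' \<subseteq> N\<close> by blast
    qed (use Suc.prems(1) in auto)
    then obtain vs where vs: "distinct vs" "set vs = V - {v}" "hd vs \<notin> Range N'" "last vs \<notin> Domain N'"
      "successively (\<lambda>a b. (a, b) \<in> N' \<or> (a \<notin> Domain N' \<and> b \<notin> Range N')) vs" by (elim exE conjE)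
    have ne: "vs \<noteq> []" using vs(2) \<open>V - {v} \<noteq> {}\<close> by (metis empty_set)
    have hdV: "hd vs \<noteq> v" using vs(2) ne by (metis Diff_iff hd_in_set insertI1)
    have Ran: "Range N \<subseteq> insert v (Range N')" by (auto simp: N'_def)
    show ?thesis
    proof (cases "v \<in> Range N")
      case False
      then have "N' = N" by (auto simp: N'_def)
      then show ?thesis using vs ne v vD False
        by (intro exI[of _ "vs @ [v]"]) (auto simp: successively_append_iff)
    next
      case True
      then obtain u where u: "(u, v) \<in> N" by blast
      have uv: "u \<in> V - {v}" using u Suc.prems(3) vD by blast
      have Dom: "Domain N \<subseteq> insert u (Domain N')"
        using Suc.prems(6) u by (auto simp: N'_def)
      have uD: "u \<notin> Domain N'" using Suc.prems(5) u by (auto simp: N'_def)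
      obtain xs ys where xy: "vs = xs @ u # ys" using uv vs(2) by (metis split_list)
      define Q where "Q = (\<lambda>a b. (a, b) \<in> N \<or> (a \<notin> Domain N \<and> b \<notin> Range N))"
      have mono: "Q a b" if "(a, b) \<in> N' \<or> (a \<notin> Domain N' \<and> b \<notin> Range N')" "a \<noteq> u" "b \<noteq> v" for a b
        using that Ran Dom unfolding Q_def N'_def by blast
      have su: "successively (\<lambda>a b. (a, b) \<in> N' \<or> (a \<notin> Domain N' \<and> b \<notin> Range N')) (xs @ [u])"
        "successively (\<lambda>a b. (a, b) \<in> N' \<or> (a \<notin> Domain N' \<and> b \<notin> Range N')) (u # ys)"
        using vs(5) unfolding xy by (auto simp: successively_append_iff successively_Cons)
      have "successively Q (xs @ [u])"
        using su(1) unfolding successively_conv_nth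
      proof (intro allI impI)
        fix i assume *: "\<forall>i. Suc i < length (xs @ [u]) \<longrightarrow> ((xs @ [u]) ! i, (xs @ [u]) ! Suc i) \<in> N' \<or>
            ((xs @ [u]) ! i \<notin> Domain N' \<and> (xs @ [u]) ! Suc i \<notin> Range N')" "Suc i < length (xs @ [u])"
        have "(xs @ [u]) ! i \<in> set xs" using *(2) by (simp add: nth_append)
        then have "(xs @ [u]) ! i \<noteq> u" using vs(1) unfolding xy by auto
        moreover have "(xs @ [u]) ! Suc i \<in> set (xs @ [u])" using *(2) by (metis nth_mem)
        then have "(xs @ [u]) ! Suc i \<noteq> v" using vs(2) unfolding xy by auto
        ultimately show "Q ((xs @ [u]) ! i) ((xs @ [u]) ! Suc i)" using * mono by blast
      qed
      moreover have "successively Q ys"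
        using su(2) unfolding successively_conv_nth
      proof (intro allI impI)
        fix i assume *: "\<forall>i. Suc i < length (u # ys) \<longrightarrow> ((u # ys) ! i, (u # ys) ! Suc i) \<in> N' \<or>
            ((u # ys) ! i \<notin> Domain N' \<and> (u # ys) ! Suc i \<notin> Range N')" "Suc i < length ys"
        have "ys ! i \<in> set ys" "ys ! Suc i \<in> set ys" using *(2) by auto
        then have "ys ! i \<noteq> u" "ys ! Suc i \<noteq> v" using vs(1,2) unfolding xy by auto
        then show "Q (ys ! i) (ys ! Suc i)" using *(1)[rule_format, of "Suc i"] *(2) mono by simp
      qed
      moreover have "Q v (hd ys)" if "ys \<noteq> []"
      proof -
        have "(u, hd ys) \<in> N' \<or> (u \<notin> Domain N' \<and> hd ys \<notin> Range N')"
          using su(2) that by (cases ys) auto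
        then have "hd ys \<notin> Range N'" using uD by blast
        moreover have "hd ys \<noteq> v" using vs(2) that unfolding xy by (cases ys) auto
        ultimately show ?thesis using vD Ran unfolding Q_def by blast
      qed
      moreover have "Q u v" using u by (simp add: Q_def)
      ultimately have "successively Q (xs @ u # v # ys)"
        by (cases ys) (auto simp: successively_append_iff successively_Cons)
      moreover have "hd (xs @ u # v # ys) \<notin> Range N"
        using vs(3) hdV Ran unfolding xy by (cases xs) auto
      moreover have "last (xs @ u # v # ys) \<notin> Domain N"
      proof (cases "ys = []")
        case True then show ?thesis using vD by simp
      next
        case False
        then have "last ys \<noteq> u" using vs(1) unfolding xy by auto
        then show ?thesis using vs(4) Dom False unfolding xy by auto
      qed
      moreover have "distinct (xs @ u # v # ys)" "set (xs @ u # v # ys) = V"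
        using vs(1,2) v uv unfolding xy by auto
      ultimately show ?thesis unfolding Q_def by blast
    qed
  qed
qed simp

text \<open>In the order of \<open>linear_forest_order\<close> every step, the closing one included,
  is an arc or a jump from a path end to a path start. Both ends of a jump are in \<open>S\<close>,
  and different jumps leave different vertices, so at most card S steps are missing.\<close>

lemma linear_forest_closeable:
  fixes pos :: "nat \<Rightarrow> nat"
  assumes V: "finite V" "V \<noteq> {}" "N \<subseteq> V \<times> V"
    and N: "\<And>a b. (a, b) \<in> N \<Longrightarrow> pos a < pos b"
     "\<And>a b c. (a, b) \<in> N \<Longrightarrow> (a, c) \<in> N \<Longrightarrow> b = c"
     "\<And>a b c. (a, c) \<in> N \<Longrightarrow> (b, c) \<in> N \<Longrightarrow> a = b"
    and \<Gamma>: "\<And>a b. (a, b) \<in> N \<Longrightarrow> uedge a b \<in> \<Gamma>"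
    and S: "V - Domain N \<subseteq> S" "V - Range N \<subseteq> S" "S \<subseteq> V"
  shows "closeable V S \<Gamma> (card S)"
proof -
  obtain vs where vs: "distinct vs" "set vs = V" "hd vs \<notin> Range N" "last vs \<notin> Domain N"
    "successively (\<lambda>a b. (a, b) \<in> N \<or> (a \<notin> Domain N \<and> b \<notin> Range N)) vs"
  proof -
    have "\<exists>vs. distinct vs \<and> set vs = V \<and> hd vs \<notin> Range N \<and> last vs \<notin> Domain N \<and>
      successively (\<lambda>a b. (a, b) \<in> N \<or> (a \<notin> Domain N \<and> b \<notin> Range N)) vs"
      by (rule linear_forest_order[OF V, of pos]) (fact N)+
    then show thesis using that by (elim exE conjE)
  qed
  have ne: "vs \<noteq> []" using vs V by auto
  define st where "st = (\<lambda>i. uedge (vs ! i) (vs ! (Suc i mod length vs)))"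
  have bad: "\<exists>i<length vs. e = st i \<and> vs ! i \<in> S \<and> vs ! (Suc i mod length vs) \<in> S"
    if e: "e \<in> cyc vs - \<Gamma>" for e
  proof (cases "e \<in> steps vs")
    case True
    then obtain i where i: "Suc i < length vs" "e = uedge (vs ! i) (vs ! Suc i)"
      by (auto simp: steps_conv_nth)
    have "(vs ! i, vs ! Suc i) \<in> N \<or> (vs ! i \<notin> Domain N \<and> vs ! Suc i \<notin> Range N)"
      using vs(5) i(1) unfolding successively_conv_nth by blast
    moreover have "(vs ! i, vs ! Suc i) \<notin> N" using \<Gamma> e i by blast
    moreover have "vs ! i \<in> V" "vs ! Suc i \<in> V" using i vs(2) by (metis Suc_lessD nth_mem)+
    ultimately show ?thesis using i S by (intro exI[of _ i]) (auto simp: st_def)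
  next
    case False
    then have "e = uedge (last vs) (hd vs)" using e by (auto simp: cyc_def)
    moreover have "last vs \<in> S" "hd vs \<in> S" using vs ne S by (metis Diff_iff last_in_set hd_in_set subsetD)+
    moreover have "last vs = vs ! (length vs - 1)" "hd vs = vs ! 0"
      using ne by (auto simp: last_conv_nth hd_conv_nth)
    ultimately show ?thesis using ne
      by (intro exI[of _ "length vs - 1"]) (auto simp: st_def)
  qed
  have "cyc vs - \<Gamma> \<subseteq> st ` {i. i < length vs \<and> vs ! i \<in> S}" using bad by blast
  then have "card (cyc vs - \<Gamma>) \<le> card (st ` {i. i < length vs \<and> vs ! i \<in> S})"
    by (intro card_mono) auto
  also have "\<dots> \<le> card {i. i < length vs \<and> vs ! i \<in> S}" by (intro card_image_le) auto
  also have "\<dots> \<le> card S"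
    using vs(1) S(3) V(1) by (intro card_inj_on_le[where f = "\<lambda>i. vs ! i"])
      (auto simp: inj_on_def nth_eq_iff_index_eq intro: finite_subset)
  finally have "card (cyc vs - \<Gamma>) \<le> card S" .
  moreover have "cyc vs - \<Gamma> \<subseteq> S \<times> S"
  proof
    fix e assume "e \<in> cyc vs - \<Gamma>"
    then obtain i where "e = st i" "vs ! i \<in> S" "vs ! (Suc i mod length vs) \<in> S" using bad by blast
    then show "e \<in> S \<times> S" unfolding st_def by (simp only: uedge_mem_Times simp_thms)
  qed
  ultimately show ?thesis unfolding closeable_def using vs by blast
qed

section \<open>Permutations counted by the images of two points\<close>

lemma card_permutes_pair_invariant:
  fixes q :: nat
  assumes "x < q" "y < q" "x \<noteq> y" "x' < q" "y' < q" "x' \<noteq> y'"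
  shows "card {\<sigma>. \<sigma> permutes {..<q} \<and> (\<sigma> x, \<sigma> y) \<in> A} =
    card {\<sigma>. \<sigma> permutes {..<q} \<and> (\<sigma> x', \<sigma> y') \<in> A}"
proof -
  define a where "a = Transposition.transpose x x'"
  define \<pi> where "\<pi> = Transposition.transpose (a y) y' \<circ> a"
  have a: "a permutes {..<q}" unfolding a_def using assms by (intro permutes_swap_id) auto
  have "a y < q" using permutes_in_image[OF a, of y] assms by simp
  then have \<pi>: "\<pi> permutes {..<q}" unfolding \<pi>_def using assms a
    by (intro permutes_compose permutes_swap_id) auto
  have ax: "a x = x'" by (simp add: a_def)
  have "a y \<noteq> x'" using ax assms permutes_inj[OF a] by (metis injD)
  then have \<pi>x: "\<pi> x = x'" "\<pi> y = y'" using assms ax by (auto simp: \<pi>_def Transposition.transpose_def)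
  have "bij_betw (\<lambda>\<sigma>. \<sigma> \<circ> \<pi>) {\<sigma>. \<sigma> permutes {..<q} \<and> (\<sigma> x', \<sigma> y') \<in> A}
     {\<sigma>. \<sigma> permutes {..<q} \<and> (\<sigma> x, \<sigma> y) \<in> A}"
  proof (rule bij_betwI[where g = "\<lambda>\<sigma>. \<sigma> \<circ> inv \<pi>"])
    have inv: "inv \<pi> x' = x" "inv \<pi> y' = y" using \<pi>x permutes_inv_eq[OF \<pi>] by auto
    show "(\<lambda>\<sigma>. \<sigma> \<circ> \<pi>) \<in> {\<sigma>. \<sigma> permutes {..<q} \<and> (\<sigma> x', \<sigma> y') \<in> A} \<rightarrow> {\<sigma>. \<sigma> permutes {..<q} \<and> (\<sigma> x, \<sigma> y) \<in> A}"
      using permutes_compose[OF \<pi>] \<pi>x by auto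
    show "(\<lambda>\<sigma>. \<sigma> \<circ> inv \<pi>) \<in> {\<sigma>. \<sigma> permutes {..<q} \<and> (\<sigma> x, \<sigma> y) \<in> A} \<rightarrow> {\<sigma>. \<sigma> permutes {..<q} \<and> (\<sigma> x', \<sigma> y') \<in> A}"
      using permutes_compose[OF permutes_inv[OF \<pi>]] inv by auto
  qed (auto simp: o_assoc[symmetric] permutes_inv_o[OF \<pi>])
  from bij_betw_same_card[OF this] show ?thesis by simp
qed

text \<open>Double counting of permutations against ordered pairs of distinct points: each
  permutation sends exactly card A pairs into \<open>A\<close>, and by the preceding invariance each
  pair contributes the same number of permutations.\<close>

lemma card_permutes_pair:
  fixes q :: nat
  assumes "x < q" "y < q" "x \<noteq> y" and A: "A \<subseteq> {(a, b). a < q \<and> b < q \<and> a \<noteq> b}"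
  shows "card {\<sigma>. \<sigma> permutes {..<q} \<and> (\<sigma> x, \<sigma> y) \<in> A} * (q * (q - 1)) = card A * fact q"
proof -
  let ?P = "{\<sigma>. \<sigma> permutes {..<q}}"
  let ?O = "{(a, b). a < q \<and> b < q \<and> a \<noteq> b}"
  have O_eq: "?O = (\<Union>a\<in>{..<q}. {a} \<times> ({..<q} - {a}))" by auto
  have finO: "finite ?O" unfolding O_eq by auto
  have cardO: "card ?O = q * (q - 1)"
  proof -
    have "card ?O = (\<Sum>a<q. card ({a} \<times> ({..<q} - {a})))"
      unfolding O_eq by (rule card_UN_disjoint) auto
    also have "\<dots> = (\<Sum>a<q. q - 1)" by (intro sum.cong) (auto simp: card_cartesian_product)
    finally show ?thesis by simp
  qed
  have finP: "finite ?P" by (simp add: finite_permutations)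
  have "(\<Sum>z\<in>?O. card {\<sigma> \<in> ?P. (\<sigma> (fst z), \<sigma> (snd z)) \<in> A}) = (\<Sum>\<sigma>\<in>?P. card {z \<in> ?O. (\<sigma> (fst z), \<sigma> (snd z)) \<in> A})"
    using sum.swap_restrict[OF finO finP, of "\<lambda>_ _. 1::nat" "\<lambda>z \<sigma>. (\<sigma> (fst z), \<sigma> (snd z)) \<in> A"] by simp
  also have "\<dots> = (\<Sum>\<sigma>\<in>?P. card A)"
  proof (rule sum.cong)
    fix \<sigma> assume "\<sigma> \<in> ?P"
    then have \<sigma>: "\<sigma> permutes {..<q}" by simp
    have "bij_betw (map_prod \<sigma> \<sigma>) {z \<in> ?O. (\<sigma> (fst z), \<sigma> (snd z)) \<in> A} A"
    proof (rule bij_betwI[where g = "map_prod (inv \<sigma>) (inv \<sigma>)"])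
      have "inv \<sigma> a < q" if "a < q" for a
        using permutes_in_image[OF permutes_inv[OF \<sigma>], of a] that by simp
      moreover have "inv \<sigma> a \<noteq> inv \<sigma> b" if "a \<noteq> b" for a b
        using that permutes_inj[OF permutes_inv[OF \<sigma>]] by (metis injD)
      ultimately show "map_prod (inv \<sigma>) (inv \<sigma>) \<in> A \<rightarrow> {z \<in> ?O. (\<sigma> (fst z), \<sigma> (snd z)) \<in> A}"
      proof (intro Pi_I)
        fix z assume z: "z \<in> A"
        obtain a b where ab: "z = (a, b)" by (cases z)
        then have "a < q" "b < q" "a \<noteq> b" using z A by auto
        then show "map_prod (inv \<sigma>) (inv \<sigma>) z \<in> {z \<in> ?O. (\<sigma> (fst z), \<sigma> (snd z)) \<in> A}"
          using \<open>\<And>a. a < q \<Longrightarrow> inv \<sigma> a < q\<close> \<open>\<And>a b. a \<noteq> b \<Longrightarrow> inv \<sigma> a \<noteq> inv \<sigma> b\<close> z ab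
          by (simp add: permutes_inverses[OF \<sigma>])
      qed
    qed (auto simp: permutes_inverses[OF \<sigma>])
    then show "card {z \<in> ?O. (\<sigma> (fst z), \<sigma> (snd z)) \<in> A} = card A" by (rule bij_betw_same_card)
  qed simp
  also have "\<dots> = card A * fact q" by (simp add: card_permutations)
  finally have "(\<Sum>z\<in>?O. card {\<sigma> \<in> ?P. (\<sigma> (fst z), \<sigma> (snd z)) \<in> A}) = card A * fact q" .
  moreover have "(\<Sum>z\<in>?O. card {\<sigma> \<in> ?P. (\<sigma> (fst z), \<sigma> (snd z)) \<in> A}) =
      (\<Sum>z\<in>?O. card {\<sigma>. \<sigma> permutes {..<q} \<and> (\<sigma> x, \<sigma> y) \<in> A})"
  proof (rule sum.cong)
    fix z assume "z \<in> ?O"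
    then show "card {\<sigma> \<in> ?P. (\<sigma> (fst z), \<sigma> (snd z)) \<in> A} = card {\<sigma>. \<sigma> permutes {..<q} \<and> (\<sigma> x, \<sigma> y) \<in> A}"
      using card_permutes_pair_invariant[OF _ _ _ assms(1-3), of "fst z" "snd z" A] by auto
  qed simp
  ultimately show ?thesis by (simp only: sum_constant cardO mult.commute of_nat_id)
qed

section \<open>Random coloured graphs\<close>

lemma prob_bind_le:
  fixes b :: real
  assumes "b \<ge> 0" "\<And>x. measure_pmf.prob (N x) X \<le> b * indicator A x"
  shows "measure_pmf.prob (bind_pmf M N) X \<le> b * measure_pmf.prob M A"
proof -
  have "emeasure (bind_pmf M N) X = (\<integral>\<^sup>+x. emeasure (N x) X \<partial>M)" by simp
  also have "\<dots> \<le> (\<integral>\<^sup>+x. ennreal b * indicator A x \<partial>M)"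
  proof (rule nn_integral_mono)
    fix x
    have "emeasure (N x) X = ennreal (measure_pmf.prob (N x) X)"
      by (rule measure_pmf.emeasure_eq_measure)
    also have "\<dots> \<le> ennreal (b * indicator A x)" using assms(2) by (rule ennreal_leI)
    also have "\<dots> = ennreal b * indicator A x" by (simp add: indicator_def)
    finally show "emeasure (N x) X \<le> ennreal b * indicator A x" .
  qed
  also have "\<dots> = ennreal b * emeasure M A" by (simp add: nn_integral_cmult_indicator)
  also have "\<dots> = ennreal (b * measure_pmf.prob M A)"
    using assms(1) by (simp add: measure_pmf.emeasure_eq_measure ennreal_mult')
  finally show ?thesis
    using assms(1) by (simp add: measure_pmf.emeasure_eq_measure)
qed

lemma prob_union_bound:
  assumes "finite I" "\<And>i. i \<in> I \<Longrightarrow> measure_pmf.prob M (A i) \<le> b i" "B \<subseteq> (\<Union>i\<in>I. A i)"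
  shows "measure_pmf.prob M B \<le> (\<Sum>i\<in>I. b i)"
proof -
  have "measure_pmf.prob M B \<le> measure_pmf.prob M (\<Union>i\<in>I. A i)"
    by (rule measure_pmf.finite_measure_mono) (use assms(3) in auto)
  also have "\<dots> \<le> (\<Sum>i\<in>I. measure_pmf.prob M (A i))"
    by (rule measure_pmf.finite_measure_subadditive_finite) (use assms(1) in auto)
  also have "\<dots> \<le> (\<Sum>i\<in>I. b i)" by (rule sum_mono) (rule assms(2))
  finally show ?thesis .
qed

lemma finite_vpairs [simp]: "finite (vpairs n)"
  by (rule finite_subset[of _ "{..<n} \<times> {..<n}"]) (auto simp: vpairs_def)

lemma prob_le_expectation:
  fixes f :: "'a \<Rightarrow> real"
  assumes "integrable (measure_pmf M) f" "\<And>x. f x \<ge> 0" "\<And>x. x \<in> A \<Longrightarrow> f x \<ge> t" "t > 0"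
  shows "measure_pmf.prob M A \<le> measure_pmf.expectation M f / t"
proof -
  have "t * measure_pmf.prob M A = measure_pmf.expectation M (\<lambda>x. t * indicator A x)" by simp
  also have "\<dots> \<le> measure_pmf.expectation M f"
  proof (rule integral_mono)
    show "integrable (measure_pmf M) (\<lambda>x. t * indicator A x)"
      by (rule measure_pmf.integrable_const_bound[where B = t]) (use assms(4) in \<open>auto simp: indicator_def\<close>)
  qed (use assms in \<open>auto simp: indicator_def\<close>)
  finally show ?thesis using assms(4) by (simp add: field_simps)
qed

section \<open>Exponential moments and tail bounds\<close>

definition edges_in :: "nat set \<Rightarrow> (nat \<times> nat) set \<Rightarrow> (nat \<times> nat \<Rightarrow> nat option) \<Rightarrow> (nat \<times> nat) set" where
  "edges_in K B G = {e \<in> B. G e \<in> Some ` K}"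

locale coloured_graph =
  fixes n c :: nat and p :: real
  assumes p01: "0 \<le> p" "p \<le> 1" and c_pos: "c > 0"
begin

abbreviation "\<G> \<equiv> Gnpc n p c"
abbreviation "Pr \<equiv> measure_pmf.prob \<G>"

lemma edge_pmf_finite: "finite (set_pmf (edge_pmf p c))"
proof -
  have "finite {0..<c}" "{0..<c} \<noteq> {}" using c_pos by auto
  then show ?thesis
    by (auto simp: edge_pmf_def set_pmf_of_set split: if_splits)
qed

lemma edge_pmf_prob:
  assumes "K \<subseteq> {0..<c}"
  shows "measure_pmf.prob (edge_pmf p c) (Some ` K) = p * card K / c"
    "measure_pmf.prob (edge_pmf p c) {x. x \<noteq> None} = p"
proof -
  have ne: "finite {0..<c}" "{0..<c} \<noteq> {}" using c_pos by auto
  have vi: "Some -` Some ` K = K" by auto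
  have *: "measure_pmf.prob (edge_pmf p c) X =
     p * measure_pmf.prob (pmf_of_set {0..<c}) (Some -` X) + (1 - p) * indicator X None" for X
  proof -
    have "emeasure (edge_pmf p c) X = emeasure (pmf_of_set {0..<c}) (Some -` X) * ennreal p +
       indicator X None * ennreal (1 - p)"
      unfolding edge_pmf_def using p01 by simp
    also have "\<dots> = ennreal (p * measure_pmf.prob (pmf_of_set {0..<c}) (Some -` X) + (1 - p) * indicator X None)"
      using p01 by (simp add: measure_pmf.emeasure_eq_measure ennreal_mult ennreal_plus mult.commute indicator_def)
    finally have "ennreal (measure_pmf.prob (edge_pmf p c) X) =
        ennreal (p * measure_pmf.prob (pmf_of_set {0..<c}) (Some -` X) + (1 - p) * indicator X None)"
      by (simp only: measure_pmf.emeasure_eq_measure)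
    then show ?thesis by (subst (asm) ennreal_inj) (use p01 in auto)
  qed
  show "measure_pmf.prob (edge_pmf p c) (Some ` K) = p * card K / c"
    unfolding * vi using ne assms by (simp add: measure_pmf_of_set Int_absorb1 indicator_def)
  show "measure_pmf.prob (edge_pmf p c) {x. x \<noteq> None} = p"
    unfolding * using ne by (simp add: measure_pmf_of_set indicator_def)
qed

lemma Gnpc_prod:
  fixes f :: "nat \<times> nat \<Rightarrow> nat option \<Rightarrow> real"
  assumes "\<And>e x. f e x \<ge> 0"
  shows "measure_pmf.expectation \<G> (\<lambda>G. \<Prod>e\<in>vpairs n. f e (G e)) =
    (\<Prod>e\<in>vpairs n. measure_pmf.expectation (edge_pmf p c) (f e))"
    "integrable (measure_pmf \<G>) (\<lambda>G. \<Prod>e\<in>vpairs n. f e (G e))"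
  unfolding Gnpc_def
  by (rule expectation_prod_Pi_pmf integrable_prod_Pi_pmf;
      simp add: assms integrable_measure_pmf_finite edge_pmf_finite)+

text \<open>Both factors are products over the pairs of vertices, so the expectation factorises. The
  indicator that \<open>\<Gamma>\<close> is present is carried along for the booster estimate, where
  a tail bound has to be multiplied by the probability of the graph that determines the
  boosters.\<close>

lemma mgf:
  assumes "\<Gamma> \<subseteq> vpairs n" "B \<subseteq> vpairs n" "\<Gamma> \<inter> B = {}" "K \<subseteq> {0..<c}" "y > 0"
  shows "measure_pmf.expectation \<G> (\<lambda>G. of_bool (\<forall>e\<in>\<Gamma>. G e \<noteq> None) * y ^ card (edges_in K B G)) =
      p ^ card \<Gamma> * (1 + p * card K / c * (y - 1)) ^ card B"
    "integrable (measure_pmf \<G>) (\<lambda>G. of_bool (\<forall>e\<in>\<Gamma>. G e \<noteq> None) * y ^ card (edges_in K B G))"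
proof -
  define f :: "nat \<times> nat \<Rightarrow> nat option \<Rightarrow> real" where
    "f = (\<lambda>e x. if e \<in> \<Gamma> then indicator {x. x \<noteq> None} x
       else if e \<in> B then 1 + (y - 1) * indicator (Some ` K) x else 1)"
  have f0: "f e x \<ge> 0" for e x using assms(5) by (auto simp: f_def indicator_def)
  have finB: "finite B" "finite \<Gamma>" using assms finite_vpairs by (auto intro: finite_subset)
  have split: "vpairs n = \<Gamma> \<union> (B \<union> (vpairs n - \<Gamma> - B))" using assms by auto
  have prod_split: "(\<Prod>e\<in>vpairs n. h e) = (\<Prod>e\<in>\<Gamma>. h e) * ((\<Prod>e\<in>B. h e) * (\<Prod>e\<in>vpairs n - \<Gamma> - B. h e))"
    for h :: "nat \<times> nat \<Rightarrow> real"
    by (subst split) (use assms finB in \<open>subst prod.union_disjoint; (subst prod.union_disjoint)?; auto\<close>)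
  have prod: "(\<Prod>e\<in>vpairs n. f e (G e)) = of_bool (\<forall>e\<in>\<Gamma>. G e \<noteq> None) * y ^ card (edges_in K B G)" for G
  proof -
    have "(\<Prod>e\<in>\<Gamma>. f e (G e)) = (\<Prod>e\<in>\<Gamma>. of_bool (G e \<noteq> None))"
      by (rule prod.cong) (auto simp: f_def indicator_def)
    also have "\<dots> = of_bool (\<forall>e\<in>\<Gamma>. G e \<noteq> None)"
    proof (cases "\<forall>e\<in>\<Gamma>. G e \<noteq> None")
      case False then show ?thesis using finB by (auto intro!: prod_zero)
    qed simp
    finally have 1: "(\<Prod>e\<in>\<Gamma>. f e (G e)) = of_bool (\<forall>e\<in>\<Gamma>. G e \<noteq> None)" .
    have "(\<Prod>e\<in>B. f e (G e)) = (\<Prod>e\<in>B. if e \<in> edges_in K B G then y else 1)"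
      using assms(3) by (intro prod.cong) (auto simp: f_def indicator_def edges_in_def)
    also have "\<dots> = (\<Prod>e\<in>edges_in K B G. y)"
      using finB by (subst prod.mono_neutral_cong_right[of B "edges_in K B G"]) (auto simp: edges_in_def)
    finally have 2: "(\<Prod>e\<in>B. f e (G e)) = y ^ card (edges_in K B G)" by simp
    have 3: "(\<Prod>e\<in>vpairs n - \<Gamma> - B. f e (G e)) = 1" by (rule prod.neutral) (auto simp: f_def)
    show ?thesis unfolding prod_split 1 2 3 by simp
  qed
  have "(\<Prod>e\<in>vpairs n. measure_pmf.expectation (edge_pmf p c) (f e)) =
     (\<Prod>e\<in>\<Gamma>. p) * ((\<Prod>e\<in>B. 1 + p * card K / c * (y - 1)) * (\<Prod>e\<in>vpairs n - \<Gamma> - B. 1))"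
    unfolding prod_split
  proof (intro arg_cong2[where f = "(*)"] prod.cong refl)
    fix e assume "e \<in> \<Gamma>"
    then have "f e = indicator {x. x \<noteq> None}" by (simp add: f_def fun_eq_iff)
    then show "measure_pmf.expectation (edge_pmf p c) (f e) = p" using edge_pmf_prob(2)[OF assms(4)] by simp
  next
    fix e assume "e \<in> B"
    then have "f e = (\<lambda>x. 1 + (y - 1) * indicator (Some ` K) x)" using assms(3) by (auto simp add: f_def fun_eq_iff)
    moreover have "measure_pmf.expectation (edge_pmf p c) (\<lambda>x. 1 + (y - 1) * indicator (Some ` K) x) =
        1 + (y - 1) * measure_pmf.prob (edge_pmf p c) (Some ` K)"
      by (subst Bochner_Integration.integral_add) (auto intro: integrable_measure_pmf_finite edge_pmf_finite)
    ultimately show "measure_pmf.expectation (edge_pmf p c) (f e) = 1 + p * card K / c * (y - 1)"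
      using edge_pmf_prob(1)[OF assms(4)] by simp
  next
    fix e assume "e \<in> vpairs n - \<Gamma> - B"
    then have "f e = (\<lambda>x. 1)" by (auto simp: f_def fun_eq_iff)
    then show "measure_pmf.expectation (edge_pmf p c) (f e) = 1" by simp
  qed
  then show "measure_pmf.expectation \<G> (\<lambda>G. of_bool (\<forall>e\<in>\<Gamma>. G e \<noteq> None) * y ^ card (edges_in K B G)) =
      p ^ card \<Gamma> * (1 + p * card K / c * (y - 1)) ^ card B"
    using Gnpc_prod(1)[of f, OF f0] unfolding prod by simp
  show "integrable (measure_pmf \<G>) (\<lambda>G. of_bool (\<forall>e\<in>\<Gamma>. G e \<noteq> None) * y ^ card (edges_in K B G))"
    using Gnpc_prod(2)[of f, OF f0] unfolding prod .
qed

text \<open>Exponential Markov inequality with s = \<open>\<delta>\<close> / 2; the bound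
  \<open>\<delta>\<close> \<le> 2 gives s \<le> 1, where exp s - 1 \<le> s + s^2. An upper bound
  \<open>M\<close> on the mean suffices.\<close>

lemma chernoff_upper:
  assumes "B \<subseteq> vpairs n" "K \<subseteq> {0..<c}" "card B * (p * card K / c) \<le> M" "0 \<le> \<delta>" "\<delta> \<le> 2"
  shows "Pr {G. real (card (edges_in K B G)) \<ge> (1 + \<delta>) * M} \<le> exp (- (\<delta>\<^sup>2 * M / 4))"
proof -
  define s where "s = \<delta> / 2"
  have s: "0 \<le> s" "s \<le> 1" using assms by (auto simp: s_def)
  have q: "0 \<le> p * card K / c" using p01 by simp
  have M0: "0 \<le> M" using assms(3) q by (smt (verit) mult_nonneg_nonneg of_nat_0_le_iff)
  note E = mgf[of "{}" B K "exp s", simplified, OF assms(1,2)]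
  have "Pr {G. real (card (edges_in K B G)) \<ge> (1 + \<delta>) * M} \<le>
     measure_pmf.expectation \<G> (\<lambda>G. exp s ^ card (edges_in K B G)) / exp (s * ((1 + \<delta>) * M))"
    using s by (intro prob_le_expectation E(2)) (auto simp: exp_of_nat_mult[symmetric] mult.commute mult_left_mono)
  also have "\<dots> = (1 + p * card K / c * (exp s - 1)) ^ card B / exp (s * ((1 + \<delta>) * M))"
    using E(1) by simp
  also have "\<dots> \<le> exp (p * card K / c * (exp s - 1)) ^ card B / exp (s * ((1 + \<delta>) * M))"
    using q s p01 by (intro divide_right_mono power_mono exp_ge_add_one_self) (auto intro!: add_nonneg_nonneg mult_nonneg_nonneg divide_nonneg_nonneg)
  also have "\<dots> = exp (card B * (p * card K / c) * (exp s - 1) - s * ((1 + \<delta>) * M))"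
    by (simp add: exp_of_nat_mult[symmetric] exp_diff mult.assoc)
  also have "\<dots> \<le> exp (M * (s + s\<^sup>2) - s * ((1 + \<delta>) * M))"
  proof -
    have "exp s - 1 \<le> s + s\<^sup>2" using exp_bound[OF s] by simp
    then have "card B * (p * card K / c) * (exp s - 1) \<le> M * (s + s\<^sup>2)"
      using assms(3) M0 s by (intro mult_mono) auto
    then show ?thesis by simp
  qed
  also have "M * (s + s\<^sup>2) - s * ((1 + \<delta>) * M) = - (\<delta>\<^sup>2 * M / 4)"
    by (simp add: s_def power2_eq_square algebra_simps)
  finally show ?thesis .
qed

text \<open>Exponential Markov inequality with base exp (-\<open>\<delta>\<close>), estimated by 1 -
  \<open>\<delta>\<close> + \<open>\<delta>\<close>^2 / 2. As \<open>\<Gamma>\<close> and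
  \<open>B\<close> are disjoint, the presence of \<open>\<Gamma>\<close> contributes exactly the
  factor in front.\<close>

lemma chernoff_lower:
  assumes "\<Gamma> \<subseteq> vpairs n" "B \<subseteq> vpairs n" "\<Gamma> \<inter> B = {}" "K \<subseteq> {0..<c}"
    and "M \<le> card B * (p * card K / c)" "0 \<le> \<delta>" "\<delta> \<le> 1" "0 \<le> M"
  shows "Pr {G. (\<forall>e\<in>\<Gamma>. G e \<noteq> None) \<and> real (card (edges_in K B G)) \<le> (1 - \<delta>) * M} \<le>
     p ^ card \<Gamma> * exp (- (\<delta>\<^sup>2 * M / 2))"
proof -
  let ?q = "p * card K / c"
  have "card K \<le> c" using assms(4) by (metis card_atLeastLessThan card_mono diff_zero finite_atLeastLessThan)
  then have "?q \<le> p * 1" using p01 c_pos unfolding times_divide_eq_right[symmetric] by (intro mult_left_mono) auto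
  then have q: "0 \<le> ?q" "?q \<le> 1" using p01 by (auto simp: field_simps)
  note E = mgf[of \<Gamma> B K "exp (- \<delta>)", OF assms(1-4)]
  have "Pr {G. (\<forall>e\<in>\<Gamma>. G e \<noteq> None) \<and> real (card (edges_in K B G)) \<le> (1 - \<delta>) * M} \<le>
     measure_pmf.expectation \<G> (\<lambda>G. of_bool (\<forall>e\<in>\<Gamma>. G e \<noteq> None) * exp (- \<delta>) ^ card (edges_in K B G))
       / exp (- \<delta> * ((1 - \<delta>) * M))"
    using assms(6) by (intro prob_le_expectation E(2)) (auto simp: exp_of_nat_mult[symmetric] mult.commute mult_left_mono)
  also have "\<dots> = p ^ card \<Gamma> * (1 + ?q * (exp (- \<delta>) - 1)) ^ card B / exp (- \<delta> * ((1 - \<delta>) * M))"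
    using E(1) by simp
  also have "\<dots> \<le> p ^ card \<Gamma> * exp (?q * (exp (- \<delta>) - 1)) ^ card B / exp (- \<delta> * ((1 - \<delta>) * M))"
  proof (intro divide_right_mono mult_left_mono power_mono exp_ge_add_one_self)
    have "?q * (1 - exp (- \<delta>)) \<le> 1 * 1" using q assms(6) by (intro mult_mono) auto
    moreover have "?q * (exp (- \<delta>) - 1) = - (?q * (1 - exp (- \<delta>)))" by (metis minus_diff_eq mult_minus_right)
    moreover have "0 \<le> 1 + b" if "a \<le> 1 * 1" "b = - a" for a b :: real using that by simp
    ultimately show "0 \<le> 1 + ?q * (exp (- \<delta>) - 1)" by blast
  qed (use p01 in auto)
  also have "\<dots> = p ^ card \<Gamma> * exp (card B * ?q * (exp (- \<delta>) - 1) + \<delta> * ((1 - \<delta>) * M))"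
  proof -
    have "exp (?q * (exp (- \<delta>) - 1)) ^ card B = exp (card B * ?q * (exp (- \<delta>) - 1))"
      by (simp only: exp_of_nat_mult[symmetric] mult.assoc)
    moreover have "x * exp a / exp (- \<delta> * b) = x * exp (a + \<delta> * b)" for x a b :: real
      by (simp add: exp_add exp_minus divide_inverse)
    ultimately show ?thesis by metis
  qed
  also have "\<dots> \<le> p ^ card \<Gamma> * exp (- (\<delta>\<^sup>2 * M / 2))"
  proof (intro mult_left_mono)
    have "exp (- \<delta>) \<le> 1 - \<delta> + \<delta>\<^sup>2 / 2"
    proof -
      have "1 + \<delta> + \<delta>\<^sup>2 / 2 \<le> exp \<delta>" using exp_lower_Taylor_quadratic[OF assms(6)] by simp
      then have "exp (- \<delta>) \<le> 1 / (1 + \<delta> + \<delta>\<^sup>2 / 2)"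
        using assms(6) unfolding exp_minus by (subst inverse_eq_divide) (intro divide_left_mono, auto intro!: mult_pos_pos add_pos_nonneg)
      also have "\<dots> \<le> 1 - \<delta> + \<delta>\<^sup>2 / 2"
      proof -
        have "(1 - \<delta> + \<delta>\<^sup>2 / 2) * (1 + \<delta> + \<delta>\<^sup>2 / 2) = 1 + \<delta> ^ 4 / 4"
          by (simp add: power2_eq_square power4_eq_xxxx field_simps)
        then have "1 \<le> (1 - \<delta> + \<delta>\<^sup>2 / 2) * (1 + \<delta> + \<delta>\<^sup>2 / 2)" by simp
        moreover have "0 < 1 + \<delta> + \<delta>\<^sup>2 / 2" using assms(6) by (auto intro!: add_pos_nonneg)
        ultimately show ?thesis by (simp add: divide_le_eq)
      qed
      finally show ?thesis .
    qed
    then have *: "1 - exp (- \<delta>) \<ge> \<delta> - \<delta>\<^sup>2 / 2" by simp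
    have "\<delta> - \<delta>\<^sup>2 / 2 \<ge> 0" using assms(6,7) by (simp add: power2_eq_square) (smt (verit) mult_left_le)
    then have "M * (\<delta> - \<delta>\<^sup>2 / 2) \<le> card B * ?q * (1 - exp (- \<delta>))"
      using * assms(5,8) q by (intro mult_mono) auto
    moreover have "a * (x - 1) + \<delta> * ((1 - \<delta>) * M) \<le> - (\<delta>\<^sup>2 * M / 2)"
      if "M * (\<delta> - \<delta>\<^sup>2 / 2) \<le> a * (1 - x)" for a x
      using that by (simp add: algebra_simps power2_eq_square)
    ultimately have "card B * ?q * (exp (- \<delta>) - 1) + \<delta> * ((1 - \<delta>) * M) \<le> - (\<delta>\<^sup>2 * M / 2)"
      by blast
    then show "exp (card B * ?q * (exp (- \<delta>) - 1) + \<delta> * ((1 - \<delta>) * M)) \<le> exp (- (\<delta>\<^sup>2 * M / 2))" by simp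
  qed (use p01 in auto)
  finally show ?thesis .
qed

end

lemma Pr_many_le:
  fixes r :: real
  assumes "finite B" "\<And>A. A \<subseteq> B \<Longrightarrow> card A = b \<Longrightarrow> measure_pmf.prob M {x. \<forall>e\<in>A. P e x} \<le> r"
  shows "measure_pmf.prob M {x. b \<le> card {e \<in> B. P e x}} \<le> (card B choose b) * r"
proof -
  have "measure_pmf.prob M {x. b \<le> card {e \<in> B. P e x}} \<le> (\<Sum>A\<in>{A. A \<subseteq> B \<and> card A = b}. r)"
  proof (rule prob_union_bound)
    show "{x. b \<le> card {e \<in> B. P e x}} \<subseteq> (\<Union>A\<in>{A. A \<subseteq> B \<and> card A = b}. {x. \<forall>e\<in>A. P e x})"
    proof
      fix x assume "x \<in> {x. b \<le> card {e \<in> B. P e x}}"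
      then obtain A where "A \<subseteq> {e \<in> B. P e x}" "card A = b"
        using obtain_subset_with_card_n by (metis mem_Collect_eq)
      then show "x \<in> (\<Union>A\<in>{A. A \<subseteq> B \<and> card A = b}. {x. \<forall>e\<in>A. P e x})" by blast
    qed
  qed (use assms in auto)
  then show ?thesis using assms(1) by (simp add: n_subsets)
qed

context coloured_graph
begin

lemma prob_all_edges_in:
  assumes "A \<subseteq> vpairs n" "K \<subseteq> {0..<c}"
  shows "Pr {G. \<forall>e\<in>A. G e \<in> Some ` K} = (p * card K / c) ^ card A"
proof -
  have finA: "finite A" using assms finite_vpairs by (meson finite_subset)
  define f :: "nat \<times> nat \<Rightarrow> nat option \<Rightarrow> real" where
    "f = (\<lambda>e x. if e \<in> A then indicator (Some ` K) x else 1)"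
  have f0: "f e x \<ge> 0" for e x by (simp add: f_def)
  have "(\<Prod>e\<in>vpairs n. f e (G e)) = indicator {G. \<forall>e\<in>A. G e \<in> Some ` K} G" for G
  proof -
    have "(\<Prod>e\<in>vpairs n. f e (G e)) = (\<Prod>e\<in>A. indicator (Some ` K) (G e))"
      by (rule prod.mono_neutral_cong_right) (use assms in \<open>auto simp: f_def\<close>)
    also have "\<dots> = indicator {G. \<forall>e\<in>A. G e \<in> Some ` K} G"
    proof (cases "\<forall>e\<in>A. G e \<in> Some ` K")
      case True then show ?thesis by simp
    next
      case False
      then obtain e where "e \<in> A" "G e \<notin> Some ` K" by blast
      then have "(\<Prod>e\<in>A. indicator (Some ` K) (G e)) = (0::real)"
        using finA by (intro prod_zero) (auto intro!: bexI[of _ e])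
      then show ?thesis using False by simp
    qed
    finally show ?thesis .
  qed
  moreover have "(\<Prod>e\<in>vpairs n. measure_pmf.expectation (edge_pmf p c) (f e)) = (\<Prod>e\<in>A. p * card K / c)"
  proof (rule prod.mono_neutral_cong_right)
    fix e assume "e \<in> A"
    then have "f e = indicator (Some ` K)" by (simp add: f_def fun_eq_iff)
    then show "measure_pmf.expectation (edge_pmf p c) (f e) = p * card K / c"
      using edge_pmf_prob(1)[OF assms(2)] by simp
  next
    show "\<forall>e\<in>vpairs n - A. measure_pmf.expectation (edge_pmf p c) (f e) = 1"
    proof
      fix e assume "e \<in> vpairs n - A"
      then have "f e = (\<lambda>_. 1)" by (simp add: f_def fun_eq_iff)
      then show "measure_pmf.expectation (edge_pmf p c) (f e) = 1" by simp
    qed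
  qed (use assms in auto)
  ultimately show ?thesis using Gnpc_prod(1)[of f, OF f0] by simp
qed

lemma prob_many_edges_le:
  assumes "B \<subseteq> vpairs n" "K \<subseteq> {0..<c}"
  shows "Pr {G. b \<le> card (edges_in K B G)} \<le> (card B choose b) * (p * card K / c) ^ b"
  unfolding edges_in_def
proof (rule Pr_many_le)
  fix A assume "A \<subseteq> B" "card A = b"
  then show "Pr {G. \<forall>e\<in>A. G e \<in> Some ` K} \<le> (p * card K / c) ^ b"
    using prob_all_edges_in[of A K] assms by auto
qed (use assms finite_vpairs in \<open>auto intro: finite_subset\<close>)

end

section \<open>Resampling the colours of one palette\<close>

definition recolour :: "nat \<Rightarrow> (nat \<times> nat \<Rightarrow> nat option) \<Rightarrow> (nat \<times> nat \<Rightarrow> nat) \<Rightarrow> nat \<times> nat \<Rightarrow> nat option" where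
  "recolour d G \<psi> e = (case G e of None \<Rightarrow> None | Some k \<Rightarrow> if k < d then Some (\<psi> e) else Some k)"

context coloured_graph
begin

lemma edge_pmf_recolour:
  assumes d: "0 < d" "d \<le> c"
  shows "bind_pmf (edge_pmf p c) (\<lambda>x. map_pmf (\<lambda>y. case x of None \<Rightarrow> None | Some k \<Rightarrow> if k < d then Some y else Some k)
      (pmf_of_set {0..<d})) = edge_pmf p c"
proof -
  have ne: "finite {0..<c}" "{0..<c} \<noteq> {}" "finite {0..<d}" "{0..<d} \<noteq> {}" using d c_pos by auto
  have "bind_pmf (pmf_of_set {0..<c}) (\<lambda>k. map_pmf (\<lambda>y. if k < d then y else k) (pmf_of_set {0..<d})) = pmf_of_set {0..<c}"
    (is "?l = ?r")
  proof (rule pmf_eqI)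
    fix i
    have inner: "pmf (map_pmf (\<lambda>y. if k < d then y else k) (pmf_of_set {0..<d})) i =
       (if k < d then indicator {0..<d} i / d else indicator {k} i)" for k
    proof (cases "k < d")
      case True
      then have "map_pmf (\<lambda>y. if k < d then y else k) (pmf_of_set {0..<d}) = pmf_of_set {0..<d}"
        by (simp add: map_pmf_ident)
      then show ?thesis using True ne by simp
    next
      case False
      then have "map_pmf (\<lambda>y. if k < d then y else k) (pmf_of_set {0..<d}) = return_pmf k" by simp
      then show ?thesis using False by (simp add: indicator_def)
    qed
    have "pmf ?l i = (\<Sum>k\<in>{0..<c}. if k < d then indicator {0..<d} i / d else indicator {k} i) / c"
      using ne by (simp add: pmf_bind inner integral_pmf_of_set)
    also have "(\<Sum>k\<in>{0..<c}. if k < d then indicator {0..<d} i / d else indicator {k} i) =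
        (\<Sum>k\<in>{0..<d}. indicator {0..<d} i / d) + (\<Sum>k\<in>{d..<c}. indicator {k} i :: real)"
      using d by (subst sum.atLeastLessThan_concat[of 0 d c, symmetric]) (auto intro!: arg_cong2[where f = "(+)"] sum.cong)
    also have "\<dots> = indicator {0..<c} i"
      using d by (auto simp: indicator_def sum.delta)
    also have "indicator {0..<c} i / c = pmf ?r i" using ne by simp
    finally show "pmf ?l i = pmf ?r i" .
  qed
  then have "map_pmf Some ?r = map_pmf Some ?l" by simp
  also have "\<dots> = bind_pmf (pmf_of_set {0..<c}) (\<lambda>k. map_pmf (\<lambda>y. if k < d then Some y else Some k) (pmf_of_set {0..<d}))"
    by (simp add: map_bind_pmf pmf.map_comp o_def if_distrib)
  finally have "bind_pmf (pmf_of_set {0..<c}) (\<lambda>k. map_pmf (\<lambda>y. if k < d then Some y else Some k) (pmf_of_set {0..<d}))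
     = map_pmf Some (pmf_of_set {0..<c})" by simp
  then show ?thesis
    unfolding edge_pmf_def bind_assoc_pmf
    by (intro bind_pmf_cong refl) (auto simp: bind_map_pmf bind_return_pmf split: if_splits)
qed

text \<open>A uniform colour that is redrawn from the first d colours whenever it is among them
  stays uniform. Hence the edges with colours below d can be fixed first and treated as coloured
  afresh and independently.\<close>

lemma Gnpc_recolour:
  assumes d: "0 < d" "d \<le> c"
  shows "bind_pmf \<G> (\<lambda>G. map_pmf (recolour d G) (Pi_pmf (vpairs n) 0 (\<lambda>_. pmf_of_set {0..<d}))) = \<G>"
proof -
  let ?g = "\<lambda>x y. case x of None \<Rightarrow> None | Some k \<Rightarrow> if k < d then Some y else Some (k::nat)"
  let ?u = "pmf_of_set {0..<d}"
  have "\<G> = Pi_pmf (vpairs n) None (\<lambda>_. bind_pmf (edge_pmf p c) (\<lambda>x. map_pmf (?g x) ?u))"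
    unfolding edge_pmf_recolour[OF d] Gnpc_def ..
  also have "\<dots> = bind_pmf \<G> (\<lambda>G. Pi_pmf (vpairs n) None (\<lambda>e. map_pmf (?g (G e)) ?u))"
    unfolding Gnpc_def by (rule Pi_pmf_bind) simp
  also have "\<dots> = bind_pmf \<G> (\<lambda>G. map_pmf (recolour d G) (Pi_pmf (vpairs n) 0 (\<lambda>_. ?u)))"
  proof (rule bind_pmf_cong[OF refl])
    fix G assume "G \<in> set_pmf \<G>"
    then have G: "G e = None" if "e \<notin> vpairs n" for e
      using that set_Pi_pmf_subset[of "vpairs n" None "\<lambda>_. edge_pmf p c"] unfolding Gnpc_def by (cases e) auto
    have "Pi_pmf (vpairs n) None (\<lambda>e. map_pmf (?g (G e)) ?u) =
       Pi_pmf (vpairs n) None (\<lambda>e. bind_pmf ?u (\<lambda>y. return_pmf (?g (G e) y)))"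
      by (simp add: map_pmf_def)
    also have "\<dots> = bind_pmf (Pi_pmf (vpairs n) 0 (\<lambda>_. ?u)) (\<lambda>\<psi>. Pi_pmf (vpairs n) None (\<lambda>e. return_pmf (?g (G e) (\<psi> e))))"
      by (rule Pi_pmf_bind) simp
    also have "\<dots> = map_pmf (recolour d G) (Pi_pmf (vpairs n) 0 (\<lambda>_. ?u))"
      unfolding map_pmf_def
    proof (intro bind_pmf_cong refl)
      fix \<psi>
      have "(\<lambda>e. if e \<in> vpairs n then ?g (G e) (\<psi> e) else None) = recolour d G \<psi>"
        using G by (auto simp: fun_eq_iff recolour_def)
      then show "Pi_pmf (vpairs n) None (\<lambda>e. return_pmf (?g (G e) (\<psi> e))) = return_pmf (recolour d G \<psi>)"
        by simp
    qed
    finally show "Pi_pmf (vpairs n) None (\<lambda>e. map_pmf (?g (G e)) ?u) = \<dots>" .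
  qed
  finally show ?thesis by simp
qed

end

text \<open>Induction on \<open>B\<close>, removing its element of highest rank. The events of the
  other elements involve lower ranks only, so the colour of the removed element is independent of
  them and has to hit one of at most \<open>M\<close> values out of \<open>d\<close>.\<close>

lemma prob_colour_repeats:
  fixes rk :: "'e \<Rightarrow> nat" and M d :: nat
  assumes "finite U" "d > 0" "finite B" "B \<subseteq> U" "inj_on rk B"
    "\<And>e. e \<in> B \<Longrightarrow> K e \<subseteq> U \<and> (\<forall>f\<in>K e. rk f < rk e) \<and> card (K e) \<le> M"
  shows "measure_pmf.prob (Pi_pmf U 0 (\<lambda>_. pmf_of_set {0..<d})) {\<psi>. \<forall>e\<in>B. \<exists>f\<in>K e. \<psi> f = \<psi> e}
    \<le> (real M / d) ^ card B"
  using assms(3-6)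
proof (induction "card B" arbitrary: B)
  case 0
  then have "B = {}" by simp
  then show ?case by simp
next
  case (Suc k)
  let ?u = "pmf_of_set {0..<d}"
  let ?P = "\<lambda>B. {\<psi>. \<forall>e\<in>B. \<exists>f\<in>K e. \<psi> f = \<psi> e}"
  have "B \<noteq> {}" using Suc by auto
  then have "Max (rk ` B) \<in> rk ` B" using Suc.prems(1) by (intro Max_in) auto
  then obtain e where e: "e \<in> B" "rk e = Max (rk ` B)" by auto
  have max: "rk f < rk e" if "f \<in> B" "f \<noteq> e" for f
  proof -
    have "rk f \<le> rk e" using e that Suc.prems(1) by simp
    moreover have "rk f \<noteq> rk e" using inj_onD[OF Suc.prems(3), of f e] e that by blast
    ultimately show ?thesis by simp
  qed
  define A where "A = U - {e}"
  have A: "finite A" "e \<notin> A" "insert e A = U" using assms(1) Suc.prems(2) e by (auto simp: A_def)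
  have indep: "\<psi>(e := y) \<in> ?P (B - {e}) \<longleftrightarrow> \<psi> \<in> ?P (B - {e})" for \<psi> y
  proof -
    have "f \<noteq> e" if "g \<in> B - {e}" "f \<in> K g" for f g
      using Suc.prems(4)[of g] max[of g] that by force
    then show ?thesis by fastforce
  qed
  have U: "Pi_pmf U 0 (\<lambda>_. ?u) = bind_pmf (Pi_pmf A 0 (\<lambda>_. ?u)) (\<lambda>f. map_pmf (\<lambda>y. f(e := y)) ?u)"
    unfolding A(3)[symmetric] Pi_pmf_insert'[OF A(1,2)]
    by (subst bind_commute_pmf) (simp add: map_pmf_def)
  have ne: "finite {0..<d}" "{0..<d} \<noteq> {}" using assms(2) by auto
  have Ke: "K e \<subseteq> A" "card (K e) \<le> M" using Suc.prems(4)[OF e(1)] by (auto simp: A_def)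
  have "measure_pmf.prob (Pi_pmf U 0 (\<lambda>_. ?u)) (?P B) \<le> real M / d * measure_pmf.prob (Pi_pmf A 0 (\<lambda>_. ?u)) (?P (B - {e}))"
    unfolding U
  proof (rule prob_bind_le)
    fix f
    show "measure_pmf.prob (map_pmf (\<lambda>y. f(e := y)) ?u) (?P B) \<le> real M / d * indicator (?P (B - {e})) f"
    proof (cases "f \<in> ?P (B - {e})")
      case True
      have "measure_pmf.prob (map_pmf (\<lambda>y. f(e := y)) ?u) (?P B) \<le> measure_pmf.prob ?u (f ` K e)"
      proof (simp only: measure_map_pmf, rule measure_pmf.finite_measure_mono)
        show "(\<lambda>y. f(e := y)) -` ?P B \<subseteq> f ` K e"
        proof
          fix y assume "y \<in> (\<lambda>y. f(e := y)) -` ?P B"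
          then obtain g where "g \<in> K e" "(f(e := y)) g = y" using e by force
          moreover from this have "g \<noteq> e" using Ke A(2) by blast
          ultimately show "y \<in> f ` K e" by auto
        qed
      qed simp
      also have "\<dots> = card ({0..<d} \<inter> f ` K e) / d" using ne by (simp add: measure_pmf_of_set)
      also have "\<dots> \<le> M / d"
      proof (intro divide_right_mono of_nat_mono)
        have "finite (K e)" using Ke A(1) by (meson finite_subset)
        then have "card ({0..<d} \<inter> f ` K e) \<le> card (f ` K e)" by (intro card_mono) auto
        also have "\<dots> \<le> card (K e)" by (rule card_image_le) fact
        finally show "card ({0..<d} \<inter> f ` K e) \<le> M" using Ke by simp
      qed simp
      finally show ?thesis using True by simp
    next
      case False
      have "(\<lambda>y. f(e := y)) -` ?P B = {}" (is "?L = _")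
      proof -
        have "f(e := y) \<notin> ?P B" for y
        proof
          assume "f(e := y) \<in> ?P B"
          then have "f(e := y) \<in> ?P (B - {e})" by blast
          then show False using False by (simp only: indep)
        qed
        then show ?thesis by blast
      qed
      then have "measure_pmf.prob ?u ?L = 0" by (simp only: measure_empty)
      then have "measure_pmf.prob (map_pmf (\<lambda>y. f(e := y)) ?u) (?P B) = 0" by (simp only: measure_map_pmf)
      moreover have "indicator (?P (B - {e})) f = (0 :: real)" using False by (rule indicator_simps(2))
      ultimately show ?thesis by (simp only: mult_zero_right order_refl)
    qed
  qed simp
  also have "measure_pmf.prob (Pi_pmf A 0 (\<lambda>_. ?u)) (?P (B - {e})) = measure_pmf.prob (Pi_pmf U 0 (\<lambda>_. ?u)) (?P (B - {e}))"
  proof -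
    have "(\<lambda>(y, f). f(e := y)) -` ?P (B - {e}) = (UNIV :: nat set) \<times> ?P (B - {e})"
    proof (rule set_eqI)
      fix z :: "nat \<times> ('e \<Rightarrow> nat)"
      obtain y f where z: "z = (y, f)" by (cases z)
      show "z \<in> (\<lambda>(y, f). f(e := y)) -` ?P (B - {e}) \<longleftrightarrow> z \<in> (UNIV :: nat set) \<times> ?P (B - {e})"
        by (simp only: z vimage_eq prod.case indep mem_Sigma_iff UNIV_I simp_thms)
    qed
    moreover have "measure_pmf.prob (map_pmf (\<lambda>(y, f). f(e := y)) N) X = measure_pmf.prob N (snd -` X)"
      if "(\<lambda>(y, f). f(e := y)) -` X = (UNIV :: nat set) \<times> X" for X and N :: "(nat \<times> ('e \<Rightarrow> nat)) pmf"
      unfolding measure_map_pmf that by (rule arg_cong[where f = "measure_pmf.prob N"]) auto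
    ultimately have "measure_pmf.prob (Pi_pmf U 0 (\<lambda>_. ?u)) (?P (B - {e})) =
       measure_pmf.prob (pair_pmf ?u (Pi_pmf A 0 (\<lambda>_. ?u))) (snd -` ?P (B - {e}))"
      unfolding A(3)[symmetric] Pi_pmf_insert[OF A(1,2)] by blast
    also have "\<dots> = measure_pmf.prob (map_pmf snd (pair_pmf ?u (Pi_pmf A 0 (\<lambda>_. ?u)))) (?P (B - {e}))"
      by (simp only: measure_map_pmf)
    finally show ?thesis by (simp only: map_snd_pair_pmf)
  qed
  also have "real M / d * \<dots> \<le> real M / d * (real M / d) ^ card (B - {e})"
  proof (intro mult_left_mono Suc.hyps(1))
    show "k = card (B - {e})" using Suc.hyps(2) e Suc.prems(1) by simp
    show "inj_on rk (B - {e})" using Suc.prems(3) by (auto intro: inj_on_subset)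
  qed (use Suc.prems in auto)
  also have "\<dots> = (real M / d) ^ card B"
    using e Suc.prems(1) by (metis card_Suc_Diff1 power_Suc)
  finally show ?case .
qed

section \<open>Random expanders\<close>

text \<open>Each element picks one of at most \<open>m\<close> owners through a uniform random label.\<close>

lemma random_owner_partition:
  fixes Es :: "'i \<Rightarrow> 'e set" and B :: "'i \<Rightarrow> 'e set \<Rightarrow> 'e set" and m M T \<beta> :: nat
  assumes I: "finite I" and E: "\<And>i. i \<in> I \<Longrightarrow> finite (Es i) \<and> card (Es i) \<le> M"
    and m: "m > 0" "\<And>e. card {i \<in> I. e \<in> Es i} \<le> m"
    and num: "card I * (\<Sum>j\<le>T. real (M choose j) * ((1 / m) ^ j * (1 - 1 / m) ^ \<beta>)) < 1"
  shows "\<exists>R. (\<forall>i\<in>I. R i \<subseteq> Es i) \<and> (\<forall>i\<in>I. \<forall>j\<in>I. i \<noteq> j \<longrightarrow> R i \<inter> R j = {}) \<and>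
    (\<forall>i\<in>I. \<forall>A\<subseteq>R i. card A \<le> T \<and> B i A \<subseteq> Es i - A \<and> \<beta> \<le> card (B i A) \<longrightarrow> B i A \<inter> R i \<noteq> {})"
proof -
  \<comment> \<open>The owners of e are numbered injectively by \<open>r e\<close> below
    \<open>m\<close>. A uniform label then selects at most one owner, and each possible owner with
    probability exactly 1/m.\<close>
  have "\<exists>f. inj_on f {i \<in> I. e \<in> Es i} \<and> f ` {i \<in> I. e \<in> Es i} \<subseteq> {0..<m}" for e
    using inj_on_iff_card_le[of "{i \<in> I. e \<in> Es i}" "{0..<m}"] m(2)[of e] I by auto
  then have "\<forall>e. \<exists>f. inj_on f {i \<in> I. e \<in> Es i} \<and> f ` {i \<in> I. e \<in> Es i} \<subseteq> {0..<m}" by blast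
  from choice[OF this] obtain r :: "'e \<Rightarrow> 'i \<Rightarrow> nat" where
    r0: "\<forall>e. inj_on (r e) {i \<in> I. e \<in> Es i} \<and> r e ` {i \<in> I. e \<in> Es i} \<subseteq> {0..<m}" by (elim exE)
  have r: "inj_on (r e) {i \<in> I. e \<in> Es i}" "i \<in> I \<Longrightarrow> e \<in> Es i \<Longrightarrow> r e i < m" for e i
  proof -
    have r1: "inj_on (r e) {i \<in> I. e \<in> Es i}" "r e ` {i \<in> I. e \<in> Es i} \<subseteq> {0..<m}"
      using spec[OF r0, of e] by simp_all
    show "inj_on (r e) {i \<in> I. e \<in> Es i}" by (fact r1(1))
    show "r e i < m" if "i \<in> I" "e \<in> Es i"
    proof -
      have "r e i \<in> r e ` {i \<in> I. e \<in> Es i}" using that by (intro imageI CollectI conjI)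
      then have "r e i \<in> {0..<m}" using r1(2) by (rule rev_subsetD)
      then show ?thesis by simp
    qed
  qed
  define U where "U = (\<Union>i\<in>I. Es i)"
  have finU: "finite U" using I E by (auto simp: U_def)
  let ?u = "pmf_of_set {0..<m}"
  have ne: "finite {0..<m}" "{0..<m} \<noteq> {}" using m by auto
  define Mu where "Mu = Pi_pmf U 0 (\<lambda>_. ?u)"
  define R where "R = (\<lambda>g i. {e \<in> Es i. g e = r e i})"
  \<comment> \<open>The target \<open>B i A\<close> depends on the set \<open>A\<close> that i has
    already used, so every \<open>A\<close> is a separate event: owning \<open>A\<close> has
    probability (1/m)^card A, and owning nothing of \<open>B i A\<close>, which is disjoint from
    \<open>A\<close>, at most (1 - 1/m)^\<beta>.\<close>
  define bad where "bad = (\<lambda>i A. {g. A \<subseteq> R g i \<and> B i A \<inter> R g i = {}})"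
  define ok where "ok = (\<lambda>i A. A \<subseteq> Es i \<and> B i A \<subseteq> Es i - A \<and> \<beta> \<le> card (B i A))"
  let ?w = "\<lambda>j. (1 / m) ^ j * (1 - 1 / m) ^ \<beta> :: real"
  have m1: "0 \<le> 1 - 1 / real m" "1 - 1 / real m \<le> 1" using m by auto
  have p1: "measure_pmf.prob Mu (bad i A) \<le> ?w (card A)" if i: "i \<in> I" and ok: "ok i A" for i A
  proof -
    define C where "C = (\<lambda>e. if e \<in> A then {r e i} else if e \<in> B i A then - {r e i} else UNIV)"
    have sub: "A \<subseteq> U" "B i A \<subseteq> U" "A \<inter> B i A = {}" using ok i by (auto simp: ok_def U_def)
    have fin: "finite A" "finite (B i A)" using sub finU by (auto intro: finite_subset)
    have "bad i A \<subseteq> Pi U C"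
      using ok by (auto simp: bad_def R_def C_def ok_def Pi_def)
    then have "measure_pmf.prob Mu (bad i A) \<le> measure_pmf.prob Mu (Pi U C)"
      by (intro measure_pmf.finite_measure_mono) auto
    also have "\<dots> = (\<Prod>e\<in>U. measure_pmf.prob ?u (C e))"
      unfolding Mu_def by (rule measure_Pi_pmf_Pi) fact
    also have "\<dots> = (\<Prod>e\<in>A \<union> B i A. measure_pmf.prob ?u (C e))"
      by (rule prod.mono_neutral_right) (use sub finU in \<open>auto simp: C_def\<close>)
    also have "\<dots> = (\<Prod>e\<in>A. measure_pmf.prob ?u (C e)) * (\<Prod>e\<in>B i A. measure_pmf.prob ?u (C e))"
      by (rule prod.union_disjoint) (use fin sub in auto)
    also have "(\<Prod>e\<in>A. measure_pmf.prob ?u (C e)) = (\<Prod>e\<in>A. 1 / m)"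
    proof (rule prod.cong)
      fix e assume "e \<in> A"
      then have "C e = {r e i}" "r e i < m" using r(2)[of i e] i ok by (auto simp: C_def ok_def)
      then show "measure_pmf.prob ?u (C e) = 1 / m" using ne by (simp add: measure_pmf_of_set)
    qed simp
    also have "(\<Prod>e\<in>B i A. measure_pmf.prob ?u (C e)) = (\<Prod>e\<in>B i A. 1 - 1 / m)"
    proof (rule prod.cong)
      fix e assume e: "e \<in> B i A"
      then have "C e = - {r e i}" "r e i < m" using r(2)[of i e] i ok sub by (auto simp: C_def ok_def)
      moreover have "{0..<m} \<inter> - {r e i} = {0..<m} - {r e i}" by auto
      ultimately show "measure_pmf.prob ?u (C e) = 1 - 1 / m"
        using ne m by (simp add: measure_pmf_of_set of_nat_diff diff_divide_distrib)
    qed simp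
    also have "(\<Prod>e\<in>A. 1 / m) * (\<Prod>e\<in>B i A. 1 - 1 / m) \<le> ?w (card A)"
      using m1 ok unfolding ok_def by (auto intro!: mult_left_mono power_decreasing)
    finally show ?thesis .
  qed
  have p2: "measure_pmf.prob Mu (\<Union>A\<in>{A. card A = j \<and> ok i A}. bad i A) \<le> real (M choose j) * ?w j" if i: "i \<in> I" for i j
  proof -
    have sub: "{A. card A = j \<and> ok i A} \<subseteq> {A. A \<subseteq> Es i \<and> card A = j}" by (auto simp: ok_def)
    have finA: "finite {A. A \<subseteq> Es i \<and> card A = j}" using E[OF i] by simp
    have "measure_pmf.prob Mu (\<Union>A\<in>{A. card A = j \<and> ok i A}. bad i A) \<le> (\<Sum>A\<in>{A. card A = j \<and> ok i A}. ?w j)"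
      by (rule prob_union_bound) (use p1[OF i] finite_subset[OF sub finA] in auto)
    also have "\<dots> = real (card {A. card A = j \<and> ok i A}) * ?w j" by simp
    also have "\<dots> \<le> real (M choose j) * ?w j"
    proof (intro mult_right_mono of_nat_mono)
      have "card {A. card A = j \<and> ok i A} \<le> card {A. A \<subseteq> Es i \<and> card A = j}" by (rule card_mono[OF finA sub])
      also have "\<dots> = card (Es i) choose j" using E[OF i] by (simp add: n_subsets)
      also have "\<dots> \<le> M choose j" using E[OF i] by (intro binomial_right_mono) auto
      finally show "card {A. card A = j \<and> ok i A} \<le> M choose j" .
    qed (use m1 in simp)
    finally show ?thesis .
  qed
  let ?Bad = "\<Union>i\<in>I. \<Union>j\<in>{..T}. \<Union>A\<in>{A. card A = j \<and> ok i A}. bad i A"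
  have "measure_pmf.prob Mu ?Bad \<le> (\<Sum>i\<in>I. \<Sum>j\<le>T. real (M choose j) * ?w j)"
    by (rule prob_union_bound[OF I _ order_refl], rule prob_union_bound[OF _ _ order_refl]) (use p2 in auto)
  also have "\<dots> < 1" using num by simp
  finally have "measure_pmf.prob Mu ?Bad < 1" .
  then have "?Bad \<noteq> UNIV" by auto
  then obtain g where g: "g \<notin> ?Bad" by blast
  have "R g i \<inter> R g j = {}" if "i \<in> I" "j \<in> I" "i \<noteq> j" for i j
  proof -
    have "r e i \<noteq> r e j" if "e \<in> Es i" "e \<in> Es j" for e
      using inj_onD[OF r(1), of e i j] that \<open>i \<in> I\<close> \<open>j \<in> I\<close> \<open>i \<noteq> j\<close> by auto
    then show ?thesis unfolding R_def by force
  qed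
  moreover have "B i A \<inter> R g i \<noteq> {}"
    if i: "i \<in> I" "A \<subseteq> R g i" "card A \<le> T" "B i A \<subseteq> Es i - A" "\<beta> \<le> card (B i A)" for i A
  proof
    assume "B i A \<inter> R g i = {}"
    then have "g \<in> bad i A" using i by (simp add: bad_def)
    moreover have "ok i A" using i by (auto simp: ok_def R_def)
    ultimately have "g \<in> ?Bad" using i by blast
    then show False using g by blast
  qed
  moreover have "R g i \<subseteq> Es i" for i by (auto simp: R_def)
  ultimately show ?thesis by (intro exI[of _ "R g"]) blast
qed

text \<open>Arithmetic-geometric mean inequality. It turns a bound on the number of edges leaving a
  set into one on the product of the degrees.\<close>

lemma prod_le_mean_power:
  fixes d :: "'a \<Rightarrow> real" and l :: real
  assumes "finite X" "X \<noteq> {}" "\<And>u. u \<in> X \<Longrightarrow> d u \<ge> 0" "(\<Sum>u\<in>X. d u) \<le> card X * l"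
  shows "(\<Prod>u\<in>X. d u) \<le> l ^ card X"
proof -
  have c: "card X > 0" using assms by (simp add: card_gt_0_iff)
  have p0: "(\<Prod>u\<in>X. d u) \<ge> 0" using assms by (intro prod_nonneg) auto
  have "(\<Prod>u\<in>X. d u) powr (1 / card X) \<le> (\<Sum>u\<in>X. d u / card X)"
    by (rule arith_geom_mean[OF assms(1,2)]) (rule assms(3))
  then have "root (card X) (\<Prod>u\<in>X. d u) \<le> (\<Sum>u\<in>X. d u) / card X"
    using p0 c by (simp add: root_powr_inverse sum_divide_distrib)
  also have "\<dots> \<le> l" using assms(4) c by (simp add: field_simps)
  finally have "root (card X) (\<Prod>u\<in>X. d u) ^ card X \<le> l ^ card X"
    using p0 by (intro power_mono) (auto intro: real_root_ge_zero)
  then show ?thesis using c p0 by simp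
qed

lemma sum_over_Sigma:
  assumes "finite A" "\<And>x. x \<in> A \<Longrightarrow> finite (B x)"
  shows "sum h (Sigma A B) = (\<Sum>x\<in>A. \<Sum>y\<in>B x. h (x, y))"
  using assms by (subst sum.Sigma) (auto intro!: sum.cong)

text \<open>A slot (i, u, j) is the j-th of k choices of a neighbour in \<open>W i\<close> by the
  vertex u of forest i; one independent transversal serves all forests. If a set X of size a failed
  to expand, all its k a choices would fall into some Y of size 3 a. Either X and Y span fewer than
  k a pairs, which contradicts that choices are distinct edges, or the pairs are few relative to the
  lists, and the event has weight at most (2 lam a)^(k a) by the mean inequality.\<close>

lemma rainbow_expanders:
  fixes I :: "'i set" and S W :: "'i \<Rightarrow> nat set" and lay :: "nat \<Rightarrow> nat" and E :: "(nat \<times> nat) set"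
    and col :: "nat \<times> nat \<Rightarrow> 'c" and k a0 m q n :: nat and D :: real and lam :: "nat \<Rightarrow> real"
  assumes I: "finite I" "\<And>i. i \<in> I \<Longrightarrow> S i \<subseteq> {..<n}" "\<And>i. i \<in> I \<Longrightarrow> W i \<subseteq> S i"
    and E: "E \<subseteq> vpairs n" and D: "D > 0"
    and lists: "\<And>i u. i \<in> I \<Longrightarrow> u \<in> S i \<Longrightarrow> D \<le> card {w \<in> W i. lay w \<noteq> lay u \<and> uedge u w \<in> E}"
    and m: "\<And>u w. lay u \<noteq> lay w \<Longrightarrow> card {i \<in> I. u \<in> S i \<and> w \<in> S i} \<le> m"
    and q: "\<And>\<kappa>. card {e \<in> E. col e = \<kappa>} \<le> q"
    and few: "real (2 * k * m + 2 * k * q) \<le> D / 4"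
    and sparse: "\<And>X Y a. X \<subseteq> {..<n} \<Longrightarrow> Y \<subseteq> {..<n} \<Longrightarrow> card X = a \<Longrightarrow> card Y = 3 * a \<Longrightarrow> 1 \<le> a \<Longrightarrow> a \<le> a0 \<Longrightarrow>
       (\<Sum>u\<in>X. card {w \<in> Y. uedge u w \<in> E}) < k * a \<or>
       real (\<Sum>u\<in>X. card {w \<in> Y. uedge u w \<in> E}) \<le> lam a * a * D"
    and num: "card I * (\<Sum>a\<in>{1..a0}. real (n choose a) * real (n choose (3 * a)) * (2 * lam a) ^ (k * a)) < 1"
    and a0: "3 * a0 \<le> n" and k: "k > 0" and lam: "\<And>a. lam a \<ge> 0"
  shows "\<exists>H. (\<forall>i\<in>I. H i \<subseteq> E \<and> H i \<subseteq> {uedge u w |u w. u \<in> S i \<and> w \<in> W i} \<and> inj_on col (H i) \<and>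
       card (H i) \<le> k * card (S i) \<and>
       (\<forall>X\<subseteq>S i. X \<noteq> {} \<and> card X \<le> a0 \<longrightarrow> card {w \<in> W i. \<exists>x\<in>X. uedge x w \<in> H i} > 3 * card X)) \<and>
     (\<forall>i\<in>I. \<forall>j\<in>I. i \<noteq> j \<longrightarrow> H i \<inter> H j = {})"
proof -
  define P where "P = (SIGMA i:I. S i \<times> {..<k})"
  define Lst where "Lst = (\<lambda>(i, u, j :: nat). {w \<in> W i. lay w \<noteq> lay u \<and> uedge u w \<in> E})"
  define conf where "conf = (\<lambda>(i :: 'i, u, j :: nat) w (i', u', j' :: nat) w'.
     uedge u w = uedge u' w' \<or> (i = i' \<and> col (uedge u w) = col (uedge u' w')))"
  have finS: "finite (S i)" if "i \<in> I" for i using I(2)[OF that] by (rule finite_subset) simp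
  have finW: "finite (W i)" if "i \<in> I" for i using I(3)[OF that] finS[OF that] by (rule finite_subset)
  have finE: "finite E" using E finite_vpairs by (rule finite_subset)
  interpret sparse_conflicts P Lst conf D
  proof
    show "finite P" unfolding P_def using I(1) finS by auto
    show "finite (Lst v)" if "v \<in> P" for v using that finW by (auto simp: P_def Lst_def)
    show "D > 0" by fact
    show "D \<le> card (Lst v)" if "v \<in> P" for v using that lists by (auto simp: P_def Lst_def)
    show "conf v' y v x" if "conf v x v' y" for v x v' y using that by (auto simp: conf_def split: prod.splits)
    show "real (card {(v', y). v' \<in> P \<and> y \<in> Lst v' \<and> v' \<noteq> v \<and> conf v x v' y}) \<le> D / 4"
      if v: "v \<in> P" and x: "x \<in> Lst v" for v x
    proof -
      obtain i u j where v_eq: "v = (i, u, j)" by (cases v)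
      have iu: "i \<in> I" "u \<in> S i" "j < k" "x \<in> W i" "lay x \<noteq> lay u" "uedge u x \<in> E"
        using v x by (auto simp: P_def Lst_def v_eq)
      \<comment> \<open>\<open>C1\<close> collects the slots that could pick the same edge,
        \<open>C2\<close> those of the same forest that could pick an edge of the same colour. The
        boolean says which end of the edge is the choosing vertex; this is the 2 in both
        counts.\<close>
      define C1 where "C1 = (\<lambda>(i', j', b). if b then ((i', u, j' :: nat), x) else ((i', x, j'), u)) `
         ({i' \<in> I. u \<in> S i' \<and> x \<in> S i'} \<times> {..<k} \<times> (UNIV :: bool set))"
      define C2 where "C2 = (\<lambda>(e, j', b). if b then ((i, fst e, j' :: nat), snd e) else ((i, snd e, j'), fst e)) `
         ({e \<in> E. col e = col (uedge u x)} \<times> {..<k} \<times> (UNIV :: bool set))"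
      have fin1: "finite ({i' \<in> I. u \<in> S i' \<and> x \<in> S i'} \<times> {..<k} \<times> (UNIV :: bool set))" using I(1) by auto
      have fin2: "finite ({e \<in> E. col e = col (uedge u x)} \<times> {..<k} \<times> (UNIV :: bool set))" using finE by auto
      have "card C1 \<le> card ({i' \<in> I. u \<in> S i' \<and> x \<in> S i'} \<times> {..<k} \<times> (UNIV :: bool set))"
        unfolding C1_def by (rule card_image_le[OF fin1])
      also have "\<dots> \<le> 2 * k * m" using m[of u x] iu(5) by (simp add: card_cartesian_product)
      finally have c1: "card C1 \<le> 2 * k * m" .
      have "card C2 \<le> card ({e \<in> E. col e = col (uedge u x)} \<times> {..<k} \<times> (UNIV :: bool set))"
        unfolding C2_def by (rule card_image_le[OF fin2])
      also have "\<dots> \<le> 2 * k * q" using q[of "col (uedge u x)"] by (simp add: card_cartesian_product)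
      finally have c2: "card C2 \<le> 2 * k * q" .
      have sub: "{(v', y). v' \<in> P \<and> y \<in> Lst v' \<and> v' \<noteq> v \<and> conf v x v' y} \<subseteq> C1 \<union> C2"
      proof
        fix z assume z: "z \<in> {(v', y). v' \<in> P \<and> y \<in> Lst v' \<and> v' \<noteq> v \<and> conf v x v' y}"
        obtain i' u' j' y where zz: "z = ((i', u', j'), y)" by (metis surj_pair)
        have *: "i' \<in> I" "u' \<in> S i'" "j' < k" "y \<in> W i'" "uedge u' y \<in> E"
          and c: "uedge u x = uedge u' y \<or> (i = i' \<and> col (uedge u x) = col (uedge u' y))"
          using z by (auto simp: zz P_def Lst_def conf_def v_eq)
        have y: "y \<in> S i'" using * I(3) by blast
        show "z \<in> C1 \<union> C2"
        proof (cases "uedge u x = uedge u' y")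
          case True
          then consider "u' = u" "y = x" | "u' = x" "y = u" by (auto simp: uedge_eq_iff)
          then have "z \<in> C1"
          proof cases
            case 1
            then show ?thesis unfolding C1_def
              by (intro image_eqI[where x = "(i', j', True)"]) (use * y zz in auto)
          next
            case 2
            then show ?thesis unfolding C1_def
              by (intro image_eqI[where x = "(i', j', False)"]) (use * y zz in auto)
          qed
          then show ?thesis by simp
        next
          case False
          then have c': "i = i'" "col (uedge u x) = col (uedge u' y)" using c by auto
          consider "uedge u' y = (u', y)" | "uedge u' y = (y, u')" by (cases "u' \<le> y") (auto simp: uedge_def)
          then have "z \<in> C2"
          proof cases
            case 1
            then show ?thesis unfolding C2_def
              by (intro image_eqI[where x = "(uedge u' y, j', True)"]) (use * c' zz in auto)
          next
            case 2
            then show ?thesis unfolding C2_def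
              by (intro image_eqI[where x = "(uedge u' y, j', False)"]) (use * c' zz in auto)
          qed
          then show ?thesis by simp
        qed
      qed
      have "finite (C1 \<union> C2)" unfolding C1_def C2_def using fin1 fin2 by blast
      then have "card {(v', y). v' \<in> P \<and> y \<in> Lst v' \<and> v' \<noteq> v \<and> conf v x v' y} \<le> card (C1 \<union> C2)"
        using sub by (rule card_mono)
      also have "\<dots> \<le> 2 * k * m + 2 * k * q" using card_Un_le[of C1 C2] c1 c2 by linarith
      finally show ?thesis using few by linarith
    qed
  qed
  define s where "s = (\<lambda>X Y. \<Sum>u\<in>X. card {w \<in> Y. uedge u w \<in> E})"
  define XY where "XY = (\<lambda>i a. {(X, Y). X \<subseteq> S i \<and> card X = a \<and> Y \<subseteq> {..<n} \<and> card Y = 3 * a \<and> real (s X Y) \<le> lam a * a * D})"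
  define \<B> where "\<B> = (SIGMA i:I. SIGMA a:{1..a0}. XY i a)"
  define Z where "Z = (\<lambda>(i :: 'i, a :: nat, X :: nat set, Y :: nat set). {i} \<times> X \<times> {..<k})"
  define L' where "L' = (\<lambda>(i :: 'i, a :: nat, X :: nat set, Y). \<lambda>(i' :: 'i, u, j :: nat). {w \<in> Y. uedge u w \<in> E})"
  have XY_sub: "XY i a \<subseteq> {X. X \<subseteq> {..<n} \<and> card X = a} \<times> {Y. Y \<subseteq> {..<n} \<and> card Y = 3 * a}" if "i \<in> I" for i a
    using I(2)[OF that] by (auto simp: XY_def)
  have finXY: "finite (XY i a)" if "i \<in> I" for i a
    by (rule finite_subset[OF XY_sub[OF that]]) auto
  have ev: "(\<Prod>z\<in>Z (i, a, X, Y). 2 * card (L' (i, a, X, Y) z) / D) \<le> (2 * lam a) ^ (k * a)"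
    if "i \<in> I" "a \<in> {1..a0}" "(X, Y) \<in> XY i a" for i a X Y
  proof -
    have X: "X \<subseteq> S i" "card X = a" "a \<ge> 1" "real (s X Y) \<le> lam a * a * D"
      using that by (auto simp: XY_def)
    have finX: "finite X" using X(1) finS[OF that(1)] by (rule finite_subset)
    have ne: "X \<noteq> {}" using X by auto
    have "(\<Prod>z\<in>Z (i, a, X, Y). 2 * card (L' (i, a, X, Y) z) / D) =
       (\<Prod>z\<in>X \<times> {..<k}. 2 * card {w \<in> Y. uedge (fst z) w \<in> E} / D)"
      by (rule prod.reindex_bij_witness[of _ "\<lambda>z. (i, z)" snd]) (auto simp: Z_def L'_def)
    also have "\<dots> = (\<Prod>u\<in>X. \<Prod>j\<in>{..<k}. 2 * card {w \<in> Y. uedge u w \<in> E} / D)"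
      by (subst prod.cartesian_product) (auto intro!: prod.cong)
    also have "\<dots> = (\<Prod>u\<in>X. 2 * card {w \<in> Y. uedge u w \<in> E} / D) ^ k"
      by (simp add: prod_power_distrib)
    also have "\<dots> \<le> ((2 * lam a) ^ a) ^ k"
    proof (rule power_mono)
      have "(\<Sum>u\<in>X. 2 * card {w \<in> Y. uedge u w \<in> E} / D) = 2 * real (s X Y) / D"
        unfolding s_def by (simp add: sum_distrib_left sum_divide_distrib)
      also have "\<dots> \<le> a * (2 * lam a)" using X(4) D by (simp add: field_simps)
      finally have "(\<Sum>u\<in>X. 2 * card {w \<in> Y. uedge u w \<in> E} / D) \<le> card X * (2 * lam a)" using X by simp
      then have "(\<Prod>u\<in>X. 2 * card {w \<in> Y. uedge u w \<in> E} / D) \<le> (2 * lam a) ^ card X"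
        by (rule prod_le_mean_power[OF finX ne, rotated]) (use D in auto)
      then show "(\<Prod>u\<in>X. 2 * card {w \<in> Y. uedge u w \<in> E} / D) \<le> (2 * lam a) ^ a"
        using X(2) by simp
    qed (use D in \<open>auto intro!: prod_nonneg\<close>)
    also have "\<dots> = (2 * lam a) ^ (k * a)" by (simp only: power_mult[symmetric] mult.commute[of a k])
    finally show ?thesis .
  qed
  have cXY: "real (card (XY i a)) \<le> real (n choose a) * real (n choose (3 * a))" if "i \<in> I" for i a
  proof -
    have "card (XY i a) \<le> card ({X. X \<subseteq> {..<n} \<and> card X = a} \<times> {Y. Y \<subseteq> {..<n} \<and> card Y = 3 * a})"
      by (rule card_mono[OF _ XY_sub[OF that]]) auto
    also have "\<dots> = (n choose a) * (n choose (3 * a))"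
      by (simp add: card_cartesian_product n_subsets)
    finally show ?thesis by (metis of_nat_le_iff of_nat_mult)
  qed
  have "(\<Sum>b\<in>\<B>. \<Prod>z\<in>Z b. 2 * card (L' b z) / D) =
      (\<Sum>i\<in>I. \<Sum>a\<in>{1..a0}. \<Sum>xy\<in>XY i a. \<Prod>z\<in>Z (i, a, xy). 2 * card (L' (i, a, xy) z) / D)"
    unfolding \<B>_def
  proof (subst sum_over_Sigma)
    show "finite (SIGMA a:{1..a0}. XY i a)" if "i \<in> I" for i using finXY[OF that] by auto
    show "(\<Sum>i\<in>I. \<Sum>y\<in>(SIGMA a:{1..a0}. XY i a). \<Prod>z\<in>Z (i, y). 2 * card (L' (i, y) z) / D) =
      (\<Sum>i\<in>I. \<Sum>a\<in>{1..a0}. \<Sum>xy\<in>XY i a. \<Prod>z\<in>Z (i, a, xy). 2 * card (L' (i, a, xy) z) / D)"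
      using finXY by (intro sum.cong refl) (subst sum_over_Sigma, auto)
  qed (fact I(1))
  also have "\<dots> \<le> (\<Sum>i\<in>I. \<Sum>a\<in>{1..a0}. real (n choose a) * real (n choose (3 * a)) * (2 * lam a) ^ (k * a))"
  proof (intro sum_mono)
    fix i a assume ia: "i \<in> I" "a \<in> {1..a0}"
    have "(\<Sum>xy\<in>XY i a. \<Prod>z\<in>Z (i, a, xy). 2 * card (L' (i, a, xy) z) / D) \<le> (\<Sum>xy\<in>XY i a. (2 * lam a) ^ (k * a))"
      using ev[OF ia] by (intro sum_mono) auto
    also have "\<dots> = card (XY i a) * (2 * lam a) ^ (k * a)" by simp
    also have "\<dots> \<le> real (n choose a) * real (n choose (3 * a)) * (2 * lam a) ^ (k * a)"
      using cXY[OF ia(1)] lam by (intro mult_right_mono) auto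
    finally show "(\<Sum>xy\<in>XY i a. \<Prod>z\<in>Z (i, a, xy). 2 * card (L' (i, a, xy) z) / D)
       \<le> real (n choose a) * real (n choose (3 * a)) * (2 * lam a) ^ (k * a)" .
  qed
  also have "\<dots> < 1" using num by simp
  finally have total: "(\<Sum>b\<in>\<B>. \<Prod>z\<in>Z b. 2 * card (L' b z) / D) < 1" .
  have "\<exists>f\<in>IT P. \<forall>b\<in>\<B>. \<exists>z\<in>Z b. f z \<notin> L' b z"
  proof (rule transversal_avoiding)
    show "finite \<B>" unfolding \<B>_def using I(1) finXY by auto
    show "Z b \<subseteq> P" if "b \<in> \<B>" for b using that by (auto simp: \<B>_def Z_def P_def XY_def)
    show "finite (L' b z)" if "b \<in> \<B>" "z \<in> Z b" for b z
      using that by (auto simp: \<B>_def Z_def L'_def XY_def intro: finite_subset)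
  qed (fact total)
  then obtain f where f: "f \<in> IT P" "\<And>b. b \<in> \<B> \<Longrightarrow> \<exists>z\<in>Z b. f z \<notin> L' b z" by blast
  have fL: "f (i, u, j) \<in> W i" "uedge u (f (i, u, j)) \<in> E" if "i \<in> I" "u \<in> S i" "j < k" for i u j
  proof -
    have "(i, u, j) \<in> P" using that by (simp add: P_def)
    then have "f (i, u, j) \<in> Lst (i, u, j)" using f(1) by (auto simp: transversals_def)
    then show "f (i, u, j) \<in> W i" "uedge u (f (i, u, j)) \<in> E" by (auto simp: Lst_def)
  qed
  have fc: "uedge u (f (i, u, j)) \<noteq> uedge u' (f (i', u', j'))"
     "i = i' \<Longrightarrow> col (uedge u (f (i, u, j))) \<noteq> col (uedge u' (f (i', u', j')))"
    if "i \<in> I" "u \<in> S i" "j < k" "i' \<in> I" "u' \<in> S i'" "j' < k" "(i, u, j) \<noteq> (i', u', j')" for i u j i' u' j'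
  proof -
    have "(i, u, j) \<in> P" "(i', u', j') \<in> P" using that by (auto simp: P_def)
    moreover have "\<forall>v\<in>P. \<forall>v'\<in>P. v \<noteq> v' \<longrightarrow> \<not> conf v (f v) v' (f v')"
      using f(1) by (simp add: transversals_def)
    ultimately have "\<not> conf (i, u, j) (f (i, u, j)) (i', u', j') (f (i', u', j'))"
      using that(7) by meson
    then show "uedge u (f (i, u, j)) \<noteq> uedge u' (f (i', u', j'))"
     "i = i' \<Longrightarrow> col (uedge u (f (i, u, j))) \<noteq> col (uedge u' (f (i', u', j')))"
      by (auto simp: conf_def)
  qed
  define H where "H = (\<lambda>i. (\<lambda>(u, j). uedge u (f (i, u, j))) ` (S i \<times> {..<k}))"
  have "H i \<subseteq> E" if "i \<in> I" for i using that fL by (auto simp: H_def)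
  moreover have "H i \<subseteq> {uedge u w |u w. u \<in> S i \<and> w \<in> W i}" if "i \<in> I" for i
    using that fL by (fastforce simp: H_def)
  moreover have "inj_on col (H i)" if "i \<in> I" for i
  proof (rule inj_onI)
    fix e e' assume "e \<in> H i" "e' \<in> H i" and ee: "col e = col e'"
    then obtain u j u' j' where *: "u \<in> S i" "j < k" "e = uedge u (f (i, u, j))"
       "u' \<in> S i" "j' < k" "e' = uedge u' (f (i, u', j'))" by (auto simp: H_def)
    then have "(i, u, j) = (i, u', j')" using fc(2)[OF that *(1,2) that *(4,5)] ee by blast
    then show "e = e'" using * by simp
  qed
  moreover have "card (H i) \<le> k * card (S i)" if "i \<in> I" for i
  proof -
    have "card (H i) \<le> card (S i \<times> {..<k})" unfolding H_def using finS[OF that] by (intro card_image_le) auto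
    then show ?thesis by (simp add: card_cartesian_product mult.commute)
  qed
  moreover have "H i \<inter> H i' = {}" if "i \<in> I" "i' \<in> I" "i \<noteq> i'" for i i'
    using fc(1)[of i _ _ i'] that by (fastforce simp: H_def)
  moreover have "card {w \<in> W i. \<exists>x\<in>X. uedge x w \<in> H i} > 3 * card X"
    if i: "i \<in> I" and X: "X \<subseteq> S i" "X \<noteq> {}" "card X \<le> a0" for i X
  proof (rule ccontr)
    let ?N = "{w \<in> W i. \<exists>x\<in>X. uedge x w \<in> H i}"
    assume "\<not> card ?N > 3 * card X"
    then have cN: "card ?N \<le> 3 * card X" by simp
    have finX: "finite X" using X(1) finS[OF i] by (rule finite_subset)
    have a1: "card X \<ge> 1" using X(2) finX by (simp add: Suc_le_eq card_gt_0_iff)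
    have Nn: "?N \<subseteq> {..<n}" using I(2,3)[OF i] by blast
    \<comment> \<open>The neighbourhood is padded to exactly 3 card X vertices, so that the bad
      events range over sets of one fixed size.\<close>
    have "\<exists>Y. ?N \<subseteq> Y \<and> Y \<subseteq> {..<n} \<and> card Y = 3 * card X"
      by (rule exists_subset_between) (use cN Nn a0 X in auto)
    then obtain Y where Y: "?N \<subseteq> Y" "Y \<subseteq> {..<n}" "card Y = 3 * card X" by blast
    have pick: "f (i, u, j) \<in> Y" "uedge u (f (i, u, j)) \<in> E" if "u \<in> X" "j < k" for u j
    proof -
      have u: "u \<in> S i" using that X by blast
      have "uedge u (f (i, u, j)) \<in> H i" using u that by (auto simp: H_def)
      then have "f (i, u, j) \<in> ?N" using fL(1)[OF i u that(2)] that(1) by blast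
      then show "f (i, u, j) \<in> Y" using Y by blast
      show "uedge u (f (i, u, j)) \<in> E" using fL(2)[OF i u that(2)] .
    qed
    have Xn: "X \<subseteq> {..<n}" using X I(2)[OF i] by blast
    consider "s X Y < k * card X" | "real (s X Y) \<le> lam (card X) * card X * D"
      using sparse[OF Xn Y(2) refl Y(3) a1 X(3)] by (auto simp: s_def)
    then show False
    proof cases
      case 1
      have "inj_on (\<lambda>(u, j). (u, f (i, u, j))) (X \<times> {..<k})"
      proof (rule inj_onI)
        fix z z' assume z: "z \<in> X \<times> {..<k}" "z' \<in> X \<times> {..<k}" "(case z of (u, j) \<Rightarrow> (u, f (i, u, j))) = (case z' of (u, j) \<Rightarrow> (u, f (i, u, j)))"
        obtain u j u' j' where zz: "z = (u, j)" "z' = (u', j')" by (cases z, cases z')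
        then have *: "u' = u" "u \<in> X" "j < k" "j' < k" "f (i, u, j) = f (i, u, j')" using z by auto
        then have "u \<in> S i" using X by blast
        then have "j = j'" using fc(1)[of i u j i u j'] * i by (cases "j = j'") auto
        then show "z = z'" using zz * by simp
      qed
      moreover have "(\<lambda>(u, j). (u, f (i, u, j))) ` (X \<times> {..<k}) \<subseteq> (SIGMA u:X. {w \<in> Y. uedge u w \<in> E})"
        using pick by auto
      moreover have finY: "finite Y" using Y(2) by (rule finite_subset) simp
      then have "finite (SIGMA u:X. {w \<in> Y. uedge u w \<in> E})" using finX by auto
      ultimately have "card (X \<times> {..<k}) \<le> card (SIGMA u:X. {w \<in> Y. uedge u w \<in> E})"
        by (rule card_inj_on_le)
      also have "\<dots> = s X Y" unfolding s_def using finX finY by (subst card_SigmaI) auto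
      finally show False using 1 by (simp add: card_cartesian_product mult.commute)
    next
      case 2
      then have "(i, card X, X, Y) \<in> \<B>" using i X a1 Y by (auto simp: \<B>_def XY_def)
      then obtain z where "z \<in> Z (i, card X, X, Y)" "f z \<notin> L' (i, card X, X, Y) z" using f(2) by blast
      then show False using pick by (auto simp: Z_def L'_def)
    qed
  qed
  ultimately show ?thesis by (intro exI[of _ H]) blast
qed

section \<open>Templates and linear forests\<close>

lemma inj_on_uedge_right: "inj_on (uedge u) A"
  by (auto simp: inj_on_def uedge_eq_iff)

locale templates =
  fixes n L R h :: nat
  assumes L: "L \<ge> 3" and Rpos: "R > 0"
begin

definition "Q = L * R"
definition lay :: "nat \<Rightarrow> nat" where "lay v = v mod Q"
text \<open>Pairs of positions joined in a template, in both orders. The multiples of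
  \<open>L\<close> are isolated, so the Q positions fall into \<open>R\<close> paths of L - 1
  positions each and \<open>R\<close> single ones.\<close>

definition A0 :: "(nat \<times> nat) set" where
  "A0 = {(a, b). a < Q \<and> b < Q \<and> (b = Suc a \<or> a = Suc b) \<and> \<not> L dvd a \<and> \<not> L dvd b}"
definition perms :: "(nat \<Rightarrow> nat) set" where "perms = {\<sigma>. \<sigma> permutes {..<Q}}"
definition Tm :: "nat \<Rightarrow> nat \<Rightarrow> (nat \<Rightarrow> nat) set" where
  "Tm x y = {\<sigma> \<in> perms. (\<sigma> x, \<sigma> y) \<in> A0}"
text \<open>The number of templates joining two given layers; by symmetry it is the same for any
  two, as \<open>card_Tm\<close> shows.\<close>

definition "\<mu> = card (Tm 0 1)"

text \<open>An index is a permutation \<open>\<sigma>\<close>, giving layer \<open>x\<close> the position \<open>\<sigma> x\<close>, together with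
  a counter below \<open>h\<close>. The forest of an index joins consecutive positions not divisible by \<open>L\<close>.\<close>

definition idx :: "((nat \<Rightarrow> nat) \<times> nat) set" where "idx = perms \<times> {..<h}"

text \<open>Residues 1 and L - 1 are the two ends of each path of layers, residue 0 are the isolated
  pivot layers.\<close>

definition core :: "((nat \<Rightarrow> nat) \<times> nat) \<Rightarrow> nat set" where
  "core i = {u. u < n \<and> fst i (lay u) mod L \<in> {0, 1, L - 1}}"
definition pivots :: "((nat \<Rightarrow> nat) \<times> nat) \<Rightarrow> nat set" where
  "pivots i = {u. u < n \<and> L dvd fst i (lay u)}"
text \<open>Vertices without a forest neighbour in some layer that the template joins to theirs.
  Together with the core they contain every end of a path of the forest.\<close>

definition lacking :: "(nat \<times> nat) set \<Rightarrow> ((nat \<Rightarrow> nat) \<times> nat) \<Rightarrow> nat set" where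
  "lacking F i = {u. u < n \<and> (\<exists>y<Q. y \<noteq> lay u \<and> fst i \<in> Tm (lay u) y \<and> \<not> (\<exists>v<n. lay v = y \<and> uedge u v \<in> F))}"
definition special :: "(nat \<times> nat) set \<Rightarrow> ((nat \<Rightarrow> nat) \<times> nat) \<Rightarrow> nat set" where
  "special F i = core i \<union> lacking F i"

lemma Q: "Q > 0" "Q \<ge> 3" using L Rpos by (auto simp: Q_def intro: le_trans[of 3 L])

lemma lay_less: "lay v < Q" using Q by (simp add: lay_def)

lemma finite_perms: "finite perms" unfolding perms_def by (rule finite_permutations) simp
lemma finite_Tm [simp]: "finite (Tm x y)" unfolding Tm_def using finite_perms by simp

lemma finite_idx: "finite idx" unfolding idx_def using finite_perms by simp

lemma Tm_sym: "Tm x y = Tm y x"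
  by (auto simp: Tm_def A0_def)

lemma A0_offdiag: "A0 \<subseteq> {(a, b). a < Q \<and> b < Q \<and> a \<noteq> b}"
  by (auto simp: A0_def)

lemma card_Tm: "x < Q \<Longrightarrow> y < Q \<Longrightarrow> x \<noteq> y \<Longrightarrow> card (Tm x y) = \<mu>"
  unfolding \<mu>_def Tm_def perms_def using card_permutes_pair_invariant[of x Q y 0 1 A0] Q by simp

lemma mu_eq: "\<mu> * (Q * (Q - 1)) = card A0 * fact Q"
  unfolding \<mu>_def Tm_def perms_def using card_permutes_pair[of 0 Q 1 A0] A0_offdiag Q by simp

text \<open>An index may be used on an edge only if its template joins the two layers, and edges
  from one vertex to one layer carry distinct indices. So each index class is a matching between any
  two layers, and along its template these matchings form vertex-disjoint paths.\<close>

definition forest_colouring :: "(nat \<times> nat) set \<Rightarrow> (nat \<times> nat \<Rightarrow> (nat \<Rightarrow> nat) \<times> nat) \<Rightarrow> bool" where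
  "forest_colouring E f \<longleftrightarrow> (\<forall>u<n. \<forall>v<n. uedge u v \<in> E \<and> lay u \<noteq> lay v \<longrightarrow>
      f (uedge u v) \<in> Tm (lay u) (lay v) \<times> {..<h} \<and>
      (\<forall>v'<n. v' \<noteq> v \<and> lay v' = lay v \<and> uedge u v' \<in> E \<longrightarrow> f (uedge u v') \<noteq> f (uedge u v)))"

text \<open>Different pairs of layers impose no constraints on each other, so Koenig's theorem is
  applied to each pair x < y separately, with the \<open>\<mu> * h\<close> indices whose template
  joins them as colours.\<close>

lemma forest_colouring_exists:
  assumes deg: "\<And>u y. u < n \<Longrightarrow> y < Q \<Longrightarrow> y \<noteq> lay u \<Longrightarrow> card {v. v < n \<and> lay v = y \<and> uedge u v \<in> E} \<le> \<mu> * h"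
  shows "\<exists>f. forest_colouring E f"
proof -
  define B where "B = (\<lambda>x y. {(u, v). u < n \<and> v < n \<and> lay u = x \<and> lay v = y \<and> uedge u v \<in> E})"
  have kn: "\<exists>g. (\<forall>e\<in>B x y. g e \<in> Tm x y \<times> {..<h}) \<and>
     (\<forall>e\<in>B x y. \<forall>e'\<in>B x y. e \<noteq> e' \<and> (fst e = fst e' \<or> snd e = snd e') \<longrightarrow> g e \<noteq> g e')"
    if "x < y" "y < Q" for x y
  proof (rule konig_edge_colouring)
    show "finite (B x y)" by (rule finite_subset[of _ "{..<n} \<times> {..<n}"]) (auto simp: B_def)
    show "finite (Tm x y \<times> {..<h})" by simp
    have c: "card (Tm x y \<times> {..<h}) = \<mu> * h" using card_Tm that by (simp add: card_cartesian_product)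
    show "card {e \<in> B x y. fst e = a} \<le> card (Tm x y \<times> {..<h})" for a
    proof (cases "a < n \<and> lay a = x")
      case True
      have "{e \<in> B x y. fst e = a} \<subseteq> Pair a ` {v. v < n \<and> lay v = y \<and> uedge a v \<in> E}"
        by (auto simp: B_def)
      then have "card {e \<in> B x y. fst e = a} \<le> card {v. v < n \<and> lay v = y \<and> uedge a v \<in> E}"
        by (intro surj_card_le) auto
      also have "\<dots> \<le> \<mu> * h" using deg True that by auto
      finally show ?thesis unfolding c .
    next
      case False
      then have "{e \<in> B x y. fst e = a} = {}" by (auto simp: B_def)
      then show ?thesis by (metis card.empty zero_le)
    qed
    show "card {e \<in> B x y. snd e = a} \<le> card (Tm x y \<times> {..<h})" for a
    proof (cases "a < n \<and> lay a = y")
      case True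
      have "{e \<in> B x y. snd e = a} \<subseteq> (\<lambda>v. (v, a)) ` {v. v < n \<and> lay v = x \<and> uedge a v \<in> E}"
        by (auto simp: B_def uedge_commute)
      then have "card {e \<in> B x y. snd e = a} \<le> card {v. v < n \<and> lay v = x \<and> uedge a v \<in> E}"
        by (intro surj_card_le) auto
      also have "\<dots> \<le> \<mu> * h" using deg True that by auto
      finally show ?thesis unfolding c .
    next
      case False
      then have "{e \<in> B x y. snd e = a} = {}" by (auto simp: B_def)
      then show ?thesis by (metis card.empty zero_le)
    qed
  qed
  have "\<forall>z. \<exists>g. fst z < snd z \<and> snd z < Q \<longrightarrow> (\<forall>e\<in>B (fst z) (snd z). g e \<in> Tm (fst z) (snd z) \<times> {..<h}) \<and>
     (\<forall>e\<in>B (fst z) (snd z). \<forall>e'\<in>B (fst z) (snd z). e \<noteq> e' \<and> (fst e = fst e' \<or> snd e = snd e') \<longrightarrow> g e \<noteq> g e')"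
  proof
    fix z
    show "\<exists>g. fst z < snd z \<and> snd z < Q \<longrightarrow> (\<forall>e\<in>B (fst z) (snd z). g e \<in> Tm (fst z) (snd z) \<times> {..<h}) \<and>
     (\<forall>e\<in>B (fst z) (snd z). \<forall>e'\<in>B (fst z) (snd z). e \<noteq> e' \<and> (fst e = fst e' \<or> snd e = snd e') \<longrightarrow> g e \<noteq> g e')"
    proof (cases "fst z < snd z \<and> snd z < Q")
      case True
      with kn[of "fst z" "snd z"] show ?thesis by (elim conjE) (simp only: simp_thms)
    next
      case False
      then show ?thesis by (simp only: simp_thms)
    qed
  qed
  from choice[OF this] obtain G where G0: "\<forall>z. fst z < snd z \<and> snd z < Q \<longrightarrow> (\<forall>e\<in>B (fst z) (snd z). G z e \<in> Tm (fst z) (snd z) \<times> {..<h}) \<and>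
     (\<forall>e\<in>B (fst z) (snd z). \<forall>e'\<in>B (fst z) (snd z). e \<noteq> e' \<and> (fst e = fst e' \<or> snd e = snd e') \<longrightarrow> G z e \<noteq> G z e')"
    by (elim exE)
  have G1: "G (x, y) e \<in> Tm x y \<times> {..<h}" if "x < y" "y < Q" "e \<in> B x y" for x y e
    using spec[OF G0, of "(x, y)"] that by simp
  have G2: "G (x, y) e \<noteq> G (x, y) e'" if "x < y" "y < Q" "e \<in> B x y" "e' \<in> B x y" "e \<noteq> e'" "fst e = fst e' \<or> snd e = snd e'" for x y e e'
    using spec[OF G0, of "(x, y)"] that by simp
  define f where "f = (\<lambda>(u, v). if lay u < lay v then G (lay u, lay v) (u, v) else G (lay v, lay u) (v, u))"
  have f_eq: "f (uedge u v) = (if lay u < lay v then G (lay u, lay v) (u, v) else G (lay v, lay u) (v, u))"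
    if "lay u \<noteq> lay v" for u v
  proof (cases "u \<le> v")
    case True then show ?thesis by (simp add: uedge_def f_def)
  next
    case False then show ?thesis using that by (auto simp: uedge_def f_def)
  qed
  have "forest_colouring E f"
    unfolding forest_colouring_def
  proof (intro allI impI conjI; elim conjE)
    fix u v assume uv: "u < n" "v < n" "uedge u v \<in> E" "lay u \<noteq> lay v"
    have b: "(u, v) \<in> B (lay u) (lay v)" "(v, u) \<in> B (lay v) (lay u)"
      using uv by (auto simp: B_def uedge_commute)
    show "f (uedge u v) \<in> Tm (lay u) (lay v) \<times> {..<h}"
    proof (cases "lay u < lay v")
      case True then show ?thesis using G1[OF True lay_less b(1)] f_eq[OF uv(4)] by simp
    next
      case False
      then have "lay v < lay u" using uv by simp
      then show ?thesis using G1[OF _ lay_less b(2)] f_eq[OF uv(4)] False Tm_sym[of "lay v" "lay u"] by simp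
    qed
    fix v' assume v': "v' < n" "v' \<noteq> v" "lay v' = lay v" "uedge u v' \<in> E"
    have b': "(u, v') \<in> B (lay u) (lay v)" "(v', u) \<in> B (lay v) (lay u)"
      using uv v' by (auto simp: B_def uedge_commute)
    show "f (uedge u v') \<noteq> f (uedge u v)"
    proof (cases "lay u < lay v")
      case True
      then show ?thesis using G2[OF True lay_less b'(1) b(1)] f_eq[of u v] f_eq[of u v'] uv v' by simp
    next
      case False
      then have "lay v < lay u" using uv by simp
      then show ?thesis using G2[OF _ lay_less b'(2) b(2)] f_eq[of u v] f_eq[of u v'] uv v' False by simp
    qed
  qed
  then show ?thesis by blast
qed

definition forest :: "(nat \<times> nat) set \<Rightarrow> (nat \<times> nat \<Rightarrow> (nat \<Rightarrow> nat) \<times> nat) \<Rightarrow> ((nat \<Rightarrow> nat) \<times> nat) \<Rightarrow> (nat \<times> nat) set" where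
  "forest E f i = {e \<in> E. lay (fst e) \<noteq> lay (snd e) \<and> f e = i}"

definition arcs :: "(nat \<times> nat) set \<Rightarrow> ((nat \<Rightarrow> nat) \<times> nat) \<Rightarrow> (nat \<times> nat) set" where
  "arcs F i = {(u, v). u < n \<and> v < n \<and> uedge u v \<in> F \<and> fst i (lay v) = Suc (fst i (lay u))}"

lemma forest_uedge:
  "uedge u v \<in> forest E f i \<longleftrightarrow> uedge u v \<in> E \<and> lay u \<noteq> lay v \<and> f (uedge u v) = i"
  by (auto simp: forest_def uedge_def min_def max_def)

context
  fixes E f i F
  assumes E: "E \<subseteq> vpairs n" and f: "forest_colouring E f" and i: "i \<in> idx" and F: "F \<subseteq> forest E f i"
begin

lemma perm_i: "fst i permutes {..<Q}" using i by (auto simp: idx_def perms_def)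

lemma F_edge: 
  assumes "uedge u v \<in> F"
  shows "u < n" "v < n" "lay u \<noteq> lay v" "fst i \<in> Tm (lay u) (lay v)" "f (uedge u v) = i" "uedge u v \<in> E"
proof -
  have e: "uedge u v \<in> E" "lay u \<noteq> lay v" "f (uedge u v) = i"
    using subsetD[OF F assms] by (simp_all add: forest_uedge)
  then show "lay u \<noteq> lay v" "f (uedge u v) = i" "uedge u v \<in> E" by auto
  have "uedge u v \<in> vpairs n" using e E by blast
  then show uv: "u < n" "v < n" by (auto simp: uedge_in_vpairs)
  have "f (uedge u v) \<in> Tm (lay u) (lay v) \<times> {..<h}" using f uv e unfolding forest_colouring_def by blast
  then show "fst i \<in> Tm (lay u) (lay v)" using e by auto
qed

lemma F_unique:
  assumes "uedge u v \<in> F" "uedge u v' \<in> F" "lay v = lay v'"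
  shows "v = v'"
  using f F_edge[OF assms(1)] F_edge[OF assms(2)] assms(3) unfolding forest_colouring_def by metis

lemma pos_inj: "fst i (lay u) = fst i (lay v) \<Longrightarrow> lay u = lay v"
  using permutes_inj[OF perm_i] by (meson injD)

text \<open>The position of a vertex outside the core has residue other than 0, 1 and L - 1, so its
  template joins it to both neighbouring positions; if it lacks no neighbour it has an arc in each
  direction. Hence all path ends are special.\<close>

lemma forest_closeable:
  assumes "n > 0"
  shows "closeable {..<n} (special F i) F (card (special F i))"
proof (rule linear_forest_closeable[where N = "arcs F i" and pos = "\<lambda>v. fst i (lay v)"])
  show "arcs F i \<subseteq> {..<n} \<times> {..<n}" by (auto simp: arcs_def)
  show "b = c" if "(a, b) \<in> arcs F i" "(a, c) \<in> arcs F i" for a b c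
    using that F_unique[of a b c] pos_inj by (auto simp: arcs_def)
  show "a = b" if "(a, c) \<in> arcs F i" "(b, c) \<in> arcs F i" for a b c
    using that F_unique[of c a b] pos_inj by (auto simp: arcs_def uedge_commute)
  have step: "\<exists>v. v < n \<and> fst i (lay v) = a \<and> uedge u v \<in> F"
    if u: "u < n" "u \<notin> special F i" "a < Q" "(fst i (lay u), a) \<in> A0" for u a
  proof -
    define y where "y = inv (fst i) a"
    have y: "y < Q" "fst i y = a"
      using permutes_in_image[OF permutes_inv[OF perm_i], of a] u(3) permutes_inverses[OF perm_i] by (auto simp: y_def)
    have ne: "y \<noteq> lay u" using u(4) y by (auto simp: A0_def)
    have "fst i \<in> Tm (lay u) y" using u(4) y i by (auto simp: Tm_def idx_def)
    moreover have "u \<notin> lacking F i" using u(2) by (simp add: special_def)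
    ultimately obtain v where "v < n" "lay v = y" "uedge u v \<in> F"
      using u(1) y ne unfolding lacking_def by blast
    then show ?thesis using y by blast
  qed
  have mid: "Suc (fst i (lay u)) < Q \<and> (fst i (lay u), Suc (fst i (lay u))) \<in> A0 \<and>
     fst i (lay u) > 0 \<and> (fst i (lay u), fst i (lay u) - 1) \<in> A0"
    if u: "u < n" "u \<notin> special F i" for u
  proof -
    define a where "a = fst i (lay u)"
    have aQ: "a < Q" using permutes_in_image[OF perm_i, of "lay u"] lay_less by (simp add: a_def)
    have am: "a mod L \<noteq> 0" "a mod L \<noteq> 1" "a mod L \<noteq> L - 1" using u by (auto simp: special_def core_def a_def)
    have aml: "a mod L < L" using L by simp
    obtain d where d: "a = d * L + a mod L" by (metis div_mult_mod_eq)
    have s: "Suc a mod L = Suc (a mod L)" using am aml by (simp add: mod_Suc)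
    have p: "(a - 1) mod L = a mod L - 1"
    proof -
      have "a - 1 = d * L + (a mod L - 1)" using d am(1) by linarith
      moreover have "a mod L - 1 < L" using aml by linarith
      ultimately show ?thesis by (metis mod_less mod_mult_self3)
    qed
    have "\<not> L dvd a" "\<not> L dvd Suc a" "\<not> L dvd (a - 1)" "a > 0"
      using am s p by (auto simp: dvd_eq_mod_eq_0 intro!: Nat.gr0I)
    moreover have "Suc a \<noteq> Q" using \<open>\<not> L dvd Suc a\<close> by (auto simp: Q_def)
    then have "Suc a < Q" using aQ by simp
    ultimately show ?thesis using aQ unfolding a_def[symmetric] by (auto simp: A0_def)
  qed
  show "{..<n} - Domain (arcs F i) \<subseteq> special F i"
  proof (rule subsetI, rule ccontr)
    fix u assume u: "u \<in> {..<n} - Domain (arcs F i)" "u \<notin> special F i"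
    then have "u < n" by simp
    note m = mid[OF this u(2)]
    obtain v where "v < n" "fst i (lay v) = Suc (fst i (lay u))" "uedge u v \<in> F"
      using step[OF \<open>u < n\<close> u(2), of "Suc (fst i (lay u))"] m by blast
    then have "(u, v) \<in> arcs F i" using \<open>u < n\<close> by (simp add: arcs_def)
    then show False using u by blast
  qed
  show "{..<n} - Range (arcs F i) \<subseteq> special F i"
  proof (rule subsetI, rule ccontr)
    fix u assume u: "u \<in> {..<n} - Range (arcs F i)" "u \<notin> special F i"
    then have "u < n" by simp
    note m = mid[OF this u(2)]
    have "fst i (lay u) - 1 < Q" using m by linarith
    then obtain v where "v < n" "fst i (lay v) = fst i (lay u) - 1" "uedge u v \<in> F"
      using step[OF \<open>u < n\<close> u(2), of "fst i (lay u) - 1"] m by blast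
    then have "(v, u) \<in> arcs F i" using \<open>u < n\<close> m by (simp add: arcs_def uedge_commute)
    then show False using u by blast
  qed
  show "special F i \<subseteq> {..<n}" by (auto simp: special_def core_def lacking_def)
qed (use assms in \<open>auto simp: arcs_def\<close>)

text \<open>Ensures that every neighbour of a pivot comes from the expander or the boosters and is
  therefore special, as the rotations demand of \<open>W\<close>.\<close>

lemma forest_avoids_pivots: "w \<in> pivots i \<Longrightarrow> uedge w v \<notin> F"
  using F_edge(4)[of w v] by (auto simp: Tm_def A0_def pivots_def)

lemma card_forest_le: "card F \<le> n"
proof -
  have "F \<subseteq> (\<lambda>(u, v). uedge u v) ` arcs F i"
  proof
    fix e assume e: "e \<in> F"
    then have "e \<in> vpairs n" using F E by (auto simp: forest_def)
    then obtain u v where uv: "e = uedge u v" using vpairs_uedge by metis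
    note fe = F_edge[OF e[unfolded uv]]
    have "fst i (lay v) = Suc (fst i (lay u)) \<or> fst i (lay u) = Suc (fst i (lay v))"
      using fe(4) by (auto simp: Tm_def A0_def)
    then have "(u, v) \<in> arcs F i \<or> (v, u) \<in> arcs F i"
      using fe e uv by (auto simp: arcs_def uedge_commute)
    then show "e \<in> (\<lambda>(u, v). uedge u v) ` arcs F i"
      using uv uedge_commute by (metis (mono_tags, lifting) case_prod_conv image_eqI)
  qed
  moreover have fin: "finite (arcs F i)" by (rule finite_subset[of _ "{..<n} \<times> {..<n}"]) (auto simp: arcs_def)
  ultimately have "card F \<le> card (arcs F i)" by (meson surj_card_le)
  also have "\<dots> \<le> card {..<n}"
  proof (rule card_inj_on_le[where f = fst])
    show "inj_on fst (arcs F i)"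
      using F_unique pos_inj by (auto simp: inj_on_def arcs_def)
  qed (auto simp: arcs_def)
  finally show ?thesis by simp
qed

end

text \<open>Between u and a layer y there are \<open>\<mu> * h\<close> indices and at least
  \<open>\<mu> * h - g\<close> edges with distinct indices, so at most g indices are absent; this is
  summed over the layers. Each deleted edge of \<open>X\<close> at u spoils one more index.\<close>

lemma card_lacking_le:
  fixes g :: real
  assumes E: "E \<subseteq> vpairs n" and f: "forest_colouring E f" and u: "u < n"
    and deg: "\<And>y. y < Q \<Longrightarrow> y \<noteq> lay u \<Longrightarrow> real (\<mu> * h) - g \<le> card {v. v < n \<and> lay v = y \<and> uedge u v \<in> E}"
    and g: "g \<ge> 0"
  shows "card {i \<in> idx. u \<in> lacking (forest E f i - X) i} \<le> Q * g + card {e \<in> X. e \<in> E \<and> (fst e = u \<or> snd e = u)}"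
proof -
  define M where "M = (\<lambda>y. {i \<in> Tm (lay u) y \<times> {..<h}. \<not> (\<exists>v<n. lay v = y \<and> uedge u v \<in> forest E f i)})"
  have cM: "card (M y) \<le> g" if y: "y < Q" "y \<noteq> lay u" for y
  proof -
    define N where "N = {v. v < n \<and> lay v = y \<and> uedge u v \<in> E}"
    have inj: "inj_on (\<lambda>v. f (uedge u v)) N"
      using f u y unfolding forest_colouring_def N_def inj_on_def by (metis (mono_tags, lifting) mem_Collect_eq)
    have sub: "(\<lambda>v. f (uedge u v)) ` N \<subseteq> Tm (lay u) y \<times> {..<h}"
    proof (rule image_subsetI)
      fix v assume "v \<in> N"
      then have v: "v < n" "lay v = y" "uedge u v \<in> E" by (auto simp: N_def)
      then have "uedge u v \<in> E \<and> lay u \<noteq> lay v" using y by simp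
      with f[unfolded forest_colouring_def, rule_format, OF u v(1)] v(2)
      show "f (uedge u v) \<in> Tm (lay u) y \<times> {..<h}" by simp
    qed
    have "M y \<subseteq> Tm (lay u) y \<times> {..<h} - (\<lambda>v. f (uedge u v)) ` N"
      using y by (auto simp: M_def N_def forest_uedge)
    then have "card (M y) \<le> card (Tm (lay u) y \<times> {..<h} - (\<lambda>v. f (uedge u v)) ` N)"
      by (intro card_mono) auto
    also have "\<dots> = \<mu> * h - card N"
      using sub inj card_Tm[OF lay_less[of u] y(1)] y
      by (subst card_Diff_subset) (auto simp: card_cartesian_product card_image N_def intro: finite_subset)
    finally have "real (card (M y)) \<le> real (\<mu> * h - card N)" by simp
    also have "\<dots> \<le> g"
    proof (cases "card N \<le> \<mu> * h")
      case True then show ?thesis using deg[OF y] unfolding N_def[symmetric] by (simp add: of_nat_diff)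
    qed (use g in simp)
    finally show ?thesis .
  qed
  have finX: "finite {e \<in> X. e \<in> E \<and> (fst e = u \<or> snd e = u)}"
    by (rule finite_subset[OF _ finite_subset[OF E finite_vpairs]]) auto
  have finM: "finite (M y)" for y by (rule finite_subset[of _ "Tm (lay u) y \<times> {..<h}"]) (auto simp: M_def)
  let ?D = "f ` {e \<in> X. e \<in> E \<and> (fst e = u \<or> snd e = u)}"
  have "{i \<in> idx. u \<in> lacking (forest E f i - X) i} \<subseteq> (\<Union>y\<in>{..<Q} - {lay u}. M y) \<union> ?D"
  proof
    fix i assume i: "i \<in> {i \<in> idx. u \<in> lacking (forest E f i - X) i}"
    then obtain y where y: "y < Q" "y \<noteq> lay u" "fst i \<in> Tm (lay u) y"
      "\<not> (\<exists>v<n. lay v = y \<and> uedge u v \<in> forest E f i - X)" by (auto simp: lacking_def)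
    show "i \<in> (\<Union>y\<in>{..<Q} - {lay u}. M y) \<union> ?D"
    proof (cases "\<exists>v<n. lay v = y \<and> uedge u v \<in> forest E f i")
      case False
      then have "i \<in> M y" using y i by (auto simp: M_def idx_def)
      then show ?thesis using y by auto
    next
      case True
      then obtain v where v: "v < n" "uedge u v \<in> forest E f i" "uedge u v \<in> X" using y by blast
      then have "i = f (uedge u v)" "uedge u v \<in> E" by (auto simp: forest_uedge)
      moreover have "fst (uedge u v) = u \<or> snd (uedge u v) = u" by (auto simp: uedge_def min_def max_def)
      ultimately show ?thesis using v by blast
    qed
  qed
  then have "card {i \<in> idx. u \<in> lacking (forest E f i - X) i} \<le> card ((\<Union>y\<in>{..<Q} - {lay u}. M y) \<union> ?D)"
    using finM finX by (intro card_mono) auto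
  also have "\<dots> \<le> card (\<Union>y\<in>{..<Q} - {lay u}. M y) + card ?D" by (rule card_Un_le)
  also have "\<dots> \<le> (\<Sum>y\<in>{..<Q} - {lay u}. card (M y)) + card {e \<in> X. e \<in> E \<and> (fst e = u \<or> snd e = u)}"
    using finX by (intro add_mono card_UN_le card_image_le) auto
  finally have "real (card {i \<in> idx. u \<in> lacking (forest E f i - X) i}) \<le>
     real ((\<Sum>y\<in>{..<Q} - {lay u}. card (M y)) + card {e \<in> X. e \<in> E \<and> (fst e = u \<or> snd e = u)})"
    by (rule of_nat_mono)
  also have "\<dots> = (\<Sum>y\<in>{..<Q} - {lay u}. real (card (M y))) + card {e \<in> X. e \<in> E \<and> (fst e = u \<or> snd e = u)}"
    by (simp only: of_nat_add of_nat_sum)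
  also have "(\<Sum>y\<in>{..<Q} - {lay u}. real (card (M y))) \<le> (\<Sum>y\<in>{..<Q} - {lay u}. g)"
    using cM by (intro sum_mono) auto
  also have "\<dots> \<le> Q * g" using g lay_less[of u] by (simp add: mult_right_mono of_nat_diff)
  finally show ?thesis by simp
qed

end

section \<open>Boosters and the closing of all cycles\<close>

definition boosters :: "nat \<Rightarrow> (nat \<Rightarrow> nat) \<Rightarrow> nat set \<Rightarrow> (nat \<times> nat) set \<Rightarrow> nat \<Rightarrow> (nat \<times> nat) set" where
  "boosters n lay S \<Gamma> b = {e \<in> vpairs n. fst e \<in> S \<and> snd e \<in> S \<and> lay (fst e) \<noteq> lay (snd e) \<and>
     e \<notin> \<Gamma> \<and> closeable {..<n} S (insert e \<Gamma>) b}"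

text \<open>There are more than \<open>a0\<close> heads with more than \<open>a0\<close> partners
  each. Partners in the layer of the head are given up, at most \<open>ls\<close> of them: two
  vertices of one layer share a core in about 3/L of the forests instead of O(1/L^2), so such pairs
  would have too many competing owners. The factor 2 is for pairs found from both ends.\<close>

lemma many_boosters:
  assumes n: "n \<ge> 3" and S: "W \<subseteq> S" "S \<subseteq> {..<n}"
    and cl: "closeable {..<n} S \<Gamma> b" "\<not> closeable {..<n} S \<Gamma> (b - 1)"
    and nbr: "\<And>w v. w \<in> W \<Longrightarrow> uedge w v \<in> \<Gamma> \<Longrightarrow> v \<in> S"
    and expand: "\<And>X. X \<subseteq> S \<Longrightarrow> X \<noteq> {} \<Longrightarrow> card X \<le> a0 \<Longrightarrow>
       card {w \<in> W. \<exists>x\<in>X. uedge x w \<in> \<Gamma>} > 3 * card X"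
    and ls: "\<And>x. card {v. v < n \<and> lay v = x} \<le> ls"
  shows "(a0 + 1) * (a0 + 1 - ls) \<le> 2 * card (boosters n lay S \<Gamma> (b - 1))"
proof -
  have "\<exists>X\<subseteq>S. card X > a0 \<and> (\<forall>x\<in>X. \<exists>Y\<subseteq>S. card Y > a0 \<and>
     (\<forall>y\<in>Y. closeable {..<n} S (insert (uedge x y) \<Gamma>) (b - 1)))"
    by (rule Posa_boosters[where W = W]) (use assms in auto)
  then obtain X where X: "X \<subseteq> S" "card X > a0" "\<forall>x\<in>X. \<exists>Y. Y \<subseteq> S \<and> card Y > a0 \<and>
     (\<forall>y\<in>Y. closeable {..<n} S (insert (uedge x y) \<Gamma>) (b - 1))" by blast
  from bchoice[OF X(3)] obtain Y where Y: "\<forall>x\<in>X. Y x \<subseteq> S \<and> card (Y x) > a0 \<and>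
     (\<forall>y\<in>Y x. closeable {..<n} S (insert (uedge x y) \<Gamma>) (b - 1))" by (elim exE)
  have finS: "finite S" using S(2) by (rule finite_subset) simp
  have finX: "finite X" using X(1) finS by (rule finite_subset)
  let ?B = "boosters n lay S \<Gamma> (b - 1)"
  have finB: "finite ?B" unfolding boosters_def by simp
  define O' where "O' = (SIGMA x:X. {y \<in> Y x. lay y \<noteq> lay x})"
  have finY: "finite (Y x)" if "x \<in> X" for x using Y that finS by (meson finite_subset)
  have "(a0 + 1) * (a0 + 1 - ls) \<le> card X * (a0 + 1 - ls)" using X(2) by (intro mult_right_mono) auto
  also have "\<dots> = (\<Sum>x\<in>X. a0 + 1 - ls)" by simp
  also have "\<dots> \<le> (\<Sum>x\<in>X. card {y \<in> Y x. lay y \<noteq> lay x})"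
  proof (rule sum_mono)
    fix x assume x: "x \<in> X"
    have "Y x \<subseteq> {y \<in> Y x. lay y \<noteq> lay x} \<union> {v. v < n \<and> lay v = lay x}" using Y x S(2) by blast
    then have "card (Y x) \<le> card ({y \<in> Y x. lay y \<noteq> lay x} \<union> {v. v < n \<and> lay v = lay x})"
      using finY[OF x] by (intro card_mono) auto
    also have "\<dots> \<le> card {y \<in> Y x. lay y \<noteq> lay x} + ls"
      using card_Un_le[of "{y \<in> Y x. lay y \<noteq> lay x}" "{v. v < n \<and> lay v = lay x}"] ls[of "lay x"] by linarith
    finally show "a0 + 1 - ls \<le> card {y \<in> Y x. lay y \<noteq> lay x}" using Y x by fastforce
  qed
  also have "\<dots> = card O'" unfolding O'_def using finX finY by (subst card_SigmaI) auto
  also have "\<dots> \<le> card (?B \<union> prod.swap ` ?B)"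
  proof (rule card_mono)
    show "O' \<subseteq> ?B \<union> prod.swap ` ?B"
    proof
      fix z assume "z \<in> O'"
      then obtain x y where z: "z = (x, y)" "x \<in> X" "y \<in> Y x" "lay y \<noteq> lay x" by (auto simp: O'_def)
      have xy: "x \<in> S" "y \<in> S" using z X Y by auto
      have cl': "closeable {..<n} S (insert (uedge x y) \<Gamma>) (b - 1)" using Y z by blast
      have "uedge x y \<notin> \<Gamma>" using cl' cl(2) by (auto simp: insert_absorb)
      moreover have "uedge x y \<in> vpairs n" using xy S(2) z by (auto simp: uedge_in_vpairs)
      moreover have "fst (uedge x y) \<in> S \<and> snd (uedge x y) \<in> S \<and> lay (fst (uedge x y)) \<noteq> lay (snd (uedge x y))"
        using xy z by (cases "x \<le> y") (auto simp: uedge_def)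
      ultimately have "uedge x y \<in> ?B" using cl' by (simp add: boosters_def)
      moreover have "z = uedge x y \<or> z = prod.swap (uedge x y)" using z by (cases "x \<le> y") (auto simp: uedge_def)
      ultimately show "z \<in> ?B \<union> prod.swap ` ?B" by blast
    qed
  qed (use finB in simp)
  also have "\<dots> \<le> card ?B + card (prod.swap ` ?B)" by (rule card_Un_le)
  also have "\<dots> \<le> 2 * card ?B" using card_image_le[OF finB, of prod.swap] by simp
  finally show ?thesis .
qed

text \<open>Each forest owns a share \<open>R i\<close> of \<open>E\<close> and adds one owned edge
  per round. \<open>dense\<close> supplies \<beta> + T q boosters in \<open>E\<close>; at most T q
  of them have a colour used before, and the shares were chosen so that any remaining \<beta>
  boosters meet \<open>R i\<close>, whichever edges have been added.\<close>

lemma rainbow_completion: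
  fixes J :: "'i set" and S W :: "'i \<Rightarrow> nat set" and lay :: "nat \<Rightarrow> nat" and \<Gamma> :: "'i \<Rightarrow> (nat \<times> nat) set"
    and col :: "nat \<times> nat \<Rightarrow> 'c" and n T q m M a0 b0 \<beta> ls :: nat
  assumes J: "finite J" "n \<ge> 3" and S: "\<And>i. i \<in> J \<Longrightarrow> W i \<subseteq> S i" "\<And>i. i \<in> J \<Longrightarrow> S i \<subseteq> {..<n}"
    and E: "E \<subseteq> vpairs n"
    and cl: "\<And>i. i \<in> J \<Longrightarrow> closeable {..<n} (S i) (\<Gamma> i) T"
    and nbr: "\<And>i w v. i \<in> J \<Longrightarrow> w \<in> W i \<Longrightarrow> uedge w v \<in> \<Gamma> i \<Longrightarrow> v \<in> S i"
    and expand: "\<And>i X. i \<in> J \<Longrightarrow> X \<subseteq> S i \<Longrightarrow> X \<noteq> {} \<Longrightarrow> card X \<le> a0 \<Longrightarrow>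
       card {w \<in> W i. \<exists>x\<in>X. uedge x w \<in> \<Gamma> i} > 3 * card X"
    and q: "\<And>\<kappa>. card {e \<in> E. col e = \<kappa>} \<le> q"
    and m: "m > 0" "\<And>u w. lay u \<noteq> lay w \<Longrightarrow> card {i \<in> J. u \<in> S i \<and> w \<in> S i} \<le> m"
    and M: "\<And>i. i \<in> J \<Longrightarrow> card {e \<in> E. fst e \<in> S i \<and> snd e \<in> S i} \<le> M"
    and ls: "\<And>x. card {v. v < n \<and> lay v = x} \<le> ls" and b0: "2 * b0 \<le> (a0 + 1) * (a0 + 1 - ls)"
    and dense: "\<And>i A b. i \<in> J \<Longrightarrow> A \<subseteq> E \<Longrightarrow> card A \<le> T \<Longrightarrow> b \<le> T \<Longrightarrow> b0 \<le> card (boosters n lay (S i) (\<Gamma> i \<union> A) b) \<Longrightarrow>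
       \<beta> + T * q \<le> card (boosters n lay (S i) (\<Gamma> i \<union> A) b \<inter> E)"
    and num: "card J * (\<Sum>j\<le>T. real (M choose j) * ((1 / m) ^ j * (1 - 1 / m) ^ \<beta>)) < 1"
  shows "\<exists>A. (\<forall>i\<in>J. A i \<subseteq> E \<and> inj_on col (A i) \<and> closeable {..<n} (S i) (\<Gamma> i \<union> A i) 0) \<and>
    (\<forall>i\<in>J. \<forall>j\<in>J. i \<noteq> j \<longrightarrow> A i \<inter> A j = {})"
proof -
  define Es where "Es = (\<lambda>i. {e \<in> E. fst e \<in> S i \<and> snd e \<in> S i \<and> lay (fst e) \<noteq> lay (snd e)})"
  \<comment> \<open>The level is recomputed from the current graph. It is thus always least, even
    when an earlier booster lowered it by more than one, and \<open>many_boosters\<close> applies at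
    that level.\<close>
  define lev where "lev = (\<lambda>i A. LEAST b. closeable {..<n} (S i) (\<Gamma> i \<union> A) b)"
  define B where "B = (\<lambda>i A. {e \<in> boosters n lay (S i) (\<Gamma> i \<union> A) (lev i A - 1) \<inter> E. col e \<notin> col ` A})"
  have finE: "finite E" using E finite_vpairs by (rule finite_subset)
  have "\<exists>R. (\<forall>i\<in>J. R i \<subseteq> Es i) \<and> (\<forall>i\<in>J. \<forall>j\<in>J. i \<noteq> j \<longrightarrow> R i \<inter> R j = {}) \<and>
    (\<forall>i\<in>J. \<forall>A\<subseteq>R i. card A \<le> T \<and> B i A \<subseteq> Es i - A \<and> \<beta> \<le> card (B i A) \<longrightarrow> B i A \<inter> R i \<noteq> {})"
  proof (rule random_owner_partition[OF J(1) _ m(1) _ num])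
    fix i assume i: "i \<in> J"
    have "card (Es i) \<le> card {e \<in> E. fst e \<in> S i \<and> snd e \<in> S i}"
      unfolding Es_def using finE by (intro card_mono) auto
    then show "finite (Es i) \<and> card (Es i) \<le> M" using M[OF i] finE by (simp add: Es_def)
  next
    fix e
    show "card {i \<in> J. e \<in> Es i} \<le> m"
    proof (cases "lay (fst e) \<noteq> lay (snd e)")
      case True
      have "card {i \<in> J. e \<in> Es i} \<le> card {i \<in> J. fst e \<in> S i \<and> snd e \<in> S i}"
        using J(1) by (intro card_mono) (auto simp: Es_def)
      then show ?thesis using m(2)[OF True] by simp
    next
      case False
      then have "{i \<in> J. e \<in> Es i} = {}" by (auto simp: Es_def)
      then show ?thesis by (metis card.empty zero_le)
    qed
  qed
  then obtain R where R0: "(\<forall>i\<in>J. R i \<subseteq> Es i) \<and> (\<forall>i\<in>J. \<forall>j\<in>J. i \<noteq> j \<longrightarrow> R i \<inter> R j = {}) \<and>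
    (\<forall>i\<in>J. \<forall>A\<subseteq>R i. card A \<le> T \<and> B i A \<subseteq> Es i - A \<and> \<beta> \<le> card (B i A) \<longrightarrow> B i A \<inter> R i \<noteq> {})"
    by (elim exE)
  note R1 = conjunct1[OF R0] and R2 = conjunct1[OF conjunct2[OF R0]] and R3 = conjunct2[OF conjunct2[OF R0]]
  have Ra: "R i \<subseteq> Es i" if "i \<in> J" for i using R1 that by (rule bspec)
  have Rb: "R i \<inter> R j = {}" if "i \<in> J" "j \<in> J" "i \<noteq> j" for i j using R2[rule_format, OF that] .
  have Rc: "B i A \<inter> R i \<noteq> {}"
    if "i \<in> J" "A \<subseteq> R i" "card A \<le> T" "B i A \<subseteq> Es i - A" "\<beta> \<le> card (B i A)" for i A
    using R3[rule_format, OF that(1,2)] that(3-5) by (simp only: simp_thms)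
  note R = Ra Rb Rc
  have main: "\<exists>A\<subseteq>R i. card A \<le> t \<and> inj_on col A \<and> closeable {..<n} (S i) (\<Gamma> i \<union> A) (T - t)"
    if i: "i \<in> J" and t: "t \<le> T" for i t
    using t
  proof (induction t)
    case 0
    then show ?case using cl[OF i] by (intro exI[of _ "{}"]) auto
  next
    case (Suc t)
    then obtain A where A: "A \<subseteq> R i" "card A \<le> t" "inj_on col A" "closeable {..<n} (S i) (\<Gamma> i \<union> A) (T - t)" by auto
    have RE: "R i \<subseteq> E" "R i \<subseteq> Es i" using R(1)[OF i] by (auto simp: Es_def)
    have finA: "finite A" using A(1) RE(1) finE by (meson finite_subset)
    have mono: "closeable {..<n} (S i) G' b'" if "closeable {..<n} (S i) G' b" "b \<le> b'" for G' b b'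
      using that unfolding closeable_def by (meson le_trans)
    define b where "b = lev i A"
    have b: "closeable {..<n} (S i) (\<Gamma> i \<union> A) b" unfolding b_def lev_def using A(4) by (rule LeastI)
    have bT: "b \<le> T - t" unfolding b_def lev_def using A(4) by (rule Least_le)
    show ?case
    proof (cases "b = 0")
      case True
      then have "closeable {..<n} (S i) (\<Gamma> i \<union> A) (T - Suc t)" using mono[OF b] by simp
      then show ?thesis using A by (intro exI[of _ A]) auto
    next
      case False
      then have nb: "\<not> closeable {..<n} (S i) (\<Gamma> i \<union> A) (b - 1)"
        unfolding b_def lev_def by (intro not_less_Least) auto
      have "(a0 + 1) * (a0 + 1 - ls) \<le> 2 * card (boosters n lay (S i) (\<Gamma> i \<union> A) (b - 1))"
      proof (rule many_boosters[OF J(2) S[OF i] b nb _ _ ls])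
        show "v \<in> S i" if w: "w \<in> W i" "uedge w v \<in> \<Gamma> i \<union> A" for w v
        proof (cases "uedge w v \<in> \<Gamma> i")
          case True then show ?thesis using nbr[OF i] w by blast
        next
          case False
          then have "uedge w v \<in> Es i" using w A(1) RE by blast
          then have "uedge w v \<in> S i \<times> S i" by (auto simp: Es_def mem_Times_iff)
          then show ?thesis by (simp only: uedge_mem_Times)
        qed
        show "card {w \<in> W i. \<exists>x\<in>X. uedge x w \<in> \<Gamma> i \<union> A} > 3 * card X"
          if X: "X \<subseteq> S i" "X \<noteq> {}" "card X \<le> a0" for X
        proof -
          have "finite (W i)" using S[OF i] by (meson finite_lessThan finite_subset)
          then have "card {w \<in> W i. \<exists>x\<in>X. uedge x w \<in> \<Gamma> i} \<le> card {w \<in> W i. \<exists>x\<in>X. uedge x w \<in> \<Gamma> i \<union> A}"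
            by (intro card_mono) auto
          then show ?thesis using expand[OF i X] by linarith
        qed
      qed
      then have "b0 \<le> card (boosters n lay (S i) (\<Gamma> i \<union> A) (b - 1))" using b0 by linarith
      then have dn: "\<beta> + T * q \<le> card (boosters n lay (S i) (\<Gamma> i \<union> A) (b - 1) \<inter> E)"
        using A RE Suc.prems bT by (intro dense[OF i]) auto
      have "boosters n lay (S i) (\<Gamma> i \<union> A) (b - 1) \<inter> E \<subseteq> B i A \<union> (\<Union>\<kappa>\<in>col ` A. {e \<in> E. col e = \<kappa>})"
        unfolding B_def b_def by auto
      then have "card (boosters n lay (S i) (\<Gamma> i \<union> A) (b - 1) \<inter> E) \<le> card (B i A \<union> (\<Union>\<kappa>\<in>col ` A. {e \<in> E. col e = \<kappa>}))"
        using finE finA by (intro card_mono) (auto simp: B_def)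
      also have "\<dots> \<le> card (B i A) + card (\<Union>\<kappa>\<in>col ` A. {e \<in> E. col e = \<kappa>})" by (rule card_Un_le)
      also have "card (\<Union>\<kappa>\<in>col ` A. {e \<in> E. col e = \<kappa>}) \<le> (\<Sum>\<kappa>\<in>col ` A. card {e \<in> E. col e = \<kappa>})"
        using finA by (intro card_UN_le) auto
      also have "\<dots> \<le> (\<Sum>\<kappa>\<in>col ` A. q)" using q by (intro sum_mono) auto
      also have "\<dots> \<le> T * q" using card_image_le[OF finA, of col] A(2) Suc.prems by simp
      finally have "\<beta> \<le> card (B i A)" using dn by linarith
      moreover have "B i A \<subseteq> Es i - A" by (auto simp: B_def Es_def boosters_def)
      ultimately have "B i A \<inter> R i \<noteq> {}" using A Suc.prems by (intro R(3)[OF i]) auto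
      then obtain e where e: "e \<in> B i A" "e \<in> R i" by blast
      have "closeable {..<n} (S i) (\<Gamma> i \<union> insert e A) (b - 1)"
        using e(1) unfolding B_def b_def boosters_def by simp
      then have "closeable {..<n} (S i) (\<Gamma> i \<union> insert e A) (T - Suc t)" by (rule mono) (use bT in simp)
      moreover have "inj_on col (insert e A)" using A(3) e(1) by (auto simp: B_def)
      moreover have "card (insert e A) \<le> Suc t" using A(2) finA by (simp add: card_insert_if)
      ultimately show ?thesis using A e by (intro exI[of _ "insert e A"]) auto
    qed
  qed
  have "\<forall>i\<in>J. \<exists>A. A \<subseteq> R i \<and> inj_on col A \<and> closeable {..<n} (S i) (\<Gamma> i \<union> A) 0"
  proof
    fix i assume "i \<in> J"
    from main[OF this order_refl] show "\<exists>A. A \<subseteq> R i \<and> inj_on col A \<and> closeable {..<n} (S i) (\<Gamma> i \<union> A) 0"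
      by auto
  qed
  from bchoice[OF this] obtain A where A: "\<forall>i\<in>J. A i \<subseteq> R i \<and> inj_on col (A i) \<and> closeable {..<n} (S i) (\<Gamma> i \<union> A i) 0"
    by (elim exE)
  have "A i \<inter> A j = {}" if "i \<in> J" "j \<in> J" "i \<noteq> j" for i j
    using A R(2)[OF that] that by blast
  moreover have "A i \<subseteq> E" if "i \<in> J" for i using A R(1)[OF that] that by (auto simp: Es_def)
  ultimately show ?thesis using A by (intro exI[of _ A]) blast
qed

section \<open>Sizes in a template and the deterministic packing statement\<close>

context templates
begin

text \<open>A choice that depends on the edge set alone, so that resampling colours leaves all
  forests as they are.\<close>

definition fcol :: "(nat \<times> nat) set \<Rightarrow> nat \<times> nat \<Rightarrow> (nat \<Rightarrow> nat) \<times> nat" where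
  "fcol E = (SOME f. forest_colouring E f)"

text \<open>Among edges of equal colour in a forest all but the first in the order of
  \<open>prod_encode\<close> are marked. Their deletion makes the forest rainbow, and the order
  allows the colours to be exposed one after another.\<close>

definition repeats :: "(nat \<times> nat) set \<Rightarrow> (nat \<times> nat \<Rightarrow> nat option) \<Rightarrow> (nat \<times> nat) set" where
  "repeats E G = {e \<in> E. lay (fst e) \<noteq> lay (snd e) \<and>
     (\<exists>e'\<in>forest E (fcol E) (fcol E e). prod_encode e' < prod_encode e \<and> G e' = G e)}"

lemma card_core_positions: "card {a. a < Q \<and> a mod L \<in> {0, 1, L - 1}} \<le> 3 * R"
proof -
  have "{a. a < Q \<and> a mod L \<in> {0, 1, L - 1}} \<subseteq> (\<lambda>(d, r). d * L + r) ` ({..<R} \<times> {0, 1, L - 1})"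
  proof
    fix a assume a: "a \<in> {a. a < Q \<and> a mod L \<in> {0, 1, L - 1}}"
    then have "a div L < R" by (simp add: Q_def less_mult_imp_div_less mult.commute)
    then show "a \<in> (\<lambda>(d, r). d * L + r) ` ({..<R} \<times> {0, 1, L - 1})"
      using a by (intro image_eqI[where x = "(a div L, a mod L)"]) auto
  qed
  then have "card {a. a < Q \<and> a mod L \<in> {0, 1, L - 1}} \<le> card ({..<R} \<times> {0, 1, L - 1})"
    by (intro surj_card_le) auto
  also have "\<dots> \<le> R * 3" unfolding card_cartesian_product by (intro mult_mono) (auto simp: card_insert_if)
  finally show ?thesis by simp
qed

text \<open>Each of the R blocks holds L - 2 consecutive pairs in two orders, and 2 (L - 2) \<ge> L.
  This bounds the number of forests from above in terms of \<open>\<mu>\<close>.\<close>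

lemma card_A0_ge:
  assumes "L \<ge> 4"
  shows "Q \<le> card A0"
proof -
  let ?f = "\<lambda>(d, r, b). if b then (d * L + r, Suc (d * L + r)) else (Suc (d * L + r), d * L + r)"
  let ?X = "{..<R} \<times> {1..L - 2} \<times> (UNIV :: bool set)"
  have dec: "(d * L + r) div L = d" "(d * L + r) mod L = r" if "r < L" for d r using that by auto
  have "inj_on ?f ?X"
  proof (rule inj_onI)
    fix z z' assume z: "z \<in> ?X" "z' \<in> ?X" "?f z = ?f z'"
    obtain d r b d' r' b' where zz: "z = (d, r, b)" "z' = (d', r', b')" by (metis surj_pair)
    have r: "r < L" "r' < L" using z zz assms by auto
    have "d * L + r = d' * L + r' \<and> b = b'" using z(3) unfolding zz by (cases b; cases b') auto
    then show "z = z'" using dec[OF r(1), of d] dec[OF r(2), of d'] zz by simp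
  qed
  moreover have "?f ` ?X \<subseteq> A0"
  proof
    fix y assume "y \<in> ?f ` ?X"
    then obtain d r b where z: "d < R" "1 \<le> r" "r \<le> L - 2" "y = ?f (d, r, b)" by auto
    have r: "r < L" "Suc r < L" using z assms by linarith+
    have m: "(d * L + r) mod L = r" "Suc (d * L + r) mod L = Suc r"
      using dec(2)[OF r(1), of d] dec(2)[OF r(2), of d] by simp_all
    have "d * L + L \<le> R * L" using z(1) by (metis Suc_leI add.commute mult_Suc mult_le_mono1)
    then have "Suc (d * L + r) < Q" using r by (simp add: Q_def mult.commute)
    moreover have "\<not> L dvd d * L + r" "\<not> L dvd Suc (d * L + r)" using m z(2) by (simp_all add: dvd_eq_mod_eq_0)
    ultimately show "y \<in> A0" using z(4) by (auto simp: A0_def)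
  qed
  moreover have "finite A0" by (rule finite_subset[of _ "{..<Q} \<times> {..<Q}"]) (auto simp: A0_def)
  ultimately have "card ?X \<le> card A0" by (rule card_inj_on_le)
  moreover have "card ?X = R * ((L - 2) * 2)" by (simp add: card_cartesian_product)
  moreover have "R * L \<le> R * ((L - 2) * 2)" using assms by (intro mult_le_mono) auto
  moreover have "Q = R * L" by (simp add: Q_def)
  ultimately show ?thesis by (metis order_trans)
qed

text \<open>The origin of the 1/2 in np/2: with at most Q - 1 adjacencies per template,
  \<open>\<mu>\<close> is at most 2 Q! / Q, so there are Q! h \<ge> \<open>\<mu> * h\<close> Q / 2
  forests, half of the total degree budget of a vertex.\<close>

lemma card_A0_le: "card A0 \<le> 2 * (Q - 1)"
proof -
  have "A0 \<subseteq> (\<lambda>(a, b). if b then (a, Suc a) else (Suc a, a)) ` ({..<Q - 1} \<times> (UNIV :: bool set))"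
  proof
    fix z assume "z \<in> A0"
    then obtain a where "Suc a < Q" "z = (a, Suc a) \<or> z = (Suc a, a)" by (auto simp: A0_def)
    then show "z \<in> (\<lambda>(a, b). if b then (a, Suc a) else (Suc a, a)) ` ({..<Q - 1} \<times> (UNIV :: bool set))"
      by (auto intro: image_eqI[where x = "(a, True)"] image_eqI[where x = "(a, False)"])
  qed
  then have "card A0 \<le> card ({..<Q - 1} \<times> (UNIV :: bool set))" by (intro surj_card_le) auto
  then show ?thesis by (simp add: card_cartesian_product)
qed

lemma card_core:
  assumes i: "i \<in> idx" and ls: "\<And>x. card {v. v < n \<and> lay v = x} \<le> ls"
  shows "card (core i) \<le> 3 * R * ls"
proof -
  have perm: "fst i permutes {..<Q}" using i by (auto simp: idx_def perms_def)
  let ?P = "{a. a < Q \<and> a mod L \<in> {0, 1, L - 1}}"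
  have "core i \<subseteq> (\<Union>a\<in>?P. {v. v < n \<and> lay v = inv (fst i) a})"
  proof
    fix u assume u: "u \<in> core i"
    have "fst i (lay u) \<in> ?P" using u permutes_in_image[OF perm, of "lay u"] lay_less[of u] by (auto simp: core_def)
    moreover have "u \<in> {v. v < n \<and> lay v = inv (fst i) (fst i (lay u))}"
      using u permutes_inverses[OF perm] by (auto simp: core_def)
    ultimately show "u \<in> (\<Union>a\<in>?P. {v. v < n \<and> lay v = inv (fst i) a})" by (rule UN_I)
  qed
  then have "card (core i) \<le> card (\<Union>a\<in>?P. {v. v < n \<and> lay v = inv (fst i) a})"
    by (intro card_mono) auto
  also have "\<dots> \<le> (\<Sum>a\<in>?P. card {v. v < n \<and> lay v = inv (fst i) a})" by (intro card_UN_le) auto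
  also have "\<dots> \<le> (\<Sum>a\<in>?P. ls)" using ls by (intro sum_mono) auto
  also have "\<dots> = card ?P * ls" by simp
  also have "\<dots> \<le> 3 * R * ls" using card_core_positions by (intro mult_right_mono) auto
  finally show ?thesis .
qed

lemma card_pivot_layers:
  assumes i: "i \<in> idx"
  shows "R - 1 \<le> card {x. x < Q \<and> x \<noteq> y \<and> L dvd fst i x}"
proof -
  have perm: "fst i permutes {..<Q}" using i by (auto simp: idx_def perms_def)
  let ?f = "\<lambda>d. inv (fst i) (d * L)"
  have inj: "inj_on ?f {..<R}"
  proof (rule inj_onI)
    fix d d' assume "?f d = ?f d'"
    then have "d * L = d' * L" using permutes_inj[OF permutes_inv[OF perm]] by (meson injD)
    then show "d = d'" using L by simp
  qed
  have dL: "d * L < Q" if "d < R" for d using that L by (simp add: Q_def mult.commute)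
  have "?f ` {..<R} \<subseteq> insert y {x. x < Q \<and> x \<noteq> y \<and> L dvd fst i x}"
    using permutes_in_image[OF permutes_inv[OF perm]] dL permutes_inverses[OF perm] by auto
  then have "card (?f ` {..<R}) \<le> card (insert y {x. x < Q \<and> x \<noteq> y \<and> L dvd fst i x})"
    by (intro card_mono) auto
  also have "\<dots> \<le> Suc (card {x. x < Q \<and> x \<noteq> y \<and> L dvd fst i x})" by (simp add: card_insert_if)
  finally show ?thesis using card_image[OF inj] by simp
qed

text \<open>By \<open>card_permutes_pair\<close> two different layers both land on the at most 3 R
  core positions in a share of at most (3 R)^2 / (Q (Q - 1)), about 9 / L^2, of the templates. This
  rate fixes the number \<open>m\<close> of forests that compete for an edge.\<close>

lemma card_core_pairs:
  assumes "lay u \<noteq> lay w"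
  shows "real (card {i \<in> idx. u \<in> core i \<and> w \<in> core i}) * (Q * (Q - 1)) \<le> h * ((3 * R)\<^sup>2 * fact Q)"
proof -
  let ?P = "{a. a < Q \<and> a mod L \<in> {0, 1, L - 1}}"
  let ?A = "{(a, b). a \<in> ?P \<and> b \<in> ?P \<and> a \<noteq> b}"
  let ?C = "{\<sigma>. \<sigma> permutes {..<Q} \<and> (\<sigma> (lay u), \<sigma> (lay w)) \<in> ?A}"
  have finP: "finite ?P" by simp
  have finC: "finite ?C" by (rule finite_subset[OF _ finite_perms]) (auto simp: perms_def)
  have "{i \<in> idx. u \<in> core i \<and> w \<in> core i} \<subseteq> ?C \<times> {..<h}"
  proof
    fix i assume i: "i \<in> {i \<in> idx. u \<in> core i \<and> w \<in> core i}"
    then have perm: "fst i permutes {..<Q}" and "snd i < h" by (auto simp: idx_def perms_def)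
    have "fst i (lay u) < Q" "fst i (lay w) < Q" using permutes_in_image[OF perm] lay_less by auto
    moreover have "fst i (lay u) \<noteq> fst i (lay w)" using assms permutes_inj[OF perm] by (auto dest: injD)
    ultimately show "i \<in> ?C \<times> {..<h}" using i perm \<open>snd i < h\<close> by (cases i) (auto simp: core_def)
  qed
  then have "card {i \<in> idx. u \<in> core i \<and> w \<in> core i} \<le> card (?C \<times> {..<h})"
    using finC by (intro card_mono) auto
  then have "card {i \<in> idx. u \<in> core i \<and> w \<in> core i} * (Q * (Q - 1)) \<le> h * (card ?C * (Q * (Q - 1)))"
    by (simp add: card_cartesian_product mult.commute mult.left_commute)
  also have "card ?C * (Q * (Q - 1)) = card ?A * fact Q"
    by (rule card_permutes_pair) (use lay_less assms in auto)
  also have "card ?A \<le> (3 * R)\<^sup>2"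
  proof -
    have "card ?A \<le> card (?P \<times> ?P)" by (intro card_mono) auto
    also have "\<dots> \<le> (3 * R) * (3 * R)" unfolding card_cartesian_product
      using card_core_positions by (intro mult_mono) auto
    finally show ?thesis by (simp add: power2_eq_square)
  qed
  finally have "card {i \<in> idx. u \<in> core i \<and> w \<in> core i} * (Q * (Q - 1)) \<le> h * ((3 * R)\<^sup>2 * fact Q)"
    by (simp add: mult_left_mono mult_right_mono)
  then have "real (card {i \<in> idx. u \<in> core i \<and> w \<in> core i} * (Q * (Q - 1))) \<le> real (h * ((3 * R)\<^sup>2 * fact Q))"
    by (rule of_nat_mono)
  then show ?thesis by (simp only: of_nat_mult of_nat_power of_nat_fact) 
qed

lemma card_idx: "card idx = fact Q * h"
  unfolding idx_def perms_def by (simp add: card_cartesian_product card_permutations)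

text \<open>All randomness is replaced by properties of one graph: degrees between layers, few
  repeated colours, sparseness in the second palette, density in the third. Every surviving forest
  is extended by expander edges and then by boosters. Within each part colours are distinct, and the
  three parts use disjoint palettes.\<close>

lemma packing:
  fixes G :: "nat \<times> nat \<Rightarrow> nat option" and c1 c2 k q T m M a0 b0 \<beta> ls N :: nat
    and g dl \<theta>0 \<theta>1 d2 D :: real and lam :: "nat \<Rightarrow> real"
  defines "E1 \<equiv> edges_in {..<c1} (vpairs n) G"
    and "E2 \<equiv> edges_in {c1..<c1 + c2} (vpairs n) G"
    and "E3 \<equiv> edges_in {c1 + c2..<c1 + 2 * c2} (vpairs n) G"
  assumes n: "n \<ge> 3" and R2: "R \<ge> 2"
    and ls: "\<And>x. card {v. v < n \<and> lay v = x} \<le> ls"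
    and deg1: "\<And>u y. u < n \<Longrightarrow> y < Q \<Longrightarrow> y \<noteq> lay u \<Longrightarrow> card {v. v < n \<and> lay v = y \<and> uedge u v \<in> E1} \<le> \<mu> * h"
      "\<And>u y. u < n \<Longrightarrow> y < Q \<Longrightarrow> y \<noteq> lay u \<Longrightarrow> real (\<mu> * h) - g \<le> card {v. v < n \<and> lay v = y \<and> uedge u v \<in> E1}"
    and g: "g \<ge> 0"
    and deg2: "\<And>u y. u < n \<Longrightarrow> y < Q \<Longrightarrow> y \<noteq> lay u \<Longrightarrow> d2 \<le> card {v. v < n \<and> lay v = y \<and> uedge u v \<in> E2}"
    and D: "0 < D" "D \<le> (R - 1) * d2" "d2 \<ge> 0"
    and q: "\<And>\<kappa>. card {e \<in> vpairs n. G e = Some \<kappa>} \<le> q"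
    and rep: "\<And>u. u < n \<Longrightarrow> card {e \<in> repeats E1 G. fst e = u \<or> snd e = u} \<le> dl"
      "\<And>i. i \<in> idx \<Longrightarrow> card (repeats E1 G \<inter> forest E1 (fcol E1) i) \<le> \<theta>1"
    and sparse: "\<And>X Y a. X \<subseteq> {..<n} \<Longrightarrow> Y \<subseteq> {..<n} \<Longrightarrow> card X = a \<Longrightarrow> card Y = 3 * a \<Longrightarrow> 1 \<le> a \<Longrightarrow> a \<le> a0 \<Longrightarrow>
       (\<Sum>u\<in>X. card {w \<in> Y. uedge u w \<in> E2}) < k * a \<or>
       real (\<Sum>u\<in>X. card {w \<in> Y. uedge u w \<in> E2}) \<le> lam a * a * D"
    and dense: "\<And>\<Gamma> S b. \<Gamma> \<subseteq> vpairs n \<Longrightarrow> (\<forall>e\<in>\<Gamma>. G e \<noteq> None) \<Longrightarrow> card \<Gamma> \<le> 2 * n \<Longrightarrow> S \<subseteq> {..<n} \<Longrightarrow> b \<le> T \<Longrightarrow>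
       b0 \<le> card (boosters n lay S \<Gamma> b) \<Longrightarrow> \<beta> + T * q \<le> card (boosters n lay S \<Gamma> b \<inter> E3)"
    and T: "3 * R * ls + \<theta>0 + 2 * \<theta>1 \<le> T" "k * T + T \<le> n"
    and m: "h * ((3 * R)\<^sup>2 * fact Q) / (Q * (Q - 1)) + 2 * (Q * g + dl) \<le> m" "m > 0"
    and few: "real (2 * k * m + 2 * k * q) \<le> D / 4"
    and num1: "card idx * (\<Sum>a\<in>{1..a0}. real (n choose a) * real (n choose (3 * a)) * (2 * lam a) ^ (k * a)) < 1"
    and a0: "3 * a0 \<le> n" "2 * b0 \<le> (a0 + 1) * (a0 + 1 - ls)" and k: "k > 0" and lam: "\<And>a. lam a \<ge> 0"
    and M: "\<And>u. u < n \<Longrightarrow> T * card {e \<in> E3. fst e = u \<or> snd e = u} \<le> M"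
    and num2: "card idx * (\<Sum>j\<le>T. real (M choose j) * ((1 / m) ^ j * (1 - 1 / m) ^ \<beta>)) < 1"
    and N: "real N \<le> fact Q * h - n * (Q * g) / \<theta>0" "\<theta>0 > 0"
  shows "has_disjoint_rainbow_HCs n G N"
proof -
  define f where "f = fcol E1"
  define X where "X = repeats E1 G"
  \<comment> \<open>Lacking vertices are counted before the deletion of repeated colours. Their
    number is controlled only on average over the forests, so the bad forests are dropped; the
    deletions are bounded in every forest, and each deleted edge adds at most its two ends.\<close>
  define J where "J = {i \<in> idx. card (lacking (forest E1 f i) i) \<le> \<theta>0}"
  define F where "F = (\<lambda>i. forest E1 f i - X)"
  define S where "S = (\<lambda>i. special (F i) i)"
  define col where "col = (\<lambda>e. the (G e))"
  have sub: "E1 \<subseteq> vpairs n" "E2 \<subseteq> vpairs n" "E3 \<subseteq> vpairs n" by (auto simp: E1_def E2_def E3_def edges_in_def)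
  have fc: "forest_colouring E1 f"
    unfolding f_def fcol_def using forest_colouring_exists[OF deg1(1)] by (rule someI_ex)
  have J_sub: "J \<subseteq> idx" by (auto simp: J_def)
  have finJ: "finite J" using J_sub finite_idx by (rule finite_subset)
  have lackn: "lacking A i \<subseteq> {..<n}" for A i by (auto simp: lacking_def)
  have Sn: "S i \<subseteq> {..<n}" for i by (auto simp: S_def special_def core_def lacking_def)
  have piv: "pivots i \<subseteq> S i" for i by (auto simp: S_def special_def core_def pivots_def)
  have F_sub: "F i \<subseteq> forest E1 f i" for i by (auto simp: F_def)
  have cJ: "N \<le> card J"
  proof -
    have "real (card (idx - J)) * \<theta>0 \<le> (\<Sum>i\<in>idx - J. real (card (lacking (forest E1 f i) i)))"
    proof (rule sum_bounded_below)
      fix i assume "i \<in> idx - J"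
      then show "\<theta>0 \<le> real (card (lacking (forest E1 f i) i))" unfolding J_def by auto
    qed
    also have "\<dots> \<le> (\<Sum>i\<in>idx. real (card (lacking (forest E1 f i) i)))"
      using finite_idx by (intro sum_mono2) auto
    also have "\<dots> = (\<Sum>i\<in>idx. \<Sum>u<n. of_bool (u \<in> lacking (forest E1 f i) i))"
    proof (intro sum.cong refl)
      fix i
      have "{..<n} \<inter> {u. u \<in> lacking (forest E1 f i) i} = lacking (forest E1 f i) i" using lackn by blast
      then show "real (card (lacking (forest E1 f i) i)) = (\<Sum>u<n. of_bool (u \<in> lacking (forest E1 f i) i))"
        by (simp add: sum_of_bool_eq)
    qed
    also have "\<dots> = (\<Sum>u<n. \<Sum>i\<in>idx. of_bool (u \<in> lacking (forest E1 f i) i))" by (rule sum.swap)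
    also have "\<dots> = (\<Sum>u<n. real (card {i \<in> idx. u \<in> lacking (forest E1 f i) i}))"
      using finite_idx by (intro sum.cong refl) (simp add: sum_of_bool_eq Int_def)
    also have "\<dots> \<le> (\<Sum>u<n. Q * g)"
    proof (rule sum_mono)
      fix u assume "u \<in> {..<n}"
      then show "real (card {i \<in> idx. u \<in> lacking (forest E1 f i) i}) \<le> Q * g"
        using card_lacking_le[OF sub(1) fc _ deg1(2) g, of u "{}"] by simp
    qed
    also have "\<dots> = n * (Q * g)" by simp
    finally have "real (card (idx - J)) \<le> n * (Q * g) / \<theta>0" using N(2) by (simp add: field_simps)
    moreover have "real (card J) = real (card idx) - real (card (idx - J))"
      using J_sub finite_idx finJ card_mono[OF finite_idx J_sub] by (simp add: card_Diff_subset of_nat_diff)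
    ultimately have "real N \<le> real (card J)" using N(1) by (simp add: card_idx)
    then show ?thesis by simp
  qed
  have lack_u: "card {i \<in> idx. u \<in> lacking (F i) i} \<le> Q * g + dl" if u: "u < n" for u
  proof -
    have "{e \<in> X. e \<in> E1 \<and> (fst e = u \<or> snd e = u)} = {e \<in> repeats E1 G. fst e = u \<or> snd e = u}"
      by (auto simp: X_def repeats_def)
    then show ?thesis
      using card_lacking_le[OF sub(1) fc u deg1(2)[OF u] g, of X] rep(1)[OF u] unfolding F_def by simp
  qed
  have cS: "card (S i) \<le> T" if i: "i \<in> J" for i
  proof -
    have ii: "i \<in> idx" using i J_sub by blast
    have finX: "finite (X \<inter> forest E1 f i)"
      by (rule finite_subset[OF _ finite_vpairs[of n]]) (use sub in \<open>auto simp: forest_def\<close>)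
    have "lacking (F i) i \<subseteq> lacking (forest E1 f i) i \<union> (fst ` (X \<inter> forest E1 f i) \<union> snd ` (X \<inter> forest E1 f i))"
    proof
      fix u assume "u \<in> lacking (F i) i"
      then obtain y where y: "u < n" "y < Q" "y \<noteq> lay u" "fst i \<in> Tm (lay u) y"
        "\<not> (\<exists>v<n. lay v = y \<and> uedge u v \<in> F i)" by (auto simp: lacking_def)
      show "u \<in> lacking (forest E1 f i) i \<union> (fst ` (X \<inter> forest E1 f i) \<union> snd ` (X \<inter> forest E1 f i))"
      proof (cases "\<exists>v<n. lay v = y \<and> uedge u v \<in> forest E1 f i")
        case True
        then obtain v where v: "uedge u v \<in> X \<inter> forest E1 f i" using y(5) by (auto simp: F_def)
        have "u = fst (uedge u v) \<or> u = snd (uedge u v)" by (auto simp: uedge_def min_def max_def)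
        then show ?thesis using v by blast
      next
        case False
        then show ?thesis using y by (auto simp: lacking_def)
      qed
    qed
    then have "card (lacking (F i) i) \<le> card (lacking (forest E1 f i) i \<union> (fst ` (X \<inter> forest E1 f i) \<union> snd ` (X \<inter> forest E1 f i)))"
      using finX finite_subset[OF lackn] by (intro card_mono) auto
    also have "\<dots> \<le> card (lacking (forest E1 f i) i) + (card (fst ` (X \<inter> forest E1 f i)) + card (snd ` (X \<inter> forest E1 f i)))"
      by (intro order_trans[OF card_Un_le] add_mono order_refl card_Un_le)
    also have "\<dots> \<le> card (lacking (forest E1 f i) i) + (card (X \<inter> forest E1 f i) + card (X \<inter> forest E1 f i))"
      using finX by (intro add_mono order_refl card_image_le)
    finally have "real (card (lacking (F i) i)) \<le> \<theta>0 + 2 * \<theta>1"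
      using rep(2)[OF ii] i unfolding J_def X_def f_def by simp
    moreover have "card (S i) \<le> card (core i) + card (lacking (F i) i)"
      unfolding S_def special_def by (rule card_Un_le)
    ultimately have "real (card (S i)) \<le> 3 * R * ls + \<theta>0 + 2 * \<theta>1"
      using card_core[OF ii ls] by linarith
    then show ?thesis using T(1) by linarith
  qed
  \<comment> \<open>Two vertices special for the same forest are both in its core, or one of them is
    lacking. The second case is charged to that vertex alone.\<close>
  have own: "card {i \<in> J. u \<in> S i \<and> w \<in> S i} \<le> m" if uw: "lay u \<noteq> lay w" for u w
  proof (cases "u < n \<and> w < n")
    case True
    have "{i \<in> J. u \<in> S i \<and> w \<in> S i} \<subseteq> {i \<in> idx. u \<in> core i \<and> w \<in> core i} \<union>
       ({i \<in> idx. u \<in> lacking (F i) i} \<union> {i \<in> idx. w \<in> lacking (F i) i})"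
      using J_sub by (auto simp: S_def special_def)
    then have "card {i \<in> J. u \<in> S i \<and> w \<in> S i} \<le> card ({i \<in> idx. u \<in> core i \<and> w \<in> core i} \<union>
       ({i \<in> idx. u \<in> lacking (F i) i} \<union> {i \<in> idx. w \<in> lacking (F i) i}))"
      using finite_idx by (intro card_mono) auto
    also have "\<dots> \<le> card {i \<in> idx. u \<in> core i \<and> w \<in> core i} +
       (card {i \<in> idx. u \<in> lacking (F i) i} + card {i \<in> idx. w \<in> lacking (F i) i})"
      by (intro order_trans[OF card_Un_le] add_mono order_refl card_Un_le)
    finally have "real (card {i \<in> J. u \<in> S i \<and> w \<in> S i}) \<le> real (card {i \<in> idx. u \<in> core i \<and> w \<in> core i} +
       (card {i \<in> idx. u \<in> lacking (F i) i} + card {i \<in> idx. w \<in> lacking (F i) i}))"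
      by (rule of_nat_mono)
    also have "\<dots> \<le> real (card {i \<in> idx. u \<in> core i \<and> w \<in> core i}) + ((Q * g + dl) + (Q * g + dl))"
      unfolding of_nat_add using True by (intro add_mono order_refl lack_u) auto
    finally have "real (card {i \<in> J. u \<in> S i \<and> w \<in> S i}) \<le> card {i \<in> idx. u \<in> core i \<and> w \<in> core i} + 2 * (Q * g + dl)"
      by (simp only: mult_2 ac_simps)
    moreover have "real (card {i \<in> idx. u \<in> core i \<and> w \<in> core i}) \<le> h * ((3 * R)\<^sup>2 * fact Q) / (Q * (Q - 1))"
    proof -
      have "0 < Q * (Q - 1)" using Q by simp
      then have "0 < real (Q * (Q - 1))" by (simp only: of_nat_0_less_iff)
      then show ?thesis using card_core_pairs[OF uw] by (simp only: pos_le_divide_eq)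
    qed
    ultimately have "real (card {i \<in> J. u \<in> S i \<and> w \<in> S i}) \<le> h * ((3 * R)\<^sup>2 * fact Q) / (Q * (Q - 1)) + 2 * (Q * g + dl)"
      by (meson add_right_mono order_trans)
    from order_trans[OF this m(1)] show ?thesis by (simp only: of_nat_le_iff)
  next
    case False
    then have "{i \<in> J. u \<in> S i \<and> w \<in> S i} = {}" using Sn by auto
    then show ?thesis by (metis card.empty zero_le)
  qed
  have q2: "card {e \<in> E. col e = \<kappa>} \<le> q" if "E = E2 \<or> E = E3" for E \<kappa>
  proof -
    have "{e \<in> E. col e = \<kappa>} \<subseteq> {e \<in> vpairs n. G e = Some \<kappa>}"
      using that by (auto simp: E2_def E3_def edges_in_def col_def)
    then have "card {e \<in> E. col e = \<kappa>} \<le> card {e \<in> vpairs n. G e = Some \<kappa>}" by (intro card_mono) auto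
    then show ?thesis using q[of \<kappa>] by simp
  qed
  have cJ_idx: "real (card J) \<le> real (card idx)" using card_mono[OF finite_idx J_sub] by simp
  have "\<exists>H. (\<forall>i\<in>J. H i \<subseteq> E2 \<and> H i \<subseteq> {uedge u w |u w. u \<in> S i \<and> w \<in> pivots i} \<and> inj_on col (H i) \<and>
       card (H i) \<le> k * card (S i) \<and>
       (\<forall>X\<subseteq>S i. X \<noteq> {} \<and> card X \<le> a0 \<longrightarrow> card {w \<in> pivots i. \<exists>x\<in>X. uedge x w \<in> H i} > 3 * card X)) \<and>
     (\<forall>i\<in>J. \<forall>j\<in>J. i \<noteq> j \<longrightarrow> H i \<inter> H j = {})"
  proof (rule rainbow_expanders[OF finJ _ _ sub(2) D(1) _ own q2[of E2] few sparse _ a0(1) k lam])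
    show "D \<le> card {w \<in> pivots i. lay w \<noteq> lay u \<and> uedge u w \<in> E2}" if i: "i \<in> J" and u: "u \<in> S i" for i u
    proof -
      have un: "u < n" using u Sn by blast
      have ii: "i \<in> idx" using i J_sub by blast
      let ?Y = "{x. x < Q \<and> x \<noteq> lay u \<and> L dvd fst i x}"
      let ?N = "\<lambda>y. {v. v < n \<and> lay v = y \<and> uedge u v \<in> E2}"
      have "real (R - 1) * d2 \<le> card ?Y * d2"
        using card_pivot_layers[OF ii, of "lay u"] D(3) by (intro mult_right_mono) auto
      also have "\<dots> = (\<Sum>y\<in>?Y. d2)" by simp
      also have "\<dots> \<le> (\<Sum>y\<in>?Y. real (card (?N y)))" using deg2[OF un] by (intro sum_mono) auto
      also have "\<dots> = real (\<Sum>y\<in>?Y. card (?N y))" by simp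
      also have "(\<Sum>y\<in>?Y. card (?N y)) = card (\<Union>y\<in>?Y. ?N y)"
        by (rule card_UN_disjoint[symmetric]) auto
      also have "\<dots> \<le> card {w \<in> pivots i. lay w \<noteq> lay u \<and> uedge u w \<in> E2}"
        by (intro card_mono) (auto simp: pivots_def)
      finally have "real (R - 1) * d2 \<le> card {w \<in> pivots i. lay w \<noteq> lay u \<and> uedge u w \<in> E2}" by simp
      then show ?thesis using D(2) R2 by (simp add: of_nat_diff)
    qed
    have S0: "0 \<le> (\<Sum>a\<in>{1..a0}. real (n choose a) * real (n choose (3 * a)) * (2 * lam a) ^ (k * a))"
      using lam by (intro sum_nonneg) auto
    show "card J * (\<Sum>a\<in>{1..a0}. real (n choose a) * real (n choose (3 * a)) * (2 * lam a) ^ (k * a)) < 1"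
      using mult_right_mono[OF cJ_idx S0] num1 by linarith
  qed (use Sn piv in auto)
  then obtain H where H: "\<forall>i\<in>J. H i \<subseteq> E2 \<and> H i \<subseteq> {uedge u w |u w. u \<in> S i \<and> w \<in> pivots i} \<and> inj_on col (H i) \<and>
       card (H i) \<le> k * card (S i) \<and>
       (\<forall>X\<subseteq>S i. X \<noteq> {} \<and> card X \<le> a0 \<longrightarrow> card {w \<in> pivots i. \<exists>x\<in>X. uedge x w \<in> H i} > 3 * card X)"
     "\<forall>i\<in>J. \<forall>j\<in>J. i \<noteq> j \<longrightarrow> H i \<inter> H j = {}" by (elim exE conjE)
  define \<Gamma> where "\<Gamma> = (\<lambda>i. F i \<union> H i)"
  have fin12: "finite E1" "finite E2" "finite E3" using sub finite_vpairs by (meson finite_subset)+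
  have FE: "F i \<subseteq> E1" for i by (auto simp: F_def forest_def)
  have HE: "H i \<subseteq> E2" if "i \<in> J" for i using H(1) that by blast
  have "\<exists>A. (\<forall>i\<in>J. A i \<subseteq> E3 \<and> inj_on col (A i) \<and> closeable {..<n} (S i) (\<Gamma> i \<union> A i) 0) \<and>
    (\<forall>i\<in>J. \<forall>j\<in>J. i \<noteq> j \<longrightarrow> A i \<inter> A j = {})"
  proof (rule rainbow_completion[OF finJ n piv Sn sub(3) _ _ _ q2[of E3] m(2) own _ ls a0(2)])
    show "closeable {..<n} (S i) (\<Gamma> i) T" if i: "i \<in> J" for i
    proof -
      have "i \<in> idx" "n > 0" using i J_sub n by auto
      then have "closeable {..<n} (S i) (F i) (card (S i))"
        unfolding S_def using forest_closeable[OF sub(1) fc _ F_sub] by blast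
      then obtain vs where vs: "distinct vs" "set vs = {..<n}" "cyc vs - F i \<subseteq> S i \<times> S i" "card (cyc vs - F i) \<le> card (S i)"
        unfolding closeable_def by blast
      have "card (cyc vs - \<Gamma> i) \<le> card (cyc vs - F i)" unfolding \<Gamma>_def by (intro card_mono) auto
      then show ?thesis unfolding closeable_def using vs cS[OF i] unfolding \<Gamma>_def by (intro exI[of _ vs]) auto
    qed
    show "v \<in> S i" if i: "i \<in> J" "w \<in> pivots i" "uedge w v \<in> \<Gamma> i" for i w v
    proof -
      have "uedge w v \<notin> F i" using forest_avoids_pivots[OF sub(1) fc _ F_sub i(2)] i J_sub by blast
      then have "uedge w v \<in> H i" using i(3) by (simp add: \<Gamma>_def)
      then obtain x y where "uedge w v = uedge x y" "x \<in> S i" "y \<in> pivots i" using H(1) i(1) by blast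
      then show ?thesis using piv[of i] by (auto simp: uedge_eq_iff)
    qed
    show "card {w \<in> pivots i. \<exists>x\<in>X. uedge x w \<in> \<Gamma> i} > 3 * card X"
      if i: "i \<in> J" "X \<subseteq> S i" "X \<noteq> {}" "card X \<le> a0" for i X
    proof -
      have fp: "finite (pivots i)" by (simp add: pivots_def)
      have "3 * card X < card {w \<in> pivots i. \<exists>x\<in>X. uedge x w \<in> H i}" using H(1) i by blast
      also have "\<dots> \<le> card {w \<in> pivots i. \<exists>x\<in>X. uedge x w \<in> \<Gamma> i}"
        using fp unfolding \<Gamma>_def by (intro card_mono) auto
      finally show ?thesis .
    qed
    show "card {e \<in> E3. fst e \<in> S i \<and> snd e \<in> S i} \<le> M" if i: "i \<in> J" for i
    proof (cases "S i = {}")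
      case True then show ?thesis by simp
    next
      case False
      let ?d = "\<lambda>u. card {e \<in> E3. fst e = u \<or> snd e = u}"
      have finS: "finite (S i)" using Sn by (rule finite_subset) simp
      obtain u0 where u0: "u0 \<in> S i" "\<And>u. u \<in> S i \<Longrightarrow> ?d u \<le> ?d u0"
      proof -
        have "Max (?d ` S i) \<in> ?d ` S i" using finS False by (intro Max_in) auto
        then obtain u0 where u0: "u0 \<in> S i" "Max (?d ` S i) = ?d u0" by (rule imageE)
        have "?d u \<le> ?d u0" if "u \<in> S i" for u
          unfolding u0(2)[symmetric] using finS that by (intro Max_ge) auto
        then show thesis using that[OF u0(1)] by simp
      qed
      have "{e \<in> E3. fst e \<in> S i \<and> snd e \<in> S i} \<subseteq> (\<Union>u\<in>S i. {e \<in> E3. fst e = u \<or> snd e = u})"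
        by (auto simp: E3_def edges_in_def)
      then have "card {e \<in> E3. fst e \<in> S i \<and> snd e \<in> S i} \<le> card (\<Union>u\<in>S i. {e \<in> E3. fst e = u \<or> snd e = u})"
        using finS fin12(3) by (intro card_mono) auto
      also have "\<dots> \<le> (\<Sum>u\<in>S i. ?d u)" using finS by (rule card_UN_le)
      also have "\<dots> \<le> (\<Sum>u\<in>S i. ?d u0)" using u0(2) by (rule sum_mono)
      also have "\<dots> = card (S i) * ?d u0" by simp
      also have "\<dots> \<le> T * ?d u0" using cS[OF i] by (rule mult_right_mono) simp
      also have "\<dots> \<le> M" using M[of u0] u0(1) Sn by blast
      finally show ?thesis .
    qed
    show "\<beta> + T * q \<le> card (boosters n lay (S i) (\<Gamma> i \<union> A) b \<inter> E3)"
      if i: "i \<in> J" "A \<subseteq> E3" "card A \<le> T" "b \<le> T" "b0 \<le> card (boosters n lay (S i) (\<Gamma> i \<union> A) b)" for i A b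
    \<comment> \<open>The graph consists of at most n forest edges, k T expander edges and T
      boosters, which is at most 2 n in total and hence within the range of the density
      hypothesis.\<close>
    proof (rule dense[OF _ _ _ Sn i(4,5)])
      have s: "\<Gamma> i \<union> A \<subseteq> E1 \<union> E2 \<union> E3" using FE[of i] HE[OF i(1)] i(2) by (auto simp: \<Gamma>_def)
      then show "\<Gamma> i \<union> A \<subseteq> vpairs n" using sub by blast
      show "\<forall>e\<in>\<Gamma> i \<union> A. G e \<noteq> None" using s by (auto simp: E1_def E2_def E3_def edges_in_def)
      have "card (\<Gamma> i \<union> A) \<le> card (\<Gamma> i) + card A" by (rule card_Un_le)
      also have "\<dots> \<le> card (F i) + card (H i) + card A" unfolding \<Gamma>_def using card_Un_le by simp
      also have "card (F i) \<le> n" using card_forest_le[OF sub(1) fc _ F_sub] i(1) J_sub by blast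
      also have "card (H i) \<le> k * card (S i)" using H(1) i(1) by blast
      also have "\<dots> \<le> k * T" using cS[OF i(1)] by simp
      finally show "card (\<Gamma> i \<union> A) \<le> 2 * n" using i(3) T(2) by linarith
    qed
    have "0 \<le> (\<Sum>j\<le>T. real (M choose j) * ((1 / m) ^ j * (1 - 1 / m) ^ \<beta>))"
      using m(2) by (intro sum_nonneg) auto
    from mult_right_mono[OF cJ_idx this]
    show "card J * (\<Sum>j\<le>T. real (M choose j) * ((1 / m) ^ j * (1 - 1 / m) ^ \<beta>)) < 1" using num2 by linarith
  qed auto
  then obtain A where A: "\<forall>i\<in>J. A i \<subseteq> E3 \<and> inj_on col (A i) \<and> closeable {..<n} (S i) (\<Gamma> i \<union> A i) 0"
    "\<forall>i\<in>J. \<forall>j\<in>J. i \<noteq> j \<longrightarrow> A i \<inter> A j = {}" by (elim exE conjE)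
  have AE: "A i \<subseteq> E3" if "i \<in> J" for i using A(1) that by blast
  have "\<forall>i\<in>J. \<exists>vs. distinct vs \<and> set vs = {..<n} \<and> cyc vs \<subseteq> \<Gamma> i \<union> A i"
  proof
    fix i assume "i \<in> J"
    then have "closeable {..<n} (S i) (\<Gamma> i \<union> A i) 0" using A(1) by blast
    then obtain vs where "distinct vs" "set vs = {..<n}" "card (cyc vs - (\<Gamma> i \<union> A i)) \<le> 0"
      unfolding closeable_def by blast
    then show "\<exists>vs. distinct vs \<and> set vs = {..<n} \<and> cyc vs \<subseteq> \<Gamma> i \<union> A i"
      by (intro exI[of _ vs]) auto
  qed
  from bchoice[OF this] obtain V where V: "\<forall>i\<in>J. distinct (V i) \<and> set (V i) = {..<n} \<and> cyc (V i) \<subseteq> \<Gamma> i \<union> A i"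
    by (elim exE)
  have ce: "cycle_edges n (V i) \<subseteq> F i \<union> H i \<union> A i" and len: "length (V i) = n" if i: "i \<in> J" for i
  proof -
    have "distinct (V i)" "set (V i) = {..<n}" using V i by auto
    then show l: "length (V i) = n" using distinct_card[of "V i"] by simp
    have "cyc (V i) = cycle_edges n (V i)" using l n by (intro cyc_conv_cycle_edges) auto
    then show "cycle_edges n (V i) \<subseteq> F i \<union> H i \<union> A i" using V i by (auto simp: \<Gamma>_def)
  qed
  have colr: "e \<in> E1 \<Longrightarrow> col e < c1" "e \<in> E2 \<Longrightarrow> c1 \<le> col e \<and> col e < c1 + c2" "e \<in> E3 \<Longrightarrow> c1 + c2 \<le> col e" for e
    by (auto simp: E1_def E2_def E3_def edges_in_def col_def)
  have injF: "inj_on col (F i)" for i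
  proof (rule inj_onI, rule ccontr)
    fix e e' assume e: "e \<in> F i" "e' \<in> F i" "col e = col e'" "e \<noteq> e'"
    have "e \<in> E1" "e' \<in> E1" using e FE[of i] by auto
    then have "G e = G e'" using e(3) by (auto simp: E1_def edges_in_def col_def)
    moreover have ne: "prod_encode e \<noteq> prod_encode e'" using e(4) by (simp add: prod_encode_eq)
    moreover have ff: "e \<in> forest E1 f i" "e' \<in> forest E1 f i" using e F_sub[of i] by auto
    have "y \<in> X" if "y \<in> forest E1 f i" "y' \<in> forest E1 f i" "prod_encode y' < prod_encode y" "G y' = G y" for y y'
    proof -
      have "f y = i" "y \<in> E1" "lay (fst y) \<noteq> lay (snd y)" using that(1) by (simp_all add: forest_def)
      then show ?thesis using that(2-4) unfolding X_def repeats_def f_def[symmetric] by blast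
    qed
    ultimately have "e \<in> X \<or> e' \<in> X" using ff by (metis neq_iff)
    then show False using e by (auto simp: F_def)
  qed
  have inj: "inj_on col (F i \<union> H i \<union> A i)" if i: "i \<in> J" for i
  proof -
    have "inj_on col (H i)" "inj_on col (A i)" using H(1) A(1) i by auto
    moreover have "col ` F i \<inter> col ` H i = {}" "col ` (F i \<union> H i) \<inter> col ` A i = {}"
      using colr FE[of i] HE[OF i] AE[OF i] by fastforce+
    ultimately show ?thesis using injF[of i] by (auto simp: inj_on_Un)
  qed
  have rb: "rainbow_ham_cycle n G (V i)" if i: "i \<in> J" for i
    unfolding rainbow_ham_cycle_def
  proof (intro conjI)
    show "ham_order n (V i)" using V i len[OF i] n by (auto simp: ham_order_def)
    show "\<forall>e\<in>cycle_edges n (V i). G e \<noteq> None"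
    proof
      fix e assume "e \<in> cycle_edges n (V i)"
      then have "e \<in> E1 \<union> E2 \<union> E3" using ce[OF i] FE[of i] HE[OF i] AE[OF i] by blast
      then show "G e \<noteq> None" by (auto simp: E1_def E2_def E3_def edges_in_def)
    qed
    show "inj_on (\<lambda>e. the (G e)) (cycle_edges n (V i))"
      using inj_on_subset[OF inj[OF i] ce[OF i]] unfolding col_def .
  qed
  have disj: "cycle_edges n (V i) \<inter> cycle_edges n (V j) = {}" if ij: "i \<in> J" "j \<in> J" "i \<noteq> j" for i j
  proof -
    have "F i \<inter> F j = {}" using ij by (auto simp: F_def forest_def)
    moreover have "H i \<inter> H j = {}" "A i \<inter> A j = {}" using H(2) A(2) ij by auto
    moreover have "E1 \<inter> E2 = {}" "E1 \<inter> E3 = {}" "E2 \<inter> E3 = {}" by (auto simp: E1_def E2_def E3_def edges_in_def)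
    ultimately have d: "\<not> (e \<in> F i \<and> e \<in> F j)" "\<not> (e \<in> H i \<and> e \<in> H j)" "\<not> (e \<in> A i \<and> e \<in> A j)"
      "\<not> (e \<in> E1 \<and> e \<in> E2)" "\<not> (e \<in> E1 \<and> e \<in> E3)" "\<not> (e \<in> E2 \<and> e \<in> E3)" for e
      by (metis disjoint_iff)+
    show ?thesis
    proof (rule equals0I)
      fix e assume e: "e \<in> cycle_edges n (V i) \<inter> cycle_edges n (V j)"
      have "e \<in> F i \<or> e \<in> H i \<or> e \<in> A i" "e \<in> F j \<or> e \<in> H j \<or> e \<in> A j"
        using e ce[OF ij(1)] ce[OF ij(2)] by auto
      then show False using d[of e] subsetD[OF FE[of i], of e] subsetD[OF FE[of j], of e] subsetD[OF HE[OF ij(1)], of e]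
          subsetD[OF HE[OF ij(2)], of e] subsetD[OF AE[OF ij(1)], of e] subsetD[OF AE[OF ij(2)], of e] by argo
    qed
  qed
  obtain b where b: "bij_betw b {0..<card J} J" using ex_bij_betw_nat_finite[OF finJ] by blast
  have bJ: "b x \<in> J" if "x < N" for x using bij_betwE[OF b] that cJ by auto
  have binj: "b x \<noteq> b y" if "x < N" "y < N" "x \<noteq> y" for x y
    using bij_betw_imp_inj_on[OF b] that cJ by (auto simp: inj_on_def)
  show ?thesis
    unfolding has_disjoint_rainbow_HCs_def
    by (intro exI[of _ "\<lambda>x. V (b x)"]) (use rb bJ disj binj in blast)
qed

end

section \<open>Probability bounds\<close>

text \<open>The left side divided by b! is a single term of the series of exp b, and e \<le>
  3.\<close>

lemma power_le_exp_fact: "real b ^ b \<le> 3 ^ b * fact b"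
proof -
  have s: "(\<lambda>k. real b ^ k / fact k) sums exp (real b)"
    using exp_converges[of "real b"] by (simp add: divide_inverse mult.commute scaleR_conv_of_real)
  have "(\<Sum>k\<in>{b}. real b ^ k / fact k) \<le> (\<Sum>k. real b ^ k / fact k)"
    by (rule sum_le_suminf) (use s in \<open>auto simp: sums_iff\<close>)
  then have "real b ^ b / fact b \<le> exp (real b)" using s by (simp add: sums_iff)
  also have "\<dots> = exp 1 ^ b" by (simp add: exp_of_nat_mult[symmetric])
  also have "\<dots> \<le> 3 ^ b" using exp_le by (intro power_mono) auto
  finally show ?thesis by (simp add: field_simps)
qed

lemma choose_le_power:
  assumes "b > 0"
  shows "real (N choose b) \<le> (3 * N / b) ^ b"
proof -
  have "real (N choose b) * fact b \<le> real N ^ b"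
  proof (cases "b \<le> N")
    case True
    have "(N choose b) * fact b \<le> N ^ b"
      using binomial_fact_lemma[OF True] binomial_fact_pow[of N b] by simp
    then show ?thesis by (metis of_nat_fact of_nat_le_iff of_nat_mult of_nat_power)
  qed (simp add: binomial_eq_0)
  from mult_right_mono[OF this, of "3 ^ b"]
  have "real (N choose b) * (fact b * 3 ^ b) \<le> real N ^ b * 3 ^ b" by (simp add: mult.assoc)
  moreover have "real (N choose b) * real b ^ b \<le> real (N choose b) * (fact b * 3 ^ b)"
    using power_le_exp_fact[of b] by (intro mult_left_mono) (auto simp: mult.commute)
  moreover have "real N ^ b * 3 ^ b = (3 * real N) ^ b" by (simp add: power_mult_distrib)
  ultimately have "real (N choose b) * real b ^ b \<le> (3 * real N) ^ b" by linarith
  then show ?thesis using assms by (simp add: power_divide field_simps)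
qed

lemma choose_power_le:
  assumes "b > 0" "x \<ge> 0"
  shows "real (N choose b) * x ^ b \<le> (3 * N * x / b) ^ b"
proof -
  have "real (N choose b) * x ^ b \<le> (3 * N / b) ^ b * x ^ b"
    using choose_le_power[OF assms(1)] assms(2) by (intro mult_right_mono) auto
  then show ?thesis by (simp add: power_mult_distrib[symmetric])
qed

text \<open>Writing y = (y / t) t, the factor (y / t)^i is at most (y / t)^T, and the rest is a
  partial sum of exp t. With t near T the bound is close to the last term of the sum.\<close>

lemma sum_power_over_fact_le:
  fixes y t :: real
  assumes "0 < t" "t \<le> y" "real T \<le> t"
  shows "(\<Sum>i\<le>T. y ^ i / fact i) \<le> exp t * (y / t) ^ T"
proof -
  have r: "1 \<le> y / t" using assms by simp
  have "(\<Sum>i\<le>T. y ^ i / fact i) \<le> (\<Sum>i\<le>T. (y / t) ^ T * (t ^ i / fact i))"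
  proof (rule sum_mono)
    fix i assume i: "i \<in> {..T}"
    have "y ^ i = (y / t) ^ i * t ^ i" using assms by (simp add: power_divide)
    also have "\<dots> \<le> (y / t) ^ T * t ^ i" using r i assms by (intro mult_right_mono power_increasing) auto
    finally show "y ^ i / fact i \<le> (y / t) ^ T * (t ^ i / fact i)" by (simp add: divide_right_mono)
  qed
  also have "\<dots> = (y / t) ^ T * (\<Sum>i\<le>T. t ^ i / fact i)" by (simp add: sum_distrib_left)
  also have "\<dots> \<le> (y / t) ^ T * exp t"
  proof (rule mult_left_mono)
    have s: "(\<lambda>k. t ^ k / fact k) sums exp t"
      using exp_converges[of t] by (simp add: divide_inverse mult.commute scaleR_conv_of_real)
    have "(\<Sum>k\<in>{..T}. t ^ k / fact k) \<le> (\<Sum>k. t ^ k / fact k)"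
      by (rule sum_le_suminf) (use s assms in \<open>auto simp: sums_iff\<close>)
    then show "(\<Sum>i\<le>T. t ^ i / fact i) \<le> exp t" using s by (simp add: sums_iff)
  qed (use r in auto)
  finally show ?thesis by (simp add: mult.commute)
qed

lemma choose_le_power_over_fact: "real (N choose i) \<le> real N ^ i / fact i"
proof (cases "i \<le> N")
  case True
  have "(N choose i) * fact i \<le> N ^ i"
    using binomial_fact_lemma[OF True] binomial_fact_pow[of N i] by simp
  then have "real (N choose i) * fact i \<le> real N ^ i"
    by (metis of_nat_fact of_nat_le_iff of_nat_mult of_nat_power)
  then show ?thesis by (simp add: field_simps)
qed (simp add: binomial_eq_0)

section \<open>Failure probabilities of the single random properties\<close>

context coloured_graph
begin

text \<open>Lets events about some colour be bounded by a union over the c colours that can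
  occur.\<close>

lemma Pr_support: "Pr A = Pr (A \<inter> {G. \<forall>e k. G e = Some k \<longrightarrow> k < c})"
proof -
  have sup: "set_pmf \<G> \<subseteq> {G. \<forall>e k. G e = Some k \<longrightarrow> k < c}"
  proof (intro subsetI CollectI allI impI)
    fix G e k assume G: "G \<in> set_pmf \<G>" and k: "G e = Some k"
    have "G \<in> PiE_dflt (vpairs n) None (set_pmf \<circ> (\<lambda>_. edge_pmf p c))"
      using G set_Pi_pmf[of "vpairs n" None "\<lambda>_. edge_pmf p c"] unfolding Gnpc_def by simp
    then have "Some k \<in> set_pmf (edge_pmf p c)"
      using k by (cases "e \<in> vpairs n"; cases e) (auto simp: PiE_dflt_def, metis)
    moreover have "finite {0..<c}" "{0..<c} \<noteq> {}" using c_pos by auto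
    ultimately show "k < c" by (auto simp: edge_pmf_def set_pmf_of_set split: if_splits)
  qed
  have "Pr A = Pr (A \<inter> set_pmf \<G>)" by (simp add: measure_Int_set_pmf)
  also have "\<dots> \<le> Pr (A \<inter> {G. \<forall>e k. G e = Some k \<longrightarrow> k < c})"
    using sup by (intro measure_pmf.finite_measure_mono) auto
  finally have "Pr A \<le> Pr (A \<inter> {G. \<forall>e k. G e = Some k \<longrightarrow> k < c})" .
  moreover have "Pr (A \<inter> {G. \<forall>e k. G e = Some k \<longrightarrow> k < c}) \<le> Pr A"
    by (intro measure_pmf.finite_measure_mono) auto
  ultimately show ?thesis by simp
qed

lemma star_edges:
  assumes "u < n" "Y \<subseteq> {..<n}" "u \<notin> Y"
  shows "uedge u ` Y \<subseteq> vpairs n" "card (uedge u ` Y) = card Y"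
    "card {v \<in> Y. uedge u v \<in> edges_in K (vpairs n) G} = card (edges_in K (uedge u ` Y) G)"
proof -
  show sub: "uedge u ` Y \<subseteq> vpairs n" using assms by (auto simp: uedge_in_vpairs)
  show "card (uedge u ` Y) = card Y" by (rule card_image[OF inj_on_uedge_right])
  have "edges_in K (uedge u ` Y) G = uedge u ` {v \<in> Y. uedge u v \<in> edges_in K (vpairs n) G}"
    using sub by (auto simp: edges_in_def)
  then show "card {v \<in> Y. uedge u v \<in> edges_in K (vpairs n) G} = card (edges_in K (uedge u ` Y) G)"
    using card_image[OF inj_on_uedge_right] by metis
qed

lemma degree_into_layers:
  assumes K: "K \<subseteq> {0..<c}" and y: "\<And>y. y < q \<Longrightarrow> finite (Y y) \<and> Y y \<subseteq> {..<n}"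
    and lo: "\<And>y. y < q \<Longrightarrow> lo \<le> card (Y y) * (p * card K / c)"
    and hi: "\<And>y. y < q \<Longrightarrow> card (Y y) * (p * card K / c) \<le> hi"
    and \<delta>: "0 \<le> \<delta>" "\<delta> \<le> 1" and lo0: "0 \<le> lo"
  shows "Pr {G. \<exists>u<n. \<exists>y<q. u \<notin> Y y \<and>
      (real (card {v \<in> Y y. uedge u v \<in> edges_in K (vpairs n) G}) \<ge> (1 + \<delta>) * hi \<or>
       real (card {v \<in> Y y. uedge u v \<in> edges_in K (vpairs n) G}) \<le> (1 - \<delta>) * lo)}
    \<le> n * q * (2 * exp (- (\<delta>\<^sup>2 * lo / 4)))"
proof -
  have one: "Pr {G. u \<notin> Y y \<and> (real (card {v \<in> Y y. uedge u v \<in> edges_in K (vpairs n) G}) \<ge> (1 + \<delta>) * hi \<or>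
       real (card {v \<in> Y y. uedge u v \<in> edges_in K (vpairs n) G}) \<le> (1 - \<delta>) * lo)} \<le> 2 * exp (- (\<delta>\<^sup>2 * lo / 4))"
    if u: "u < n" and y': "y < q" for u y
  proof (cases "u \<in> Y y")
    case True then show ?thesis by simp
  next
    case False
    note st = star_edges[OF u conjunct2[OF y[OF y']] False]
    have lohi: "lo \<le> hi" using lo[OF y'] hi[OF y'] by linarith
    have "{G. u \<notin> Y y \<and> (real (card {v \<in> Y y. uedge u v \<in> edges_in K (vpairs n) G}) \<ge> (1 + \<delta>) * hi \<or>
       real (card {v \<in> Y y. uedge u v \<in> edges_in K (vpairs n) G}) \<le> (1 - \<delta>) * lo)} \<subseteq>
       {G. real (card (edges_in K (uedge u ` Y y) G)) \<ge> (1 + \<delta>) * hi} \<union>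
       {G. (\<forall>e\<in>{}. G e \<noteq> None) \<and> real (card (edges_in K (uedge u ` Y y) G)) \<le> (1 - \<delta>) * lo}"
      unfolding st(3) by auto
    then have "Pr {G. u \<notin> Y y \<and> (real (card {v \<in> Y y. uedge u v \<in> edges_in K (vpairs n) G}) \<ge> (1 + \<delta>) * hi \<or>
       real (card {v \<in> Y y. uedge u v \<in> edges_in K (vpairs n) G}) \<le> (1 - \<delta>) * lo)} \<le>
       Pr ({G. real (card (edges_in K (uedge u ` Y y) G)) \<ge> (1 + \<delta>) * hi} \<union>
       {G. (\<forall>e\<in>{}. G e \<noteq> None) \<and> real (card (edges_in K (uedge u ` Y y) G)) \<le> (1 - \<delta>) * lo})"
      by (intro measure_pmf.finite_measure_mono) auto
    also have "\<dots> \<le> Pr {G. real (card (edges_in K (uedge u ` Y y) G)) \<ge> (1 + \<delta>) * hi} +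
       Pr {G. (\<forall>e\<in>{}. G e \<noteq> None) \<and> real (card (edges_in K (uedge u ` Y y) G)) \<le> (1 - \<delta>) * lo}"
      by (intro measure_Un_le) auto
    also have "\<dots> \<le> exp (- (\<delta>\<^sup>2 * hi / 4)) + p ^ card ({} :: (nat \<times> nat) set) * exp (- (\<delta>\<^sup>2 * lo / 2))"
      using st(1,2) K hi[OF y'] lo[OF y'] \<delta> lo0
      by (intro add_mono chernoff_upper chernoff_lower) auto
    also have "\<dots> \<le> exp (- (\<delta>\<^sup>2 * lo / 4)) + exp (- (\<delta>\<^sup>2 * lo / 4))"
    proof -
      have "\<delta>\<^sup>2 * lo \<le> \<delta>\<^sup>2 * hi" using lohi by (intro mult_left_mono) auto
      moreover have "0 \<le> \<delta>\<^sup>2 * lo" using lo0 by simp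
      ultimately show ?thesis by (intro add_mono) (auto simp: mult.commute)
    qed
    finally show ?thesis by simp
  qed
  have "Pr {G. \<exists>u<n. \<exists>y<q. u \<notin> Y y \<and>
      (real (card {v \<in> Y y. uedge u v \<in> edges_in K (vpairs n) G}) \<ge> (1 + \<delta>) * hi \<or>
       real (card {v \<in> Y y. uedge u v \<in> edges_in K (vpairs n) G}) \<le> (1 - \<delta>) * lo)}
     \<le> (\<Sum>z\<in>{..<n} \<times> {..<q}. 2 * exp (- (\<delta>\<^sup>2 * lo / 4)))"
    by (rule prob_union_bound[where A = "\<lambda>(u, y). {G. u \<notin> Y y \<and> (real (card {v \<in> Y y. uedge u v \<in> edges_in K (vpairs n) G}) \<ge> (1 + \<delta>) * hi \<or>
       real (card {v \<in> Y y. uedge u v \<in> edges_in K (vpairs n) G}) \<le> (1 - \<delta>) * lo)}"]) (use one in auto)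
  then show ?thesis by (simp add: card_cartesian_product)
qed

lemma degree_upper:
  assumes K: "K \<subseteq> {0..<c}" and hi: "n * (p * card K / c) \<le> hi"
  shows "Pr {G. \<exists>u<n. real (card {e \<in> edges_in K (vpairs n) G. fst e = u \<or> snd e = u}) \<ge> 2 * hi} \<le> n * exp (- (hi / 4))"
proof -
  have "Pr {G. \<exists>u<n. real (card {e \<in> edges_in K (vpairs n) G. fst e = u \<or> snd e = u}) \<ge> 2 * hi} \<le> (\<Sum>u<n. exp (- (1\<^sup>2 * hi / 4)))"
  proof (rule prob_union_bound[where A = "\<lambda>u. {G. real (card (edges_in K (uedge u ` ({..<n} - {u})) G)) \<ge> (1 + 1) * hi}"])
    fix u assume u: "u \<in> {..<n}"
    have st: "uedge u ` ({..<n} - {u}) \<subseteq> vpairs n" "card (uedge u ` ({..<n} - {u})) = card ({..<n} - {u})"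
      using star_edges(1,2)[of u "{..<n} - {u}"] u by auto
    have "real (card (uedge u ` ({..<n} - {u}))) * (p * card K / c) \<le> n * (p * card K / c)"
      unfolding st(2) using p01 card_mono[of "{..<n}" "{..<n} - {u}"] by (intro mult_right_mono) auto
    then show "Pr {G. real (card (edges_in K (uedge u ` ({..<n} - {u})) G)) \<ge> (1 + 1) * hi} \<le> exp (- (1\<^sup>2 * hi / 4))"
      using hi by (intro chernoff_upper st K) auto
  next
    show "{G. \<exists>u<n. real (card {e \<in> edges_in K (vpairs n) G. fst e = u \<or> snd e = u}) \<ge> 2 * hi} \<subseteq>
      (\<Union>u<n. {G. real (card (edges_in K (uedge u ` ({..<n} - {u})) G)) \<ge> (1 + 1) * hi})"
    proof
      fix G assume "G \<in> {G. \<exists>u<n. real (card {e \<in> edges_in K (vpairs n) G. fst e = u \<or> snd e = u}) \<ge> 2 * hi}"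
      then obtain u where u: "u < n" "real (card {e \<in> edges_in K (vpairs n) G. fst e = u \<or> snd e = u}) \<ge> 2 * hi" by blast
      have "{e \<in> edges_in K (vpairs n) G. fst e = u \<or> snd e = u} \<subseteq> edges_in K (uedge u ` ({..<n} - {u})) G"
      proof
        fix e assume e: "e \<in> {e \<in> edges_in K (vpairs n) G. fst e = u \<or> snd e = u}"
        obtain a b where ab: "e = (a, b)" by (cases e)
        have "a < b" "b < n" using e ab by (auto simp: edges_in_def vpairs_def)
        then have "e = uedge u (if a = u then b else a)" "(if a = u then b else a) \<in> {..<n} - {u}"
          using e ab by (auto simp: uedge_def)
        then show "e \<in> edges_in K (uedge u ` ({..<n} - {u})) G" using e by (auto simp: edges_in_def)
      qed
      moreover have "finite (edges_in K (uedge u ` ({..<n} - {u})) G)" by (simp add: edges_in_def)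
      ultimately have "card {e \<in> edges_in K (vpairs n) G. fst e = u \<or> snd e = u} \<le> card (edges_in K (uedge u ` ({..<n} - {u})) G)"
        by (intro card_mono)
      then have "real (card {e \<in> edges_in K (vpairs n) G. fst e = u \<or> snd e = u}) \<le> real (card (edges_in K (uedge u ` ({..<n} - {u})) G))"
        by (rule of_nat_mono)
      from order_trans[OF u(2) this] have "real (card (edges_in K (uedge u ` ({..<n} - {u})) G)) \<ge> (1 + 1) * hi" by simp
      then show "G \<in> (\<Union>u<n. {G. real (card (edges_in K (uedge u ` ({..<n} - {u})) G)) \<ge> (1 + 1) * hi})" using u(1) by blast
    qed
  qed simp
  then show ?thesis by simp
qed

text \<open>The clause \<open>M > 0\<close> makes a class of size at least 2 M nonempty, so its
  colour occurs and is below c.\<close>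

lemma colour_classes:
  assumes M: "card (vpairs n) * (p / c) \<le> M"
  shows "Pr {G. \<exists>\<kappa>. real (card {e \<in> vpairs n. G e = Some \<kappa>}) \<ge> 2 * M \<and> M > 0} \<le> c * exp (- (M / 4))"
proof -
  have eq: "edges_in {\<kappa>} (vpairs n) G = {e \<in> vpairs n. G e = Some \<kappa>}" for \<kappa> G by (auto simp: edges_in_def)
  have "Pr ({G. \<exists>\<kappa>. real (card {e \<in> vpairs n. G e = Some \<kappa>}) \<ge> 2 * M \<and> M > 0} \<inter> {G. \<forall>e k. G e = Some k \<longrightarrow> k < c})
     \<le> (\<Sum>\<kappa><c. exp (- (1\<^sup>2 * M / 4)))"
  proof (rule prob_union_bound[where A = "\<lambda>\<kappa>. {G. real (card (edges_in {\<kappa>} (vpairs n) G)) \<ge> (1 + 1) * M}"])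
    fix \<kappa> assume "\<kappa> \<in> {..<c}"
    then show "Pr {G. real (card (edges_in {\<kappa>} (vpairs n) G)) \<ge> (1 + 1) * M} \<le> exp (- (1\<^sup>2 * M / 4))"
      using M by (intro chernoff_upper) auto
  next
    show "{G. \<exists>\<kappa>. real (card {e \<in> vpairs n. G e = Some \<kappa>}) \<ge> 2 * M \<and> M > 0} \<inter> {G. \<forall>e k. G e = Some k \<longrightarrow> k < c}
      \<subseteq> (\<Union>\<kappa><c. {G. real (card (edges_in {\<kappa>} (vpairs n) G)) \<ge> (1 + 1) * M})"
    proof
      fix G assume "G \<in> {G. \<exists>\<kappa>. real (card {e \<in> vpairs n. G e = Some \<kappa>}) \<ge> 2 * M \<and> M > 0} \<inter> {G. \<forall>e k. G e = Some k \<longrightarrow> k < c}"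
      then obtain \<kappa> where k: "real (card {e \<in> vpairs n. G e = Some \<kappa>}) \<ge> 2 * M" "M > 0" "\<forall>e k. G e = Some k \<longrightarrow> k < c" by blast
      have "card {e \<in> vpairs n. G e = Some \<kappa>} \<noteq> 0" using k by linarith
      then obtain e where "G e = Some \<kappa>" by (metis (mono_tags, lifting) card.empty empty_Collect_eq)
      then have "\<kappa> < c" using k(3) by blast
      then show "G \<in> (\<Union>\<kappa><c. {G. real (card (edges_in {\<kappa>} (vpairs n) G)) \<ge> (1 + 1) * M})"
        using k(1) unfolding eq by auto
    qed
  qed simp
  then show ?thesis by (subst Pr_support) simp
qed

text \<open>The sum counts an edge at most twice, namely when both ends lie in X and in Y, so s
  pairs contain at least \<open>e0 a\<close> edges as soon as 2 e0 a \<le> s + 1. There are at most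
  3 a^2 candidate pairs, and the union over sets of \<open>e0 a\<close> of them gives the base 9 a^2
  q / e0 a.\<close>

lemma sparse_pairs:
  assumes K: "K \<subseteq> {0..<c}" and e0: "\<And>a. 1 \<le> a \<Longrightarrow> a \<le> a0 \<Longrightarrow> e0 a > 0"
    and thr: "\<And>a s. 1 \<le> a \<Longrightarrow> a \<le> a0 \<Longrightarrow> k * a \<le> s \<Longrightarrow> thr a < real s \<Longrightarrow> 2 * e0 a \<le> s + 1"
    and x: "\<And>a. 1 \<le> a \<Longrightarrow> a \<le> a0 \<Longrightarrow> 9 * (real a)\<^sup>2 * (p * card K / c) / e0 a \<le> r a"
  shows "Pr {G. \<exists>a X Y. 1 \<le> a \<and> a \<le> a0 \<and> X \<subseteq> {..<n} \<and> Y \<subseteq> {..<n} \<and> card X = a \<and> card Y = 3 * a \<and>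
       k * a \<le> (\<Sum>u\<in>X. card {w \<in> Y. uedge u w \<in> edges_in K (vpairs n) G}) \<and>
       thr a < real (\<Sum>u\<in>X. card {w \<in> Y. uedge u w \<in> edges_in K (vpairs n) G})}
    \<le> (\<Sum>a\<in>{1..a0}. real (n choose a) * real (n choose (3 * a)) * r a ^ e0 a)"
proof -
  let ?q = "p * card K / c"
  have q0: "0 \<le> ?q" using p01 by simp
  let ?s = "\<lambda>X Y G. \<Sum>u\<in>X. card {w \<in> Y. uedge u w \<in> edges_in K (vpairs n) G}"
  define BB where "BB = (\<lambda>X Y. (\<lambda>(u, w). uedge u w) ` (X \<times> Y) \<inter> vpairs n)"
  have cB: "card (BB X Y) \<le> card X * card Y" if "finite X" "finite Y" for X Y
  proof -
    have "card (BB X Y) \<le> card ((\<lambda>(u, w). uedge u w) ` (X \<times> Y))" unfolding BB_def using that by (intro card_mono) auto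
    also have "\<dots> \<le> card (X \<times> Y)" using that by (intro card_image_le) auto
    finally show ?thesis by (simp add: card_cartesian_product)
  qed
  have s_le: "?s X Y G \<le> 2 * card (edges_in K (BB X Y) G)" if fin: "finite X" "finite Y" for X Y G
  proof -
    let ?E = "edges_in K (BB X Y) G"
    have finE: "finite ?E" using fin by (simp add: edges_in_def BB_def)
    have "?s X Y G = card (SIGMA u:X. {w \<in> Y. uedge u w \<in> edges_in K (vpairs n) G})"
      using fin by (subst card_SigmaI) auto
    also have "\<dots> \<le> card (?E \<union> prod.swap ` ?E)"
    proof (rule card_mono)
      show "(SIGMA u:X. {w \<in> Y. uedge u w \<in> edges_in K (vpairs n) G}) \<subseteq> ?E \<union> prod.swap ` ?E"
      proof
        fix z assume "z \<in> (SIGMA u:X. {w \<in> Y. uedge u w \<in> edges_in K (vpairs n) G})"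
        then obtain u w where z: "z = (u, w)" "u \<in> X" "w \<in> Y" "uedge u w \<in> edges_in K (vpairs n) G" by auto
        then have "uedge u w \<in> ?E" by (auto simp: edges_in_def BB_def)
        moreover have "z = uedge u w \<or> z = prod.swap (uedge u w)" using z by (cases "u \<le> w") (auto simp: uedge_def)
        ultimately show "z \<in> ?E \<union> prod.swap ` ?E" by blast
      qed
    qed (use finE in simp)
    also have "\<dots> \<le> card ?E + card (prod.swap ` ?E)" by (rule card_Un_le)
    also have "\<dots> \<le> 2 * card ?E" using card_image_le[OF finE, of prod.swap] by simp
    finally show ?thesis .
  qed
  have one: "Pr {G. k * a \<le> ?s X Y G \<and> thr a < real (?s X Y G)} \<le> r a ^ e0 a"
    if a: "1 \<le> a" "a \<le> a0" and X: "X \<subseteq> {..<n}" "card X = a" and Y: "Y \<subseteq> {..<n}" "card Y = 3 * a" for a X Y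
  proof -
    have fin: "finite X" "finite Y" using X Y by (meson finite_lessThan finite_subset)+
    have "Pr {G. k * a \<le> ?s X Y G \<and> thr a < real (?s X Y G)} \<le> Pr {G. e0 a \<le> card (edges_in K (BB X Y) G)}"
    proof (rule measure_pmf.finite_measure_mono)
      show "{G. k * a \<le> ?s X Y G \<and> thr a < real (?s X Y G)} \<subseteq> {G. e0 a \<le> card (edges_in K (BB X Y) G)}"
      proof (intro subsetI CollectI; elim CollectE conjE)
        fix G assume "k * a \<le> ?s X Y G" "thr a < real (?s X Y G)"
        then have "2 * e0 a \<le> ?s X Y G + 1" by (rule thr[OF a])
        then show "e0 a \<le> card (edges_in K (BB X Y) G)" using s_le[OF fin, of G] by linarith
      qed
    qed simp
    also have "\<dots> \<le> (card (BB X Y) choose e0 a) * ?q ^ e0 a"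
      by (rule prob_many_edges_le) (use K in \<open>auto simp: BB_def\<close>)
    also have "\<dots> \<le> (3 * card (BB X Y) * ?q / e0 a) ^ e0 a"
      using choose_power_le[OF e0[OF a] q0] by simp
    also have "\<dots> \<le> r a ^ e0 a"
    proof (rule power_mono)
      have "card (BB X Y) \<le> a * (3 * a)" using cB[OF fin] X Y by simp
      then have "real (card (BB X Y)) \<le> real (a * (3 * a))" by (rule of_nat_mono)
      then have "3 * card (BB X Y) * ?q / e0 a \<le> 3 * (a * (3 * a)) * ?q / e0 a"
        using q0 by (intro divide_right_mono mult_right_mono) auto
      also have "\<dots> = 9 * (real a)\<^sup>2 * ?q / e0 a" by (simp add: power2_eq_square)
      also have "\<dots> \<le> r a" by (rule x[OF a])
      finally show "3 * card (BB X Y) * ?q / e0 a \<le> r a" .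
    qed (use p01 in auto)
    finally show ?thesis .
  qed
  let ?I = "SIGMA a:{1..a0}. {X. X \<subseteq> {..<n} \<and> card X = a} \<times> {Y. Y \<subseteq> {..<n} \<and> card Y = 3 * a}"
  have fI: "finite ({X. X \<subseteq> {..<n} \<and> card X = a} \<times> {Y. Y \<subseteq> {..<n} \<and> card Y = 3 * a})" for a by simp
  have "Pr {G. \<exists>a X Y. 1 \<le> a \<and> a \<le> a0 \<and> X \<subseteq> {..<n} \<and> Y \<subseteq> {..<n} \<and> card X = a \<and> card Y = 3 * a \<and>
       k * a \<le> ?s X Y G \<and> thr a < real (?s X Y G)} \<le> (\<Sum>z\<in>?I. r (fst z) ^ e0 (fst z))"
  proof (rule prob_union_bound[where A = "\<lambda>(a, X, Y). {G. k * a \<le> ?s X Y G \<and> thr a < real (?s X Y G)}"])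
    show "finite ?I" using fI by blast
    fix z assume z: "z \<in> ?I"
    obtain a X Y where "z = (a, X, Y)" by (cases z)
    then show "Pr (case z of (a, X, Y) \<Rightarrow> {G. k * a \<le> ?s X Y G \<and> thr a < real (?s X Y G)}) \<le> r (fst z) ^ e0 (fst z)"
      using one[of a X Y] z by auto
  next
    show "{G. \<exists>a X Y. 1 \<le> a \<and> a \<le> a0 \<and> X \<subseteq> {..<n} \<and> Y \<subseteq> {..<n} \<and> card X = a \<and> card Y = 3 * a \<and>
       k * a \<le> ?s X Y G \<and> thr a < real (?s X Y G)} \<subseteq> (\<Union>z\<in>?I. case z of (a, X, Y) \<Rightarrow> {G. k * a \<le> ?s X Y G \<and> thr a < real (?s X Y G)})"
    proof (rule subsetI, elim CollectE exE conjE)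
      fix G a X Y
      assume *: "1 \<le> a" "a \<le> a0" "X \<subseteq> {..<n}" "Y \<subseteq> {..<n}" "card X = a" "card Y = 3 * a"
        "k * a \<le> ?s X Y G" "thr a < real (?s X Y G)"
      show "G \<in> (\<Union>z\<in>?I. case z of (a, X, Y) \<Rightarrow> {G. k * a \<le> ?s X Y G \<and> thr a < real (?s X Y G)})"
        by (rule UN_I[of "(a, X, Y)"]) (use * in simp_all)
    qed
  qed
  also have "\<dots> = (\<Sum>a\<in>{1..a0}. \<Sum>xy\<in>{X. X \<subseteq> {..<n} \<and> card X = a} \<times> {Y. Y \<subseteq> {..<n} \<and> card Y = 3 * a}. r a ^ e0 a)"
    by (subst sum_over_Sigma) auto
  also have "\<dots> = (\<Sum>a\<in>{1..a0}. real (n choose a) * real (n choose (3 * a)) * r a ^ e0 a)"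
    by (intro sum.cong refl) (simp add: card_cartesian_product n_subsets)
  finally show ?thesis .
qed

text \<open>The boosters are determined by a subgraph \<open>\<Gamma>\<close> of the random graph
  itself, so a union is taken over all possible \<open>\<Gamma>\<close>. As boosters avoid
  \<open>\<Gamma>\<close>, the lower tail holds jointly with the event that \<open>\<Gamma>\<close>
  is present; the factor p^card \<Gamma> makes the union affordable.\<close>

lemma dense_boosters:
  fixes T b0 :: nat
  assumes K: "K \<subseteq> {0..<c}" and M: "M \<le> b0 * (p * card K / c)" "0 \<le> M"
  shows "Pr {G. \<exists>\<Gamma> S b. \<Gamma> \<subseteq> vpairs n \<and> (\<forall>e\<in>\<Gamma>. G e \<noteq> None) \<and> card \<Gamma> \<le> 2 * n \<and> S \<subseteq> {..<n} \<and> b \<le> T \<and>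
       b0 \<le> card (boosters n lay S \<Gamma> b) \<and> real (card (boosters n lay S \<Gamma> b \<inter> edges_in K (vpairs n) G)) \<le> M / 2}
    \<le> (T + 1) * 2 ^ n * ((\<Sum>j\<le>2 * n. real (card (vpairs n) choose j) * p ^ j) * exp (- (M / 8)))"
proof -
  let ?bad = "\<lambda>\<Gamma> S b. {G. (\<forall>e\<in>\<Gamma>. G e \<noteq> None) \<and> b0 \<le> card (boosters n lay S \<Gamma> b) \<and>
     real (card (boosters n lay S \<Gamma> b \<inter> edges_in K (vpairs n) G)) \<le> M / 2}"
  have one: "Pr (?bad \<Gamma> S b) \<le> p ^ card \<Gamma> * exp (- (M / 8))" if \<Gamma>: "\<Gamma> \<subseteq> vpairs n" for \<Gamma> S b
  proof (cases "b0 \<le> card (boosters n lay S \<Gamma> b)")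
    case False then show ?thesis using p01 by simp
  next
    case True
    let ?B = "boosters n lay S \<Gamma> b"
    have B: "?B \<subseteq> vpairs n" "\<Gamma> \<inter> ?B = {}" by (auto simp: boosters_def)
    have eq: "?B \<inter> edges_in K (vpairs n) G = edges_in K ?B G" for G using B by (auto simp: edges_in_def)
    have "real b0 * (p * card K / c) \<le> card ?B * (p * card K / c)" using True p01 by (intro mult_right_mono) auto
    then have M': "M \<le> card ?B * (p * card K / c)" using M by linarith
    have "Pr (?bad \<Gamma> S b) \<le> Pr {G. (\<forall>e\<in>\<Gamma>. G e \<noteq> None) \<and> real (card (edges_in K ?B G)) \<le> (1 - 1 / 2) * M}"
      by (rule measure_pmf.finite_measure_mono) (auto simp: eq)
    also have "\<dots> \<le> p ^ card \<Gamma> * exp (- ((1 / 2)\<^sup>2 * M / 2))"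
      by (rule chernoff_lower[OF \<Gamma> B(1) B(2) K M']) (use M in auto)
    finally show ?thesis by (simp add: power2_eq_square)
  qed
  let ?Gs = "\<lambda>j. {\<Gamma>. \<Gamma> \<subseteq> vpairs n \<and> card \<Gamma> = j}"
  let ?I = "SIGMA j:{..2 * n}. ?Gs j \<times> Pow {..<n} \<times> {..T}"
  have "Pr {G. \<exists>\<Gamma> S b. \<Gamma> \<subseteq> vpairs n \<and> (\<forall>e\<in>\<Gamma>. G e \<noteq> None) \<and> card \<Gamma> \<le> 2 * n \<and> S \<subseteq> {..<n} \<and> b \<le> T \<and>
       b0 \<le> card (boosters n lay S \<Gamma> b) \<and> real (card (boosters n lay S \<Gamma> b \<inter> edges_in K (vpairs n) G)) \<le> M / 2}
     \<le> (\<Sum>z\<in>?I. p ^ fst z * exp (- (M / 8)))"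
  proof (rule prob_union_bound[where A = "\<lambda>(j, \<Gamma>, S, b). ?bad \<Gamma> S b"])
    show "finite ?I" by (intro finite_SigmaI) auto
    fix z assume z: "z \<in> ?I"
    obtain j \<Gamma> S b where zz: "z = (j, \<Gamma>, S, b)" by (cases z)
    then have "\<Gamma> \<subseteq> vpairs n" "card \<Gamma> = j" using z by auto
    then show "Pr (case z of (j, \<Gamma>, S, b) \<Rightarrow> ?bad \<Gamma> S b) \<le> p ^ fst z * exp (- (M / 8))"
      using one[of \<Gamma> S b] zz by simp
  next
    show "{G. \<exists>\<Gamma> S b. \<Gamma> \<subseteq> vpairs n \<and> (\<forall>e\<in>\<Gamma>. G e \<noteq> None) \<and> card \<Gamma> \<le> 2 * n \<and> S \<subseteq> {..<n} \<and> b \<le> T \<and>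
       b0 \<le> card (boosters n lay S \<Gamma> b) \<and> real (card (boosters n lay S \<Gamma> b \<inter> edges_in K (vpairs n) G)) \<le> M / 2}
      \<subseteq> (\<Union>z\<in>?I. case z of (j, \<Gamma>, S, b) \<Rightarrow> ?bad \<Gamma> S b)"
    proof (rule subsetI, elim CollectE exE conjE)
      fix G \<Gamma> S b
      assume *: "\<Gamma> \<subseteq> vpairs n" "\<forall>e\<in>\<Gamma>. G e \<noteq> None" "card \<Gamma> \<le> 2 * n" "S \<subseteq> {..<n}" "b \<le> T"
        "b0 \<le> card (boosters n lay S \<Gamma> b)" "real (card (boosters n lay S \<Gamma> b \<inter> edges_in K (vpairs n) G)) \<le> M / 2"
      show "G \<in> (\<Union>z\<in>?I. case z of (j, \<Gamma>, S, b) \<Rightarrow> ?bad \<Gamma> S b)"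
        by (rule UN_I[of "(card \<Gamma>, \<Gamma>, S, b)"]) (use * in simp_all)
    qed
  qed
  also have "\<dots> = (\<Sum>j\<le>2 * n. \<Sum>y\<in>?Gs j \<times> Pow {..<n} \<times> {..T}. p ^ j * exp (- (M / 8)))"
    by (subst sum_over_Sigma) auto
  also have "\<dots> = (\<Sum>j\<le>2 * n. (T + 1) * 2 ^ n * exp (- (M / 8)) * (real (card (vpairs n) choose j) * p ^ j))"
    by (intro sum.cong refl) (simp add: card_cartesian_product n_subsets card_Pow algebra_simps)
  also have "\<dots> = (T + 1) * 2 ^ n * exp (- (M / 8)) * (\<Sum>j\<le>2 * n. real (card (vpairs n) choose j) * p ^ j)"
    by (rule sum_distrib_left[symmetric])
  finally show ?thesis by (simp add: mult_ac)
qed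

end

locale coloured_templates = templates n L R h + coloured_graph n c p for n L R h c p
begin

text \<open>After conditioning on the graph, the colours of the first palette are redrawn while its
  edges and forests stay. An edge repeats a colour only if it hits one of at most n earlier edges of
  its forest, which has probability at most n / c1; then sets of \<open>b1\<close> edges at a vertex
  and \<open>b2\<close> edges in a forest are summed over.\<close>

lemma repeats_bound:
  assumes c1: "0 < c1" "c1 \<le> c"
  defines "E \<equiv> \<lambda>G. edges_in {..<c1} (vpairs n) G"
  shows "Pr {G. (\<exists>f. forest_colouring (E G) f) \<and> (\<forall>u<n. card {e \<in> E G. fst e = u \<or> snd e = u} \<le> dm) \<and>
      ((\<exists>u<n. b1 \<le> card {e \<in> repeats (E G) G. fst e = u \<or> snd e = u}) \<or>
       (\<exists>i\<in>idx. b2 \<le> card (repeats (E G) G \<inter> forest (E G) (fcol (E G)) i)))}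
    \<le> n * (real (dm choose b1) * (real n / c1) ^ b1) + card idx * (real (n choose b2) * (real n / c1) ^ b2)"
    (is "Pr ?X \<le> ?bnd")
proof -
  let ?U = "Pi_pmf (vpairs n) 0 (\<lambda>_. pmf_of_set {0..<c1})"
  have ne: "finite {0..<c1}" "{0..<c1} \<noteq> {}" using c1 by auto
  have bnd0: "0 \<le> ?bnd" by (intro add_nonneg_nonneg mult_nonneg_nonneg) auto
  have one: "measure_pmf.prob (map_pmf (recolour c1 G) ?U) ?X \<le> ?bnd" for G
  proof (cases "(\<exists>f. forest_colouring (E G) f) \<and> (\<forall>u<n. card {e \<in> E G. fst e = u \<or> snd e = u} \<le> dm)")
    case cond: True
    have fc: "forest_colouring (E G) (fcol (E G))"
      unfolding fcol_def using conjunct1[OF cond] by (rule someI_ex)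
    have dm: "card {e \<in> E G. fst e = u \<or> snd e = u} \<le> dm" if "u < n" for u using cond that by blast
    have EV: "E G \<subseteq> vpairs n" by (auto simp: E_def edges_in_def)
    have finE: "finite (E G)" using EV finite_vpairs by (rule finite_subset)
    define C where "C = {e \<in> E G. lay (fst e) \<noteq> lay (snd e)}"
    define K where "K = (\<lambda>e. {e' \<in> forest (E G) (fcol (E G)) (fcol (E G) e). prod_encode e' < prod_encode e})"
    define P where "P = (\<lambda>e (\<psi> :: nat \<times> nat \<Rightarrow> nat). \<exists>e'\<in>K e. \<psi> e' = \<psi> e)"
    have fidx: "fcol (E G) e \<in> idx" if "e \<in> C" for e
    proof -
      have "e \<in> vpairs n" using that EV by (auto simp: C_def)
      then obtain u v where uv: "e = uedge u v" "u < n" "v < n" using vpairs_uedge[of e n] by (auto simp: vpairs_def)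
      have "lay u \<noteq> lay v" using that uv by (auto simp: C_def uedge_def min_def max_def split: if_splits)
      then have "fcol (E G) e \<in> Tm (lay u) (lay v) \<times> {..<h}"
        using fc that uv unfolding forest_colouring_def by (auto simp: C_def)
      then show ?thesis by (auto simp: idx_def Tm_def)
    qed
    have K: "K e \<subseteq> vpairs n \<and> (\<forall>e'\<in>K e. prod_encode e' < prod_encode e) \<and> card (K e) \<le> n" if "e \<in> C" for e
    proof (intro conjI)
      show "K e \<subseteq> vpairs n" using EV by (auto simp: K_def forest_def)
      show "\<forall>e'\<in>K e. prod_encode e' < prod_encode e" by (simp add: K_def)
      have "card (K e) \<le> card (forest (E G) (fcol (E G)) (fcol (E G) e))"
        using finE by (intro card_mono) (auto simp: K_def forest_def)
      also have "\<dots> \<le> n" by (rule card_forest_le[OF EV fc fidx[OF that] order_refl])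
      finally show "card (K e) \<le> n" .
    qed
    have many: "measure_pmf.prob ?U {\<psi>. b \<le> card {e \<in> B. P e \<psi>}} \<le> real (N choose b) * (real n / c1) ^ b"
      if B: "B \<subseteq> C" "card B \<le> N" for B b N
    proof -
      have finB: "finite B" using B(1) finE by (auto simp: C_def intro: finite_subset)
      have "measure_pmf.prob ?U {\<psi>. b \<le> card {e \<in> B. P e \<psi>}} \<le> (card B choose b) * (real n / c1) ^ b"
      proof (rule Pr_many_le[OF finB])
        fix A assume A: "A \<subseteq> B" "card A = b"
        have "measure_pmf.prob ?U {\<psi>. \<forall>e\<in>A. \<exists>e'\<in>K e. \<psi> e' = \<psi> e} \<le> (real n / c1) ^ card A"
        proof (rule prob_colour_repeats[where rk = prod_encode])
          show "finite A" using A(1) finB by (rule finite_subset)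
          show "A \<subseteq> vpairs n" using A(1) B(1) EV by (auto simp: C_def)
          show "inj_on prod_encode A" by (rule inj_prod_encode)
          show "K e \<subseteq> vpairs n \<and> (\<forall>f\<in>K e. prod_encode f < prod_encode e) \<and> card (K e) \<le> n" if "e \<in> A" for e
            using K[of e] that A(1) B(1) by blast
        qed (use c1 in auto)
        then show "measure_pmf.prob ?U {\<psi>. \<forall>e\<in>A. P e \<psi>} \<le> (real n / c1) ^ b"
          unfolding P_def A(2) .
      qed
      also have "\<dots> \<le> real (N choose b) * (real n / c1) ^ b"
        using binomial_right_mono[OF B(2), of b] by (intro mult_right_mono) auto
      finally show ?thesis .
    qed
    define Bu where "Bu = (\<lambda>u. {e \<in> C. fst e = u \<or> snd e = u})"
    define Bi where "Bi = (\<lambda>i. forest (E G) (fcol (E G)) i)"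
    have Bu: "Bu u \<subseteq> C" "card (Bu u) \<le> dm" if "u < n" for u
    proof -
      have "card (Bu u) \<le> card {e \<in> E G. fst e = u \<or> snd e = u}"
        using finE by (intro card_mono) (auto simp: Bu_def C_def)
      then show "card (Bu u) \<le> dm" using dm[OF that] by simp
    qed (auto simp: Bu_def)
    have Bi: "Bi i \<subseteq> C" "card (Bi i) \<le> n" if "i \<in> idx" for i
      using card_forest_le[OF EV fc that order_refl] by (auto simp: Bi_def C_def forest_def)
    let ?Y1 = "\<Union>u\<in>{..<n}. {\<psi>. b1 \<le> card {e \<in> Bu u. P e \<psi>}}"
    let ?Y2 = "\<Union>i\<in>idx. {\<psi>. b2 \<le> card {e \<in> Bi i. P e \<psi>}}"
    have "recolour c1 G -` ?X \<inter> set_pmf ?U \<subseteq> ?Y1 \<union> ?Y2"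
    proof
      fix \<psi> assume \<psi>: "\<psi> \<in> recolour c1 G -` ?X \<inter> set_pmf ?U"
      have lt: "\<psi> e < c1" if "e \<in> vpairs n" for e
      proof -
        have "\<psi> \<in> PiE_dflt (vpairs n) 0 (set_pmf \<circ> (\<lambda>_. pmf_of_set {0..<c1}))"
          using \<psi> set_Pi_pmf[of "vpairs n" 0 "\<lambda>_. pmf_of_set {0..<c1}"] by simp
        then have "\<psi> e \<in> set_pmf (pmf_of_set {0..<c1})" using that unfolding PiE_dflt_def by (cases e) auto
        then show ?thesis using ne by simp
      qed
      have same: "E (recolour c1 G \<psi>) = E G"
        using lt by (auto simp: E_def edges_in_def recolour_def split: option.splits if_splits)
      have new: "recolour c1 G \<psi> e = Some (\<psi> e)" if "e \<in> E G" for e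
        using that by (auto simp: E_def edges_in_def recolour_def)
      have rep: "repeats (E G) (recolour c1 G \<psi>) = {e \<in> C. P e \<psi>}"
      proof -
        have "(\<exists>e'\<in>forest (E G) (fcol (E G)) (fcol (E G) e). prod_encode e' < prod_encode e \<and>
            recolour c1 G \<psi> e' = recolour c1 G \<psi> e) \<longleftrightarrow> P e \<psi>" if "e \<in> E G" for e
          using new[OF that] new by (auto simp: P_def K_def forest_def)
        then show ?thesis unfolding repeats_def C_def by blast
      qed
      have "(\<exists>u<n. b1 \<le> card {e \<in> {e \<in> C. P e \<psi>}. fst e = u \<or> snd e = u}) \<or>
         (\<exists>i\<in>idx. b2 \<le> card ({e \<in> C. P e \<psi>} \<inter> Bi i))"
        using \<psi> unfolding vimage_def Int_iff mem_Collect_eq same rep Bi_def by blast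
      moreover have "{e \<in> {e \<in> C. P e \<psi>}. fst e = u \<or> snd e = u} = {e \<in> Bu u. P e \<psi>}" for u
        by (auto simp: Bu_def)
      moreover have "{e \<in> C. P e \<psi>} \<inter> Bi i = {e \<in> Bi i. P e \<psi>}" if "i \<in> idx" for i
        using Bi(1)[OF that] by blast
      ultimately show "\<psi> \<in> ?Y1 \<union> ?Y2" by auto
    qed
    then have "measure_pmf.prob ?U (recolour c1 G -` ?X \<inter> set_pmf ?U) \<le> measure_pmf.prob ?U (?Y1 \<union> ?Y2)"
      by (intro measure_pmf.finite_measure_mono) auto
    also have "\<dots> \<le> measure_pmf.prob ?U ?Y1 + measure_pmf.prob ?U ?Y2" by (intro measure_Un_le) auto
    also have "\<dots> \<le> (\<Sum>u\<in>{..<n}. real (dm choose b1) * (real n / c1) ^ b1) + (\<Sum>i\<in>idx. real (n choose b2) * (real n / c1) ^ b2)"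
      by (intro add_mono prob_union_bound[OF _ _ order_refl]) (use many Bu Bi finite_idx in auto)
    finally show ?thesis by (simp add: measure_Int_set_pmf)
  next
    \<comment> \<open>Both conditions concern the edge set only, so they fail for every recolouring
      and the event is empty.\<close>
    case False
    have "recolour c1 G -` ?X \<inter> set_pmf ?U = {}"
    proof -
      have "\<psi> \<notin> recolour c1 G -` ?X" if \<psi>: "\<psi> \<in> set_pmf ?U" for \<psi>
      proof -
        have lt: "\<psi> e < c1" if "e \<in> vpairs n" for e
        proof -
          have "\<psi> \<in> PiE_dflt (vpairs n) 0 (set_pmf \<circ> (\<lambda>_. pmf_of_set {0..<c1}))"
            using \<psi> set_Pi_pmf[of "vpairs n" 0 "\<lambda>_. pmf_of_set {0..<c1}"] by simp
          then have "\<psi> e \<in> set_pmf (pmf_of_set {0..<c1})" using that unfolding PiE_dflt_def by (cases e) auto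
          then show ?thesis using ne by simp
        qed
        have same: "E (recolour c1 G \<psi>) = E G"
          using lt by (auto simp: E_def edges_in_def recolour_def split: option.splits if_splits)
        then show ?thesis using False unfolding vimage_def mem_Collect_eq same by blast
      qed
      then show ?thesis by blast
    qed
    then have "measure_pmf.prob ?U (recolour c1 G -` ?X \<inter> set_pmf ?U) = 0" by (simp only: measure_empty)
    then have "measure_pmf.prob ?U (recolour c1 G -` ?X) = 0" by (simp only: measure_Int_set_pmf)
    then show ?thesis using bnd0 by (simp only: measure_map_pmf)
  qed
  have "Pr ?X = measure_pmf.prob (bind_pmf \<G> (\<lambda>G. map_pmf (recolour c1 G) ?U)) ?X"
    by (simp only: Gnpc_recolour[OF c1])
  also have "\<dots> \<le> ?bnd * Pr UNIV"
    by (rule prob_bind_le[OF bnd0]) (use one in simp)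
  finally show ?thesis by simp
qed

end

context templates
begin

lemma card_layer:
  "card {v. v < n \<and> lay v = y} \<le> n div Q + 1"
  "y < Q \<Longrightarrow> n div Q \<le> card {v. v < n \<and> lay v = y}"
proof -
  have "{v. v < n \<and> lay v = y} \<subseteq> (\<lambda>i. y + Q * i) ` {..n div Q}"
  proof
    fix v assume v: "v \<in> {v. v < n \<and> lay v = y}"
    then have "v = y + Q * (v div Q)" by (auto simp: lay_def)
    moreover have "v div Q \<le> n div Q" using v by (intro div_le_mono) auto
    ultimately show "v \<in> (\<lambda>i. y + Q * i) ` {..n div Q}" by blast
  qed
  then have "card {v. v < n \<and> lay v = y} \<le> card {..n div Q}" by (intro surj_card_le) auto
  then show "card {v. v < n \<and> lay v = y} \<le> n div Q + 1" by simp
next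
  assume y: "y < Q"
  have "(\<lambda>i. y + Q * i) ` {..<n div Q} \<subseteq> {v. v < n \<and> lay v = y}"
  proof
    fix v assume "v \<in> (\<lambda>i. y + Q * i) ` {..<n div Q}"
    then obtain i where i: "i < n div Q" "v = y + Q * i" by blast
    have "Q * i + Q \<le> Q * (n div Q)" using i(1) by (metis Suc_leI mult_Suc_right add.commute mult_le_mono2)
    also have "\<dots> \<le> n" by simp
    finally show "v \<in> {v. v < n \<and> lay v = y}" using i y by (simp add: lay_def)
  qed
  then have "card ((\<lambda>i. y + Q * i) ` {..<n div Q}) \<le> card {v. v < n \<and> lay v = y}" by (intro card_mono) auto
  moreover have "inj_on (\<lambda>i. y + Q * i) {..<n div Q}" using Q by (auto simp: inj_on_def)
  ultimately show "n div Q \<le> card {v. v < n \<and> lay v = y}" by (simp add: card_image)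
qed

end

context coloured_templates
begin

text \<open>The summands are, in order, the failure of: degrees between layers in the first and in
  the second palette, total degrees in the first and the third, sizes of colour classes, few
  repeats, sparseness of the second palette, density of the third. Outside these events
  \<open>packing\<close> applies.\<close>

lemma failure_bound:
  fixes c1 c2 k T m M a0 b0 \<beta> N q dm b1 b2 :: nat and \<delta> \<theta>0 hi M0 D q1 q2 g :: real
    and lam r :: "nat \<Rightarrow> real" and e0 :: "nat \<Rightarrow> nat"
  defines "q1 \<equiv> p * c1 / c" and "q2 \<equiv> p * c2 / c"
  defines "g \<equiv> \<mu> * h - (1 - \<delta>) * ((n div Q) * q1)"
  assumes c: "c = c1 + 2 * c2" "c1 > 0" and n: "n \<ge> 3" "R \<ge> 2"
    and \<delta>: "0 \<le> \<delta>" "\<delta> \<le> 1"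
    and deg: "(1 + \<delta>) * ((n div Q + 1) * q1) \<le> \<mu> * h"
    and D: "0 < D" "D \<le> (R - 1) * ((n div Q) * q2 / 2)"
    and hi: "n * p \<le> hi" "2 * hi \<le> dm + 1"
    and M0: "M0 > 0" "card (vpairs n) * (p / c) \<le> M0" "2 * M0 \<le> q"
    and e0: "\<And>a. 1 \<le> a \<Longrightarrow> a \<le> a0 \<Longrightarrow> e0 a > 0"
      "\<And>a s. 1 \<le> a \<Longrightarrow> a \<le> a0 \<Longrightarrow> k * a \<le> s \<Longrightarrow> lam a * a * D < real s \<Longrightarrow> 2 * e0 a \<le> s + 1"
      "\<And>a. 1 \<le> a \<Longrightarrow> a \<le> a0 \<Longrightarrow> 9 * (real a)\<^sup>2 * q2 / e0 a \<le> r a"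
    and dense: "\<beta> + T * q \<le> b0 * q2 / 2"
    and T: "3 * R * (n div Q + 1) + \<theta>0 + 2 * b2 \<le> T" "k * T + T \<le> n"
    and m: "h * ((3 * R)\<^sup>2 * fact Q) / (Q * (Q - 1)) + 2 * (Q * g + b1) \<le> m" "m > 0"
    and few: "real (2 * k * m + 2 * k * q) \<le> D / 4"
    and num1: "card idx * (\<Sum>a\<in>{1..a0}. real (n choose a) * real (n choose (3 * a)) * (2 * lam a) ^ (k * a)) < 1"
    and a0: "3 * a0 \<le> n" "2 * b0 \<le> (a0 + 1) * (a0 + 1 - (n div Q + 1))" and k: "k > 0" and lam: "\<And>a. lam a \<ge> 0"
    and M: "T * dm \<le> M"
    and num2: "card idx * (\<Sum>j\<le>T. real (M choose j) * ((1 / m) ^ j * (1 - 1 / m) ^ \<beta>)) < 1"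
    and N: "real N \<le> fact Q * h - n * (Q * g) / \<theta>0" "\<theta>0 > 0"
  shows "Pr {G. \<not> has_disjoint_rainbow_HCs n G N} \<le>
     n * Q * (2 * exp (- (\<delta>\<^sup>2 * ((n div Q) * q1) / 4))) +
     n * Q * (2 * exp (- ((1 / 2)\<^sup>2 * ((n div Q) * q2) / 4))) +
     n * exp (- (hi / 4)) + n * exp (- (hi / 4)) + c * exp (- (M0 / 4)) +
     (n * (real (dm choose b1) * (real n / c1) ^ b1) + card idx * (real (n choose b2) * (real n / c1) ^ b2)) +
     (\<Sum>a\<in>{1..a0}. real (n choose a) * real (n choose (3 * a)) * r a ^ e0 a) +
     (T + 1) * 2 ^ n * ((\<Sum>j\<le>2 * n. real (card (vpairs n) choose j) * p ^ j) * exp (- (b0 * q2 / 8)))"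
proof -
  define K1 where "K1 = {..<c1}"
  define K2 where "K2 = {c1..<c1 + c2}"
  define K3 where "K3 = {c1 + c2..<c1 + 2 * c2}"
  have KK: "K1 \<subseteq> {0..<c}" "K2 \<subseteq> {0..<c}" "K3 \<subseteq> {0..<c}" using c by (auto simp: K1_def K2_def K3_def)
  have cK: "card K1 = c1" "card K2 = c2" "card K3 = c2" by (auto simp: K1_def K2_def K3_def)
  define E where "E = (\<lambda>K G. edges_in K (vpairs n) G)"
  define Y where "Y = (\<lambda>y. {v. v < n \<and> lay v = y})"
  have Yc: "n div Q \<le> card (Y y)" "card (Y y) \<le> n div Q + 1" if "y < Q" for y
    using card_layer that by (auto simp: Y_def)
  have YE: "{v. v < n \<and> lay v = y \<and> P v} = {v \<in> Y y. P v}" for y P by (auto simp: Y_def)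
  have q0: "0 \<le> q1" "0 \<le> q2" using p01 by (auto simp: q1_def q2_def)
  define X1 where "X1 = {G. \<exists>u<n. \<exists>y<Q. u \<notin> Y y \<and>
      (real (card {v \<in> Y y. uedge u v \<in> E K1 G}) \<ge> (1 + \<delta>) * ((n div Q + 1) * q1) \<or>
       real (card {v \<in> Y y. uedge u v \<in> E K1 G}) \<le> (1 - \<delta>) * ((n div Q) * q1))}"
  define X2 where "X2 = {G. \<exists>u<n. \<exists>y<Q. u \<notin> Y y \<and>
      (real (card {v \<in> Y y. uedge u v \<in> E K2 G}) \<ge> (1 + 1 / 2) * ((n div Q + 1) * q2) \<or>
       real (card {v \<in> Y y. uedge u v \<in> E K2 G}) \<le> (1 - 1 / 2) * ((n div Q) * q2))}"
  define X3 where "X3 = (\<lambda>K. {G. \<exists>u<n. real (card {e \<in> E K G. fst e = u \<or> snd e = u}) \<ge> 2 * hi})"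
  define X4 where "X4 = {G :: nat \<times> nat \<Rightarrow> nat option. \<exists>\<kappa>. real (card {e \<in> vpairs n. G e = Some \<kappa>}) \<ge> 2 * M0 \<and> M0 > 0}"
  define X5 where "X5 = {G. (\<exists>f. forest_colouring (E K1 G) f) \<and> (\<forall>u<n. card {e \<in> E K1 G. fst e = u \<or> snd e = u} \<le> dm) \<and>
      ((\<exists>u<n. b1 \<le> card {e \<in> repeats (E K1 G) G. fst e = u \<or> snd e = u}) \<or>
       (\<exists>i\<in>idx. b2 \<le> card (repeats (E K1 G) G \<inter> forest (E K1 G) (fcol (E K1 G)) i)))}"
  define X6 where "X6 = {G. \<exists>a X Y. 1 \<le> a \<and> a \<le> a0 \<and> X \<subseteq> {..<n} \<and> Y \<subseteq> {..<n} \<and> card X = a \<and> card Y = 3 * a \<and>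
       k * a \<le> (\<Sum>u\<in>X. card {w \<in> Y. uedge u w \<in> E K2 G}) \<and>
       lam a * a * D < real (\<Sum>u\<in>X. card {w \<in> Y. uedge u w \<in> E K2 G})}"
  define X7 where "X7 = {G. \<exists>\<Gamma> S b. \<Gamma> \<subseteq> vpairs n \<and> (\<forall>e\<in>\<Gamma>. G e \<noteq> None) \<and> card \<Gamma> \<le> 2 * n \<and> S \<subseteq> {..<n} \<and> b \<le> T \<and>
       b0 \<le> card (boosters n lay S \<Gamma> b) \<and> real (card (boosters n lay S \<Gamma> b \<inter> E K3 G)) \<le> (b0 * q2) / 2}"
  have P1: "Pr X1 \<le> n * Q * (2 * exp (- (\<delta>\<^sup>2 * ((n div Q) * q1) / 4)))"
    unfolding X1_def E_def
    by (rule degree_into_layers[OF KK(1)])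
      (use Yc q0 \<delta> in \<open>auto simp: cK q1_def[symmetric] Y_def simp del: of_nat_add of_nat_Suc intro!: mult_right_mono mult_nonneg_nonneg\<close>)
  have P2: "Pr X2 \<le> n * Q * (2 * exp (- ((1 / 2)\<^sup>2 * ((n div Q) * q2) / 4)))"
    unfolding X2_def E_def
    by (rule degree_into_layers[OF KK(2)])
      (use Yc q0 in \<open>auto simp: cK q2_def[symmetric] Y_def simp del: of_nat_add of_nat_Suc intro!: mult_right_mono mult_nonneg_nonneg\<close>)
  have pq: "p * real a / c \<le> p" if "a \<le> c" for a
    using that p01 c_pos by (simp add: divide_le_eq mult_left_mono)
  have P3: "Pr (X3 K) \<le> n * exp (- (hi / 4))" if K: "K \<subseteq> {0..<c}" for K
    unfolding X3_def E_def
  proof (rule degree_upper[OF K])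
    have "card K \<le> c" using card_mono[OF _ K] by simp
    then have "n * (p * card K / c) \<le> n * p" using pq by (intro mult_left_mono) auto
    then show "n * (p * card K / c) \<le> hi" using hi by linarith
  qed
  have P4: "Pr X4 \<le> c * exp (- (M0 / 4))" unfolding X4_def by (rule colour_classes[OF M0(2)])
  have P5: "Pr X5 \<le> n * (real (dm choose b1) * (real n / c1) ^ b1) + card idx * (real (n choose b2) * (real n / c1) ^ b2)"
    unfolding X5_def E_def K1_def by (rule repeats_bound) (use c in auto)
  have P6: "Pr X6 \<le> (\<Sum>a\<in>{1..a0}. real (n choose a) * real (n choose (3 * a)) * r a ^ e0 a)"
    unfolding X6_def E_def
    by (rule sparse_pairs[OF KK(2), where thr = "\<lambda>a. lam a * a * D"]) (use e0 in \<open>auto simp: cK q2_def\<close>)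
  have P7: "Pr X7 \<le> (T + 1) * 2 ^ n * ((\<Sum>j\<le>2 * n. real (card (vpairs n) choose j) * p ^ j) * exp (- (b0 * q2 / 8)))"
    unfolding X7_def E_def
    by (rule dense_boosters[OF KK(3)]) (use q0 p01 in \<open>auto simp: cK q2_def\<close>)
  have Ef: "edges_in K (vpairs n) G = E K G" for K G by (simp add: E_def)
  have good: "has_disjoint_rainbow_HCs n G N" if G: "G \<notin> X1 \<union> X2 \<union> X3 K1 \<union> X3 K3 \<union> X4 \<union> X5 \<union> X6 \<union> X7" for G
  proof (rule packing[where ?c1.0 = c1 and ?c2.0 = c2 and G = G and ?d2.0 = "(n div Q) * q2 / 2" and dl = b1 and ?\<theta>1.0 = b2 and ?\<theta>0.0 = \<theta>0 and g = g
      and ls = "n div Q + 1" and q = q and T = T and m = m and M = M and ?a0.0 = a0 and ?b0.0 = b0 and \<beta> = \<beta> and k = k and D = D and lam = lam,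
      folded K1_def K2_def K3_def, unfolded Ef])
    have d1: "real (card {v \<in> Y y. uedge u v \<in> E K1 G}) < (1 + \<delta>) * ((n div Q + 1) * q1)"
        "real (card {v \<in> Y y. uedge u v \<in> E K1 G}) > (1 - \<delta>) * ((n div Q) * q1)"
       if u: "u < n" "y < Q" "y \<noteq> lay u" for u y
    proof -
      have "u \<notin> Y y" using u by (auto simp: Y_def)
      then show "real (card {v \<in> Y y. uedge u v \<in> E K1 G}) < (1 + \<delta>) * ((n div Q + 1) * q1)"
        "real (card {v \<in> Y y. uedge u v \<in> E K1 G}) > (1 - \<delta>) * ((n div Q) * q1)"
        using G u unfolding X1_def by (auto simp: not_le)
    qed
    show deg1: "card {v. v < n \<and> lay v = y \<and> uedge u v \<in> E K1 G} \<le> \<mu> * h" if "u < n" "y < Q" "y \<noteq> lay u" for u y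
    proof -
      have "real (card {v \<in> Y y. uedge u v \<in> E K1 G}) < real (\<mu> * h)" using d1(1)[OF that] deg by linarith
      then show ?thesis unfolding YE of_nat_less_iff by (rule less_imp_le)
    qed
    show "real (\<mu> * h) - g \<le> card {v. v < n \<and> lay v = y \<and> uedge u v \<in> E K1 G}" if "u < n" "y < Q" "y \<noteq> lay u" for u y
      using d1(2)[OF that] unfolding YE g_def by simp
    show "g \<ge> 0"
    proof -
      have "(1 - \<delta>) * ((n div Q) * q1) \<le> (1 + \<delta>) * ((n div Q + 1) * q1)"
        using \<delta> q0 by (intro mult_mono) auto
      then show ?thesis using deg unfolding g_def by linarith
    qed
    show "(n div Q) * q2 / 2 \<le> card {v. v < n \<and> lay v = y \<and> uedge u v \<in> E K2 G}" if u: "u < n" "y < Q" "y \<noteq> lay u" for u y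
    proof -
      have "u \<notin> Y y" using u by (auto simp: Y_def)
      then have "real (card {v \<in> Y y. uedge u v \<in> E K2 G}) > (1 - 1 / 2) * ((n div Q) * q2)"
        using G u unfolding X2_def by (auto simp: not_le)
      then show ?thesis unfolding YE by simp
    qed
    show "card {e \<in> vpairs n. G e = Some \<kappa>} \<le> q" for \<kappa>
    proof -
      have "real (card {e \<in> vpairs n. G e = Some \<kappa>}) < 2 * M0" using G M0(1) unfolding X4_def by (auto simp: not_le)
      then show ?thesis using M0(3) by linarith
    qed
    have dmK: "card {e \<in> E K G. fst e = u \<or> snd e = u} \<le> dm" if "K = K1 \<or> K = K3" "u < n" for K u
    proof -
      have "G \<notin> X3 K" using G that(1) by blast
      then have "real (card {e \<in> E K G. fst e = u \<or> snd e = u}) < 2 * hi" using that(2) unfolding X3_def by (auto simp: not_le)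
      then have "real (card {e \<in> E K G. fst e = u \<or> snd e = u}) < real (dm + 1)" using hi(2) by simp
      then show ?thesis unfolding of_nat_less_iff by simp
    qed
    have fe: "\<exists>f. forest_colouring (E K1 G) f" using deg1 by (rule forest_colouring_exists)
    have n5: "\<not> (\<exists>u<n. b1 \<le> card {e \<in> repeats (E K1 G) G. fst e = u \<or> snd e = u})"
      "\<not> (\<exists>i\<in>idx. b2 \<le> card (repeats (E K1 G) G \<inter> forest (E K1 G) (fcol (E K1 G)) i))"
    proof -
      have "G \<notin> X5" using G by simp
      moreover have "\<forall>u<n. card {e \<in> E K1 G. fst e = u \<or> snd e = u} \<le> dm" using dmK by blast
      ultimately show "\<not> (\<exists>u<n. b1 \<le> card {e \<in> repeats (E K1 G) G. fst e = u \<or> snd e = u})"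
        "\<not> (\<exists>i\<in>idx. b2 \<le> card (repeats (E K1 G) G \<inter> forest (E K1 G) (fcol (E K1 G)) i))"
        using fe unfolding X5_def mem_Collect_eq by blast+
    qed
    show "real (card {e \<in> repeats (E K1 G) G. fst e = u \<or> snd e = u}) \<le> b1" if "u < n" for u
    proof -
      have "\<not> b1 \<le> card {e \<in> repeats (E K1 G) G. fst e = u \<or> snd e = u}" using n5(1) that by blast
      then show ?thesis by simp
    qed
    show "real (card (repeats (E K1 G) G \<inter> forest (E K1 G) (fcol (E K1 G)) i)) \<le> b2" if "i \<in> idx" for i
    proof -
      have "\<not> b2 \<le> card (repeats (E K1 G) G \<inter> forest (E K1 G) (fcol (E K1 G)) i)" using n5(2) that by blast
      then show ?thesis by simp
    qed
    show "(\<Sum>u\<in>X. card {w \<in> Y. uedge u w \<in> E K2 G}) < k * a \<or>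
       real (\<Sum>u\<in>X. card {w \<in> Y. uedge u w \<in> E K2 G}) \<le> lam a * a * D"
      if "X \<subseteq> {..<n}" "Y \<subseteq> {..<n}" "card X = a" "card Y = 3 * a" "1 \<le> a" "a \<le> a0" for X Y a
    proof -
      have "G \<notin> X6" using G by simp
      then have "\<not> (k * a \<le> (\<Sum>u\<in>X. card {w \<in> Y. uedge u w \<in> E K2 G}) \<and>
       lam a * a * D < real (\<Sum>u\<in>X. card {w \<in> Y. uedge u w \<in> E K2 G}))"
        using that unfolding X6_def mem_Collect_eq by blast
      then show ?thesis by (meson not_le)
    qed
    show "\<beta> + T * q \<le> card (boosters n lay S \<Gamma> b \<inter> E K3 G)"
      if "\<Gamma> \<subseteq> vpairs n" "\<forall>e\<in>\<Gamma>. G e \<noteq> None" "card \<Gamma> \<le> 2 * n" "S \<subseteq> {..<n}" "b \<le> T"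
        "b0 \<le> card (boosters n lay S \<Gamma> b)" for \<Gamma> S b
    proof -
      have "G \<notin> X7" using G by simp
      then have "\<not> real (card (boosters n lay S \<Gamma> b \<inter> E K3 G)) \<le> (b0 * q2) / 2"
        using that unfolding X7_def mem_Collect_eq by blast
      then have "real (\<beta> + T * q) < real (card (boosters n lay S \<Gamma> b \<inter> E K3 G))" using dense by linarith
      then show ?thesis unfolding of_nat_less_iff by simp
    qed
    show "T * card {e \<in> E K3 G. fst e = u \<or> snd e = u} \<le> M" if "u < n" for u
      using dmK[OF _ that, of K3] M by (meson le_trans mult_le_mono2)
    show "0 \<le> (n div Q) * q2 / 2" using q0 by simp
  qed (use assms card_layer(1) in \<open>auto simp: g_def\<close>)
  have "{G. \<not> has_disjoint_rainbow_HCs n G N} \<subseteq> X1 \<union> X2 \<union> X3 K1 \<union> X3 K3 \<union> X4 \<union> X5 \<union> X6 \<union> X7"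
    using good by blast
  then have "Pr {G. \<not> has_disjoint_rainbow_HCs n G N} \<le> Pr (X1 \<union> X2 \<union> X3 K1 \<union> X3 K3 \<union> X4 \<union> X5 \<union> X6 \<union> X7)"
    by (intro measure_pmf.finite_measure_mono) auto
  also have "\<dots> \<le> Pr X1 + Pr X2 + Pr (X3 K1) + Pr (X3 K3) + Pr X4 + Pr X5 + Pr X6 + Pr X7"
    by (intro order_trans[OF measure_Un_le] add_right_mono order_refl) auto
  also have "\<dots> \<le> n * Q * (2 * exp (- (\<delta>\<^sup>2 * ((n div Q) * q1) / 4))) +
     n * Q * (2 * exp (- ((1 / 2)\<^sup>2 * ((n div Q) * q2) / 4))) +
     n * exp (- (hi / 4)) + n * exp (- (hi / 4)) + c * exp (- (M0 / 4)) +
     (n * (real (dm choose b1) * (real n / c1) ^ b1) + card idx * (real (n choose b2) * (real n / c1) ^ b2)) +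
     (\<Sum>a\<in>{1..a0}. real (n choose a) * real (n choose (3 * a)) * r a ^ e0 a) +
     (T + 1) * 2 ^ n * ((\<Sum>j\<le>2 * n. real (card (vpairs n) choose j) * p ^ j) * exp (- (b0 * q2 / 8)))"
    by (intro add_mono P1 P2 P3 P4 P5 P6 P7 KK)
  finally show ?thesis .
qed

end

section \<open>Choice of parameters\<close>

lemma nat_ceiling_bounds:
  fixes y :: real
  assumes "y \<ge> 0"
  shows "y \<le> nat \<lceil>y\<rceil>" "nat \<lceil>y\<rceil> \<le> y + 1"
  using assms by linarith+

lemma nat_floor_bounds:
  fixes y :: real
  assumes "y \<ge> 0"
  shows "nat \<lfloor>y\<rfloor> \<le> y" "y - 1 \<le> nat \<lfloor>y\<rfloor>"
  using assms by linarith+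

text \<open>Here \<open>x\<close> is \<open>n\<close>, \<open>z\<close> is \<open>n p\<close>, \<open>U\<close> is the number of templates joining two given layers and \<open>F\<close>
  is the number of all templates. Each bound on \<open>\<kappa>\<close> makes one exponential error term at most \<open>1 / x\<^sup>2\<close>;
  the remaining lower bounds on \<open>x\<close> and \<open>z\<close> absorb the rounding.\<close>

locale regime =
  fixes \<epsilon> p e \<theta> \<delta> C \<kappa> x z :: real and j n L R Q U F :: nat
  assumes eps: "0 < \<epsilon>" "\<epsilon> < 1" and e: "e = \<epsilon> / 8"
    and p: "0 \<le> p" "p \<le> 1"
    and j: "8 \<le> j" "10 ^ 25 * (real j + 1) \<le> e * L"
    and L: "L = 2 ^ j" and R: "R = 40000000000" and Q: "Q = L * R"
    and \<theta>: "\<theta> = 1 / (100 * (real L)\<^sup>2)" and \<delta>: "\<delta> = \<epsilon> * \<theta> / 100"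
    and U: "real U * Q \<le> 2 * F" "F \<le> U * (real Q - 1)" "U > 0"
    and C: "3600 * (real L)\<^sup>2 \<le> C" "768 * 10 ^ 20 * L \<le> e * C" "6144 * j * L \<le> e * C"
    and x: "x = n" "L * (6 * real R + 6) \<le> x" "4 * (real L)\<^sup>2 < x"
    and z: "z = x * p" "C \<le> z" "Q * (U + 2) \<le> \<delta> * z" "4 * (real L)\<^sup>2 \<le> z" "4 \<le> \<epsilon> * z"
      "5 + 2 * ln z \<le> e / (128 * 10 ^ 20 * (real L)\<^sup>2) * z"
    and \<kappa>: "0 < \<kappa>" "\<kappa> \<le> \<delta>\<^sup>2 / (16 * Q)" "\<kappa> \<le> e / (64 * Q)" "\<kappa> \<le> 1 / 4" "\<kappa> \<le> 1 / (4 * C)" "\<kappa> \<le> \<theta>"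
      "\<kappa> \<le> e / (5376 * 10 ^ 20)" "2 * ln x \<le> \<kappa> * z"
begin

definition "c = nat \<lceil>C * x\<rceil>"
definition "c2 = nat \<lfloor>e * c\<rfloor>"
definition "c1 = c - 2 * c2"
definition "q1 = p * c1 / c"
definition "q2 = p * c2 / c"
definition "w = n div Q"
text \<open>The least h for which the budget \<open>U * h\<close> reaches the upper estimate of the
  degrees between layers; \<open>g\<close> is the gap between this budget and the lower
  estimate.\<close>

definition "h = nat \<lceil>(1 + \<delta>) * ((w + 1) * q1) / U\<rceil>"
definition "g = real (U * h) - (1 - \<delta>) * (w * q1)"
text \<open>An eighth of x q2 / L, the approximate mean number of second-palette edges from a vertex
  to the pivots of a forest. One factor 2 each pays for the lower degree estimate, the rounding of
  layer sizes and the loss of the vertex's own layer.\<close>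

definition "D = x * q2 / (8 * L)"
definition "dm = nat \<lfloor>2 * z\<rfloor>"
definition "q = nat \<lceil>2 * (z / C)\<rceil>"
definition "r a = sqrt (L * real a / x)"
definition "lam a = 144 * r a"
text \<open>Eight times log2 L. On sets of size up to \<open>a0\<close> both (2 lam a)^(k a) and r
  a^(k a / 2) are then at most (L a / x)^(2 j a); the power j of L a / x beats the L^4 = 16^j that
  comes from the binomials.\<close>

definition "k = 8 * j"
text \<open>Half of the larger threshold of the sparseness alternative, as an edge may be counted
  from both ends.\<close>

definition "e0 a = nat \<lceil>max (real (k * a)) (lam a * a * D) / 2\<rceil>"
text \<open>The 10^10 exceeds 288^4, the constant in (2 lam a)^4.\<close>

definition "a0 = nat \<lfloor>x / (10 ^ 10 * L)\<rfloor>"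
definition "b0 = nat \<lfloor>x\<^sup>2 / (4 * 10 ^ 20 * (real L)\<^sup>2)\<rfloor>"
definition "\<beta> = nat \<lfloor>b0 * q2 / 4\<rfloor>"
text \<open>About 3 x / L for the core, and x / L for rounding, lacking vertices and
  deletions.\<close>

definition "T = nat \<lfloor>4 * x / L\<rfloor>"
definition "b1 = nat \<lceil>\<theta> * z\<rceil>"
definition "b2 = nat \<lceil>\<theta> * x\<rceil>"
definition "m = nat \<lceil>20 * z / (real L)\<^sup>2\<rceil>"
definition "N = nat \<lceil>(1 - \<epsilon>) * x * p / 2\<rceil>"

lemma L_ge: "256 \<le> L" "256 \<le> real L" "L > 0" "real L > 0"
proof -
  have "(2::nat) ^ 8 \<le> 2 ^ j" using j(1) by (intro power_increasing) auto
  then show "256 \<le> L" using L by simp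
  then show "256 \<le> real L" "L > 0" "real L > 0" by linarith+
qed

lemma R_real: "real R = 4 * 10 ^ 10" using R by simp

lemma Q_real: "real Q = L * (4 * 10 ^ 10)" using Q R_real by simp
lemma Q_pos: "0 < real Q" "Q > 0" using Q_real L_ge by simp_all

lemma e_bounds: "0 < e" "e \<le> 1 / 8" using eps e by simp_all

lemma C_pos: "C \<ge> 1"
proof -
  have "1 \<le> (real L)\<^sup>2" using L_ge by simp
  then show ?thesis using C(1) by linarith
qed

lemma x_pos: "x \<ge> 3" "x > 0" "n \<ge> 3"
proof -
  have "256 * 6 \<le> real L * (6 * real R + 6)" using L_ge by (intro mult_mono) auto
  then show "x \<ge> 3" using x(2) by linarith
  then show "x > 0" "n \<ge> 3" using x(1) by simp_all
qed

lemma z_pos: "z \<ge> 2" "z > 0" "z \<le> x"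
proof -
  have "2 \<le> (real L)\<^sup>2" using power_mono[OF L_ge(2), of 2] by simp
  then show "z \<ge> 2" using z(4) by linarith
  then show "z > 0" by simp
  show "z \<le> x" using z(1) p x_pos by (simp add: mult_left_le)
qed

lemma p_pos: "p > 0" using z_pos z(1) p(1) by (cases "p = 0") auto

lemma L_sq: "65536 \<le> (real L)\<^sup>2"
  using power_mono[OF L_ge(2), of 2] by simp

lemma \<theta>_bounds: "0 < \<theta>" "\<theta> \<le> 1 / 6553600" "\<theta> * (100 * (real L)\<^sup>2) = 1"
  using L_sq L_ge by (auto simp: \<theta> field_simps)

lemma \<delta>_bounds: "0 < \<delta>" "\<delta> \<le> \<theta> / 100" "\<delta> \<le> 1 / 2"
proof -
  show "0 < \<delta>" unfolding \<delta> using eps \<theta>_bounds by simp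
  have "\<epsilon> * \<theta> \<le> 1 * \<theta>" using eps \<theta>_bounds by (intro mult_right_mono) auto
  then show "\<delta> \<le> \<theta> / 100" using \<delta> by simp
  then show "\<delta> \<le> 1 / 2" using \<theta>_bounds by simp
qed

lemma eC: "e * C \<ge> 2"
proof -
  have "768 * 10 ^ 20 * 256 \<le> 768 * 10 ^ 20 * real L" using L_ge by simp
  then show ?thesis using C(2) by simp
qed

lemma c_bounds: "C * x \<le> c" "c \<le> 2 * C * x" "c > 0" "2 \<le> e * c"
proof -
  have a: "1 * 1 \<le> C * x" using C_pos x_pos by (intro mult_mono) auto
  show b: "C * x \<le> c" unfolding c_def by (rule nat_ceiling_bounds) (use a in simp)
  have "c \<le> C * x + 1" unfolding c_def by (rule nat_ceiling_bounds) (use a in simp)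
  then show "c \<le> 2 * C * x" using a by simp
  show "c > 0" using a b by linarith
  have "2 * 1 \<le> (e * C) * x" using eC x_pos by (intro mult_mono) auto
  also have "\<dots> \<le> e * c" using b e_bounds by (simp add: mult.assoc)
  finally show "2 \<le> e * c" by simp
qed

lemma c2_bounds: "c2 \<le> e * c" "e * c / 2 \<le> c2"
proof -
  show "c2 \<le> e * c" unfolding c2_def by (rule nat_floor_bounds) (use c_bounds in simp)
  have "e * c - 1 \<le> c2" unfolding c2_def by (rule nat_floor_bounds) (use c_bounds in simp)
  then show "e * c / 2 \<le> c2" using c_bounds by simp
qed

lemma c1_real: "real c1 = c - 2 * real c2" "2 * c2 \<le> c" "c = c1 + 2 * c2"
proof -
  have "e * c \<le> 1 / 8 * c" using e_bounds by (intro mult_right_mono) auto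
  then have "2 * real c2 \<le> c" using c2_bounds by linarith
  then show *: "2 * c2 \<le> c" by linarith
  then show "real c1 = c - 2 * real c2" unfolding c1_def by (simp add: of_nat_diff)
  show "c = c1 + 2 * c2" using * by (simp add: c1_def)
qed

lemma c1_bounds: "(1 - 2 * e) * c \<le> c1" "3 / 4 * c \<le> c1" "c1 \<le> c" "c1 > 0" "3 / 4 * (C * x) \<le> c1"
proof -
  show a: "(1 - 2 * e) * c \<le> c1" using c1_real c2_bounds by (simp add: algebra_simps)
  have "3 / 4 * c \<le> (1 - 2 * e) * real c" using e_bounds by (intro mult_right_mono) auto
  then show b: "3 / 4 * c \<le> c1" using a by linarith
  show "c1 \<le> c" by (simp add: c1_def)
  show "c1 > 0" using b c_bounds by linarith
  show "3 / 4 * (C * x) \<le> c1" using b c_bounds by linarith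
qed

lemma q1_bounds: "p * (1 - 2 * e) \<le> q1" "q1 \<le> p" "3 / 4 * p \<le> q1" "0 \<le> q1" "q1 \<le> 1"
proof -
  have 1: "1 - 2 * e \<le> c1 / c" using c1_bounds(1) c_bounds(3) by (simp add: le_divide_eq)
  have 2: "c1 / c \<le> 1" using c1_bounds(3) c_bounds(3) by simp
  have q: "q1 = p * (c1 / c)" by (simp add: q1_def)
  show a: "p * (1 - 2 * e) \<le> q1" unfolding q using 1 p by (intro mult_left_mono) auto
  show b: "q1 \<le> p" unfolding q using 2 p by (intro mult_left_le) auto
  have "p * (3 / 4) \<le> p * (1 - 2 * e)" using e_bounds p by (intro mult_left_mono) auto
  then show "3 / 4 * p \<le> q1" using a by linarith
  then show "0 \<le> q1" using p by linarith
  show "q1 \<le> 1" using b p by linarith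
qed

lemma q2_bounds: "e * p / 2 \<le> q2" "q2 \<le> e * p" "0 < q2"
proof -
  have 1: "e / 2 \<le> c2 / c" using c2_bounds(2) c_bounds(3) by (simp add: le_divide_eq)
  have 2: "c2 / c \<le> e" using c2_bounds(1) c_bounds(3) by (simp add: divide_le_eq)
  have q: "q2 = p * (c2 / c)" by (simp add: q2_def)
  have "p * (e / 2) \<le> q2" unfolding q using 1 p by (intro mult_left_mono) auto
  then show a: "e * p / 2 \<le> q2" by (simp add: mult.commute)
  have "q2 \<le> p * e" unfolding q using 2 p by (intro mult_left_mono) auto
  then show "q2 \<le> e * p" by (simp add: mult.commute)
  show "0 < q2" using a p_pos e_bounds by (smt (verit) divide_pos_pos mult_pos_pos)
qed

lemma xq2: "e * z / 2 \<le> x * q2"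
proof -
  have "x * (e * p / 2) \<le> x * q2" using q2_bounds x_pos by (intro mult_left_mono) auto
  then show ?thesis using z(1) by (simp add: mult.assoc mult.left_commute)
qed

lemma Q_le_x: "2 * Q \<le> x"
proof -
  have "2 * Q = L * (2 * real R)" using Q by simp
  also have "\<dots> \<le> L * (6 * real R + 6)" by (intro mult_left_mono) auto
  finally show ?thesis using x(2) by simp
qed

lemma w_bounds: "w \<le> x / Q" "x / Q \<le> w + 1" "x / (2 * Q) \<le> w"
proof -
  show "w \<le> x / Q" unfolding w_def x(1) by (rule of_nat_div_le_of_nat)
  have "x / Q - real w \<le> 1" using floor_divide_of_nat_eq[of n Q, where ?'a = real] unfolding w_def x(1) by linarith
  then show a: "x / Q \<le> w + 1" by simp
  have "1 \<le> x / (2 * Q)" using Q_le_x Q_pos by simp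
  moreover have "x / Q = x / (2 * Q) + x / (2 * Q)" using Q_pos by simp
  ultimately show "x / (2 * Q) \<le> w" using a by linarith
qed

lemma wq1: "z * (1 - 2 * e) / Q \<le> (w + 1) * q1" "(w + 1) * q1 \<le> z / Q + 1" "w * q1 \<le> z / Q" "z / (4 * Q) \<le> w * q1"
proof -
  have "x / Q * (p * (1 - 2 * e)) \<le> (w + 1) * q1"
    using w_bounds q1_bounds x_pos e_bounds p by (intro mult_mono) auto
  then show "z * (1 - 2 * e) / Q \<le> (w + 1) * q1" by (simp add: z(1))
  have "w * q1 \<le> x / Q * p" using w_bounds q1_bounds x_pos by (intro mult_mono) auto
  then show a: "w * q1 \<le> z / Q" by (simp add: z(1))
  then show "(w + 1) * q1 \<le> z / Q + 1" using q1_bounds by (simp add: algebra_simps)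
  have "z / (4 * Q) \<le> x / (2 * Q) * (3 / 4 * p)"
    using x_pos p_pos Q_pos by (simp add: z(1) field_simps)
  also have "\<dots> \<le> w * q1" using w_bounds q1_bounds x_pos p by (intro mult_mono) auto
  finally show "z / (4 * Q) \<le> w * q1" .
qed

lemma wq2: "e * z / (4 * Q) \<le> w * q2"
proof -
  have "e * z / (4 * Q) = x / (2 * Q) * (e * p / 2)" by (simp add: z(1))
  also have "\<dots> \<le> w * q2" using w_bounds q2_bounds x_pos p e_bounds by (intro mult_mono) auto
  finally show ?thesis .
qed

lemma \<delta>z: "real U + 2 \<le> \<delta> * z / Q"
  using z(3) Q_pos by (simp add: le_divide_eq algebra_simps)

lemma h_bounds: "(1 + \<delta>) * ((w + 1) * q1) \<le> U * h" "U * h \<le> (1 + \<delta>) * ((w + 1) * q1) + U" "U * h \<le> 2 * z / Q"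
proof -
  let ?y = "(1 + \<delta>) * ((w + 1) * q1)"
  have y0: "?y \<ge> 0" using \<delta>_bounds q1_bounds by simp
  have "?y / U \<le> h" unfolding h_def by (rule nat_ceiling_bounds) (use y0 in simp)
  then show "?y \<le> U * h" using U(3) by (simp add: divide_le_eq mult.commute)
  have "h \<le> ?y / U + 1" unfolding h_def by (rule nat_ceiling_bounds) (use y0 in simp)
  then have "U * real h \<le> U * (?y / U + 1)" by (intro mult_left_mono) auto
  also have "\<dots> = ?y + U" using U(3) by (simp add: distrib_left)
  finally show a: "U * h \<le> ?y + U" by simp
  have "?y \<le> (1 + \<delta>) * (z / Q + 1)" using wq1(2) \<delta>_bounds by (intro mult_left_mono) auto
  also have "\<dots> = z / Q + \<delta> * z / Q + 1 + \<delta>" by (simp add: algebra_simps add_divide_distrib)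
  finally have "U * h \<le> z / Q + \<delta> * z / Q + 2 + U" using a \<delta>_bounds by linarith
  also have "\<dots> \<le> z / Q + 2 * (\<delta> * z / Q)" using \<delta>z by linarith
  also have "\<dots> \<le> 2 * z / Q"
  proof -
    have "\<delta> * z \<le> 1 / 2 * z" using \<delta>_bounds z_pos by (intro mult_right_mono) auto
    then have "\<delta> * z / Q \<le> 1 / 2 * z / Q" using Q_pos by (intro divide_right_mono) auto
    then show ?thesis by simp
  qed
  finally show "U * h \<le> 2 * z / Q" .
qed

text \<open>The gap has three sources, each at most \<delta> z / Q up to a constant factor: the
  two-sided deviation, the rounding of layer sizes and the rounding of \<open>h\<close>; the latter
  two are absorbed by \<open>\<delta>z\<close>.\<close>

lemma g_bounds: "Q * g \<le> 3 * \<delta> * z"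
proof -
  have "g \<le> 2 * \<delta> * (w * q1) + (1 + \<delta>) * q1 + U"
    using h_bounds(2) unfolding g_def by (simp add: algebra_simps)
  moreover have "2 * \<delta> * (w * q1) \<le> 2 * \<delta> * (z / Q)" using wq1 \<delta>_bounds by (intro mult_left_mono) auto
  moreover have "(1 + \<delta>) * q1 \<le> 2 * 1" using \<delta>_bounds q1_bounds by (intro mult_mono) auto
  ultimately have "g \<le> 3 * (\<delta> * z / Q)" using \<delta>z by simp
  then have "Q * g \<le> Q * (3 * (\<delta> * z / Q))" by (intro mult_left_mono) auto
  then show ?thesis using Q_pos by simp
qed

text \<open>The number of forests lies between half of Q times the budget \<open>U * h\<close> and
  (Q - 1) times it. The budget is at least (1 - 2 e) z / Q, where 2 e is the share of colours
  withheld from the forests.\<close>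

lemma Fh_bounds: "(1 - 2 * e) * z / 2 \<le> F * h" "F * h \<le> 2 * z"
proof -
  have "z * (1 - 2 * e) / Q \<le> (1 + \<delta>) * ((w + 1) * q1)"
    using wq1(1) \<delta>_bounds q1_bounds by (smt (verit) mult_le_cancel_right1 mult_nonneg_nonneg of_nat_0_le_iff)
  also have "\<dots> \<le> U * h" by (rule h_bounds)
  finally have "z * (1 - 2 * e) \<le> U * h * Q" using Q_pos by (simp add: divide_le_eq)
  also have "\<dots> = (U * real Q) * h" by simp
  also have "\<dots> \<le> (2 * F) * real h" using U(1) by (intro mult_right_mono) auto
  finally show "(1 - 2 * e) * z / 2 \<le> F * h" by (simp add: mult.commute)
  have "F * real h \<le> (U * (real Q - 1)) * h" using U(2) by (intro mult_right_mono) auto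
  also have "\<dots> = (U * h) * (real Q - 1)" by simp
  also have "\<dots> \<le> (2 * z / Q) * (real Q - 1)" using h_bounds(3) Q_pos by (intro mult_right_mono) auto
  also have "\<dots> \<le> (2 * z / Q) * Q" using z_pos by (intro mult_left_mono) auto
  also have "\<dots> = 2 * z" using Q_pos by simp
  finally show "F * h \<le> 2 * z" by simp
qed

end

section \<open>The numerical hypotheses of the packing statement\<close>

context regime
begin

lemma D_bounds: "0 < D" "D \<le> (real R - 1) * (w * q2 / 2)" "e * z / (16 * L) \<le> D"
proof -
  show "0 < D" using x_pos q2_bounds L_ge by (simp add: D_def)
  have "D = (R / 2) * (x / (2 * Q) * q2 / 2)" unfolding D_def Q using R by simp
  also have "\<dots> \<le> (real R - 1) * (w * q2 / 2)"
    using w_bounds q2_bounds x_pos R by (intro mult_mono divide_right_mono) auto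
  finally show "D \<le> (real R - 1) * (w * q2 / 2)" .
  have "e * z / (16 * L) = e * z / 2 / (8 * L)" by simp
  also have "\<dots> \<le> D" unfolding D_def using xq2 by (intro divide_right_mono) auto
  finally show "e * z / (16 * L) \<le> D" .
qed

lemma card_vpairs_le: "card (vpairs n) \<le> x * x"
proof -
  have "card (vpairs n) \<le> card ({..<n} \<times> {..<n})" by (intro card_mono) (auto simp: vpairs_def)
  then have "card (vpairs n) \<le> n * n" by simp
  then have "real (card (vpairs n)) \<le> real (n * n)" by (rule of_nat_mono)
  then show ?thesis by (simp add: x)
qed

lemma edges_per_colour: "card (vpairs n) * (p / c) \<le> z / C"
proof -
  have "card (vpairs n) * (p / c) \<le> (x * x) * (p / (C * x))"
    using card_vpairs_le p c_bounds C_pos x_pos by (intro mult_mono divide_left_mono) auto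
  also have "\<dots> = z / C" using x_pos by (simp add: z(1))
  finally show ?thesis .
qed

lemma zC: "1 \<le> z / C" using z(2) C_pos by simp

lemma q_bounds: "2 * (z / C) \<le> q" "q \<le> 3 * (z / C)"
proof -
  show "2 * (z / C) \<le> q" unfolding q_def by (rule nat_ceiling_bounds) (use zC in simp)
  have "q \<le> 2 * (z / C) + 1" unfolding q_def by (rule nat_ceiling_bounds) (use zC in simp)
  then show "q \<le> 3 * (z / C)" using zC by simp
qed

lemma zL: "4 \<le> z / (real L)\<^sup>2" using z(4) L_ge by (simp add: le_divide_eq)

lemma m_bounds: "20 * (z / (real L)\<^sup>2) \<le> m" "m \<le> 21 * (z / (real L)\<^sup>2)" "m > 0"
proof -
  show a: "20 * (z / (real L)\<^sup>2) \<le> m" unfolding m_def times_divide_eq_right by (rule nat_ceiling_bounds) (use z_pos in simp)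
  have "m \<le> 20 * (z / (real L)\<^sup>2) + 1" unfolding m_def times_divide_eq_right by (rule nat_ceiling_bounds) (use z_pos in simp)
  then show "m \<le> 21 * (z / (real L)\<^sup>2)" using zL by simp
  show "m > 0" using a zL by linarith
qed

text \<open>\<open>D\<close> is at least e z / (16 L), while k m is of order j z / L^2 and k q of
  order j z / C. So j has to be small against e L and C large against j L / e; 43008 = 16 * 21 * 128
  and 6144 = 16 * 3 * 128.\<close>

lemma few_conflicts: "real (2 * k * m + 2 * k * q) \<le> D / 4"
proof -
  have "16 * real j * m \<le> 16 * real j * (21 * (z / (real L)\<^sup>2))" using m_bounds by (intro mult_left_mono) auto
  also have "\<dots> = (43008 * j) * (z / (128 * (real L)\<^sup>2))" by simp
  also have "\<dots> \<le> (e * L) * (z / (128 * (real L)\<^sup>2))" using j z_pos by (intro mult_right_mono) auto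
  also have "\<dots> = e * z / (128 * L)" using L_ge by (simp add: power2_eq_square)
  finally have 1: "16 * real j * m \<le> e * z / (128 * L)" .
  have "16 * real j * q \<le> 16 * real j * (3 * (z / C))" using q_bounds by (intro mult_left_mono) auto
  also have "\<dots> = (6144 * j * L) * (z / (128 * L * C))" using L_ge by simp
  also have "\<dots> \<le> (e * C) * (z / (128 * L * C))" using C z_pos C_pos by (intro mult_right_mono) auto
  also have "\<dots> = e * z / (128 * L)" using C_pos by simp
  finally have 2: "16 * real j * q \<le> e * z / (128 * L)" .
  have "real (2 * k * m + 2 * k * q) = 16 * real j * m + 16 * real j * q" by (simp add: k_def)
  also have "\<dots> \<le> e * z / (16 * L) / 4" using 1 2 by simp
  also have "\<dots> \<le> D / 4" using D_bounds by simp
  finally show ?thesis .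
qed

lemma T_bounds: "T \<le> 4 * x / L" "4 * x / L - 1 \<le> T"
  using x_pos unfolding T_def by (intro nat_floor_bounds; simp)+

lemma jL: "real (k + 1) * 4 \<le> L"
proof -
  have "e * L \<le> 1 * real L" using e_bounds by (intro mult_right_mono) auto
  then show ?thesis using j by (simp add: k_def)
qed

lemma xL: "6 * real R + 6 \<le> x / L" using x(2) L_ge by (simp add: le_divide_eq mult.commute)

lemma b2_bounds: "\<theta> * x \<le> b2" "b2 \<le> \<theta> * x + 1"
  using x_pos \<theta>_bounds unfolding b2_def by (intro nat_ceiling_bounds; simp)+

lemma b1_bounds: "\<theta> * z \<le> b1" "b1 \<le> \<theta> * z + 1"
  using z_pos \<theta>_bounds unfolding b1_def by (intro nat_ceiling_bounds; simp)+

lemma T_large: "3 * real R * (w + 1) + \<theta> * x + 2 * b2 \<le> T"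
proof -
  have "3 * real R * (w + 1) \<le> 3 * real R * (x / Q + 1)" using w_bounds by (intro mult_left_mono) auto
  also have "\<dots> = 3 * (x / L) + 3 * R" unfolding Q using R by (simp add: field_simps)
  finally have 1: "3 * real R * (w + 1) \<le> 3 * (x / L) + 3 * R" .
  have "6 \<le> 100 * real L" using L_ge by simp
  then have "6 * \<theta> \<le> 1 / L" unfolding \<theta> using L_ge by (simp add: field_simps power2_eq_square)
  then have "6 * \<theta> * x \<le> 1 / L * x" using x_pos by (intro mult_right_mono) auto
  then have 2: "3 * (\<theta> * x) \<le> (x / L) / 2" by simp
  show ?thesis using 1 2 xL T_bounds b2_bounds by simp
qed

lemma T_small: "k * T + T \<le> n"
proof -
  have "real (k + 1) * T \<le> real (k + 1) * (4 * x / L)" using T_bounds by (intro mult_left_mono) auto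
  also have "\<dots> = (real (k + 1) * 4) * (x / L)" by simp
  also have "\<dots> \<le> L * (x / L)" using jL x_pos by (intro mult_right_mono) auto
  also have "\<dots> = n" using L_ge x(1) by simp
  finally have "real ((k + 1) * T) \<le> real n" unfolding of_nat_mult .
  then have "(k + 1) * T \<le> n" unfolding of_nat_le_iff .
  then show ?thesis by simp
qed

lemma b0_bounds: "b0 \<le> x\<^sup>2 / (4 * 10 ^ 20 * (real L)\<^sup>2)" "x\<^sup>2 / (8 * 10 ^ 20 * (real L)\<^sup>2) \<le> b0"
proof -
  show "b0 \<le> x\<^sup>2 / (4 * 10 ^ 20 * (real L)\<^sup>2)" unfolding b0_def by (rule nat_floor_bounds) simp
  have 1: "x\<^sup>2 / (4 * 10 ^ 20 * (real L)\<^sup>2) - 1 \<le> b0" unfolding b0_def by (rule nat_floor_bounds) simp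
  have "(24 * 10 ^ 10)\<^sup>2 \<le> (x / L)\<^sup>2" using xL R_real by (intro power_mono) auto
  then have "8 * 10 ^ 20 \<le> x\<^sup>2 / (real L)\<^sup>2" by (simp add: power_divide)
  then have "1 \<le> x\<^sup>2 / (8 * 10 ^ 20 * (real L)\<^sup>2)" using L_ge by (simp add: field_simps)
  moreover have "x\<^sup>2 / (4 * 10 ^ 20 * (real L)\<^sup>2) = 2 * (x\<^sup>2 / (8 * 10 ^ 20 * (real L)\<^sup>2))" by simp
  ultimately show "x\<^sup>2 / (8 * 10 ^ 20 * (real L)\<^sup>2) \<le> b0" using 1 by linarith
qed

lemma b0q2: "e * x * z / (16 * 10 ^ 20 * (real L)\<^sup>2) \<le> b0 * q2"
proof -
  have "e * x * z / (16 * 10 ^ 20 * (real L)\<^sup>2) = x\<^sup>2 / (8 * 10 ^ 20 * (real L)\<^sup>2) * (e * p / 2)"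
    by (simp add: z(1) power2_eq_square)
  also have "\<dots> \<le> b0 * q2" using b0_bounds q2_bounds e_bounds p by (intro mult_mono) auto
  finally show ?thesis .
qed

lemma \<beta>_bounds: "\<beta> \<le> b0 * q2 / 4" "b0 * q2 / 4 - 1 \<le> \<beta>"
  using q2_bounds unfolding \<beta>_def by (intro nat_floor_bounds; simp)+

text \<open>Half of the mean number of boosters in the third palette is available: a quarter of the
  mean is kept as \<beta>, another quarter covers the boosters whose colours have been used.\<close>

lemma many_boosters_left: "\<beta> + T * q \<le> b0 * q2 / 2"
proof -
  have "real T * q \<le> (4 * x / L) * (3 * (z / C))" using T_bounds q_bounds x_pos by (intro mult_mono) auto
  also have "\<dots> = (768 * 10 ^ 20 * L) * (x * z / (64 * 10 ^ 20 * (real L)\<^sup>2 * C))"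
    using L_ge by (simp add: power2_eq_square)
  also have "\<dots> \<le> (e * C) * (x * z / (64 * 10 ^ 20 * (real L)\<^sup>2 * C))"
    using C x_pos z_pos C_pos by (intro mult_right_mono) auto
  also have "\<dots> = (e * x * z / (16 * 10 ^ 20 * (real L)\<^sup>2)) / 4" using C_pos by simp
  also have "\<dots> \<le> b0 * q2 / 4" using b0q2 by (intro divide_right_mono) auto
  finally show ?thesis using \<beta>_bounds by simp
qed

text \<open>Common cores give 9 R^2 * 2 z / Q^2 = 18 z / L^2. Lacking vertices add at most 4
  \<theta> z + 2, which fits into the remaining 2 z / L^2 because \<theta> is 1 / (100 L^2) and z /
  L^2 \<ge> 4.\<close>

lemma m_large: "real h * (9 * (real R)\<^sup>2 * F) / (Q * (real Q - 1)) + 2 * (Q * g + b1) \<le> m"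
proof -
  have Q1: "real Q - 1 > 0" using Q_real L_ge by simp
  have "real h * F \<le> real h * (U * (real Q - 1))" using U(2) by (intro mult_left_mono) auto
  also have "\<dots> = (U * h) * (real Q - 1)" by simp
  also have "\<dots> \<le> 2 * z / Q * (real Q - 1)" using h_bounds(3) Q1 by (intro mult_right_mono) auto
  finally have "real h * F / (real Q - 1) \<le> 2 * z / Q" using Q1 by (simp add: divide_le_eq)
  then have "(9 * (real R)\<^sup>2 / Q) * (real h * F / (real Q - 1)) \<le> (9 * (real R)\<^sup>2 / Q) * (2 * z / Q)"
    by (intro mult_left_mono) auto
  also have "\<dots> = 18 * (z / (real L)\<^sup>2)" unfolding Q using R by (simp add: power2_eq_square)
  finally have 1: "real h * (9 * (real R)\<^sup>2 * F) / (Q * (real Q - 1)) \<le> 18 * (z / (real L)\<^sup>2)"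
    by (simp add: mult_ac)
  have "3 * \<delta> * z \<le> \<theta> * z" using \<delta>_bounds \<theta>_bounds z_pos by (intro mult_right_mono) auto
  then have 2: "2 * (Q * g + b1) \<le> 4 * (\<theta> * z) + 2" using g_bounds b1_bounds by simp
  have "\<theta> * z = (z / (real L)\<^sup>2) / 100" by (simp add: \<theta>)
  moreover have "A \<le> 18 * u \<Longrightarrow> B \<le> 4 * t + 2 \<Longrightarrow> t = u / 100 \<Longrightarrow> 20 * u \<le> m \<Longrightarrow> 4 \<le> u \<Longrightarrow> A + B \<le> m"
    for A B t u :: real by simp
  ultimately show ?thesis using 1 2 m_bounds(1) zL by blast
qed

text \<open>The target leaves a slack of \<epsilon> z / 2. The withheld colours use \<epsilon> z /
  8, the discarded forests 3 \<epsilon> z / 100, and rounding uses 1, which \<epsilon> z \<ge> 4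
  pays for.\<close>

lemma N_small: "real N \<le> F * h - n * (Q * g) / (\<theta> * x)"
proof -
  have "n * (Q * g) / (\<theta> * x) = Q * g / \<theta>" using x x_pos by simp
  also have "\<dots> \<le> 3 * \<delta> * z / \<theta>" using g_bounds \<theta>_bounds by (intro divide_right_mono) auto
  also have "\<dots> = 3 * \<epsilon> * z / 100" using \<theta>_bounds by (simp add: \<delta>)
  finally have 1: "n * (Q * g) / (\<theta> * x) \<le> 3 * \<epsilon> * z / 100" .
  have "0 \<le> (1 - \<epsilon>) * x * p / 2" using eps x_pos p by simp
  from nat_ceiling_bounds(2)[OF this] have "N \<le> (1 - \<epsilon>) * z / 2 + 1" by (simp add: N_def z(1) mult.assoc)
  moreover have "(1 - 2 * e) * z / 2 = z / 2 - \<epsilon> * z / 8" by (simp add: e algebra_simps diff_divide_distrib)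
  moreover have "(1 - \<epsilon>) * z / 2 = z / 2 - \<epsilon> * z / 2" by (simp add: algebra_simps diff_divide_distrib)
  ultimately show ?thesis using 1 Fh_bounds(1) z(5) by simp
qed

lemma a0_bounds: "a0 \<le> x / (10 ^ 10 * L)" "x / (10 ^ 10 * L) - 1 \<le> a0"
  using x_pos unfolding a0_def by (intro nat_floor_bounds; simp)+

lemma a0_small: "3 * a0 \<le> n"
proof -
  have "x / (10 ^ 10 * L) \<le> x / 3" using x_pos L_ge by (intro divide_left_mono) auto
  then have "3 * real a0 \<le> n" using a0_bounds x(1) by simp
  then show ?thesis by linarith
qed

text \<open>With y = x / (10^10 L) the value of \<open>R\<close> makes a layer about y / 4, so
  \<open>a0 - w\<close> is at least y / 2 and the product at least y^2 / 2, twice the bound y^2 / 4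
  on \<open>b0\<close>.\<close>

lemma a0_large: "2 * b0 \<le> (a0 + 1) * (a0 + 1 - (w + 1))"
proof -
  define y where "y = x / (10 ^ 10 * L)"
  have "x / L = y * 10 ^ 10" by (simp add: y_def)
  then have y: "24 \<le> y" using xL R_real by simp
  have "x / Q = y / 4" unfolding y_def Q_real by (simp add: field_simps)
  then have "real a0 - w \<ge> y / 2" using w_bounds a0_bounds y unfolding y_def[symmetric] by linarith
  then have 1: "real (a0 + 1 - (w + 1)) \<ge> y / 2" by (simp add: of_nat_diff)
  have 2: "real (a0 + 1) \<ge> y" using a0_bounds unfolding y_def[symmetric] by simp
  have "2 * b0 \<le> y * (y / 2)" using b0_bounds(1) unfolding y_def by (simp add: power2_eq_square)
  also have "\<dots> \<le> real (a0 + 1) * real (a0 + 1 - (w + 1))" using 1 2 y by (intro mult_mono) auto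
  finally have "real (2 * b0) \<le> real ((a0 + 1) * (a0 + 1 - (w + 1)))" by (simp only: of_nat_mult of_nat_numeral)
  then show ?thesis unfolding of_nat_le_iff .
qed

lemma r_pos: "0 \<le> r a" "a \<ge> 1 \<Longrightarrow> 0 < r a" "(r a)\<^sup>2 = L * real a / x"
  using x_pos L_ge by (auto simp: r_def)

lemma e0_bounds: "k * a \<le> 2 * e0 a" "lam a * a * D \<le> 2 * e0 a"
    "k * a \<le> s \<Longrightarrow> lam a * a * D < real s \<Longrightarrow> 2 * e0 a \<le> s + 1"
proof -
  let ?M = "max (real (k * a)) (lam a * a * D) / 2"
  have "0 \<le> real (k * a)" by simp
  also have "\<dots> \<le> max (real (k * a)) (lam a * a * D)" by simp
  finally have M: "0 \<le> ?M" by simp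
  have 1: "?M \<le> e0 a" unfolding e0_def using M by (rule nat_ceiling_bounds)
  then have "real (k * a) \<le> 2 * e0 a" by linarith
  then show "k * a \<le> 2 * e0 a" by linarith
  show "lam a * a * D \<le> 2 * e0 a" using 1 by linarith
  assume s: "k * a \<le> s" "lam a * a * D < real s"
  have "real (k * a) \<le> s" using s(1) by (rule of_nat_mono)
  then have "?M \<le> s / 2" using s(2) by simp
  then have "\<lceil>?M\<rceil> \<le> \<lceil>real s / 2\<rceil>" by (rule ceiling_mono)
  moreover have "\<lceil>real s / 2\<rceil> * 2 \<le> int s + 1" by linarith
  ultimately show "2 * e0 a \<le> s + 1" unfolding e0_def by linarith
qed

lemma e0_pos: "a \<ge> 1 \<Longrightarrow> e0 a > 0"
proof -
  assume "a \<ge> 1"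
  then have "k * a > 0" using j by (simp add: k_def)
  then show "e0 a > 0" using e0_bounds(1)[of a] by linarith
qed

text \<open>The 144 in \<open>lam\<close> is 2 * 8 * 9: with D = x q2 / (8 L), half of lam a * a * D
  is 9 r a * a x q2 / L, and multiplied by r a this is 9 a^2 q2 because (r a)^2 = L a / x.\<close>

lemma sparse_ratio:
  assumes a: "a \<ge> 1"
  shows "9 * (real a)\<^sup>2 * q2 / e0 a \<le> r a"
proof -
  have "9 * (real a)\<^sup>2 * q2 = (9 * r a * a * x * q2 / L) * r a"
    using r_pos(3)[of a] x_pos L_ge by (simp add: field_simps power2_eq_square)
  also have "9 * r a * a * x * q2 / L = lam a * a * D / 2" by (simp add: lam_def D_def)
  also have "\<dots> * r a \<le> e0 a * r a" using e0_bounds(2)[of a] r_pos by (intro mult_right_mono) auto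
  finally show ?thesis using e0_pos[OF a] by (simp add: divide_le_eq mult.commute)
qed

end

lemma square_le_power: "(real (Suc a))\<^sup>2 \<le> 4 ^ a"
proof (induction a)
  case (Suc a)
  have "(real (Suc (Suc a)))\<^sup>2 \<le> (2 * real (Suc a))\<^sup>2" by (intro power_mono) auto
  also have "\<dots> = 4 * (real (Suc a))\<^sup>2" by (simp only: power_mult_distrib) simp
  also have "\<dots> \<le> 4 * 4 ^ a" using Suc by simp
  finally show ?case by simp
qed simp

lemma sum_half_powers: "(\<Sum>a\<in>{1..N}. (1 / 2) ^ (a - 1)) \<le> (2 :: real)"
proof -
  have "(\<Sum>a\<in>{1..N}. (1 / 2) ^ (a - 1)) = (\<Sum>a<N. (1 / 2) ^ a :: real)"
    by (rule sum.reindex_bij_witness[of _ Suc "\<lambda>a. a - 1"]) auto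
  also have "\<dots> = 2 - 2 * (1 / 2) ^ N" by (induction N) auto
  also have "\<dots> \<le> 2" by simp
  finally show ?thesis .
qed

context regime
begin

lemma density_bounds:
  assumes "1 \<le> a" "a \<le> a0"
  shows "0 < L * real a / x" "L * real a / x \<le> 1 / 10 ^ 10"
proof -
  show "0 < L * real a / x" using assms L_ge x_pos by simp
  have "real a \<le> x / (10 ^ 10 * L)" using a0_bounds(1) assms by simp
  then show "L * real a / x \<le> 1 / 10 ^ 10" using L_ge x_pos by (simp add: field_simps)
qed

text \<open>With y = L a / x the two binomials give at most (3 L^4 / y^4)^a. Out of y^(2 j) four
  factors cancel y^4, j factors turn L^4 = 16^j into (16 y)^j \<le> 1, the others absorb the 3, and
  y^2 is left over. The sum over a is then dominated by a = 1.\<close>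

lemma pairs_term:
  assumes a: "1 \<le> a" "a \<le> a0"
  shows "real (n choose a) * real (n choose (3 * a)) * (L * real a / x) ^ (2 * j * a) \<le> (L / x)\<^sup>2 * (1 / 2) ^ (a - 1)"
proof -
  define y where "y = L * real a / x"
  have y: "0 < y" "y \<le> 1 / 10 ^ 10" using density_bounds[OF a] by (auto simp: y_def)
  have "real (n choose a) \<le> (3 * real n / a) ^ a" using a by (intro choose_le_power) simp
  moreover have "real (n choose (3 * a)) \<le> (3 * real n / real (3 * a)) ^ (3 * a)" using a by (intro choose_le_power) simp
  moreover have "3 * real n / a = 3 * (L / y)" "3 * real n / real (3 * a) = L / y" using a L_ge x_pos by (auto simp: y_def x)
  ultimately have "real (n choose a) * real (n choose (3 * a)) \<le> (3 * (L / y)) ^ a * (L / y) ^ (3 * a)"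
    using y by (intro mult_mono) auto
  also have "\<dots> = (3 * (L / y) * (L / y) ^ 3) ^ a" by (simp only: power_mult power_mult_distrib)
  also have "3 * (L / y) * (L / y) ^ 3 = 3 * (real L ^ 4 / y ^ 4)" by (simp add: power_divide power4_eq_xxxx power3_eq_cube)
  finally have "real (n choose a) * real (n choose (3 * a)) * y ^ (2 * j * a) \<le> (3 * (real L ^ 4 / y ^ 4)) ^ a * y ^ (2 * j * a)"
    using y by (intro mult_right_mono) auto
  also have "\<dots> = (3 * (real L ^ 4 / y ^ 4) * y ^ (2 * j)) ^ a" by (simp only: power_mult power_mult_distrib)
  also have "\<dots> \<le> (y\<^sup>2) ^ a"
  proof (intro power_mono)
    have "2 * j = 4 + (2 + (j + (j - 6)))" using j by simp
    then have "y ^ (2 * j) = y ^ 4 * (y\<^sup>2 * (y ^ j * y ^ (j - 6)))" by (metis power_add)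
    moreover have "3 * (a / b) * (b * (u * (v * t))) = u * ((a * v) * (3 * t))" if "b \<noteq> 0" for a b u v t :: real
      using that by simp
    ultimately have "3 * (real L ^ 4 / y ^ 4) * y ^ (2 * j) = y\<^sup>2 * ((real L ^ 4 * y ^ j) * (3 * y ^ (j - 6)))"
      using y by (metis power_not_zero less_irrefl)
    also have "\<dots> \<le> y\<^sup>2 * (1 * 1)"
    proof (intro mult_left_mono mult_mono)
      have "real L ^ 4 = 16 ^ j" unfolding L by (simp add: power_mult[symmetric] mult.commute[of j 4]) (simp add: power_mult)
      then have "real L ^ 4 * y ^ j = (16 * y) ^ j" by (simp add: power_mult_distrib)
      also have "\<dots> \<le> 1" using y by (intro power_le_one) auto
      finally show "real L ^ 4 * y ^ j \<le> 1" .
      have "y ^ (j - 6) \<le> y ^ 1" using y j by (intro power_decreasing) auto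
      then show "3 * y ^ (j - 6) \<le> 1" using y by simp
    qed (use y in auto)
    finally show "3 * (real L ^ 4 / y ^ 4) * y ^ (2 * j) \<le> y\<^sup>2" by simp
  qed (use y in auto)
  also have "(y\<^sup>2) ^ a = y\<^sup>2 * (y\<^sup>2) ^ (a - 1)" using a by (cases a) auto
  also have "y\<^sup>2 = (L / x)\<^sup>2 * (real a)\<^sup>2" by (simp add: y_def power_mult_distrib power_divide)
  also have "(L / x)\<^sup>2 * (real a)\<^sup>2 * ((L / x)\<^sup>2 * (real a)\<^sup>2) ^ (a - 1) = (L / x)\<^sup>2 * ((real a)\<^sup>2 * (y\<^sup>2) ^ (a - 1))"
    by (simp add: y_def power_mult_distrib power_divide)
  also have "\<dots> \<le> (L / x)\<^sup>2 * (4 ^ (a - 1) * (1 / 8) ^ (a - 1))"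
  proof (intro mult_left_mono mult_mono power_mono)
    show "(real a)\<^sup>2 \<le> 4 ^ (a - 1)" using square_le_power[of "a - 1"] a by simp
    have "y\<^sup>2 \<le> (1 / 10 ^ 10)\<^sup>2" using y by (intro power_mono) auto
    then show "y\<^sup>2 \<le> 1 / 8" by (simp add: power_divide)
  qed auto
  also have "\<dots> = (L / x)\<^sup>2 * (1 / 2) ^ (a - 1)" by (simp add: power_mult_distrib[symmetric])
  finally show ?thesis by (simp add: y_def)
qed

lemma pairs_sum:
  assumes "\<And>a. 1 \<le> a \<Longrightarrow> a \<le> a0 \<Longrightarrow> f a \<le> (L * real a / x) ^ (2 * j * a)"
  shows "(\<Sum>a\<in>{1..a0}. real (n choose a) * real (n choose (3 * a)) * f a) \<le> 2 * (L / x)\<^sup>2"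
proof -
  have "(\<Sum>a\<in>{1..a0}. real (n choose a) * real (n choose (3 * a)) * f a) \<le> (\<Sum>a\<in>{1..a0}. (L / x)\<^sup>2 * (1 / 2) ^ (a - 1))"
  proof (rule sum_mono)
    fix a assume "a \<in> {1..a0}"
    then have a: "1 \<le> a" "a \<le> a0" by auto
    have "real (n choose a) * real (n choose (3 * a)) * f a \<le> real (n choose a) * real (n choose (3 * a)) * (L * real a / x) ^ (2 * j * a)"
      using assms[OF a] by (intro mult_left_mono) auto
    also have "\<dots> \<le> (L / x)\<^sup>2 * (1 / 2) ^ (a - 1)" by (rule pairs_term[OF a])
    finally show "real (n choose a) * real (n choose (3 * a)) * f a \<le> (L / x)\<^sup>2 * (1 / 2) ^ (a - 1)" .
  qed
  also have "\<dots> = (L / x)\<^sup>2 * (\<Sum>a\<in>{1..a0}. (1 / 2) ^ (a - 1))" by (simp add: sum_distrib_left)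
  also have "\<dots> \<le> (L / x)\<^sup>2 * 2" using sum_half_powers by (intro mult_left_mono) auto
  finally show ?thesis by simp
qed

text \<open>The exponent k a is 4 * 2 j a, and (2 lam a)^4 = 288^4 (L a / x)^2 is at most L a / x in
  the range up to \<open>a0\<close>.\<close>

lemma lam_sum: "(\<Sum>a\<in>{1..a0}. real (n choose a) * real (n choose (3 * a)) * (2 * lam a) ^ (k * a)) \<le> 2 * (L / x)\<^sup>2"
proof (rule pairs_sum)
  fix a assume a: "1 \<le> a" "a \<le> a0"
  note y = density_bounds[OF a]
  have "(2 * lam a) ^ 4 = 288 ^ 4 * ((r a)\<^sup>2)\<^sup>2" by (simp add: lam_def power_mult_distrib)
  also have "\<dots> = (288 ^ 4 * (L * real a / x)) * (L * real a / x)" unfolding r_pos(3) by (simp add: power2_eq_square)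
  also have "\<dots> \<le> 1 * (L * real a / x)" using y by (intro mult_right_mono) auto
  finally have 1: "(2 * lam a) ^ 4 \<le> L * real a / x" by simp
  have "k * a = 4 * (2 * j * a)" by (simp add: k_def)
  then have "(2 * lam a) ^ (k * a) = ((2 * lam a) ^ 4) ^ (2 * j * a)" by (simp only: power_mult)
  also have "\<dots> \<le> (L * real a / x) ^ (2 * j * a)" using 1 by (intro power_mono) auto
  finally show "(2 * lam a) ^ (k * a) \<le> (L * real a / x) ^ (2 * j * a)" .
qed

text \<open>\<open>e0 a\<close> is at least k a / 2 = 4 j a, and r a is the square root of L a / x,
  so the same sum appears as for \<open>lam\<close>.\<close>

lemma r_sum: "(\<Sum>a\<in>{1..a0}. real (n choose a) * real (n choose (3 * a)) * r a ^ e0 a) \<le> 2 * (L / x)\<^sup>2"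
proof (rule pairs_sum)
  fix a assume a: "1 \<le> a" "a \<le> a0"
  note y = density_bounds[OF a]
  have "L * real a / x \<le> 1" by (rule order_trans[OF y(2)]) simp
  then have "r a \<le> 1" by (simp add: r_def)
  then have "r a ^ e0 a \<le> r a ^ (2 * (2 * j * a))"
    using e0_bounds(1)[of a] r_pos by (intro power_decreasing) (auto simp: k_def mult_ac)
  also have "\<dots> = (L * real a / x) ^ (2 * j * a)" unfolding power_mult[of _ 2] r_pos(3) ..
  finally show "r a ^ e0 a \<le> (L * real a / x) ^ (2 * j * a)" .
qed

lemma Lx: "x * (L / x)\<^sup>2 = (real L)\<^sup>2 / x" using x_pos by (simp add: power2_eq_square)

lemma num1: "F * h * (\<Sum>a\<in>{1..a0}. real (n choose a) * real (n choose (3 * a)) * (2 * lam a) ^ (k * a)) < 1"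
proof -
  have "F * h * (\<Sum>a\<in>{1..a0}. real (n choose a) * real (n choose (3 * a)) * (2 * lam a) ^ (k * a)) \<le> (2 * x) * (2 * (L / x)\<^sup>2)"
    using lam_sum Fh_bounds z_pos x_pos r_pos(1) by (intro mult_mono sum_nonneg mult_nonneg_nonneg zero_le_power) (auto simp: lam_def)
  also have "\<dots> = 4 * (x * (L / x)\<^sup>2)" by simp
  also have "\<dots> < 1" unfolding Lx using x(3) x_pos by simp
  finally show ?thesis .
qed

text \<open>Here the growth of np against log n is used: 2 ln x \<le> \<kappa> z turns every error
  exponent of at least \<kappa> z into the factor x^-2.\<close>

lemma decay:
  assumes "\<kappa> \<le> a" "a * z \<le> b"
  shows "exp (- b) \<le> 1 / x\<^sup>2"
proof -
  have "2 * ln x \<le> \<kappa> * z" by (rule \<kappa>(8))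
  also have "\<dots> \<le> a * z" using assms z_pos by (intro mult_right_mono) auto
  finally have "exp (- b) \<le> exp (- (2 * ln x))" using assms by simp
  also have "\<dots> = 1 / x\<^sup>2" using x_pos by (simp add: exp_minus exp_double inverse_eq_divide)
  finally show ?thesis .
qed

text \<open>Since T dm / m is at most 0.4 L x, the sum over owned sets is at most exp t (L^2 / 10)^T
  \<le> exp ((1 + 2 j) 4 x / L) \<le> exp s, because j / L is tiny against e. Missing \<beta>
  boosters has weight exp (-\<beta> / m) \<le> exp (-2 s), so exp (-s) remains.\<close>

lemma num2: "F * h * (\<Sum>i\<le>T. real ((T * dm) choose i) * ((1 / m) ^ i * (1 - 1 / m) ^ \<beta>)) < 1"
proof -
  define y where "y = 4 / 10 * L * x"
  define t where "t = 4 * x / L"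
  \<comment> \<open>5376 = 42 * 128: together with m \<le> 21 z / L^2 this makes 2 s m equal to at
    most e x z / (128 * 10^20 L^2), a lower bound of \<beta>.\<close>
  define s where "s = e * x / (5376 * 10 ^ 20)"
  have m1: "1 \<le> real m" using m_bounds(3) by simp
  have m0: "0 \<le> 1 - 1 / real m" using m1 by simp
  have "real (T * dm) \<le> (4 * x / L) * (2 * z)"
    unfolding of_nat_mult dm_def using T_bounds x_pos z_pos nat_floor_bounds(1)[of "2 * z"] by (intro mult_mono) auto
  also have "\<dots> = y * (20 * (z / (real L)\<^sup>2))" using L_ge by (simp add: y_def power2_eq_square)
  also have "\<dots> \<le> y * m" using m_bounds x_pos L_ge by (intro mult_left_mono) (auto simp: y_def)
  finally have My: "real (T * dm) / m \<le> y" using m1 by (simp add: divide_le_eq)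
  have "(\<Sum>i\<le>T. real ((T * dm) choose i) * (1 / m) ^ i) \<le> (\<Sum>i\<le>T. y ^ i / fact i)"
  proof (rule sum_mono)
    fix i
    have "real ((T * dm) choose i) * (1 / m) ^ i \<le> real (T * dm) ^ i / fact i * (1 / m) ^ i"
      by (intro mult_right_mono choose_le_power_over_fact) auto
    also have "\<dots> = (real (T * dm) / m) ^ i / fact i" by (simp add: power_divide)
    also have "\<dots> \<le> y ^ i / fact i" using My by (intro divide_right_mono power_mono) auto
    finally show "real ((T * dm) choose i) * (1 / m) ^ i \<le> y ^ i / fact i" .
  qed
  also have "\<dots> \<le> exp t * (y / t) ^ T"
  proof (rule sum_power_over_fact_le)
    show "0 < t" using x_pos L_ge by (simp add: t_def)
    have "4 / L \<le> 4 / 10 * real L" using L_ge L_sq by (simp add: divide_le_eq power2_eq_square)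
    then have "4 / L * x \<le> 4 / 10 * L * x" using x_pos by (intro mult_right_mono) auto
    then show "t \<le> y" by (simp add: t_def y_def)
    show "real T \<le> t" using T_bounds by (simp add: t_def)
  qed
  also have "\<dots> \<le> exp t * exp (2 * j * t)"
  proof (intro mult_left_mono)
    have "y / t = (real L)\<^sup>2 / 10" using x_pos L_ge by (simp add: y_def t_def power2_eq_square)
    also have "\<dots> \<le> (real L)\<^sup>2" by simp
    also have "\<dots> = 2 ^ (2 * j)" by (simp add: L power_mult[symmetric] mult.commute)
    also have "\<dots> \<le> exp 1 ^ (2 * j)" using exp_ge_add_one_self[of 1] by (intro power_mono) auto
    also have "\<dots> = exp (2 * j)" by (simp add: exp_of_nat_mult[symmetric])
    finally have "(y / t) ^ T \<le> exp (2 * j) ^ T" using x_pos L_ge by (intro power_mono) (auto simp: y_def t_def)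
    also have "\<dots> = exp (real (2 * j) * real T)" by (simp add: exp_of_nat_mult[symmetric] mult.commute)
    also have "\<dots> \<le> exp (real (2 * j) * t)"
      unfolding exp_le_cancel_iff using T_bounds by (intro mult_left_mono) (auto simp: t_def)
    finally show "(y / t) ^ T \<le> exp (2 * j * t)" .
  qed auto
  also have "\<dots> = exp ((1 + 2 * real j) * t)" by (simp add: exp_add[symmetric] algebra_simps)
  also have "\<dots> \<le> exp s"
  proof -
    have "a * (4 * x / L) \<le> e * x / b" if "a * (4 * b) \<le> e * L" "b > 0" for a b :: real
    proof -
      have "a * (4 * x / L) = a * (4 * b) * (x / (L * b))" using that by simp
      also have "\<dots> \<le> e * L * (x / (L * b))" using that x_pos by (intro mult_right_mono) auto
      also have "\<dots> = e * x / b" using L_ge by simp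
      finally show ?thesis .
    qed
    moreover have "(1 + 2 * real j) * (4 * (5376 * 10 ^ 20)) \<le> e * L" using j by simp
    moreover have "(0 :: real) < 5376 * 10 ^ 20" by simp
    ultimately have "(1 + 2 * real j) * t \<le> s" unfolding t_def s_def by blast
    then show ?thesis by simp
  qed
  finally have S: "(\<Sum>i\<le>T. real ((T * dm) choose i) * (1 / m) ^ i) \<le> exp s" .
  have "(1 - 1 / real m) ^ \<beta> \<le> exp (- (1 / real m)) ^ \<beta>"
    using m0 exp_ge_add_one_self[of "- (1 / real m)"] by (intro power_mono) auto
  also have "\<dots> = exp (- (\<beta> / m))" by (simp add: exp_of_nat_mult[symmetric])
  also have "\<dots> \<le> exp (- (2 * s))"
  proof -
    define u where "u = e * x * z / (128 * 10 ^ 20 * (real L)\<^sup>2)"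
    have "ln z \<ge> 0" using z_pos by simp
    then have "1 \<le> e / (128 * 10 ^ 20 * (real L)\<^sup>2) * z" using z(6) by linarith
    then have "1 * 1 \<le> x * (e / (128 * 10 ^ 20 * (real L)\<^sup>2) * z)" using x_pos by (intro mult_mono) auto
    then have u1: "1 \<le> u" by (simp add: u_def mult_ac)
    have "2 * u \<le> b0 * q2 / 4" using b0q2 by (simp add: u_def)
    then have u2: "u \<le> \<beta>" using \<beta>_bounds(2) u1 by linarith
    have "2 * s * m \<le> 2 * s * (21 * (z / (real L)\<^sup>2))"
      using m_bounds e_bounds x_pos by (intro mult_left_mono) (auto simp: s_def)
    also have "\<dots> = u" by (simp add: s_def u_def)
    finally have "2 * s * m \<le> \<beta>" using u2 by linarith
    then show ?thesis using m1 by (simp add: le_divide_eq)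
  qed
  finally have B: "(1 - 1 / real m) ^ \<beta> \<le> exp (- (2 * s))" .
  have "(\<Sum>i\<le>T. real ((T * dm) choose i) * ((1 / m) ^ i * (1 - 1 / m) ^ \<beta>)) =
     (\<Sum>i\<le>T. real ((T * dm) choose i) * (1 / m) ^ i) * (1 - 1 / m) ^ \<beta>"
    by (simp only: sum_distrib_right mult.assoc)
  also have "\<dots> \<le> exp s * exp (- (2 * s))" using S B m0 by (intro mult_mono) auto
  also have "\<dots> = exp (- s)" by (simp add: exp_add[symmetric])
  also have "\<dots> \<le> 1 / x\<^sup>2"
  proof (rule decay[OF \<kappa>(7)])
    have "e / (5376 * 10 ^ 20) * z \<le> e / (5376 * 10 ^ 20) * x" using z_pos e_bounds by (intro mult_left_mono) auto
    then show "e / (5376 * 10 ^ 20) * z \<le> s" by (simp add: s_def)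
  qed
  finally have 1: "(\<Sum>i\<le>T. real ((T * dm) choose i) * ((1 / m) ^ i * (1 - 1 / m) ^ \<beta>)) \<le> 1 / x\<^sup>2" .
  have "F * h * (\<Sum>i\<le>T. real ((T * dm) choose i) * ((1 / m) ^ i * (1 - 1 / m) ^ \<beta>)) \<le> (2 * x) * (1 / x\<^sup>2)"
    using 1 Fh_bounds z_pos x_pos m0 by (intro mult_mono sum_nonneg mult_nonneg_nonneg zero_le_power) auto
  also have "\<dots> = 2 / x" using x_pos by (simp add: power2_eq_square)
  also have "\<dots> < 1" using x_pos by simp
  finally show ?thesis .
qed

end

context templates
begin

lemma mu_bounds:
  assumes "L \<ge> 4"
  shows "real \<mu> * Q \<le> 2 * real (fact Q)" "real (fact Q) \<le> \<mu> * (real Q - 1)" "\<mu> > 0"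
proof -
  have eq: "(\<mu> * Q) * (Q - 1) = card A0 * fact Q" using mu_eq by (simp add: mult.assoc)
  also have "\<dots> \<le> 2 * (Q - 1) * fact Q" using card_A0_le by (intro mult_right_mono) auto
  finally have "(\<mu> * Q) * (Q - 1) \<le> (2 * fact Q) * (Q - 1)" by (simp add: mult_ac)
  then have "\<mu> * Q \<le> 2 * fact Q" using Q by simp
  then have "real (\<mu> * Q) \<le> real (2 * fact Q)" by (rule of_nat_mono)
  then show "real \<mu> * Q \<le> 2 * real (fact Q)" by simp
  have "Q * fact Q \<le> card A0 * fact Q" using card_A0_ge[OF assms] by (intro mult_right_mono) auto
  also have "\<dots> = Q * (\<mu> * (Q - 1))" using eq by (simp add: mult_ac)
  finally have le: "fact Q \<le> \<mu> * (Q - 1)" using Q by simp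
  then have "real (fact Q) \<le> real (\<mu> * (Q - 1))" by (rule of_nat_mono)
  then show "real (fact Q) \<le> \<mu> * (real Q - 1)" using Q by (simp add: of_nat_diff)
  have "(0 :: nat) < fact Q" by simp
  then show "\<mu> > 0" using le by (metis gr0I less_le_trans mult_0 not_less0)
qed

end

section \<open>The error terms\<close>

context regime
begin

lemma decay_x:
  assumes "\<kappa> \<le> a" "a * z \<le> b"
  shows "x * exp (- b) \<le> 1 / x"
proof -
  have "x * exp (- b) \<le> x * (1 / x\<^sup>2)" using decay[OF assms] x_pos by (intro mult_left_mono) auto
  then show ?thesis using x_pos by (simp add: power2_eq_square)
qed

lemma degree_failure:
  "x * Q * (2 * exp (- (\<delta>\<^sup>2 * (w * q1) / 4))) \<le> 2 * Q / x"
  "x * Q * (2 * exp (- ((1 / 2)\<^sup>2 * (w * q2) / 4))) \<le> 2 * Q / x"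
proof -
  have "\<delta>\<^sup>2 * (z / (4 * Q)) \<le> \<delta>\<^sup>2 * (w * q1)" using wq1 by (intro mult_left_mono) auto
  then have "x * exp (- (\<delta>\<^sup>2 * (w * q1) / 4)) \<le> 1 / x" by (intro decay_x[OF \<kappa>(2)]) (simp add: mult_ac)
  then have "2 * Q * (x * exp (- (\<delta>\<^sup>2 * (w * q1) / 4))) \<le> 2 * Q * (1 / x)" by (intro mult_left_mono) auto
  then show "x * Q * (2 * exp (- (\<delta>\<^sup>2 * (w * q1) / 4))) \<le> 2 * Q / x" by (simp add: mult_ac)
  have "x * exp (- ((1 / 2)\<^sup>2 * (w * q2) / 4)) \<le> 1 / x"
    using wq2 by (intro decay_x[OF \<kappa>(3)]) (simp add: power2_eq_square)
  then have "2 * Q * (x * exp (- ((1 / 2)\<^sup>2 * (w * q2) / 4))) \<le> 2 * Q * (1 / x)" by (intro mult_left_mono) auto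
  then show "x * Q * (2 * exp (- ((1 / 2)\<^sup>2 * (w * q2) / 4))) \<le> 2 * Q / x" by (simp add: mult_ac)
qed

lemma palette_degree_failure: "x * exp (- (z / 4)) \<le> 1 / x"
  by (intro decay_x[OF \<kappa>(4)]) simp

lemma colour_class_failure: "c * exp (- ((z / C) / 4)) \<le> 2 * C / x"
proof -
  have "c * exp (- ((z / C) / 4)) \<le> (2 * C * x) * exp (- ((z / C) / 4))" using c_bounds by (intro mult_right_mono) auto
  also have "\<dots> = (2 * C) * (x * exp (- ((z / C) / 4)))" by simp
  also have "\<dots> \<le> (2 * C) * (1 / x)" using C_pos by (intro mult_left_mono decay_x[OF \<kappa>(5)]) auto
  finally show ?thesis by simp
qed

text \<open>The base 3 M (x / c1) / b is at most 8 / (C \<theta>) \<le> 8 / 36, below exp (-1). This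
  is the reason for C \<ge> 3600 L^2: an edge repeats a colour with probability about 1 / C, and
  repeats must be rarer than the share \<theta>.\<close>

lemma choose_decay:
  assumes b: "\<theta> * y \<le> b" "0 < y" and M: "real M \<le> 2 * y"
  shows "real (M choose b) * (x / c1) ^ b \<le> exp (- (\<theta> * y))"
proof -
  have b0: "real b > 0" using b \<theta>_bounds by (smt (verit) mult_pos_pos)
  have c1: "real c1 > 0" "3 / 4 * (C * x) \<le> c1" using c1_bounds by simp_all
  have "real (M choose b) * (x / c1) ^ b \<le> (3 * real M * (x / c1) / b) ^ b"
    using b0 x_pos by (intro choose_power_le) auto
  also have "\<dots> \<le> exp (- 1) ^ b"
  proof (intro power_mono)
    have "3600 * (real L)\<^sup>2 * \<theta> \<le> C * \<theta>" using C \<theta>_bounds by (intro mult_right_mono) auto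
    moreover have "3600 * (real L)\<^sup>2 * \<theta> = 36 * (\<theta> * (100 * (real L)\<^sup>2))" by simp
    ultimately have C\<theta>: "36 \<le> C * \<theta>" unfolding \<theta>_bounds(3) by simp
    have "6 * y * x * 3 \<le> (3 / 4 * 36) * (x * y)" using x_pos b by simp
    also have "\<dots> \<le> (3 / 4 * (C * \<theta>)) * (x * y)" using C\<theta> x_pos b by (intro mult_right_mono) auto
    also have "\<dots> = 3 / 4 * (C * x) * (\<theta> * y)" by simp
    also have "\<dots> \<le> real c1 * real b" using b c1 C_pos x_pos \<theta>_bounds by (intro mult_mono) auto
    finally have "6 * y * x * 3 \<le> real c1 * real b" .
    then have "6 * y * (x / c1) / b \<le> 1 / 3" using c1 b0 by (simp add: divide_le_eq mult_ac)
    moreover have "3 * real M * (x / c1) / b \<le> 6 * y * (x / c1) / b"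
      using M x_pos by (intro divide_right_mono mult_right_mono) auto
    moreover have "1 / 3 \<le> exp (- 1 :: real)" using exp_le by (simp add: exp_minus field_simps)
    ultimately show "3 * real M * (x / c1) / b \<le> exp (- 1)" by linarith
  qed (use x_pos in auto)
  also have "\<dots> = exp (- b)" by (simp add: exp_of_nat_mult[symmetric])
  also have "\<dots> \<le> exp (- (\<theta> * y))" using b by simp
  finally show ?thesis .
qed

lemma repeats_failure:
  "x * (real (dm choose b1) * (x / c1) ^ b1) \<le> 1 / x"
  "F * h * (real (n choose b2) * (x / c1) ^ b2) \<le> 2 / x"
proof -
  have "real (dm choose b1) * (x / c1) ^ b1 \<le> exp (- (\<theta> * z))"
    using b1_bounds z_pos nat_floor_bounds(1)[of "2 * z"] by (intro choose_decay) (auto simp: dm_def)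
  then have "x * (real (dm choose b1) * (x / c1) ^ b1) \<le> x * exp (- (\<theta> * z))" using x_pos by (intro mult_left_mono) auto
  also have "\<dots> \<le> 1 / x" by (intro decay_x[OF \<kappa>(6)]) simp
  finally show "x * (real (dm choose b1) * (x / c1) ^ b1) \<le> 1 / x" .
  have "real (n choose b2) * (x / c1) ^ b2 \<le> exp (- (\<theta> * x))"
    using b2_bounds x_pos x(1) by (intro choose_decay) auto
  then have "F * h * (real (n choose b2) * (x / c1) ^ b2) \<le> (2 * x) * exp (- (\<theta> * x))"
    using Fh_bounds z_pos x_pos by (intro mult_mono) auto
  also have "\<dots> = 2 * (x * exp (- (\<theta> * x)))" by simp
  also have "\<dots> \<le> 2 * (1 / x)"
    using z_pos \<theta>_bounds by (intro mult_left_mono decay_x[OF \<kappa>(6)]) auto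
  finally show "F * h * (real (n choose b2) * (x / c1) ^ b2) \<le> 2 / x" by simp
qed

lemma sparse_failure: "(\<Sum>a\<in>{1..a0}. real (n choose a) * real (n choose (3 * a)) * r a ^ e0 a) \<le> 2 * (real L)\<^sup>2 / x"
proof -
  have "x * 1 \<le> x * x" using x_pos by (intro mult_left_mono) auto
  then have "2 * (L / x)\<^sup>2 \<le> 2 * (real L)\<^sup>2 / x"
    using x_pos by (simp add: power_divide power2_eq_square) (intro divide_left_mono; simp)
  then show ?thesis using r_sum by linarith
qed

text \<open>The factors T + 1 and 2^n are at most exp x each, and the sum over graphs is at most exp
  (2 x) z^(2 n). The exponents add up to (4 + 2 ln z) x, one x less than the tail (5 + 2 ln z)
  x.\<close>

lemma dense_failure:
  "(real T + 1) * 2 ^ n * ((\<Sum>i\<le>2 * n. real (card (vpairs n) choose i) * p ^ i) * exp (- (b0 * q2 / 8))) \<le> 1 / x"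
proof -
  have "(\<Sum>i\<le>2 * n. real (card (vpairs n) choose i) * p ^ i) \<le> (\<Sum>i\<le>2 * n. (x * z) ^ i / fact i)"
  proof (rule sum_mono)
    fix i
    have "real (card (vpairs n) choose i) * p ^ i \<le> real (card (vpairs n)) ^ i / fact i * p ^ i"
      using p by (intro mult_right_mono choose_le_power_over_fact) auto
    also have "\<dots> \<le> (x * x) ^ i / fact i * p ^ i"
      using card_vpairs_le p by (intro mult_right_mono divide_right_mono power_mono) auto
    also have "\<dots> = (x * z) ^ i / fact i" by (simp add: z(1) power_mult_distrib)
    finally show "real (card (vpairs n) choose i) * p ^ i \<le> (x * z) ^ i / fact i" .
  qed
  also have "\<dots> \<le> exp (2 * x) * ((x * z) / (2 * x)) ^ (2 * n)"
    using x_pos z_pos by (intro sum_power_over_fact_le) (auto simp: x(1))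
  also have "\<dots> \<le> exp (2 * x) * z ^ (2 * n)"
    using x_pos z_pos by (intro mult_left_mono power_mono) auto
  also have "z ^ (2 * n) = exp (2 * x * ln z)"
    using z_pos exp_of_nat_mult[of "2 * n" "ln z"] by (simp add: x(1))
  finally have S: "(\<Sum>i\<le>2 * n. real (card (vpairs n) choose i) * p ^ i) \<le> exp (2 * x) * exp (2 * x * ln z)" .
  have two: "(2::real) ^ n \<le> exp x"
  proof -
    have "(2::real) ^ n \<le> exp 1 ^ n" using exp_ge_add_one_self[of 1] by (intro power_mono) auto
    then show ?thesis by (simp add: exp_of_nat_mult[symmetric] x(1))
  qed
  have "T \<le> n" using T_small by simp
  then have "real T + 1 \<le> x + 1" by (simp add: x(1))
  also have "\<dots> \<le> exp x" using exp_ge_add_one_self[of x] by linarith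
  finally have T1: "real T + 1 \<le> exp x" .
  have "e / (128 * 10 ^ 20 * (real L)\<^sup>2) * z * x \<le> b0 * q2 / 8" using b0q2 by (simp add: mult_ac)
  moreover have "(5 + 2 * ln z) * x \<le> e / (128 * 10 ^ 20 * (real L)\<^sup>2) * z * x" using z(6) x_pos by (intro mult_right_mono) auto
  ultimately have "(5 + 2 * ln z) * x \<le> b0 * q2 / 8" by linarith
  then have E: "exp (- (b0 * q2 / 8)) \<le> exp (- ((5 + 2 * ln z) * x))" by simp
  have "(real T + 1) * 2 ^ n * ((\<Sum>i\<le>2 * n. real (card (vpairs n) choose i) * p ^ i) * exp (- (b0 * q2 / 8)))
     \<le> exp x * exp x * ((exp (2 * x) * exp (2 * x * ln z)) * exp (- ((5 + 2 * ln z) * x)))"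
    using S T1 two E p by (intro mult_mono sum_nonneg mult_nonneg_nonneg zero_le_power) auto
  also have "\<dots> = exp (- x)" by (simp add: exp_add[symmetric] algebra_simps)
  also have "\<dots> = 1 / exp x" by (simp add: exp_minus inverse_eq_divide)
  also have "\<dots> \<le> 1 / x"
  proof -
    have "x \<le> exp x" using exp_ge_add_one_self[of x] by linarith
    then show ?thesis using x_pos by (intro divide_left_mono) auto
  qed
  finally show ?thesis .
qed

end

context regime
begin

lemma failure:
  assumes U_mu: "U = templates.\<mu> L R" and F_fact: "F = fact Q"
  shows "measure_pmf.prob (Gnpc n p c) {G. \<not> has_disjoint_rainbow_HCs n G N} \<le> (4 * Q + 2 * C + 2 * (real L)\<^sup>2 + 6) / x"
proof -
  interpret CT: coloured_templates n L R h c p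
    by unfold_locales (use L_ge R p c_bounds in auto)
  have CQ: "CT.Q = Q" by (simp add: CT.Q_def Q)
  have idx: "card CT.idx = F * h" by (simp add: CT.card_idx CQ F_fact)
  have Q1: "real (Q - 1) = real Q - 1" using Q_pos by simp
  show ?thesis
  proof (rule CT.failure_bound[where ?c1.0 = c1 and ?c2.0 = c2 and k = k and T = T and m = m and M = "T * dm" and ?a0.0 = a0 and ?b0.0 = b0
     and \<beta> = \<beta> and N = N and q = q and dm = dm and ?b1.0 = b1 and ?b2.0 = b2 and \<delta> = \<delta> and ?\<theta>0.0 = "\<theta> * x" and hi = z and ?M0.0 = "z / C" and D = D
     and lam = lam and r = r and ?e0.0 = e0,
     unfolded CQ idx U_mu[symmetric] F_fact[symmetric] x(1)[symmetric],
     folded w_def q1_def q2_def, folded g_def, THEN order_trans])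
    show "c = c1 + 2 * c2" by (rule c1_real)
    show "0 < c1" by (rule c1_bounds)
    show "3 \<le> n" by (rule x_pos)
    show "2 \<le> R" using R by simp
    show "0 \<le> \<delta>" "\<delta> \<le> 1" using \<delta>_bounds by simp_all
    show "(1 + \<delta>) * (real (w + 1) * q1) \<le> real (U * h)" using h_bounds(1) by simp
    show "0 < D" by (rule D_bounds)
    show "D \<le> real (R - 1) * (real w * q2 / 2)" using D_bounds(2) R by (simp add: of_nat_diff)
    show "x * p \<le> z" by (simp add: z)
    show "2 * z \<le> real (dm + 1)"
    proof -
      have "2 * z - 1 \<le> dm" unfolding dm_def by (rule nat_floor_bounds) (use z_pos in simp)
      then show ?thesis by simp
    qed
    show "0 < z / C" using z_pos C_pos by simp
    show "real (card (vpairs n)) * (p / real c) \<le> z / C" by (rule edges_per_colour)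
    show "2 * (z / C) \<le> real q" by (rule q_bounds)
    show "0 < e0 a" if "1 \<le> a" for a using e0_pos[OF that] .
    show "2 * e0 a \<le> s + 1" if "k * a \<le> s" "lam a * real a * D < real s" for a s using e0_bounds(3)[OF that] .
    show "9 * (real a)\<^sup>2 * q2 / real (e0 a) \<le> r a" if "1 \<le> a" for a using sparse_ratio[OF that] .
    show "real (\<beta> + T * q) \<le> real b0 * q2 / 2" using many_boosters_left by simp
    show "real (3 * R * (w + 1)) + \<theta> * x + real (2 * b2) \<le> real T"
      using T_large unfolding of_nat_mult of_nat_add by simp
    show "k * T + T \<le> n" by (rule T_small)
    show "real (h * ((3 * R)\<^sup>2 * F)) / real (Q * (Q - 1)) + 2 * (real Q * g + real b1) \<le> real m"
      using m_large unfolding of_nat_mult of_nat_power Q1 by (simp add: power_mult_distrib)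
    show "0 < m" by (rule m_bounds)
    show "real (2 * k * m + 2 * k * q) \<le> D / 4" by (rule few_conflicts)
    show "real (F * h) * (\<Sum>a = 1..a0. real (n choose a) * real (n choose 3 * a) * (2 * lam a) ^ (k * a)) < 1" by (rule num1)
    show "3 * a0 \<le> n" by (rule a0_small)
    show "2 * b0 \<le> (a0 + 1) * (a0 + 1 - (w + 1))" by (rule a0_large)
    show "0 < k" using j by (simp add: k_def)
    show "0 \<le> lam a" for a using r_pos(1) by (simp add: lam_def)
    show "real (F * h) * (\<Sum>j\<le>T. real (T * dm choose j) * ((1 / real m) ^ j * (1 - 1 / real m) ^ \<beta>)) < 1" by (rule num2)
    show "real N \<le> real (F * h) - x * (real Q * g) / (\<theta> * x)" using N_small by (simp add: x(1))
    show "0 < \<theta> * x" using \<theta>_bounds x_pos by simp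
    show "real (n * Q) * (2 * exp (- (\<delta>\<^sup>2 * (real w * q1) / 4))) +
        real (n * Q) * (2 * exp (- ((1 / 2)\<^sup>2 * (real w * q2) / 4))) +
        x * exp (- (z / 4)) + x * exp (- (z / 4)) + real c * exp (- (z / C / 4)) +
        (x * (real (dm choose b1) * (x / real c1) ^ b1) + real (F * h) * (real (n choose b2) * (x / real c1) ^ b2)) +
        (\<Sum>a = 1..a0. real (n choose a) * real (n choose 3 * a) * r a ^ e0 a) +
        real ((T + 1) * 2 ^ n) * ((\<Sum>j\<le>2 * n. real (card (vpairs n) choose j) * p ^ j) * exp (- (real b0 * q2 / 8)))
      \<le> (4 * Q + 2 * C + 2 * (real L)\<^sup>2 + 6) / x" (is "?S \<le> _")
    proof -
      have nQ: "real (n * Q) = x * Q" by (simp add: x(1))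
      have T2: "real ((T + 1) * 2 ^ n) = (real T + 1) * 2 ^ n" by (simp add: algebra_simps)
      have "?S \<le> 2 * Q / x + 2 * Q / x + 1 / x + 1 / x + 2 * C / x + (1 / x + 2 / x) + 2 * (real L)\<^sup>2 / x + 1 / x"
        unfolding nQ T2
        by (intro add_mono degree_failure palette_degree_failure colour_class_failure repeats_failure sparse_failure dense_failure)
      also have "\<dots> = (4 * Q + 2 * C + 2 * (real L)\<^sup>2 + 6) / x" by (simp add: add_divide_distrib)
      finally show ?thesis .
    qed
  qed auto
qed

end

theorem theorem4:
  fixes \<epsilon> :: real
  assumes "0 < \<epsilon>" and "\<epsilon> < 1"
  shows "\<exists>C > 0. \<forall>p :: nat \<Rightarrow> real.
           (\<forall>n. 0 \<le> p n \<and> p n \<le> 1) \<and>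
           filterlim (\<lambda>n. p n / (ln (real n) / real n)) at_top sequentially \<longrightarrow>
           (\<lambda>n. measure_pmf.prob (Gnpc n (p n) (nat \<lceil>C * real n\<rceil>))
                  {G. has_disjoint_rainbow_HCs n G (nat \<lceil>(1 - \<epsilon>) * real n * p n / 2\<rceil>)})
           \<longlonglongrightarrow> 1"
proof -
  \<comment> \<open>The share of colours given to each of the last two palettes; the resulting loss
    of \<epsilon> z / 8 forests is well within the allowed \<epsilon> z / 2.\<close>
  define e where "e = \<epsilon> / 8"
  have e: "0 < e" using assms by (simp add: e_def)
  \<comment> \<open>The special set is a 4 / L share of the vertices and the expander degree is 8 j,
    so exponential growth of L in j makes the demand on a palette of share e as small as
    desired.\<close>
  have "eventually (\<lambda>j::nat. 10 ^ 25 * (real j + 1) \<le> e * 2 ^ j) at_top" using e by real_asymp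
  then have "eventually (\<lambda>j::nat. 8 \<le> j \<and> 10 ^ 25 * (real j + 1) \<le> e * 2 ^ j) at_top"
    using eventually_ge_at_top by (rule eventually_conj[rotated])
  then obtain j :: nat where j: "8 \<le> j" "10 ^ 25 * (real j + 1) \<le> e * 2 ^ j"
    using eventually_happens'[OF sequentially_bot] by blast
  define L :: nat where "L = 2 ^ j"
  \<comment> \<open>Four times the 10^10 of \<open>a0\<close>: a layer is about a quarter of the
    guaranteed number of rotation endpoints, so excluding pairs inside a layer costs only a constant
    factor.\<close>
  define R :: nat where "R = 40000000000"
  define Q where "Q = L * R"
  define U where "U = templates.\<mu> L R"
  define F :: nat where "F = fact Q"
  \<comment> \<open>The tolerated share of lacking vertices and of repeated colours. Order 1 / L^2
    is dictated by \<open>m\<close>, which is itself of order z / L^2.\<close>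
  define \<theta> where "\<theta> = 1 / (100 * (real L)\<^sup>2)"
  \<comment> \<open>A forest is discarded when \<theta> n of its vertices lack a neighbour, and the
    deficits sum to at most 3 \<delta> n z; so at most 3 \<delta> z / \<theta> = 3 \<epsilon> z /
    100 forests are lost.\<close>
  define \<delta> where "\<delta> = \<epsilon> * \<theta> / 100"
  \<comment> \<open>One summand for each demand on the number of colours: repeats in a forest,
    colours used up by boosters, and colour conflicts among expander edges.\<close>
  define C where "C = 3600 * (real L)\<^sup>2 + 768 * 10 ^ 20 * L / e + 6144 * j * L / e"
  \<comment> \<open>The smallest rate, relative to np, among the exponential error terms.\<close>
  define \<kappa> where "\<kappa> = Min {\<delta>\<^sup>2 / (16 * Q), e / (64 * Q), 1 / 4, 1 / (4 * C), \<theta>, e / (5376 * 10 ^ 20)}"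
  define \<kappa>8 where "\<kappa>8 = e / (128 * 10 ^ 20 * (real L)\<^sup>2)"
  define K where "K = 4 * Q + 2 * C + 2 * (real L)\<^sup>2 + 6"
  have j2: "10 ^ 25 * (real j + 1) \<le> e * real L" using j by (simp add: L_def)
  have "(2::nat) ^ 8 \<le> L" unfolding L_def using j by (intro power_increasing) auto
  then have L4: "L \<ge> 4" by simp
  have Q0: "Q > 0" using L4 by (simp add: Q_def R_def)
  \<comment> \<open>\<open>\<mu>\<close> depends on \<open>L\<close> and \<open>R\<close> only, so n
    and h are set to dummy values and \<open>U\<close> is fixed before n.\<close>
  interpret tm: templates 0 L R 0 by unfold_locales (use L4 in \<open>auto simp: R_def\<close>)
  have tQ: "tm.Q = Q" by (simp add: tm.Q_def Q_def)
  have U: "real U * Q \<le> real (2 * F)" "real F \<le> U * (real Q - 1)" "U > 0"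
    using tm.mu_bounds[OF L4] unfolding tQ U_def[symmetric] F_def[symmetric] by simp_all
  have \<theta>0: "\<theta> > 0" and \<delta>0: "\<delta> > 0" using L4 assms by (auto simp: \<theta>_def \<delta>_def)
  have nn: "0 \<le> 3600 * (real L)\<^sup>2" "0 \<le> 768 * 10 ^ 20 * L / e" "0 \<le> 6144 * j * L / e" using e by simp_all
  have "0 < 3600 * (real L)\<^sup>2" using L4 by simp
  then have C0: "0 < C" using nn unfolding C_def by linarith
  have Cb: "3600 * (real L)\<^sup>2 \<le> C" using nn unfolding C_def by linarith
  have "768 * 10 ^ 20 * L / e \<le> C" "6144 * j * L / e \<le> C" using nn unfolding C_def by linarith+
  then have Cc: "real (768 * 10 ^ 20 * L) \<le> e * C" "real (6144 * j * L) \<le> e * C"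
    using e by (simp_all add: divide_le_eq mult.commute)
  have \<kappa>: "0 < \<kappa>" "\<kappa> \<le> \<delta>\<^sup>2 / (16 * Q)" "\<kappa> \<le> e / (64 * Q)" "\<kappa> \<le> 1 / 4" "\<kappa> \<le> 1 / (4 * C)" "\<kappa> \<le> \<theta>"
    "\<kappa> \<le> e / (5376 * 10 ^ 20)" using e Q0 C0 \<theta>0 \<delta>0 by (auto simp: \<kappa>_def)
  have \<kappa>8: "0 < \<kappa>8" using e L4 by (simp add: \<kappa>8_def)
  show ?thesis
  proof (intro exI[of _ C] conjI allI impI C0)
    fix p :: "nat \<Rightarrow> real"
    assume p: "(\<forall>n. 0 \<le> p n \<and> p n \<le> 1) \<and> filterlim (\<lambda>n. p n / (ln (real n) / real n)) at_top sequentially"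
    then have p01: "0 \<le> p n" "p n \<le> 1" for n by auto
    define z where "z n = real n * p n" for n
    \<comment> \<open>The assumption on p says exactly that np eventually exceeds every multiple of
      log n; n \<ge> 3 keeps the logarithm positive.\<close>
    have zB: "eventually (\<lambda>n. B * ln (real n) \<le> z n) sequentially" for B
    proof -
      have "eventually (\<lambda>n. B \<le> p n / (ln (real n) / real n)) sequentially"
        using p by (auto simp: filterlim_at_top)
      then show ?thesis using eventually_ge_at_top[of 3]
      proof eventually_elim
        case (elim n)
        have "B \<le> z n / ln (real n)" using elim by (simp add: z_def mult.commute)
        then show ?case using elim by (simp add: pos_le_divide_eq)
      qed
    qed
    have "filterlim (\<lambda>n::nat. ln (real n)) at_top sequentially" by real_asymp
    then have z_top: "filterlim z at_top sequentially"
      by (rule filterlim_at_top_mono) (use zB[of 1] in simp)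
    have zK: "eventually (\<lambda>n. B \<le> z n) sequentially" for B
      using z_top by (auto simp: filterlim_at_top)
    have "eventually (\<lambda>t. 5 + 2 * ln t \<le> \<kappa>8 * t) at_top" using \<kappa>8 by real_asymp
    then have z_ln: "eventually (\<lambda>n. 5 + 2 * ln (z n) \<le> \<kappa>8 * z n) sequentially"
      by (rule eventually_compose_filterlim[OF _ z_top])
    have xK: "eventually (\<lambda>n. B \<le> real n) sequentially" for B
      using filterlim_real_sequentially by (auto simp: filterlim_at_top)
    have "eventually (\<lambda>n. measure_pmf.prob (Gnpc n (p n) (nat \<lceil>C * real n\<rceil>))
        {G. \<not> has_disjoint_rainbow_HCs n G (nat \<lceil>(1 - \<epsilon>) * real n * p n / 2\<rceil>)} \<le> K / real n) sequentially"
      using xK[of "L * (6 * real R + 6)"] xK[of "4 * (real L)\<^sup>2 + 1"] zK[of C] zK[of "Q * (U + 2) / \<delta>"]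
        zK[of "4 * (real L)\<^sup>2"] zK[of "4 / \<epsilon>"] z_ln zB[of "2 / \<kappa>"]
    proof eventually_elim
      case (elim n)
      have 1: "4 * (real L)\<^sup>2 < real n" using elim(2) by linarith
      have 2: "real (Q * (U + 2)) \<le> \<delta> * z n" using elim(4) \<delta>0 by (simp add: divide_le_eq mult.commute)
      have 3: "4 \<le> \<epsilon> * z n" using elim(6) assms by (simp add: divide_le_eq mult.commute)
      have 4: "2 * ln (real n) \<le> \<kappa> * z n" using elim(8) \<kappa>(1) by (simp add: field_simps)
      have 5: "5 + 2 * ln (z n) \<le> e / (128 * 10 ^ 20 * (real L)\<^sup>2) * z n" using elim(7) by (simp add: \<kappa>8_def)
      have reg: "regime \<epsilon> (p n) e \<theta> \<delta> C \<kappa> (real n) (z n) j n L R Q U F"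
        by (rule regime.intro;
          (rule refl assms e_def p01 j(1) j2 L_def R_def Q_def \<theta>_def \<delta>_def U Cb Cc elim(1) 1 z_def elim(3) 2 elim(5) 3 5 \<kappa> 4)?)
      show ?case
        using regime.failure[OF reg U_def F_def] unfolding regime.c_def[OF reg] regime.N_def[OF reg] K_def .
    qed
    then have lower: "eventually (\<lambda>n. 1 - K / real n \<le> measure_pmf.prob (Gnpc n (p n) (nat \<lceil>C * real n\<rceil>))
        {G. has_disjoint_rainbow_HCs n G (nat \<lceil>(1 - \<epsilon>) * real n * p n / 2\<rceil>)}) sequentially"
    proof eventually_elim
      case (elim n)
      let ?M = "Gnpc n (p n) (nat \<lceil>C * real n\<rceil>)" and ?A = "{G. has_disjoint_rainbow_HCs n G (nat \<lceil>(1 - \<epsilon>) * real n * p n / 2\<rceil>)}"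
      have "- ?A = {G. \<not> has_disjoint_rainbow_HCs n G (nat \<lceil>(1 - \<epsilon>) * real n * p n / 2\<rceil>)}" by auto
      moreover have "measure_pmf.prob ?M (UNIV - ?A) = 1 - measure_pmf.prob ?M ?A"
        using measure_pmf.prob_compl[of ?A ?M] by simp
      ultimately show ?case using elim by (simp add: Compl_eq_Diff_UNIV)
    qed
    have "(\<lambda>n. 1 - K / real n) \<longlonglongrightarrow> 1 - 0"
      by (intro tendsto_diff tendsto_const lim_const_over_n)
    then have lim: "(\<lambda>n. 1 - K / real n) \<longlonglongrightarrow> 1" by simp
    show "(\<lambda>n. measure_pmf.prob (Gnpc n (p n) (nat \<lceil>C * real n\<rceil>))
        {G. has_disjoint_rainbow_HCs n G (nat \<lceil>(1 - \<epsilon>) * real n * p n / 2\<rceil>)}) \<longlonglongrightarrow> 1"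
      by (rule tendsto_sandwich[OF lower _ lim tendsto_const])
        (intro always_eventually allI measure_pmf.prob_le_1)
  qed
qed

end
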